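(* Let $\mathbf{k}$ be a commutative noetherian ring and let $\mathsf{T}$ be an essentially small, Hom-finite, $\mathbf{k}$-linear, Krull-Schmidt triangulated category with shift functor $\Sigma$. Let $\mathsf{S}=\mathsf{add}(s)$ be a presilting subcategory of $\mathsf{T}$, for an object $s$ of $\mathsf{T}$, and let $\mathsf{C}=\mathsf{S} * \Sigma\mathsf{S}$. Then the restricted Yoneda functor $F\colon\mathsf{C}\to\mathsf{mod}\,\mathsf{S}$ induces a bijection $$\{\text{complete cotorsion pairs in } \mathsf{C}\}\ \longleftrightarrow\ \{\text{functorially finite torsion pairs in } \mathsf{mod}\,\mathsf{S}\},\qquad (\mathcal{X},\mathcal{Y})\longmapsto\big(F\mathcal{Y},(F\mathcal{Y})^{\perp}\big).$$ In particular, $F$ sends cotorsionfree classes to torsion classes; that is, for every complete cotorsion pair $(\mathcal{X},\mathcal{Y})$ in $\mathsf{C}$, the essential image $F\mathcal{Y}$ is a torsion class in $\mathsf{mod}\,\mathsf{S}$.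
   Context: Write $\mathsf{T}(a,b)=\mathrm{Hom}_{\mathsf{T}}(a,b)$. Hom-finite means that $\mathsf{T}(a,b)$ is a finitely generated $\mathbf{k}$-module for all $a,b\in\mathsf{T}$. $\mathsf{add}(s)$ is the full subcategory of direct summands of finite direct sums of copies of $s$. A subcategory $\mathsf{S}$ is presilting if $\mathsf{T}(s_1,\Sigma^i s_2)=0$ for all $s_1,s_2\in\mathsf{S}$ and $i>0$. $\mathsf{S} * \Sigma\mathsf{S}$ is the full subcategory of objects $t$ admitting a distinguished triangle $s_1\to t\to\Sigma s_2\to\Sigma s_1$ with $s_1,s_2\in\mathsf{S}$. $\mathsf{C}=\mathsf{S} * \Sigma\mathsf{S}$ is extension-closed in $\mathsf{T}$ and is regarded as an extriangulated category with the structure induced from $\mathsf{T}$: $\mathbb{E}(c,a)=\mathsf{T}(c,\Sigma a)$, and the $\mathbb{E}$-triangles $a\to b\to c$ are given by distinguished triangles $a\to b\to c\to\Sigma a$ of $\mathsf{T}$ with $a,b,c\in\mathsf{C}$. A complete cotorsion pair in $\mathsf{C}$ is a pair $(\mathcal{X},\mathcal{Y})$ of full additive subcategories of $\mathsf{C}$ closed under direct summands such that: (1) $\mathbb{E}(x,y)=0$ for all $x\in\mathcal{X}$, $y\in\mathcal{Y}$; (2) for each $c\in\mathsf{C}$ there is an $\mathbb{E}$-triangle $c\to y\to x$ with $x\in\mathcal{X}$, $y\in\mathcal{Y}$; (3) for each $c\in\mathsf{C}$ there is an $\mathbb{E}$-triangle $y\to x\to c$ with $x\in\mathcal{X}$,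 $y\in\mathcal{Y}$. The class $\mathcal{Y}$ is called the cotorsionfree class. $\mathsf{mod}\,\mathsf{S}$ is the category of finitely presented contravariant additive functors from $\mathsf{S}$ to $\mathbf{k}$-modules; it is equivalent to $\mathsf{mod}\,E$ for the noetherian ring $E=\mathsf{T}(s,s)$. The restricted Yoneda functor is $F(t)=\mathsf{T}(-,t)|_{\mathsf{S}}$; it is known to induce an equivalence $(\mathsf{S} * \Sigma\mathsf{S})/\Sigma\mathsf{S}\to\mathsf{mod}\,\mathsf{S}$, where the quotient is by the ideal of morphisms factoring through $\Sigma\mathsf{S}$. $F\mathcal{Y}$ denotes the essential image of $\mathcal{Y}$. For a subcategory $\mathcal{U}$ of an abelian category $\mathsf{H}$, $\mathcal{U}^{\perp}=\{h\in\mathsf{H}\mid\mathrm{Hom}(u,h)=0\ \forall u\in\mathcal{U}\}$ and ${}^{\perp}\mathcal{U}=\{h\in\mathsf{H}\mid\mathrm{Hom}(h,u)=0\ \forall u\in\mathcal{U}\}$. A torsion pair in $\mathsf{H}$ is a pair of full subcategories $(\mathcal{T},\mathcal{F})$ with $\mathcal{T}^{\perp}=\mathcal{F}$, ${}^{\perp}\mathcal{F}=\mathcal{T}$ such that each $h\in\mathsf{H}$ fits in a short exact sequence $0\to t\to h\to f\to 0$ with $t\in\mathcal{T}$, $f\in\mathcal{F}$; $\mathcal{T}$ is the torsion class. It is functorially finite if $\mathcal{T}$ is covariantly finite in $\mathsf{H}$, i.e. every $h\in\mathsf{H}$ admits a morphism $h\to t$ with $t\in\mathcal{T}$ through which every morphism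 from $h$ to an object of $\mathcal{T}$ factors. *)

theory Defs
  imports "HOL-Algebra.Module" "HOL-Algebra.Ring_Divisibility"
begin

section \<open>Linear categories\<close>

text \<open>
  A small \<open>k\<close>-linear category. \<open>Hom C a b\<close> is a module in the sense of HOL-Algebra, whose (unused)
  ring multiplication and unit are irrelevant. Composition is written in the usual order: \<open>g \<cdot> f\<close>
  is \<open>g\<close> after \<open>f\<close>. Every morphism determines its source \<open>Dom\<close> and its target \<open>Cod\<close>.
\<close>

record ('k, 'o, 'm) lincat =
  Ob :: "'o set"
  Dom :: "'m \<Rightarrow> 'o"
  Cod :: "'m \<Rightarrow> 'o"
  Hom :: "'o \<Rightarrow> 'o \<Rightarrow> ('k, 'm) module"
  Cmp :: "'m \<Rightarrow> 'm \<Rightarrow> 'm" (infixl \<open>\<cdot>\<index>\<close> 70)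
  Id :: "'o \<Rightarrow> 'm"

definition in_hom :: "('k, 'o, 'm, 'z) lincat_scheme \<Rightarrow> 'm \<Rightarrow> 'o \<Rightarrow> 'o \<Rightarrow> bool"
    (\<open>\<guillemotleft>_ : _ \<rightarrow>\<index> _\<guillemotright>\<close>)
  where "\<guillemotleft>f : a \<rightarrow>\<^bsub>C\<^esub> b\<guillemotright> \<longleftrightarrow> a \<in> Ob C \<and> b \<in> Ob C \<and> f \<in> carrier (Hom C a b)"

abbreviation zero_mor :: "('k, 'o, 'm, 'z) lincat_scheme \<Rightarrow> 'o \<Rightarrow> 'o \<Rightarrow> 'm"
  where "zero_mor C a b \<equiv> \<zero>\<^bsub>Hom C a b\<^esub>"

locale klinear_category =
  fixes k :: "('k, 'r) ring_scheme" and C :: "('k, 'o, 'm, 'z) lincat_scheme"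
  assumes cring: "cring k"
    and Hom_module: "\<lbrakk>a \<in> Ob C; b \<in> Ob C\<rbrakk> \<Longrightarrow> module k (Hom C a b)"
    and Dom_Cod: "\<guillemotleft>f : a \<rightarrow>\<^bsub>C\<^esub> b\<guillemotright> \<Longrightarrow> Dom C f = a \<and> Cod C f = b"
    and Id_in: "a \<in> Ob C \<Longrightarrow> \<guillemotleft>Id C a : a \<rightarrow>\<^bsub>C\<^esub> a\<guillemotright>"
    and Cmp_in: "\<lbrakk>\<guillemotleft>f : a \<rightarrow>\<^bsub>C\<^esub> b\<guillemotright>; \<guillemotleft>g : b \<rightarrow>\<^bsub>C\<^esub> c\<guillemotright>\<rbrakk> \<Longrightarrow> \<guillemotleft>g \<cdot>\<^bsub>C\<^esub> f : a \<rightarrow>\<^bsub>C\<^esub> c\<guillemotright>"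
    and Cmp_Id: "\<guillemotleft>f : a \<rightarrow>\<^bsub>C\<^esub> b\<guillemotright> \<Longrightarrow> f \<cdot>\<^bsub>C\<^esub> Id C a = f"
    and Id_Cmp: "\<guillemotleft>f : a \<rightarrow>\<^bsub>C\<^esub> b\<guillemotright> \<Longrightarrow> Id C b \<cdot>\<^bsub>C\<^esub> f = f"
    and Cmp_assoc: "\<lbrakk>\<guillemotleft>f : a \<rightarrow>\<^bsub>C\<^esub> b\<guillemotright>; \<guillemotleft>g : b \<rightarrow>\<^bsub>C\<^esub> c\<guillemotright>; \<guillemotleft>h : c \<rightarrow>\<^bsub>C\<^esub> d\<guillemotright>\<rbrakk>
      \<Longrightarrow> (h \<cdot>\<^bsub>C\<^esub> g) \<cdot>\<^bsub>C\<^esub> f = h \<cdot>\<^bsub>C\<^esub> (g \<cdot>\<^bsub>C\<^esub> f)"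
    and Cmp_add_left: "\<lbrakk>\<guillemotleft>f : a \<rightarrow>\<^bsub>C\<^esub> b\<guillemotright>; \<guillemotleft>g : b \<rightarrow>\<^bsub>C\<^esub> c\<guillemotright>; \<guillemotleft>g' : b \<rightarrow>\<^bsub>C\<^esub> c\<guillemotright>\<rbrakk>
      \<Longrightarrow> (g \<oplus>\<^bsub>Hom C b c\<^esub> g') \<cdot>\<^bsub>C\<^esub> f = g \<cdot>\<^bsub>C\<^esub> f \<oplus>\<^bsub>Hom C a c\<^esub> g' \<cdot>\<^bsub>C\<^esub> f"
    and Cmp_add_right: "\<lbrakk>\<guillemotleft>f : a \<rightarrow>\<^bsub>C\<^esub> b\<guillemotright>; \<guillemotleft>f' : a \<rightarrow>\<^bsub>C\<^esub> b\<guillemotright>; \<guillemotleft>g : b \<rightarrow>\<^bsub>C\<^esub> c\<guillemotright>\<rbrakk>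
      \<Longrightarrow> g \<cdot>\<^bsub>C\<^esub> (f \<oplus>\<^bsub>Hom C a b\<^esub> f') = g \<cdot>\<^bsub>C\<^esub> f \<oplus>\<^bsub>Hom C a c\<^esub> g \<cdot>\<^bsub>C\<^esub> f'"
    and Cmp_smult_left: "\<lbrakk>r \<in> carrier k; \<guillemotleft>f : a \<rightarrow>\<^bsub>C\<^esub> b\<guillemotright>; \<guillemotleft>g : b \<rightarrow>\<^bsub>C\<^esub> c\<guillemotright>\<rbrakk>
      \<Longrightarrow> (r \<odot>\<^bsub>Hom C b c\<^esub> g) \<cdot>\<^bsub>C\<^esub> f = r \<odot>\<^bsub>Hom C a c\<^esub> (g \<cdot>\<^bsub>C\<^esub> f)"
    and Cmp_smult_right: "\<lbrakk>r \<in> carrier k; \<guillemotleft>f : a \<rightarrow>\<^bsub>C\<^esub> b\<guillemotright>; \<guillemotleft>g : b \<rightarrow>\<^bsub>C\<^esub> c\<guillemotright>\<rbrakk>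
      \<Longrightarrow> g \<cdot>\<^bsub>C\<^esub> (r \<odot>\<^bsub>Hom C a b\<^esub> f) = r \<odot>\<^bsub>Hom C a c\<^esub> (g \<cdot>\<^bsub>C\<^esub> f)"

definition is_iso :: "('k, 'o, 'm, 'z) lincat_scheme \<Rightarrow> 'm \<Rightarrow> 'o \<Rightarrow> 'o \<Rightarrow> bool"
  where "is_iso C f a b \<longleftrightarrow> \<guillemotleft>f : a \<rightarrow>\<^bsub>C\<^esub> b\<guillemotright> \<and>
    (\<exists>g. \<guillemotleft>g : b \<rightarrow>\<^bsub>C\<^esub> a\<guillemotright> \<and> g \<cdot>\<^bsub>C\<^esub> f = Id C a \<and> f \<cdot>\<^bsub>C\<^esub> g = Id C b)"

definition isomorphic :: "('k, 'o, 'm, 'z) lincat_scheme \<Rightarrow> 'o \<Rightarrow> 'o \<Rightarrow> bool"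
  where "isomorphic C a b \<longleftrightarrow> (\<exists>f. is_iso C f a b)"

definition full_sub :: "('k, 'o, 'm, 'z) lincat_scheme \<Rightarrow> 'o set \<Rightarrow> ('k, 'o, 'm, 'z) lincat_scheme"
  where "full_sub C U = C\<lparr>Ob := U\<rparr>"

text \<open>
  \<open>p\<close> is a direct sum (biproduct) of the list \<open>xs\<close>, with injections \<open>i\<close> and projections \<open>q\<close>; for
  the empty list this says that \<open>p\<close> is a zero object (its identity is the zero morphism).
\<close>

definition is_dsum :: "('k, 'o, 'm, 'z) lincat_scheme \<Rightarrow> 'o \<Rightarrow> 'o list \<Rightarrow> bool"
  where "is_dsum C p xs \<longleftrightarrow> p \<in> Ob C \<and> set xs \<subseteq> Ob C \<and>
    (\<exists>i q :: nat \<Rightarrow> 'm.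
      (\<forall>j < length xs. \<guillemotleft>i j : xs ! j \<rightarrow>\<^bsub>C\<^esub> p\<guillemotright> \<and> \<guillemotleft>q j : p \<rightarrow>\<^bsub>C\<^esub> xs ! j\<guillemotright>) \<and>
      (\<forall>j < length xs. \<forall>l < length xs.
        q l \<cdot>\<^bsub>C\<^esub> i j = (if j = l then Id C (xs ! j) else zero_mor C (xs ! j) (xs ! l))) \<and>
      finsum (Hom C p p) (\<lambda>j. i j \<cdot>\<^bsub>C\<^esub> q j) {..<length xs} = Id C p)"

definition is_zero_object :: "('k, 'o, 'm, 'z) lincat_scheme \<Rightarrow> 'o \<Rightarrow> bool"
  where "is_zero_object C z \<longleftrightarrow> is_dsum C z []"

definition is_summand :: "('k, 'o, 'm, 'z) lincat_scheme \<Rightarrow> 'o \<Rightarrow> 'o \<Rightarrow> bool"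
  where "is_summand C x p \<longleftrightarrow> (\<exists>y. is_dsum C p [x, y])"

definition additive_category ::
    "('k, 'r) ring_scheme \<Rightarrow> ('k, 'o, 'm, 'z) lincat_scheme \<Rightarrow> bool"
  where "additive_category k C \<longleftrightarrow> klinear_category k C \<and>
    (\<forall>xs. set xs \<subseteq> Ob C \<longrightarrow> (\<exists>p. is_dsum C p xs))"

definition add_closure :: "('k, 'o, 'm, 'z) lincat_scheme \<Rightarrow> 'o \<Rightarrow> 'o set"
  where "add_closure C s = {x. \<exists>n p. is_dsum C p (replicate n s) \<and> is_summand C x p}"

definition fin_gen_module :: "('k, 'r) ring_scheme \<Rightarrow> ('k, 'm, 'z) module_scheme \<Rightarrow> bool"
  where "fin_gen_module k M \<longleftrightarrow> (\<exists>B. finite B \<and> B \<subseteq> carrier M \<and>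
    (\<forall>x \<in> carrier M. \<exists>c \<in> B \<rightarrow> carrier k. x = (\<Oplus>\<^bsub>M\<^esub>b\<in>B. c b \<odot>\<^bsub>M\<^esub> b)))"

definition hom_finite :: "('k, 'r) ring_scheme \<Rightarrow> ('k, 'o, 'm, 'z) lincat_scheme \<Rightarrow> bool"
  where "hom_finite k C \<longleftrightarrow> (\<forall>a \<in> Ob C. \<forall>b \<in> Ob C. fin_gen_module k (Hom C a b))"

definition End_ring :: "('k, 'o, 'm, 'z) lincat_scheme \<Rightarrow> 'o \<Rightarrow> 'm ring"
  where "End_ring C a = \<lparr>carrier = carrier (Hom C a a), mult = Cmp C, one = Id C a,
    zero = zero_mor C a a, add = add (Hom C a a)\<rparr>"

definition local_ring :: "('a, 'r) ring_scheme \<Rightarrow> bool"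
  where "local_ring R \<longleftrightarrow> ring R \<and> \<one>\<^bsub>R\<^esub> \<noteq> \<zero>\<^bsub>R\<^esub> \<and>
    (\<forall>x \<in> carrier R - Units R. \<forall>y \<in> carrier R - Units R. x \<oplus>\<^bsub>R\<^esub> y \<notin> Units R)"

definition krull_schmidt :: "('k, 'o, 'm, 'z) lincat_scheme \<Rightarrow> bool"
  where "krull_schmidt C \<longleftrightarrow> (\<forall>a \<in> Ob C. \<exists>xs. is_dsum C a xs \<and> (\<forall>x \<in> set xs. local_ring (End_ring C x)))"

section \<open>Functors\<close>

record ('o, 'p, 'm, 'n) func =
  FOb :: "'o \<Rightarrow> 'p"
  FMor :: "'m \<Rightarrow> 'n"

definition linear_functor :: "('k, 'r) ring_scheme \<Rightarrow> ('k, 'o, 'm, 'z) lincat_scheme \<Rightarrow>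
    ('k, 'p, 'n, 'y) lincat_scheme \<Rightarrow> ('o, 'p, 'm, 'n) func \<Rightarrow> bool"
  where "linear_functor k C D F \<longleftrightarrow>
    (\<forall>a \<in> Ob C. FOb F a \<in> Ob D) \<and>
    (\<forall>a b f. \<guillemotleft>f : a \<rightarrow>\<^bsub>C\<^esub> b\<guillemotright> \<longrightarrow> \<guillemotleft>FMor F f : FOb F a \<rightarrow>\<^bsub>D\<^esub> FOb F b\<guillemotright>) \<and>
    (\<forall>a \<in> Ob C. FMor F (Id C a) = Id D (FOb F a)) \<and>
    (\<forall>a b c f g. \<guillemotleft>f : a \<rightarrow>\<^bsub>C\<^esub> b\<guillemotright> \<and> \<guillemotleft>g : b \<rightarrow>\<^bsub>C\<^esub> c\<guillemotright> \<longrightarrow>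
      FMor F (g \<cdot>\<^bsub>C\<^esub> f) = FMor F g \<cdot>\<^bsub>D\<^esub> FMor F f) \<and>
    (\<forall>a b f g. \<guillemotleft>f : a \<rightarrow>\<^bsub>C\<^esub> b\<guillemotright> \<and> \<guillemotleft>g : a \<rightarrow>\<^bsub>C\<^esub> b\<guillemotright> \<longrightarrow>
      FMor F (f \<oplus>\<^bsub>Hom C a b\<^esub> g) = FMor F f \<oplus>\<^bsub>Hom D (FOb F a) (FOb F b)\<^esub> FMor F g) \<and>
    (\<forall>a b f. \<forall>r \<in> carrier k. \<guillemotleft>f : a \<rightarrow>\<^bsub>C\<^esub> b\<guillemotright> \<longrightarrow>
      FMor F (r \<odot>\<^bsub>Hom C a b\<^esub> f) = r \<odot>\<^bsub>Hom D (FOb F a) (FOb F b)\<^esub> FMor F f)"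

definition linear_equivalence :: "('k, 'r) ring_scheme \<Rightarrow> ('k, 'o, 'm, 'z) lincat_scheme \<Rightarrow>
    ('k, 'p, 'n, 'y) lincat_scheme \<Rightarrow> ('o, 'p, 'm, 'n) func \<Rightarrow> bool"
  where "linear_equivalence k C D F \<longleftrightarrow> linear_functor k C D F \<and>
    (\<forall>a \<in> Ob C. \<forall>b \<in> Ob C.
      bij_betw (FMor F) (carrier (Hom C a b)) (carrier (Hom D (FOb F a) (FOb F b)))) \<and>
    (\<forall>d \<in> Ob D. \<exists>a \<in> Ob C. isomorphic D (FOb F a) d)"

definition essential_image ::
    "('k, 'p, 'n, 'y) lincat_scheme \<Rightarrow> ('o, 'p, 'm, 'n) func \<Rightarrow> 'o set \<Rightarrow> 'p set"
  where "essential_image D F U = {d \<in> Ob D. \<exists>u \<in> U. isomorphic D (FOb F u) d}"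

section \<open>Triangulated categories\<close>

text \<open>
  \<open>Tri\<close> is the class of distinguished triangles \<open>a \<rightarrow> b \<rightarrow> c \<rightarrow> \<Sigma> a\<close>, each given by its three
  morphisms.
\<close>

record ('k, 'o, 'm) tricat = "('k, 'o, 'm) lincat" +
  Sh :: "('o, 'o, 'm, 'm) func"
  Tri :: "('m \<times> 'm \<times> 'm) set"

abbreviation shift :: "('k, 'o, 'm, 'z) tricat_scheme \<Rightarrow> 'o \<Rightarrow> 'o" (\<open>\<Sigma>\<index>\<close>)
  where "shift T \<equiv> FOb (Sh T)"

abbreviation shift_mor :: "('k, 'o, 'm, 'z) tricat_scheme \<Rightarrow> 'm \<Rightarrow> 'm"
  where "shift_mor T \<equiv> FMor (Sh T)"

definition candidate_triangle ::
    "('k, 'o, 'm, 'z) tricat_scheme \<Rightarrow> 'o \<Rightarrow> 'o \<Rightarrow> 'o \<Rightarrow> 'm \<Rightarrow> 'm \<Rightarrow> 'm \<Rightarrow> bool"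
  where "candidate_triangle T a b c f g h \<longleftrightarrow>
    \<guillemotleft>f : a \<rightarrow>\<^bsub>T\<^esub> b\<guillemotright> \<and> \<guillemotleft>g : b \<rightarrow>\<^bsub>T\<^esub> c\<guillemotright> \<and> \<guillemotleft>h : c \<rightarrow>\<^bsub>T\<^esub> \<Sigma>\<^bsub>T\<^esub> a\<guillemotright>"

definition dist_triangle ::
    "('k, 'o, 'm, 'z) tricat_scheme \<Rightarrow> 'o \<Rightarrow> 'o \<Rightarrow> 'o \<Rightarrow> 'm \<Rightarrow> 'm \<Rightarrow> 'm \<Rightarrow> bool"
  where "dist_triangle T a b c f g h \<longleftrightarrow> candidate_triangle T a b c f g h \<and> (f, g, h) \<in> Tri T"

text \<open>
  Verdier's axioms, for a shift functor that is an autoequivalence (not necessarily strictly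
  invertible).
\<close>

locale triangulated_category =
  fixes k :: "('k, 'r) ring_scheme" and T :: "('k, 'o, 'm, 'z) tricat_scheme"
  assumes additive: "additive_category k T"
    and shift_equivalence: "linear_equivalence k T T (Sh T)"
    and Tri_candidate: "(f, g, h) \<in> Tri T \<Longrightarrow> \<exists>a b c. candidate_triangle T a b c f g h"
    and TR1_iso: "\<lbrakk>dist_triangle T a b c f g h; candidate_triangle T a' b' c' f' g' h';
        is_iso T \<alpha> a a'; is_iso T \<beta> b b'; is_iso T \<gamma> c c';
        \<beta> \<cdot>\<^bsub>T\<^esub> f = f' \<cdot>\<^bsub>T\<^esub> \<alpha>; \<gamma> \<cdot>\<^bsub>T\<^esub> g = g' \<cdot>\<^bsub>T\<^esub> \<beta>; shift_mor T \<alpha> \<cdot>\<^bsub>T\<^esub> h = h' \<cdot>\<^bsub>T\<^esub> \<gamma>\<rbrakk>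
      \<Longrightarrow> dist_triangle T a' b' c' f' g' h'"
    and TR1_id: "\<lbrakk>a \<in> Ob T; is_zero_object T z\<rbrakk>
      \<Longrightarrow> dist_triangle T a a z (Id T a) (zero_mor T a z) (zero_mor T z (\<Sigma>\<^bsub>T\<^esub> a))"
    and TR1_cone: "\<guillemotleft>f : a \<rightarrow>\<^bsub>T\<^esub> b\<guillemotright> \<Longrightarrow> \<exists>c g h. dist_triangle T a b c f g h"
    and TR2: "candidate_triangle T a b c f g h
      \<Longrightarrow> dist_triangle T a b c f g h \<longleftrightarrow>
        dist_triangle T b c (\<Sigma>\<^bsub>T\<^esub> a) g h (\<ominus>\<^bsub>Hom T (\<Sigma>\<^bsub>T\<^esub> a) (\<Sigma>\<^bsub>T\<^esub> b)\<^esub> shift_mor T f)"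
    and TR3: "\<lbrakk>dist_triangle T a b c f g h; dist_triangle T a' b' c' f' g' h';
        \<guillemotleft>\<alpha> : a \<rightarrow>\<^bsub>T\<^esub> a'\<guillemotright>; \<guillemotleft>\<beta> : b \<rightarrow>\<^bsub>T\<^esub> b'\<guillemotright>; \<beta> \<cdot>\<^bsub>T\<^esub> f = f' \<cdot>\<^bsub>T\<^esub> \<alpha>\<rbrakk>
      \<Longrightarrow> \<exists>\<gamma>. \<guillemotleft>\<gamma> : c \<rightarrow>\<^bsub>T\<^esub> c'\<guillemotright> \<and> \<gamma> \<cdot>\<^bsub>T\<^esub> g = g' \<cdot>\<^bsub>T\<^esub> \<beta> \<and> shift_mor T \<alpha> \<cdot>\<^bsub>T\<^esub> h = h' \<cdot>\<^bsub>T\<^esub> \<gamma>"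
    and TR4: "\<lbrakk>dist_triangle T a b c' u i i'; dist_triangle T b c a' v j j';
        dist_triangle T a c b' (v \<cdot>\<^bsub>T\<^esub> u) l l'\<rbrakk>
      \<Longrightarrow> \<exists>p q. dist_triangle T c' b' a' p q (shift_mor T i \<cdot>\<^bsub>T\<^esub> j') \<and>
        p \<cdot>\<^bsub>T\<^esub> i = l \<cdot>\<^bsub>T\<^esub> v \<and> l' \<cdot>\<^bsub>T\<^esub> p = i' \<and> q \<cdot>\<^bsub>T\<^esub> l = j \<and> j' \<cdot>\<^bsub>T\<^esub> q = shift_mor T u \<cdot>\<^bsub>T\<^esub> l'"

definition presilting :: "('k, 'o, 'm, 'z) tricat_scheme \<Rightarrow> 'o set \<Rightarrow> bool"
  where "presilting T S \<longleftrightarrow> (\<forall>s\<^sub>1 \<in> S. \<forall>s\<^sub>2 \<in> S. \<forall>i > 0.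
    carrier (Hom T s\<^sub>1 ((\<Sigma>\<^bsub>T\<^esub> ^^ i) s\<^sub>2)) = {zero_mor T s\<^sub>1 ((\<Sigma>\<^bsub>T\<^esub> ^^ i) s\<^sub>2)})"

definition star :: "('k, 'o, 'm, 'z) tricat_scheme \<Rightarrow> 'o set \<Rightarrow> 'o set \<Rightarrow> 'o set"
  where "star T U V = {t. \<exists>u \<in> U. \<exists>v \<in> V. \<exists>f g h. dist_triangle T u t v f g h}"

section \<open>Cotorsion pairs\<close>

text \<open>
  The extriangulated structure that an extension-closed class \<open>C\<close> of objects inherits from \<open>T\<close>.
  The object \<open>\<Sigma> a\<close> need not lie in \<open>C\<close>.
\<close>

definition E_ext :: "('k, 'o, 'm, 'z) tricat_scheme \<Rightarrow> 'o \<Rightarrow> 'o \<Rightarrow> ('k, 'm) module"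
  where "E_ext T c a = Hom T c (\<Sigma>\<^bsub>T\<^esub> a)"

definition E_triangle :: "('k, 'o, 'm, 'z) tricat_scheme \<Rightarrow> 'o set \<Rightarrow> 'o \<Rightarrow> 'o \<Rightarrow> 'o \<Rightarrow> bool"
  where "E_triangle T C a b c \<longleftrightarrow> a \<in> C \<and> b \<in> C \<and> c \<in> C \<and> (\<exists>f g h. dist_triangle T a b c f g h)"

text \<open>Closure under direct summands includes closure under isomorphism.\<close>

definition additive_summand_closed :: "('k, 'o, 'm, 'z) lincat_scheme \<Rightarrow> 'o set \<Rightarrow> bool"
  where "additive_summand_closed C X \<longleftrightarrow> X \<subseteq> Ob C \<and>
    (\<forall>xs p. set xs \<subseteq> X \<and> is_dsum C p xs \<longrightarrow> p \<in> X) \<and>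
    (\<forall>x p. p \<in> X \<and> is_summand C x p \<longrightarrow> x \<in> X)"

definition complete_cotorsion_pair ::
    "('k, 'o, 'm, 'z) tricat_scheme \<Rightarrow> 'o set \<Rightarrow> 'o set \<Rightarrow> 'o set \<Rightarrow> bool"
  where "complete_cotorsion_pair T C X Y \<longleftrightarrow>
    additive_summand_closed (full_sub T C) X \<and> additive_summand_closed (full_sub T C) Y \<and>
    (\<forall>x \<in> X. \<forall>y \<in> Y. carrier (E_ext T x y) = {\<zero>\<^bsub>E_ext T x y\<^esub>}) \<and>
    (\<forall>c \<in> C. \<exists>x \<in> X. \<exists>y \<in> Y. E_triangle T C c y x) \<and>
    (\<forall>c \<in> C. \<exists>x \<in> X. \<exists>y \<in> Y. E_triangle T C y x c)"

section \<open>Torsion pairs\<close>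

definition right_perp :: "('k, 'o, 'm, 'z) lincat_scheme \<Rightarrow> 'o set \<Rightarrow> 'o set"
  where "right_perp H U = {h \<in> Ob H. \<forall>u \<in> U. carrier (Hom H u h) = {zero_mor H u h}}"

definition left_perp :: "('k, 'o, 'm, 'z) lincat_scheme \<Rightarrow> 'o set \<Rightarrow> 'o set"
  where "left_perp H U = {h \<in> Ob H. \<forall>u \<in> U. carrier (Hom H h u) = {zero_mor H h u}}"

definition is_kernel :: "('k, 'o, 'm, 'z) lincat_scheme \<Rightarrow> 'o \<Rightarrow> 'o \<Rightarrow> 'o \<Rightarrow> 'm \<Rightarrow> 'm \<Rightarrow> bool"
  where "is_kernel H a b c f g \<longleftrightarrow> \<guillemotleft>f : a \<rightarrow>\<^bsub>H\<^esub> b\<guillemotright> \<and> \<guillemotleft>g : b \<rightarrow>\<^bsub>H\<^esub> c\<guillemotright> \<and> g \<cdot>\<^bsub>H\<^esub> f = zero_mor H a c \<and>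
    (\<forall>x t. \<guillemotleft>t : x \<rightarrow>\<^bsub>H\<^esub> b\<guillemotright> \<and> g \<cdot>\<^bsub>H\<^esub> t = zero_mor H x c \<longrightarrow> (\<exists>!u. \<guillemotleft>u : x \<rightarrow>\<^bsub>H\<^esub> a\<guillemotright> \<and> f \<cdot>\<^bsub>H\<^esub> u = t))"

definition is_cokernel :: "('k, 'o, 'm, 'z) lincat_scheme \<Rightarrow> 'o \<Rightarrow> 'o \<Rightarrow> 'o \<Rightarrow> 'm \<Rightarrow> 'm \<Rightarrow> bool"
  where "is_cokernel H a b c f g \<longleftrightarrow> \<guillemotleft>f : a \<rightarrow>\<^bsub>H\<^esub> b\<guillemotright> \<and> \<guillemotleft>g : b \<rightarrow>\<^bsub>H\<^esub> c\<guillemotright> \<and> g \<cdot>\<^bsub>H\<^esub> f = zero_mor H a c \<and>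
    (\<forall>x t. \<guillemotleft>t : b \<rightarrow>\<^bsub>H\<^esub> x\<guillemotright> \<and> t \<cdot>\<^bsub>H\<^esub> f = zero_mor H a x \<longrightarrow> (\<exists>!u. \<guillemotleft>u : c \<rightarrow>\<^bsub>H\<^esub> x\<guillemotright> \<and> u \<cdot>\<^bsub>H\<^esub> g = t))"

definition short_exact :: "('k, 'o, 'm, 'z) lincat_scheme \<Rightarrow> 'o \<Rightarrow> 'o \<Rightarrow> 'o \<Rightarrow> 'm \<Rightarrow> 'm \<Rightarrow> bool"
  where "short_exact H a b c f g \<longleftrightarrow> is_kernel H a b c f g \<and> is_cokernel H a b c f g"

definition torsion_pair :: "('k, 'o, 'm, 'z) lincat_scheme \<Rightarrow> 'o set \<Rightarrow> 'o set \<Rightarrow> bool"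
  where "torsion_pair H U V \<longleftrightarrow> U \<subseteq> Ob H \<and> V \<subseteq> Ob H \<and> right_perp H U = V \<and> left_perp H V = U \<and>
    (\<forall>h \<in> Ob H. \<exists>t \<in> U. \<exists>v \<in> V. \<exists>f g. short_exact H t h v f g)"

definition torsion_class :: "('k, 'o, 'm, 'z) lincat_scheme \<Rightarrow> 'o set \<Rightarrow> bool"
  where "torsion_class H U \<longleftrightarrow> (\<exists>V. torsion_pair H U V)"

definition covariantly_finite :: "('k, 'o, 'm, 'z) lincat_scheme \<Rightarrow> 'o set \<Rightarrow> bool"
  where "covariantly_finite H U \<longleftrightarrow> (\<forall>h \<in> Ob H. \<exists>t \<in> U. \<exists>f. \<guillemotleft>f : h \<rightarrow>\<^bsub>H\<^esub> t\<guillemotright> \<and>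
    (\<forall>t' \<in> U. \<forall>f'. \<guillemotleft>f' : h \<rightarrow>\<^bsub>H\<^esub> t'\<guillemotright> \<longrightarrow> (\<exists>g. \<guillemotleft>g : t \<rightarrow>\<^bsub>H\<^esub> t'\<guillemotright> \<and> f' = g \<cdot>\<^bsub>H\<^esub> f)))"

definition functorially_finite_torsion_pair ::
    "('k, 'o, 'm, 'z) lincat_scheme \<Rightarrow> 'o set \<Rightarrow> 'o set \<Rightarrow> bool"
  where "functorially_finite_torsion_pair H U V \<longleftrightarrow> torsion_pair H U V \<and> covariantly_finite H U"

section \<open>Finitely presented functors\<close>

definition module_homs ::
    "('k, 'r) ring_scheme \<Rightarrow> ('k, 'x, 'z) module_scheme \<Rightarrow> ('k, 'y, 'w) module_scheme \<Rightarrow> ('x \<Rightarrow> 'y) set"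
  where "module_homs k M N = {h \<in> carrier M \<rightarrow> carrier N.
    (\<forall>x \<in> carrier M. \<forall>y \<in> carrier M. h (x \<oplus>\<^bsub>M\<^esub> y) = h x \<oplus>\<^bsub>N\<^esub> h y) \<and>
    (\<forall>r \<in> carrier k. \<forall>x \<in> carrier M. h (r \<odot>\<^bsub>M\<^esub> x) = r \<odot>\<^bsub>N\<^esub> h x)}"

text \<open>
  Contravariant additive functors from \<open>S\<close> to \<open>k\<close>-modules. Only the values on objects and morphisms
  of \<open>S\<close>, and on elements of the carriers, are significant.
\<close>

type_synonym ('k, 'o, 'm, 'x) modfunc = "('o, ('k, 'x) module, 'm, 'x \<Rightarrow> 'x) func"

definition additive_cofunctor :: "('k, 'r) ring_scheme \<Rightarrow> ('k, 'o, 'm, 'z) lincat_scheme \<Rightarrow>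
    ('k, 'o, 'm, 'x) modfunc \<Rightarrow> bool"
  where "additive_cofunctor k S M \<longleftrightarrow>
    (\<forall>a \<in> Ob S. module k (FOb M a)) \<and>
    (\<forall>a b f. \<guillemotleft>f : a \<rightarrow>\<^bsub>S\<^esub> b\<guillemotright> \<longrightarrow> FMor M f \<in> module_homs k (FOb M b) (FOb M a)) \<and>
    (\<forall>a \<in> Ob S. \<forall>x \<in> carrier (FOb M a). FMor M (Id S a) x = x) \<and>
    (\<forall>a b c f g. \<guillemotleft>f : a \<rightarrow>\<^bsub>S\<^esub> b\<guillemotright> \<and> \<guillemotleft>g : b \<rightarrow>\<^bsub>S\<^esub> c\<guillemotright> \<longrightarrow>
      (\<forall>x \<in> carrier (FOb M c). FMor M (g \<cdot>\<^bsub>S\<^esub> f) x = FMor M f (FMor M g x))) \<and>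
    (\<forall>a b f g. \<guillemotleft>f : a \<rightarrow>\<^bsub>S\<^esub> b\<guillemotright> \<and> \<guillemotleft>g : a \<rightarrow>\<^bsub>S\<^esub> b\<guillemotright> \<longrightarrow>
      (\<forall>x \<in> carrier (FOb M b).
        FMor M (f \<oplus>\<^bsub>Hom S a b\<^esub> g) x = FMor M f x \<oplus>\<^bsub>FOb M a\<^esub> FMor M g x))"

definition nat_trans :: "('k, 'r) ring_scheme \<Rightarrow> ('k, 'o, 'm, 'z) lincat_scheme \<Rightarrow>
    ('k, 'o, 'm, 'x) modfunc \<Rightarrow> ('k, 'o, 'm, 'y) modfunc \<Rightarrow> ('o \<Rightarrow> 'x \<Rightarrow> 'y) set"
  where "nat_trans k S M N = {\<eta> \<in> extensional (Ob S).
    (\<forall>a \<in> Ob S. \<eta> a \<in> module_homs k (FOb M a) (FOb N a) \<inter> extensional (carrier (FOb M a))) \<and>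
    (\<forall>a b f. \<guillemotleft>f : a \<rightarrow>\<^bsub>S\<^esub> b\<guillemotright> \<longrightarrow>
      (\<forall>x \<in> carrier (FOb M b). \<eta> a (FMor M f x) = FMor N f (\<eta> b x)))}"

definition representable :: "('k, 'o, 'm, 'z) lincat_scheme \<Rightarrow> 'o \<Rightarrow> ('k, 'o, 'm, 'm) modfunc"
  where "representable C t = \<lparr>FOb = (\<lambda>a. Hom C a t), FMor = (\<lambda>f x. x \<cdot>\<^bsub>C\<^esub> f)\<rparr>"

text \<open>Finite presentation: an exact sequence \<open>S(-, s\<^sub>1) \<rightarrow> S(-, s\<^sub>0) \<rightarrow> M \<rightarrow> 0\<close>.\<close>

definition fin_pres_cofunctor :: "('k, 'r) ring_scheme \<Rightarrow> ('k, 'o, 'm, 'z) lincat_scheme \<Rightarrow>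
    ('k, 'o, 'm, 'x) modfunc \<Rightarrow> bool"
  where "fin_pres_cofunctor k S M \<longleftrightarrow> additive_cofunctor k S M \<and>
    (\<exists>s\<^sub>0 \<in> Ob S. \<exists>s\<^sub>1 \<in> Ob S.
      \<exists>\<alpha> \<in> nat_trans k S (representable S s\<^sub>1) (representable S s\<^sub>0).
      \<exists>\<pi> \<in> nat_trans k S (representable S s\<^sub>0) M.
        \<forall>a \<in> Ob S. \<pi> a ` carrier (Hom S a s\<^sub>0) = carrier (FOb M a) \<and>
          \<alpha> a ` carrier (Hom S a s\<^sub>1) = {x \<in> carrier (Hom S a s\<^sub>0). \<pi> a x = \<zero>\<^bsub>FOb M a\<^esub>})"

text \<open>
  The \<open>k\<close>-linear category \<open>mod S\<close>. A morphism is a natural transformation tagged with its source and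
  target; addition, scalar multiplication and composition are pointwise.
\<close>

type_synonym ('k, 'o, 'm, 'x) modmor =
  "('k, 'o, 'm, 'x) modfunc \<times> ('k, 'o, 'm, 'x) modfunc \<times> ('o \<Rightarrow> 'x \<Rightarrow> 'x)"

definition mod_cat :: "('k, 'r) ring_scheme \<Rightarrow> ('k, 'o, 'm, 'z) lincat_scheme \<Rightarrow>
    ('k, ('k, 'o, 'm, 'x) modfunc, ('k, 'o, 'm, 'x) modmor) lincat"
  where "mod_cat k S = \<lparr>
    Ob = {M. fin_pres_cofunctor k S M},
    Dom = (\<lambda>(M, N, \<eta>). M),
    Cod = (\<lambda>(M, N, \<eta>). N),
    Hom = (\<lambda>M N. \<lparr>
      carrier = {(M, N, \<eta>) |\<eta>. \<eta> \<in> nat_trans k S M N},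
      mult = undefined, one = undefined,
      zero = (M, N, \<lambda>a\<in>Ob S. \<lambda>x\<in>carrier (FOb M a). \<zero>\<^bsub>FOb N a\<^esub>),
      add = (\<lambda>(_, _, \<eta>) (_, _, \<theta>). (M, N, \<lambda>a\<in>Ob S. \<lambda>x\<in>carrier (FOb M a). \<eta> a x \<oplus>\<^bsub>FOb N a\<^esub> \<theta> a x)),
      smult = (\<lambda>r (_, _, \<eta>). (M, N, \<lambda>a\<in>Ob S. \<lambda>x\<in>carrier (FOb M a). r \<odot>\<^bsub>FOb N a\<^esub> \<eta> a x))\<rparr>),
    Cmp = (\<lambda>(_, P, \<theta>) (M, _, \<eta>). (M, P, \<lambda>a\<in>Ob S. \<lambda>x\<in>carrier (FOb M a). \<theta> a (\<eta> a x))),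
    Id = (\<lambda>M. (M, M, \<lambda>a\<in>Ob S. \<lambda>x\<in>carrier (FOb M a). x))\<rparr>"

text \<open>The functor \<open>t \<mapsto> T(-, t)|\<^sub>S\<close>, acting on morphisms by postcomposition.\<close>

definition restricted_yoneda :: "('k, 'o, 'm, 'z) lincat_scheme \<Rightarrow> 'o set \<Rightarrow>
    ('o, ('k, 'o, 'm, 'm) modfunc, 'm, ('k, 'o, 'm, 'm) modmor) func"
  where "restricted_yoneda T S = \<lparr>
    FOb = representable T,
    FMor = (\<lambda>f. (representable T (Dom T f), representable T (Cod T f),
      \<lambda>a\<in>S. \<lambda>x\<in>carrier (Hom T a (Dom T f)). f \<cdot>\<^bsub>T\<^esub> x))\<rparr>"

text \<open>
  The restricted Yoneda functor takes values in modules whose elements have the type \<open>'m\<close> of the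
  morphisms. Considering only such functors loses nothing: every finitely presented functor, with
  modules over any type \<open>'x\<close>, is isomorphic to one of them, since its value at \<open>a\<close> is a quotient of
  some \<open>Hom S a s\<^sub>0\<close> and can be carried by a set of representatives. This is proved below.
\<close>

definition transport_module :: "('x \<Rightarrow> 'y) \<Rightarrow> ('y \<Rightarrow> 'x) \<Rightarrow> ('k, 'x) module \<Rightarrow> ('k, 'y) module"
  where "transport_module \<sigma> \<pi> M = \<lparr>carrier = \<sigma> ` carrier M, mult = undefined, one = undefined,
    zero = \<sigma> \<zero>\<^bsub>M\<^esub>, add = (\<lambda>x y. \<sigma> (\<pi> x \<oplus>\<^bsub>M\<^esub> \<pi> y)), smult = (\<lambda>r x. \<sigma> (r \<odot>\<^bsub>M\<^esub> \<pi> x))\<rparr>"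

lemma module_transport:
  assumes M: "module k M" and inv: "\<And>x. x \<in> carrier M \<Longrightarrow> \<pi> (\<sigma> x) = x"
  shows "module k (transport_module \<sigma> \<pi> M)"
proof -
  interpret M: module k M by (rule M)
  let ?N = "transport_module \<sigma> \<pi> M"
  show ?thesis
  proof (rule moduleI)
    show "cring k" by (rule M.R.is_cring)
    show "abelian_group ?N"
    proof (rule abelian_groupI)
      fix x assume "x \<in> carrier ?N"
      then obtain u where u: "u \<in> carrier M" "x = \<sigma> u" by (auto simp: transport_module_def)
      have "\<sigma> (\<ominus>\<^bsub>M\<^esub> u) \<oplus>\<^bsub>?N\<^esub> x = \<zero>\<^bsub>?N\<^esub>"
        using u by (simp add: transport_module_def inv M.l_neg)
      then show "\<exists>y\<in>carrier ?N. y \<oplus>\<^bsub>?N\<^esub> x = \<zero>\<^bsub>?N\<^esub>"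
        using u by (intro bexI[of _ "\<sigma> (\<ominus>\<^bsub>M\<^esub> u)"]) (auto simp: transport_module_def)
    next
      fix x y assume "x \<in> carrier ?N" "y \<in> carrier ?N"
      then show "x \<oplus>\<^bsub>?N\<^esub> y = y \<oplus>\<^bsub>?N\<^esub> x"
        by (auto simp: transport_module_def inv M.a_comm)
    qed (auto simp: transport_module_def inv M.a_assoc)
  qed (auto simp: transport_module_def inv M.smult_l_distr M.smult_r_distr M.smult_assoc1)
qed

lemma fin_pres_cofunctor_iso_hom_valued:
  fixes M :: "('k, 'o, 'm, 'x) modfunc"
  assumes S: "klinear_category k S" and M: "fin_pres_cofunctor k S M"
  obtains N :: "('k, 'o, 'm, 'm) modfunc" and \<eta>
  where "fin_pres_cofunctor k S N" "\<eta> \<in> nat_trans k S M N"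
    "\<And>a. a \<in> Ob S \<Longrightarrow> bij_betw (\<eta> a) (carrier (FOb M a)) (carrier (FOb N a))"
proof -
  have add: "additive_cofunctor k S M" using M by (simp add: fin_pres_cofunctor_def)
  obtain s\<^sub>0 s\<^sub>1 \<alpha> \<pi> where s: "s\<^sub>0 \<in> Ob S" "s\<^sub>1 \<in> Ob S"
    and \<alpha>: "\<alpha> \<in> nat_trans k S (representable S s\<^sub>1) (representable S s\<^sub>0)"
    and \<pi>: "\<pi> \<in> nat_trans k S (representable S s\<^sub>0) M"
    and pres: "\<forall>a \<in> Ob S. \<pi> a ` carrier (Hom S a s\<^sub>0) = carrier (FOb M a) \<and>
      \<alpha> a ` carrier (Hom S a s\<^sub>1) = {x \<in> carrier (Hom S a s\<^sub>0). \<pi> a x = \<zero>\<^bsub>FOb M a\<^esub>}"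
    using M unfolding fin_pres_cofunctor_def by (elim conjE bexE) (rule that)
  have onto: "\<pi> a ` carrier (Hom S a s\<^sub>0) = carrier (FOb M a)"
    and exact: "\<alpha> a ` carrier (Hom S a s\<^sub>1) = {x \<in> carrier (Hom S a s\<^sub>0). \<pi> a x = \<zero>\<^bsub>FOb M a\<^esub>}"
    if "a \<in> Ob S" for a
    using pres that by simp_all
  define \<sigma> where "\<sigma> a = inv_into (carrier (Hom S a s\<^sub>0)) (\<pi> a)" for a
  define N :: "('k, 'o, 'm, 'm) modfunc" where
    "N = \<lparr>FOb = (\<lambda>a. transport_module (\<sigma> a) (\<pi> a) (FOb M a)),
      FMor = (\<lambda>f y. \<sigma> (Dom S f) (FMor M f (\<pi> (Cod S f) y)))\<rparr>"
  define \<eta> where "\<eta> = (\<lambda>a\<in>Ob S. \<lambda>x\<in>carrier (FOb M a). \<sigma> a x)"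
  define \<rho> where "\<rho> = (\<lambda>a\<in>Ob S. \<lambda>y\<in>carrier (Hom S a s\<^sub>0). \<sigma> a (\<pi> a y))"
  have inv: "\<pi> a (\<sigma> a x) = x" if "a \<in> Ob S" "x \<in> carrier (FOb M a)" for a x
    using that onto[of a] by (simp add: \<sigma>_def f_inv_into_f)
  have mod: "module k (FOb M a)" if "a \<in> Ob S" for a
    using add that by (simp add: additive_cofunctor_def)
  have plus [simp]: "x \<oplus>\<^bsub>FOb M a\<^esub> y \<in> carrier (FOb M a)"
    if "a \<in> Ob S" "x \<in> carrier (FOb M a)" "y \<in> carrier (FOb M a)" for a x y
  proof -
    interpret module k "FOb M a" using mod that by simp
    show ?thesis using that by auto
  qed
  have smult [simp]: "r \<odot>\<^bsub>FOb M a\<^esub> x \<in> carrier (FOb M a)"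
    if "a \<in> Ob S" "r \<in> carrier k" "x \<in> carrier (FOb M a)" for a r x
    using mod[OF that(1)] that by (simp add: module.smult_closed)
  have zero: "\<zero>\<^bsub>FOb M a\<^esub> \<in> carrier (FOb M a)" if "a \<in> Ob S" for a
  proof -
    interpret module k "FOb M a" using mod that by simp
    show ?thesis by simp
  qed
  have DC: "Dom S f = a" "Cod S f = b" "a \<in> Ob S" "b \<in> Ob S" if "\<guillemotleft>f : a \<rightarrow>\<^bsub>S\<^esub> b\<guillemotright>" for f a b
    using klinear_category.Dom_Cod[OF S that] that by (auto simp: in_hom_def)
  have act: "FMor M f x \<in> carrier (FOb M a)"
    "y \<in> carrier (FOb M b) \<Longrightarrow> FMor M f (x \<oplus>\<^bsub>FOb M b\<^esub> y) = FMor M f x \<oplus>\<^bsub>FOb M a\<^esub> FMor M f y"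
    "r \<in> carrier k \<Longrightarrow> FMor M f (r \<odot>\<^bsub>FOb M b\<^esub> x) = r \<odot>\<^bsub>FOb M a\<^esub> FMor M f x"
    if "\<guillemotleft>f : a \<rightarrow>\<^bsub>S\<^esub> b\<guillemotright>" "x \<in> carrier (FOb M b)" for f a b x y r
  proof -
    have "FMor M f \<in> module_homs k (FOb M b) (FOb M a)"
      using add that by (simp add: additive_cofunctor_def)
    then show "FMor M f x \<in> carrier (FOb M a)"
      "y \<in> carrier (FOb M b) \<Longrightarrow> FMor M f (x \<oplus>\<^bsub>FOb M b\<^esub> y) = FMor M f x \<oplus>\<^bsub>FOb M a\<^esub> FMor M f y"
      "r \<in> carrier k \<Longrightarrow> FMor M f (r \<odot>\<^bsub>FOb M b\<^esub> x) = r \<odot>\<^bsub>FOb M a\<^esub> FMor M f x"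
      using that by (auto simp: module_homs_def)
  qed
  have N_Ob: "carrier (FOb N a) = \<sigma> a ` carrier (FOb M a)"
    "\<zero>\<^bsub>FOb N a\<^esub> = \<sigma> a \<zero>\<^bsub>FOb M a\<^esub>"
    "x \<oplus>\<^bsub>FOb N a\<^esub> y = \<sigma> a (\<pi> a x \<oplus>\<^bsub>FOb M a\<^esub> \<pi> a y)"
    "r \<odot>\<^bsub>FOb N a\<^esub> x = \<sigma> a (r \<odot>\<^bsub>FOb M a\<^esub> \<pi> a x)" for a x y r
    by (simp_all add: N_def transport_module_def)
  have N_Mor: "FMor N f (\<sigma> b x) = \<sigma> a (FMor M f x)"
    if "\<guillemotleft>f : a \<rightarrow>\<^bsub>S\<^esub> b\<guillemotright>" "x \<in> carrier (FOb M b)" for f a b x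
    using DC[OF that(1)] that by (simp add: N_def inv)
  have add_N: "additive_cofunctor k S N"
    unfolding additive_cofunctor_def
  proof (intro conjI allI ballI impI)
    fix a assume a: "a \<in> Ob S"
    then show "module k (FOb N a)"
      unfolding N_def by (simp add: module_transport mod inv)
    fix x assume "x \<in> carrier (FOb N a)"
    then obtain u where u: "x = \<sigma> a u" "u \<in> carrier (FOb M a)" by (auto simp: N_Ob)
    have "FMor M (Id S a) u = u" using add a u by (simp add: additive_cofunctor_def)
    then show "FMor N (Id S a) x = x"
      using N_Mor[OF klinear_category.Id_in[OF S a] u(2)] u by simp
  next
    fix a b f assume f: "\<guillemotleft>f : a \<rightarrow>\<^bsub>S\<^esub> b\<guillemotright>"
    show "FMor N f \<in> module_homs k (FOb N b) (FOb N a)"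
      using DC(3,4)[OF f] by (auto simp: module_homs_def N_Ob N_Mor[OF f] inv act[OF f])
  next
    fix a b c f g x assume fg: "\<guillemotleft>f : a \<rightarrow>\<^bsub>S\<^esub> b\<guillemotright> \<and> \<guillemotleft>g : b \<rightarrow>\<^bsub>S\<^esub> c\<guillemotright>"
      and "x \<in> carrier (FOb N c)"
    then obtain u where u: "x = \<sigma> c u" "u \<in> carrier (FOb M c)" by (auto simp: N_Ob)
    have "FMor M (g \<cdot>\<^bsub>S\<^esub> f) u = FMor M f (FMor M g u)"
      using add fg u(2) unfolding additive_cofunctor_def by blast
    moreover have "\<guillemotleft>g \<cdot>\<^bsub>S\<^esub> f : a \<rightarrow>\<^bsub>S\<^esub> c\<guillemotright>" using fg klinear_category.Cmp_in[OF S] by blast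
    ultimately show "FMor N (g \<cdot>\<^bsub>S\<^esub> f) x = FMor N f (FMor N g x)"
      using fg u act(1)[of g b c u] by (simp add: N_Mor[of g b c] N_Mor[of f a b] N_Mor[of _ a c])
  next
    fix a b f g x assume fg: "\<guillemotleft>f : a \<rightarrow>\<^bsub>S\<^esub> b\<guillemotright> \<and> \<guillemotleft>g : a \<rightarrow>\<^bsub>S\<^esub> b\<guillemotright>" and "x \<in> carrier (FOb N b)"
    then obtain u where u: "x = \<sigma> b u" "u \<in> carrier (FOb M b)" by (auto simp: N_Ob)
    have ab: "a \<in> Ob S" "b \<in> Ob S" using fg by (auto simp: in_hom_def)
    interpret module k "Hom S a b" using klinear_category.Hom_module[OF S] ab by blast
    have "\<guillemotleft>f \<oplus>\<^bsub>Hom S a b\<^esub> g : a \<rightarrow>\<^bsub>S\<^esub> b\<guillemotright>" using fg by (simp add: in_hom_def)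
    moreover have "FMor M (f \<oplus>\<^bsub>Hom S a b\<^esub> g) u = FMor M f u \<oplus>\<^bsub>FOb M a\<^esub> FMor M g u"
      using add fg u(2) unfolding additive_cofunctor_def by blast
    ultimately show "FMor N (f \<oplus>\<^bsub>Hom S a b\<^esub> g) x = FMor N f x \<oplus>\<^bsub>FOb N a\<^esub> FMor N g x"
      using fg u ab act(1)[of f a b u] act(1)[of g a b u] by (simp add: N_Mor[of _ a b] N_Ob inv)
  qed
  have \<pi>_hom: "\<pi> a y \<in> carrier (FOb M a)"
    "y' \<in> carrier (Hom S a s\<^sub>0) \<Longrightarrow> \<pi> a (y \<oplus>\<^bsub>Hom S a s\<^sub>0\<^esub> y') = \<pi> a y \<oplus>\<^bsub>FOb M a\<^esub> \<pi> a y'"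
    "r \<in> carrier k \<Longrightarrow> \<pi> a (r \<odot>\<^bsub>Hom S a s\<^sub>0\<^esub> y) = r \<odot>\<^bsub>FOb M a\<^esub> \<pi> a y"
    if "a \<in> Ob S" "y \<in> carrier (Hom S a s\<^sub>0)" for a y y' r
    using \<pi> that by (auto simp: nat_trans_def module_homs_def representable_def)
  have \<pi>_nat: "\<pi> a (y \<cdot>\<^bsub>S\<^esub> f) = FMor M f (\<pi> b y)"
    if "\<guillemotleft>f : a \<rightarrow>\<^bsub>S\<^esub> b\<guillemotright>" "y \<in> carrier (Hom S b s\<^sub>0)" for f a b y
    using \<pi> that by (simp add: nat_trans_def representable_def)
  have cmp: "y \<cdot>\<^bsub>S\<^esub> f \<in> carrier (Hom S a s\<^sub>0)"
    if "\<guillemotleft>f : a \<rightarrow>\<^bsub>S\<^esub> b\<guillemotright>" "y \<in> carrier (Hom S b s\<^sub>0)" for f a b y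
    using klinear_category.Cmp_in[OF S that(1), of y s\<^sub>0] DC[OF that(1)] that s
    by (simp add: in_hom_def)
  have hom_ops: "x \<oplus>\<^bsub>Hom S a s\<^sub>0\<^esub> y \<in> carrier (Hom S a s\<^sub>0)"
    "r \<in> carrier k \<Longrightarrow> r \<odot>\<^bsub>Hom S a s\<^sub>0\<^esub> x \<in> carrier (Hom S a s\<^sub>0)"
    if "a \<in> Ob S" "x \<in> carrier (Hom S a s\<^sub>0)" "y \<in> carrier (Hom S a s\<^sub>0)" for a x y r
  proof -
    interpret module k "Hom S a s\<^sub>0" using klinear_category.Hom_module[OF S] that s by blast
    show "x \<oplus>\<^bsub>Hom S a s\<^sub>0\<^esub> y \<in> carrier (Hom S a s\<^sub>0)"
      "r \<in> carrier k \<Longrightarrow> r \<odot>\<^bsub>Hom S a s\<^sub>0\<^esub> x \<in> carrier (Hom S a s\<^sub>0)" using that by auto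
  qed
  have \<rho>: "\<rho> \<in> nat_trans k S (representable S s\<^sub>0) N"
    unfolding nat_trans_def \<rho>_def module_homs_def representable_def
    by (auto simp: N_Ob N_Mor \<pi>_hom \<pi>_nat inv cmp hom_ops DC(3,4))
  have "\<rho> a ` carrier (Hom S a s\<^sub>0) = carrier (FOb N a) \<and>
      \<alpha> a ` carrier (Hom S a s\<^sub>1) = {x \<in> carrier (Hom S a s\<^sub>0). \<rho> a x = \<zero>\<^bsub>FOb N a\<^esub>}"
    if a: "a \<in> Ob S" for a
  proof
    have "\<rho> a ` carrier (Hom S a s\<^sub>0) = \<sigma> a ` \<pi> a ` carrier (Hom S a s\<^sub>0)"
      using a by (simp add: \<rho>_def image_image)
    then show "\<rho> a ` carrier (Hom S a s\<^sub>0) = carrier (FOb N a)" using a by (simp add: onto N_Ob)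
    have "\<sigma> a (\<pi> a x) = \<sigma> a \<zero>\<^bsub>FOb M a\<^esub> \<longleftrightarrow> \<pi> a x = \<zero>\<^bsub>FOb M a\<^esub>"
      if "x \<in> carrier (Hom S a s\<^sub>0)" for x
      using inv[OF a] \<pi>_hom(1)[OF a that] zero[OF a] by metis
    then show "\<alpha> a ` carrier (Hom S a s\<^sub>1) = {x \<in> carrier (Hom S a s\<^sub>0). \<rho> a x = \<zero>\<^bsub>FOb N a\<^esub>}"
      using a by (auto simp: exact \<rho>_def N_Ob)
  qed
  then have "fin_pres_cofunctor k S N"
    unfolding fin_pres_cofunctor_def by (intro conjI add_N bexI[OF _ s(1)] bexI[OF _ s(2)] bexI[OF _ \<alpha>] bexI[OF _ \<rho>] ballI)
      simp_all
  moreover have "\<eta> \<in> nat_trans k S M N"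
    unfolding nat_trans_def \<eta>_def module_homs_def
    by (auto simp: N_Ob N_Mor inv act DC(3,4))
  moreover have "bij_betw (\<eta> a) (carrier (FOb M a)) (carrier (FOb N a))" if a: "a \<in> Ob S" for a
    unfolding bij_betw_def
  proof
    show "inj_on (\<eta> a) (carrier (FOb M a))"
      by (rule inj_on_inverseI[of _ "\<pi> a"]) (simp add: \<eta>_def a inv)
    show "\<eta> a ` carrier (FOb M a) = carrier (FOb N a)" using a by (simp add: \<eta>_def N_Ob)
  qed
  ultimately show thesis by (rule that)
qed

end

theory Submission
  imports Defs
begin

text \<open>
  Write \<open>\<bbbE>(x, t) = T(x, \<Sigma> t)\<close>. If \<open>x\<close> is the cone of \<open>\<sigma> : s1 \<rightarrow> s0\<close> with \<open>s0\<close>, \<open>s1\<close> in \<open>S\<close> and \<open>t\<close> is in \<open>C\<close>, then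
  \<open>\<bbbE>(x, t) = 0\<close> iff every \<open>s1 \<rightarrow> t\<close> extends along \<open>\<sigma>\<close>, a condition on \<open>F t\<close> only that is inherited by
  quotients and extensions. Hence in a complete cotorsion pair \<open>Y\<close> is determined by \<open>F Y\<close>, which is
  closed under quotients and extensions. The triangle \<open>s \<rightarrow> y \<rightarrow> x\<close> of the pair makes every object of
  \<open>F Y\<close> a quotient of a sum of copies of \<open>F y\<close>, so the trace of \<open>F Y\<close> in \<open>F c\<close> is the image of a single
  morphism \<open>y\<^sup>n \<rightarrow> c\<close>; it is finitely presented because \<open>k\<close> is noetherian.

  Conversely, a left approximation of \<open>F a\<close>, for \<open>a\<close> in \<open>S\<close>, in a functorially finite torsion class lifts
  to an approximation \<open>a \<rightarrow> y\<close> in the preimage \<open>Y\<close> of that class. By the Krull-Schmidt property it can be made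
  minimal, and then Wakamatsu's lemma shows that its cone \<open>x\<close> satisfies \<open>\<bbbE>(x, Y) = 0\<close>. The octahedral axiom
  turns these triangles for objects of \<open>S\<close> into the two triangles required for an arbitrary object of \<open>C\<close>.
\<close>

section \<open>Calculus in linear categories\<close>

text \<open>\<open>F\<close> is full and dense on \<open>C\<close> but not faithful: it kills the
  ghosts, the morphisms that vanish on restriction to \<open>S\<close>, and in particular it kills
  \<open>\<Sigma> S\<close>. The torsion conditions are therefore treated inside \<open>C\<close>,
  with ghosts in place of zero morphisms, and natural transformations enter only at the end. An
  equation obtained in \<open>mod S\<close> holds in \<open>T\<close> only up to ghosts, except for
  morphisms that start in \<open>S\<close>; this is why approximations are lifted for objects of
  \<open>S\<close> first. What makes \<open>F\<close> right exact on the triangles used is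
  \<open>T(a, \<Sigma> c) = 0\<close> for \<open>a\<close> in \<open>S\<close> and \<open>c\<close>
  in \<open>C\<close>. It rests on the vanishing of \<open>T(S, \<Sigma> S)\<close> and
  \<open>T(S, \<Sigma>\<Sigma> S)\<close>, which also give the closure of \<open>C\<close> under
  extensions and retracts. A subfunctor of a finitely presented functor need not be finitely
  presented in general; the noetherian hypothesis acts through weak kernels in \<open>S\<close>,
  which present the image of a morphism from \<open>S\<close> to \<open>C\<close> by an object of
  \<open>C\<close>.\<close>

locale linear_cat = klinear_category k C for k :: "('k, 'r) ring_scheme" and C :: "('k, 'o, 'm, 'z) lincat_scheme" (structure)
begin

text \<open>A morphism determines its source and target, so membership in a Hom module splits into
  \<open>arr\<close> and equations for \<open>Dom\<close> and \<open>Cod\<close>. Side conditions of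
  this form are decided by rewriting, without guessing objects.\<close>

definition arr :: "'m \<Rightarrow> bool"
  where "arr f \<longleftrightarrow> \<guillemotleft>f : Dom C f \<rightarrow> Cod C f\<guillemotright>"

text \<open>The Hom module is read off from the first summand, so that rewrite rules for sums of
  morphisms carry no object parameters.\<close>

definition plus_mor :: "'m \<Rightarrow> 'm \<Rightarrow> 'm" (infixl \<open>\<boxplus>\<close> 65)
  where "f \<boxplus> g = f \<oplus>\<^bsub>Hom C (Dom C f) (Cod C f)\<^esub> g"

definition neg_mor :: "'m \<Rightarrow> 'm"
  where "neg_mor f = \<ominus>\<^bsub>Hom C (Dom C f) (Cod C f)\<^esub> f"

lemma in_hom_iff:
  "\<guillemotleft>f : a \<rightarrow> b\<guillemotright> \<longleftrightarrow> arr f \<and> Dom C f = a \<and> Cod C f = b \<and> a \<in> Ob C \<and> b \<in> Ob C"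
  using Dom_Cod[of f a b] by (auto simp: arr_def in_hom_def)

lemma arr_Ob [simp]: "arr f \<Longrightarrow> Dom C f \<in> Ob C" "arr f \<Longrightarrow> Cod C f \<in> Ob C"
  by (auto simp: arr_def in_hom_def)

lemma carrier_Hom [simp]:
  "a \<in> Ob C \<Longrightarrow> b \<in> Ob C \<Longrightarrow> f \<in> carrier (Hom C a b) \<longleftrightarrow> arr f \<and> Dom C f = a \<and> Cod C f = b"
  using in_hom_iff[of f a b] by (simp add: in_hom_def)

lemma Hom_group: "a \<in> Ob C \<Longrightarrow> b \<in> Ob C \<Longrightarrow> abelian_group (Hom C a b)"
  using Hom_module[of a b] by (simp add: module_def)

lemma Cmp_simps [simp]:
  assumes "arr f" "arr g" "Cod C f = Dom C g"
  shows "arr (g \<cdot> f)" "Dom C (g \<cdot> f) = Dom C f" "Cod C (g \<cdot> f) = Cod C g"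
  using Cmp_in[of f "Dom C f" "Dom C g" g "Cod C g"] assms by (simp_all add: in_hom_iff)

lemma Id_simps [simp]:
  assumes "a \<in> Ob C"
  shows "arr (Id C a)" "Dom C (Id C a) = a" "Cod C (Id C a) = a"
  using Id_in[of a] assms by (simp_all add: in_hom_iff)

lemma zero_simps [simp]:
  assumes "a \<in> Ob C" "b \<in> Ob C"
  shows "arr (zero_mor C a b)" "Dom C (zero_mor C a b) = a" "Cod C (zero_mor C a b) = b"
proof -
  interpret abelian_group "Hom C a b" using assms by (rule Hom_group)
  have "\<guillemotleft>zero_mor C a b : a \<rightarrow> b\<guillemotright>" using assms by (simp add: in_hom_def del: carrier_Hom)
  then show "arr (zero_mor C a b)" "Dom C (zero_mor C a b) = a" "Cod C (zero_mor C a b) = b"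
    by (simp_all add: in_hom_iff)
qed

lemma plus_simps [simp]:
  assumes "arr f" "arr g" "Dom C f = Dom C g" "Cod C f = Cod C g"
  shows "arr (f \<boxplus> g)" "Dom C (f \<boxplus> g) = Dom C g" "Cod C (f \<boxplus> g) = Cod C g"
proof -
  interpret abelian_group "Hom C (Dom C f) (Cod C f)" using assms by (intro Hom_group) simp_all
  have "f \<boxplus> g \<in> carrier (Hom C (Dom C f) (Cod C f))"
    unfolding plus_mor_def by (rule a_closed) (simp_all add: assms)
  then show "arr (f \<boxplus> g)" "Dom C (f \<boxplus> g) = Dom C g" "Cod C (f \<boxplus> g) = Cod C g"
    using assms by auto
qed

lemma neg_simps [simp]:
  assumes "arr f"
  shows "arr (neg_mor f)" "Dom C (neg_mor f) = Dom C f" "Cod C (neg_mor f) = Cod C f"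
proof -
  interpret abelian_group "Hom C (Dom C f) (Cod C f)" using assms by (intro Hom_group) simp_all
  have "neg_mor f \<in> carrier (Hom C (Dom C f) (Cod C f))"
    unfolding neg_mor_def by (rule a_inv_closed) (simp add: assms)
  then show "arr (neg_mor f)" "Dom C (neg_mor f) = Dom C f" "Cod C (neg_mor f) = Cod C f"
    using assms by auto
qed

lemma assoc [simp]:
  "arr f \<Longrightarrow> arr g \<Longrightarrow> arr h \<Longrightarrow> Cod C f = Dom C g \<Longrightarrow> Cod C g = Dom C h \<Longrightarrow>
    (h \<cdot> g) \<cdot> f = h \<cdot> (g \<cdot> f)"
  by (rule Cmp_assoc[of f "Dom C f" "Cod C f" g "Cod C g" h "Cod C h"]) (simp_all add: in_hom_iff)

lemma Cmp_Id' [simp]: "arr f \<Longrightarrow> Dom C f = a \<Longrightarrow> f \<cdot> Id C a = f"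
  by (rule Cmp_Id[of f _ "Cod C f"]) (auto simp: in_hom_iff)

lemma Id_Cmp' [simp]: "arr f \<Longrightarrow> Cod C f = b \<Longrightarrow> Id C b \<cdot> f = f"
  by (rule Id_Cmp[of f "Dom C f"]) (auto simp: in_hom_iff)

lemma plus_Cmp [simp]:
  "arr f \<Longrightarrow> arr g \<Longrightarrow> arr g' \<Longrightarrow> Cod C f = Dom C g \<Longrightarrow> Dom C g' = Dom C g \<Longrightarrow> Cod C g' = Cod C g \<Longrightarrow>
    (g \<boxplus> g') \<cdot> f = g \<cdot> f \<boxplus> g' \<cdot> f"
  using Cmp_add_left[of f "Dom C f" "Cod C f" g "Cod C g" g'] by (simp add: in_hom_iff plus_mor_def)

lemma Cmp_plus [simp]:
  "arr f \<Longrightarrow> arr f' \<Longrightarrow> arr g \<Longrightarrow> Cod C f = Dom C g \<Longrightarrow> Cod C f' = Dom C g \<Longrightarrow> Dom C f' = Dom C f \<Longrightarrow>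
    g \<cdot> (f \<boxplus> f') = g \<cdot> f \<boxplus> g \<cdot> f'"
  using Cmp_add_right[of f "Dom C f" "Cod C f" f' g "Cod C g"] by (simp add: in_hom_iff plus_mor_def)

lemma plus_ac:
  "arr f \<Longrightarrow> arr g \<Longrightarrow> Dom C g = Dom C f \<Longrightarrow> Cod C g = Cod C f \<Longrightarrow> f \<boxplus> g = g \<boxplus> f"
  "arr f \<Longrightarrow> arr g \<Longrightarrow> arr h \<Longrightarrow> Dom C g = Dom C f \<Longrightarrow> Cod C g = Cod C f \<Longrightarrow> Dom C h = Dom C f \<Longrightarrow>
    Cod C h = Cod C f \<Longrightarrow> f \<boxplus> g \<boxplus> h = f \<boxplus> (g \<boxplus> h)"
  "arr f \<Longrightarrow> arr g \<Longrightarrow> arr h \<Longrightarrow> Dom C g = Dom C f \<Longrightarrow> Cod C g = Cod C f \<Longrightarrow> Dom C h = Dom C f \<Longrightarrow>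
    Cod C h = Cod C f \<Longrightarrow> f \<boxplus> (g \<boxplus> h) = g \<boxplus> (f \<boxplus> h)"
proof -
  assume f: "arr f"
  interpret abelian_group "Hom C (Dom C f) (Cod C f)" using f by (intro Hom_group) simp_all
  assume g: "arr g" "Dom C g = Dom C f" "Cod C g = Cod C f"
  show "f \<boxplus> g = g \<boxplus> f" using f g by (simp add: plus_mor_def a_comm)
  assume h: "arr h" "Dom C h = Dom C f" "Cod C h = Cod C f"
  have "Dom C (f \<boxplus> g) = Dom C f" "Dom C (g \<boxplus> h) = Dom C f" "Cod C (f \<boxplus> g) = Cod C f" "Cod C (g \<boxplus> h) = Cod C f"
    "Dom C (f \<boxplus> h) = Dom C f" "Cod C (f \<boxplus> h) = Cod C f"
    using f g h by simp_all
  then show "f \<boxplus> g \<boxplus> h = f \<boxplus> (g \<boxplus> h)" "f \<boxplus> (g \<boxplus> h) = g \<boxplus> (f \<boxplus> h)"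
    using f g h by (simp_all add: plus_mor_def a_assoc a_lcomm)
qed

lemma plus_zero [simp]:
  "arr f \<Longrightarrow> Dom C f = a \<Longrightarrow> Cod C f = b \<Longrightarrow> f \<boxplus> zero_mor C a b = f"
  "arr f \<Longrightarrow> Dom C f = a \<Longrightarrow> Cod C f = b \<Longrightarrow> zero_mor C a b \<boxplus> f = f"
proof -
  assume f: "arr f" "Dom C f = a" "Cod C f = b"
  then have ab: "a \<in> Ob C" "b \<in> Ob C" by auto
  interpret abelian_group "Hom C a b" using ab by (rule Hom_group)
  show "f \<boxplus> zero_mor C a b = f" "zero_mor C a b \<boxplus> f = f" using f ab by (simp_all add: plus_mor_def)
qed

lemma plus_neg [simp]:
  "arr f \<Longrightarrow> f \<boxplus> neg_mor f = zero_mor C (Dom C f) (Cod C f)"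
  "arr f \<Longrightarrow> neg_mor f \<boxplus> f = zero_mor C (Dom C f) (Cod C f)"
proof -
  assume f: "arr f"
  interpret abelian_group "Hom C (Dom C f) (Cod C f)" using f by (intro Hom_group) simp_all
  show "f \<boxplus> neg_mor f = zero_mor C (Dom C f) (Cod C f)" using f by (simp add: plus_mor_def neg_mor_def r_neg)
  then show "neg_mor f \<boxplus> f = zero_mor C (Dom C f) (Cod C f)" using f by (simp add: plus_ac(1))
qed

lemma plus_cancel:
  assumes "arr f" "arr g" "arr h" "Dom C g = Dom C f" "Cod C g = Cod C f" "Dom C h = Dom C f" "Cod C h = Cod C f"
    and "f \<boxplus> g = f \<boxplus> h"
  shows "g = h"
proof -
  have "neg_mor f \<boxplus> (f \<boxplus> g) = neg_mor f \<boxplus> (f \<boxplus> h)" using assms by simp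
  then show ?thesis using assms(1-7) by (simp flip: plus_ac(2))
qed

lemma Cmp_zero [simp]:
  "arr g \<Longrightarrow> Dom C g = b \<Longrightarrow> a \<in> Ob C \<Longrightarrow> g \<cdot> zero_mor C a b = zero_mor C a (Cod C g)"
  "arr f \<Longrightarrow> Cod C f = a \<Longrightarrow> b \<in> Ob C \<Longrightarrow> zero_mor C a b \<cdot> f = zero_mor C (Dom C f) b"
proof -
  assume g: "arr g" "Dom C g = b" "a \<in> Ob C"
  then have b: "b \<in> Ob C" by auto
  have "g \<cdot> zero_mor C a b \<boxplus> g \<cdot> zero_mor C a b = g \<cdot> zero_mor C a b"
    using g b by (simp flip: Cmp_plus)
  also have "\<dots> = g \<cdot> zero_mor C a b \<boxplus> zero_mor C a (Cod C g)" using g b by simp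
  finally show "g \<cdot> zero_mor C a b = zero_mor C a (Cod C g)" by (rule plus_cancel[rotated 7]) (use g b in simp_all)
next
  assume f: "arr f" "Cod C f = a" "b \<in> Ob C"
  then have a: "a \<in> Ob C" by auto
  have "zero_mor C a b \<cdot> f \<boxplus> zero_mor C a b \<cdot> f = zero_mor C a b \<cdot> f"
    using f a by (simp flip: plus_Cmp)
  also have "\<dots> = zero_mor C a b \<cdot> f \<boxplus> zero_mor C (Dom C f) b" using f a by simp
  finally show "zero_mor C a b \<cdot> f = zero_mor C (Dom C f) b" by (rule plus_cancel[rotated 7]) (use f a in simp_all)
qed

lemma neg_unique:
  assumes "arr f" "arr g" "Dom C g = Dom C f" "Cod C g = Cod C f" "f \<boxplus> g = zero_mor C (Dom C f) (Cod C f)"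
  shows "g = neg_mor f"
  by (rule plus_cancel[of f]) (use assms in simp_all)

lemma neg_zero [simp]: "a \<in> Ob C \<Longrightarrow> b \<in> Ob C \<Longrightarrow> neg_mor (zero_mor C a b) = zero_mor C a b"
  by (rule neg_unique[symmetric]) simp_all

lemma neg_neg [simp]: "arr f \<Longrightarrow> neg_mor (neg_mor f) = f"
  by (rule neg_unique[symmetric]) simp_all

lemma Cmp_neg [simp]:
  assumes "arr f" "arr g" "Cod C f = Dom C g"
  shows "g \<cdot> neg_mor f = neg_mor (g \<cdot> f)" "neg_mor g \<cdot> f = neg_mor (g \<cdot> f)"
proof -
  have "g \<cdot> f \<boxplus> g \<cdot> neg_mor f = zero_mor C (Dom C f) (Cod C g)"
    using assms by (simp flip: Cmp_plus)
  then show "g \<cdot> neg_mor f = neg_mor (g \<cdot> f)" using assms by (intro neg_unique) simp_all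
  have "g \<cdot> f \<boxplus> neg_mor g \<cdot> f = zero_mor C (Dom C f) (Cod C g)"
    using assms by (simp flip: plus_Cmp)
  then show "neg_mor g \<cdot> f = neg_mor (g \<cdot> f)" using assms by (intro neg_unique) simp_all
qed

lemma neg_plus [simp]:
  assumes "arr f" "arr g" "Dom C g = Dom C f" "Cod C g = Cod C f"
  shows "neg_mor (f \<boxplus> g) = neg_mor f \<boxplus> neg_mor g"
proof (rule neg_unique[symmetric])
  have "f \<boxplus> g \<boxplus> (neg_mor f \<boxplus> neg_mor g) = (f \<boxplus> neg_mor f) \<boxplus> (g \<boxplus> neg_mor g)"
    using assms by (simp add: plus_ac del: plus_neg)
  then show "f \<boxplus> g \<boxplus> (neg_mor f \<boxplus> neg_mor g) = zero_mor C (Dom C (f \<boxplus> g)) (Cod C (f \<boxplus> g))"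
    using assms by simp
qed (use assms in simp_all)

lemma diff_eq_zero:
  assumes "arr f" "arr g" "Dom C f = a" "Cod C f = b" "Dom C g = a" "Cod C g = b"
  shows "f \<boxplus> neg_mor g = zero_mor C a b \<longleftrightarrow> f = g"
proof
  assume "f \<boxplus> neg_mor g = zero_mor C a b"
  then have "neg_mor g \<boxplus> f = neg_mor g \<boxplus> g" using assms plus_ac(1)[of f "neg_mor g"] by auto
  then show "f = g" by (rule plus_cancel[rotated 7]) (use assms in simp_all)
qed (use assms in auto)

lemma diff_eq:
  assumes "arr f" "arr g" "Dom C g = Dom C f" "Cod C g = Cod C f" "f \<boxplus> neg_mor g = h"
  shows "f = g \<boxplus> h"
  using assms(5)[symmetric] assms(1-4)
  by (simp add: plus_ac(1)[of g] plus_ac(2) del: neg_plus)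

lemma neg_eq_zero:
  assumes "arr f" "Dom C f = a" "Cod C f = b" "neg_mor f = zero_mor C a b" shows "f = zero_mor C a b"
  using assms neg_neg[of f] neg_zero[of a b] by force

text \<open>Composites are normalised to the right, which hides the factor
  \<open>g \<cdot> f\<close> of a known equation behind a further morphism \<open>x\<close>; in this
  form the equation rewrites there.\<close>

lemma reassoc:
  "g \<cdot> f = w \<Longrightarrow> arr f \<Longrightarrow> arr g \<Longrightarrow> Cod C f = Dom C g \<Longrightarrow> arr x \<Longrightarrow> Cod C x = Dom C f \<Longrightarrow> g \<cdot> (f \<cdot> x) = w \<cdot> x"
  by (metis assoc)

text \<open>Scalars act by composition with a multiple of the identity, so a set of morphisms closed
  under composition with endomorphisms is closed under scalars.\<close>

lemma smult_eq:
  assumes "arr f" "r \<in> carrier k"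
  shows "r \<odot>\<^bsub>Hom C (Dom C f) (Cod C f)\<^esub> f = f \<cdot> (r \<odot>\<^bsub>Hom C (Dom C f) (Dom C f)\<^esub> Id C (Dom C f))"
  using Cmp_smult_right[of r "Id C (Dom C f)" "Dom C f" "Dom C f" f "Cod C f"] assms by (simp add: in_hom_iff)

lemma smult_simps [simp]:
  assumes "arr f" "r \<in> carrier k" "Dom C f = a" "Cod C f = b"
  shows "arr (r \<odot>\<^bsub>Hom C a b\<^esub> f)" "Dom C (r \<odot>\<^bsub>Hom C a b\<^esub> f) = a" "Cod C (r \<odot>\<^bsub>Hom C a b\<^esub> f) = b"
proof -
  have ab: "a \<in> Ob C" "b \<in> Ob C" using assms by auto
  interpret module k "Hom C a b" using ab by (rule Hom_module)
  have "r \<odot>\<^bsub>Hom C a b\<^esub> f \<in> carrier (Hom C a b)" using assms ab by (intro smult_closed) simp_all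
  then show "arr (r \<odot>\<^bsub>Hom C a b\<^esub> f)" "Dom C (r \<odot>\<^bsub>Hom C a b\<^esub> f) = a" "Cod C (r \<odot>\<^bsub>Hom C a b\<^esub> f) = b"
    using ab by simp_all
qed

end

section \<open>Direct sums\<close>

context linear_cat
begin

lemma is_zero_object_iff: "is_zero_object C z \<longleftrightarrow> z \<in> Ob C \<and> Id C z = zero_mor C z z"
proof -
  have "finsum (Hom C z z) f {} = zero_mor C z z" if "z \<in> Ob C" for f :: "nat \<Rightarrow> 'm"
  proof -
    interpret abelian_group "Hom C z z" using that by (intro Hom_group)
    show ?thesis by simp
  qed
  then show ?thesis by (auto simp: is_zero_object_def is_dsum_def)
qed

lemma finsum_mor:
  assumes "a \<in> Ob C" "b \<in> Ob C" "finite I" "\<And>i. i \<in> I \<Longrightarrow> \<guillemotleft>f i : a \<rightarrow> b\<guillemotright>"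
  shows "\<guillemotleft>finsum (Hom C a b) f I : a \<rightarrow> b\<guillemotright>"
    and "j \<notin> I \<Longrightarrow> \<guillemotleft>f j : a \<rightarrow> b\<guillemotright> \<Longrightarrow>
      finsum (Hom C a b) f (insert j I) = f j \<boxplus> finsum (Hom C a b) f I"
proof -
  interpret abelian_group "Hom C a b" using assms(1,2) by (rule Hom_group)
  have f: "f \<in> I \<rightarrow> carrier (Hom C a b)" using assms by (auto simp: in_hom_iff)
  then have "finsum (Hom C a b) f I \<in> carrier (Hom C a b)" by (rule finsum_closed)
  then show "\<guillemotleft>finsum (Hom C a b) f I : a \<rightarrow> b\<guillemotright>" using assms by (simp add: in_hom_iff)
  assume "j \<notin> I" "\<guillemotleft>f j : a \<rightarrow> b\<guillemotright>"
  then show "finsum (Hom C a b) f (insert j I) = f j \<boxplus> finsum (Hom C a b) f I"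
    using assms f by (subst finsum_insert) (auto simp: plus_mor_def in_hom_iff)
qed

lemma finsum_empty_mor [simp]: "a \<in> Ob C \<Longrightarrow> b \<in> Ob C \<Longrightarrow> finsum (Hom C a b) f {} = zero_mor C a b"
proof -
  assume "a \<in> Ob C" "b \<in> Ob C"
  then interpret abelian_group "Hom C a b" by (rule Hom_group)
  show ?thesis by simp
qed

lemma finsum_Cmp:
  assumes "finite I" "a \<in> Ob C" "b \<in> Ob C" "\<And>i. i \<in> I \<Longrightarrow> \<guillemotleft>f i : a \<rightarrow> b\<guillemotright>" "\<guillemotleft>g : a' \<rightarrow> a\<guillemotright>" "\<guillemotleft>h : b \<rightarrow> b'\<guillemotright>"
  shows "finsum (Hom C a' b') (\<lambda>i. h \<cdot> (f i \<cdot> g)) I = h \<cdot> (finsum (Hom C a b) f I \<cdot> g)"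
  using assms(1,4)
proof (induction I)
  case empty
  show ?case using assms(2,3,5,6) by (simp add: in_hom_iff)
next
  case (insert j I)
  have *: "\<guillemotleft>f j : a \<rightarrow> b\<guillemotright>" "\<And>i. i \<in> I \<Longrightarrow> \<guillemotleft>f i : a \<rightarrow> b\<guillemotright>" using insert by auto
  have **: "\<guillemotleft>h \<cdot> (f j \<cdot> g) : a' \<rightarrow> b'\<guillemotright>" "\<And>i. i \<in> I \<Longrightarrow> \<guillemotleft>h \<cdot> (f i \<cdot> g) : a' \<rightarrow> b'\<guillemotright>"
    using * assms by (auto simp: in_hom_iff)
  have "a' \<in> Ob C" "b' \<in> Ob C" using assms by (auto simp: in_hom_iff)
  then show ?case
    using insert.IH[OF *(2)] finsum_mor(2)[where f=f, OF assms(2,3) insert(1) *(2) insert(2) *(1)] finsum_mor(1)[OF assms(2,3) insert(1) *(2)]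
      finsum_mor(2)[of a' b' I "\<lambda>i. h \<cdot> (f i \<cdot> g)", OF _ _ insert(1) **(2) insert(2) **(1)] * assms(5,6)
    by (simp add: in_hom_iff)
qed

text \<open>A biproduct indexed by an arbitrary finite set of naturals, so that summands can be removed.\<close>

definition biproduct :: "'o \<Rightarrow> nat set \<Rightarrow> (nat \<Rightarrow> 'o) \<Rightarrow> (nat \<Rightarrow> 'm) \<Rightarrow> (nat \<Rightarrow> 'm) \<Rightarrow> bool"
  where "biproduct p I x \<iota> q \<longleftrightarrow> p \<in> Ob C \<and> finite I \<and>
    (\<forall>i\<in>I. \<guillemotleft>\<iota> i : x i \<rightarrow> p\<guillemotright> \<and> \<guillemotleft>q i : p \<rightarrow> x i\<guillemotright>) \<and>
    (\<forall>i\<in>I. \<forall>j\<in>I. q j \<cdot> \<iota> i = (if i = j then Id C (x i) else zero_mor C (x i) (x j))) \<and>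
    finsum (Hom C p p) (\<lambda>i. \<iota> i \<cdot> q i) I = Id C p"

lemma is_dsum_iff: "is_dsum C p xs \<longleftrightarrow> set xs \<subseteq> Ob C \<and> (\<exists>\<iota> q. biproduct p {..<length xs} (\<lambda>i. xs ! i) \<iota> q)"
  unfolding is_dsum_def biproduct_def Ball_def lessThan_iff using finite_lessThan by blast

lemma biproduct_induct:
  assumes "biproduct p I x \<iota> q" "J \<subseteq> I" "P (zero_mor C p p)"
    and "\<And>f g. \<guillemotleft>f : p \<rightarrow> p\<guillemotright> \<Longrightarrow> \<guillemotleft>g : p \<rightarrow> p\<guillemotright> \<Longrightarrow> P f \<Longrightarrow> P g \<Longrightarrow> P (f \<boxplus> g)"
    and "\<And>i. i \<in> J \<Longrightarrow> P (\<iota> i \<cdot> q i)"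
  shows "P (finsum (Hom C p p) (\<lambda>i. \<iota> i \<cdot> q i) J)"
proof -
  have p: "p \<in> Ob C" and iq: "\<guillemotleft>\<iota> i \<cdot> q i : p \<rightarrow> p\<guillemotright>" if "i \<in> I" for i
    using assms(1) that by (auto simp: biproduct_def in_hom_iff)
  have "finite J" using assms(1,2) by (auto simp: biproduct_def intro: finite_subset)
  then show ?thesis
    using assms(2,5)
  proof (induction J)
    case empty
    then show ?case using assms(1,3) by (simp add: biproduct_def)
  next
    case (insert j J)
    then have j: "j \<in> I" and J: "\<And>i. i \<in> J \<Longrightarrow> \<guillemotleft>\<iota> i \<cdot> q i : p \<rightarrow> p\<guillemotright>" using iq by auto
    note p = p[OF j]
    show ?case
      using finsum_mor(2)[where f="\<lambda>i. \<iota> i \<cdot> q i", OF p p insert(1) J insert(2) iq[OF j]] finsum_mor(1)[OF p p insert(1) J] insert iq[OF j]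
      by (simp add: assms(4))
  qed
qed

text \<open>The identity of a direct sum is a sum of morphisms through the summands, so an additive
  property of endomorphisms passes to it. Later statements about sums compose with the identity and
  apply this rule, without indices.\<close>

lemma is_dsum_induct:
  assumes "is_dsum C p xs" "P (zero_mor C p p)"
    and "\<And>f g. \<guillemotleft>f : p \<rightarrow> p\<guillemotright> \<Longrightarrow> \<guillemotleft>g : p \<rightarrow> p\<guillemotright> \<Longrightarrow> P f \<Longrightarrow> P g \<Longrightarrow> P (f \<boxplus> g)"
    and "\<And>x i q. x \<in> set xs \<Longrightarrow> \<guillemotleft>i : x \<rightarrow> p\<guillemotright> \<Longrightarrow> \<guillemotleft>q : p \<rightarrow> x\<guillemotright> \<Longrightarrow> P (i \<cdot> q)"
  shows "P (Id C p)"
proof -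
  obtain \<iota> q where b: "biproduct p {..<length xs} (\<lambda>i. xs ! i) \<iota> q"
    using assms(1) by (auto simp: is_dsum_iff)
  have "P (finsum (Hom C p p) (\<lambda>i. \<iota> i \<cdot> q i) {..<length xs})"
    using b by (rule biproduct_induct) (use b in \<open>auto simp: biproduct_def intro!: assms(2-4)\<close>)
  then show ?thesis using b by (simp add: biproduct_def)
qed

text \<open>\<open>u \<cdot> v\<close> and the sum of the remaining idempotents both complement
  \<open>\<iota> m \<cdot> q m\<close> to the identity, hence agree; \<open>p'\<close> splits this
  idempotent and so is a biproduct of the remaining summands.\<close>

lemma biproduct_remove:
  assumes b: "biproduct p I x \<iota> q" and m: "m \<in> I"
    and u: "\<guillemotleft>u : p' \<rightarrow> p\<guillemotright>" and v: "\<guillemotleft>v : p \<rightarrow> p'\<guillemotright>" and vu: "v \<cdot> u = Id C p'"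
    and uv: "\<iota> m \<cdot> q m \<boxplus> u \<cdot> v = Id C p"
  shows "biproduct p' (I - {m}) x (\<lambda>i. v \<cdot> \<iota> i) (\<lambda>i. q i \<cdot> u)"
    and "finsum (Hom C p p) (\<lambda>i. \<iota> i \<cdot> q i) (I - {m}) = u \<cdot> v"
proof -
  let ?E = "finsum (Hom C p p) (\<lambda>i. \<iota> i \<cdot> q i) (I - {m})"
  have p: "p \<in> Ob C" and fin: "finite (I - {m})" using b by (auto simp: biproduct_def)
  have iq: "\<guillemotleft>\<iota> i : x i \<rightarrow> p\<guillemotright>" "\<guillemotleft>q i : p \<rightarrow> x i\<guillemotright>" "\<guillemotleft>\<iota> i \<cdot> q i : p \<rightarrow> p\<guillemotright>" if "i \<in> I" for i
    using b that by (auto simp: biproduct_def in_hom_iff)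
  have orth: "q j \<cdot> \<iota> i = (if i = j then Id C (x i) else zero_mor C (x i) (x j))" if "i \<in> I" "j \<in> I" for i j
    using b that by (auto simp: biproduct_def)
  have E: "\<guillemotleft>?E : p \<rightarrow> p\<guillemotright>" by (rule finsum_mor(1)[OF p p fin]) (use iq in auto)
  have "Id C p = \<iota> m \<cdot> q m \<boxplus> ?E"
    using finsum_mor(2)[OF p p fin, of "\<lambda>i. \<iota> i \<cdot> q i" m] iq m b by (simp add: biproduct_def insert_absorb)
  then have "\<iota> m \<cdot> q m \<boxplus> ?E = \<iota> m \<cdot> q m \<boxplus> u \<cdot> v" using uv by simp
  then show Eq: "?E = u \<cdot> v"
    by (rule plus_cancel[rotated 7]) (use iq[OF m] u v E in \<open>simp_all add: in_hom_iff\<close>)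
  have "finsum (Hom C p' p') (\<lambda>i. v \<cdot> ((\<iota> i \<cdot> q i) \<cdot> u)) (I - {m}) = v \<cdot> (?E \<cdot> u)"
    by (rule finsum_Cmp[OF fin p p]) (use iq u v in auto)
  also have "\<dots> = Id C p'"
  proof -
    have "v \<cdot> (u \<cdot> v \<cdot> u) = (v \<cdot> u) \<cdot> (v \<cdot> u)" using u v by (simp add: in_hom_iff del: vu)
    then show ?thesis using u vu by (simp add: Eq in_hom_iff)
  qed
  finally have 1: "finsum (Hom C p' p') (\<lambda>i. v \<cdot> ((\<iota> i \<cdot> q i) \<cdot> u)) (I - {m}) = Id C p'" .
  have "finsum (Hom C p' p') (\<lambda>i. v \<cdot> \<iota> i \<cdot> (q i \<cdot> u)) (I - {m}) = finsum (Hom C p' p') (\<lambda>i. v \<cdot> ((\<iota> i \<cdot> q i) \<cdot> u)) (I - {m})"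
  proof -
    interpret abelian_group "Hom C p' p'" using u by (intro Hom_group) (auto simp: in_hom_iff)
    show ?thesis
      by (rule finsum_cong') (use iq u v in \<open>auto simp: in_hom_iff\<close>)
  qed
  with 1 have 2: "finsum (Hom C p' p') (\<lambda>i. v \<cdot> \<iota> i \<cdot> (q i \<cdot> u)) (I - {m}) = Id C p'" by simp
  have 3: "q j \<cdot> u \<cdot> (v \<cdot> \<iota> i) = (if i = j then Id C (x i) else zero_mor C (x i) (x j))"
    if "i \<in> I - {m}" "j \<in> I - {m}" for i j
  proof -
    have i: "i \<in> I" "i \<noteq> m" and j: "j \<in> I" using that by auto
    \<comment> \<open>The identity is inserted between \<open>q j\<close> and
      \<open>\<iota> i\<close>; its \<open>m\<close>-term vanishes because \<open>i\<close> differs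
      from \<open>m\<close>.\<close>
    have "q j \<cdot> \<iota> i = q j \<cdot> ((\<iota> m \<cdot> q m \<boxplus> u \<cdot> v) \<cdot> \<iota> i)"
      unfolding uv using iq[OF i(1)] by (simp add: in_hom_iff)
    also have "\<dots> = q j \<cdot> (\<iota> m \<cdot> (q m \<cdot> \<iota> i)) \<boxplus> q j \<cdot> (u \<cdot> (v \<cdot> \<iota> i))"
      using iq[OF i(1)] iq[OF j] iq[OF m] u v by (simp add: in_hom_iff)
    also have "\<dots> = q j \<cdot> u \<cdot> (v \<cdot> \<iota> i)"
      using orth[OF i(1) m] i iq[OF i(1)] iq[OF j] iq[OF m] u v by (simp add: in_hom_iff)
    finally show ?thesis using orth[OF i(1) j] by simp
  qed
  show "biproduct p' (I - {m}) x (\<lambda>i. v \<cdot> \<iota> i) (\<lambda>i. q i \<cdot> u)"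
    unfolding biproduct_def using 2 3 iq u v fin by (auto simp: in_hom_iff)
qed

text \<open>The new summand receives index 0 and the old indices move up by one, as for
  \<open>#\<close> on lists.\<close>

lemma biproduct_Suc:
  assumes b: "biproduct p' {..<n} x \<iota> q"
    and i: "\<guillemotleft>i : y \<rightarrow> p\<guillemotright>" "\<guillemotleft>r : p \<rightarrow> y\<guillemotright>" and u: "\<guillemotleft>u : p' \<rightarrow> p\<guillemotright>" "\<guillemotleft>v : p \<rightarrow> p'\<guillemotright>"
    and eqs: "r \<cdot> i = Id C y" "v \<cdot> u = Id C p'" "v \<cdot> i = zero_mor C y p'" "r \<cdot> u = zero_mor C p' y"
      "i \<cdot> r \<boxplus> u \<cdot> v = Id C p"
  shows "biproduct p {..<Suc n} (case_nat y x) (case_nat i (\<lambda>j. u \<cdot> \<iota> j)) (case_nat r (\<lambda>j. q j \<cdot> v))"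
proof -
  let ?\<iota> = "case_nat i (\<lambda>j. u \<cdot> \<iota> j)" and ?q = "case_nat r (\<lambda>j. q j \<cdot> v)"
  have p: "p \<in> Ob C" and p': "p' \<in> Ob C" using u by (auto simp: in_hom_iff)
  have iq: "\<guillemotleft>\<iota> j : x j \<rightarrow> p'\<guillemotright>" "\<guillemotleft>q j : p' \<rightarrow> x j\<guillemotright>" if "j < n" for j
    using b that by (auto simp: biproduct_def)
  have orth: "q l \<cdot> \<iota> j = (if j = l then Id C (x j) else zero_mor C (x j) (x l))" if "j < n" "l < n" for j l
    using b that by (auto simp: biproduct_def)
  have ty: "\<guillemotleft>?\<iota> j : case_nat y x j \<rightarrow> p\<guillemotright> \<and> \<guillemotleft>?q j : p \<rightarrow> case_nat y x j\<guillemotright>" if "j < Suc n" for j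
    using that iq i u by (cases j) (auto simp: in_hom_iff)
  have "?q l \<cdot> ?\<iota> j = (if j = l then Id C (case_nat y x j) else zero_mor C (case_nat y x j) (case_nat y x l))"
    if j: "j < Suc n" and l: "l < Suc n" for j l
  proof (cases j)
    case 0
    show ?thesis
    proof (cases l)
      case (Suc l')
      have "q l' \<cdot> v \<cdot> i = q l' \<cdot> (v \<cdot> i)" using Suc l iq i u by (simp add: in_hom_iff eqs(3) del: eqs)
      then show ?thesis using Suc 0 l iq[of l'] i by (simp add: eqs in_hom_iff)
    qed (simp add: 0 eqs)
  next
    case (Suc j')
    note j' = this
    show ?thesis
    proof (cases l)
      case 0
      have "r \<cdot> (u \<cdot> \<iota> j') = (r \<cdot> u) \<cdot> \<iota> j'" using j' j iq i u by (simp add: in_hom_iff eqs(4) del: eqs)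
      then show ?thesis using 0 j' j iq[of j'] i by (simp add: eqs in_hom_iff)
    next
      case (Suc l')
      have "q l' \<cdot> v \<cdot> (u \<cdot> \<iota> j') = q l' \<cdot> ((v \<cdot> u) \<cdot> \<iota> j')" using j' j Suc l iq i u by (simp add: in_hom_iff del: eqs)
      also have "\<dots> = q l' \<cdot> \<iota> j'" using j' j iq[of j'] by (simp add: eqs in_hom_iff)
      finally show ?thesis using orth j' j Suc l by simp
    qed
  qed
  moreover have "finsum (Hom C p p) (\<lambda>j. ?\<iota> j \<cdot> ?q j) {..<Suc n} = Id C p"
  proof -
    interpret abelian_group "Hom C p p" using p p by (rule Hom_group)
    have c: "(\<lambda>j. u \<cdot> \<iota> j \<cdot> (q j \<cdot> v)) \<in> {..<n} \<rightarrow> carrier (Hom C p p)"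
      using iq u by (auto simp: in_hom_iff)
    have "finsum (Hom C p p) (\<lambda>j. ?\<iota> j \<cdot> ?q j) {..<Suc n}
        = i \<cdot> r \<boxplus> finsum (Hom C p p) (\<lambda>j. ?\<iota> j \<cdot> ?q j) (Suc ` {..<n})"
      unfolding lessThan_Suc_eq_insert_0
      by (subst finsum_mor(2)) (use p iq u i in \<open>auto simp: in_hom_iff\<close>)
    also have "finsum (Hom C p p) (\<lambda>j. ?\<iota> j \<cdot> ?q j) (Suc ` {..<n})
        = finsum (Hom C p p) (\<lambda>j. u \<cdot> \<iota> j \<cdot> (q j \<cdot> v)) {..<n}"
      by (subst finsum_reindex) (use c in \<open>auto\<close>)
    also have "\<dots> = finsum (Hom C p p) (\<lambda>j. u \<cdot> ((\<iota> j \<cdot> q j) \<cdot> v)) {..<n}"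
      by (rule finsum_cong') (use iq u in \<open>auto simp: in_hom_iff\<close>)
    also have "\<dots> = u \<cdot> (Id C p' \<cdot> v)"
      using finsum_Cmp[of "{..<n}" p' p' "\<lambda>j. \<iota> j \<cdot> q j" v p u p] iq u p' b by (auto simp: biproduct_def in_hom_iff)
    also have "\<dots> = u \<cdot> v" using u by (simp add: in_hom_iff)
    finally show ?thesis using eqs by simp
  qed
  ultimately show ?thesis unfolding biproduct_def using ty p by auto
qed

lemma is_dsum_pair_iff:
  "is_dsum C p [x, y] \<longleftrightarrow> (\<exists>i i' q q'. \<guillemotleft>i : x \<rightarrow> p\<guillemotright> \<and> \<guillemotleft>i' : y \<rightarrow> p\<guillemotright> \<and> \<guillemotleft>q : p \<rightarrow> x\<guillemotright> \<and> \<guillemotleft>q' : p \<rightarrow> y\<guillemotright> \<and>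
    q \<cdot> i = Id C x \<and> q' \<cdot> i' = Id C y \<and> q' \<cdot> i = zero_mor C x y \<and> q \<cdot> i' = zero_mor C y x \<and>
    i \<cdot> q \<boxplus> i' \<cdot> q' = Id C p)" (is "?L \<longleftrightarrow> ?R")
proof
  assume ?L
  then obtain \<iota> q where b: "biproduct p {..<2} (\<lambda>i. [x, y] ! i) \<iota> q" by (auto simp: is_dsum_iff numeral_2_eq_2)
  have *: "\<guillemotleft>\<iota> j : [x, y] ! j \<rightarrow> p\<guillemotright>" "\<guillemotleft>q j : p \<rightarrow> [x, y] ! j\<guillemotright>" if "j < 2" for j
    using b that by (auto simp: biproduct_def)
  have t: "\<guillemotleft>\<iota> 0 : x \<rightarrow> p\<guillemotright>" "\<guillemotleft>\<iota> 1 : y \<rightarrow> p\<guillemotright>" "\<guillemotleft>q 0 : p \<rightarrow> x\<guillemotright>" "\<guillemotleft>q 1 : p \<rightarrow> y\<guillemotright>"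
    using *[of 0] *[of 1] by auto
  have o: "q l \<cdot> \<iota> j = (if j = l then Id C ([x,y] ! j) else zero_mor C ([x,y] ! j) ([x,y] ! l))" if "j < 2" "l < 2" for j l
    using b that by (auto simp: biproduct_def)
  have p: "p \<in> Ob C" using b by (simp add: biproduct_def)
  have "{..<2::nat} = {0, 1}" by auto
  then have "\<iota> 0 \<cdot> q 0 \<boxplus> \<iota> 1 \<cdot> q 1 = Id C p"
    using b t p finsum_mor(2)[OF p p, of "{1}" "\<lambda>i. \<iota> i \<cdot> q i" 0] finsum_mor(2)[OF p p, of "{}" "\<lambda>i. \<iota> i \<cdot> q i" 1]
    by (auto simp: biproduct_def in_hom_iff)
  then show ?R using t o[of 0 0] o[of 1 1] o[of 0 1] o[of 1 0] by auto
next
  assume ?R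
  then obtain i i' q q' where *: "\<guillemotleft>i : x \<rightarrow> p\<guillemotright>" "\<guillemotleft>i' : y \<rightarrow> p\<guillemotright>" "\<guillemotleft>q : p \<rightarrow> x\<guillemotright>" "\<guillemotleft>q' : p \<rightarrow> y\<guillemotright>"
    "q \<cdot> i = Id C x" "q' \<cdot> i' = Id C y" "q' \<cdot> i = zero_mor C x y" "q \<cdot> i' = zero_mor C y x" "i \<cdot> q \<boxplus> i' \<cdot> q' = Id C p"
    by blast
  have p: "p \<in> Ob C" using * by (auto simp: in_hom_iff)
  have iq: "\<guillemotleft>i \<cdot> q : p \<rightarrow> p\<guillemotright>" "\<guillemotleft>i' \<cdot> q' : p \<rightarrow> p\<guillemotright>" using * by (auto simp: in_hom_iff)
  let ?i = "\<lambda>j::nat. if j = 0 then i else i'" and ?q = "\<lambda>j::nat. if j = 0 then q else q'"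
  have "{..<2::nat} = {0, 1}" by auto
  then have "finsum (Hom C p p) (\<lambda>j. ?i j \<cdot> ?q j) {..<2} = Id C p"
    using p iq finsum_mor(2)[OF p p, of "{1}" "\<lambda>j. ?i j \<cdot> ?q j" 0] finsum_mor(2)[OF p p, of "{}" "\<lambda>j. ?i j \<cdot> ?q j" 1] *
    by (simp add: in_hom_iff)
  moreover have "\<forall>j\<in>{..<2}. \<guillemotleft>?i j : [x,y] ! j \<rightarrow> p\<guillemotright> \<and> \<guillemotleft>?q j : p \<rightarrow> [x,y] ! j\<guillemotright>"
    using * by (auto simp: less_2_cases_iff)
  moreover have "\<forall>j\<in>{..<2}. \<forall>l\<in>{..<2}. ?q l \<cdot> ?i j = (if j = l then Id C ([x,y] ! j) else zero_mor C ([x,y] ! j) ([x,y] ! l))"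
    using * by (auto simp: less_2_cases_iff)
  ultimately have "biproduct p {..<2} (\<lambda>j. [x,y] ! j) ?i ?q" unfolding biproduct_def using p by blast
  then show ?L using * by (auto simp: is_dsum_iff in_hom_iff numeral_2_eq_2)
qed

lemma is_dsum_pairE:
  assumes "is_dsum C p [x, y]"
  obtains i i' q q' where "\<guillemotleft>i : x \<rightarrow> p\<guillemotright>" "\<guillemotleft>i' : y \<rightarrow> p\<guillemotright>" "\<guillemotleft>q : p \<rightarrow> x\<guillemotright>" "\<guillemotleft>q' : p \<rightarrow> y\<guillemotright>"
    "q \<cdot> i = Id C x" "q' \<cdot> i' = Id C y" "q' \<cdot> i = zero_mor C x y" "q \<cdot> i' = zero_mor C y x"
    "i \<cdot> q \<boxplus> i' \<cdot> q' = Id C p"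
  using assms unfolding is_dsum_pair_iff by (elim exE conjE) (rule that)

lemma is_dsum_Cons:
  assumes "is_dsum C p' xs" "is_dsum C p [x, p']"
  shows "is_dsum C p (x # xs)"
proof -
  obtain \<iota> q where b: "biproduct p' {..<length xs} (\<lambda>i. xs ! i) \<iota> q" "set xs \<subseteq> Ob C" using assms by (auto simp: is_dsum_iff)
  have x: "x \<in> Ob C" using assms(2) by (simp add: is_dsum_def)
  have "case_nat x ((!) xs) = (!) (x # xs)" by (auto simp: fun_eq_iff nth_Cons split: nat.split)
  moreover obtain i i' r r' where "\<guillemotleft>i : x \<rightarrow> p\<guillemotright>" "\<guillemotleft>i' : p' \<rightarrow> p\<guillemotright>" "\<guillemotleft>r : p \<rightarrow> x\<guillemotright>" "\<guillemotleft>r' : p \<rightarrow> p'\<guillemotright>"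
    "r \<cdot> i = Id C x" "r' \<cdot> i' = Id C p'" "r' \<cdot> i = zero_mor C x p'" "r \<cdot> i' = zero_mor C p' x" "i \<cdot> r \<boxplus> i' \<cdot> r' = Id C p"
    using is_dsum_pairE[OF assms(2)] .
  ultimately show ?thesis using b x biproduct_Suc[OF b(1), of i x p r i' r'] by (auto simp: is_dsum_iff)
qed

text \<open>The two-sided ideal generated by the identity of \<open>s\<close>: finite sums of
  morphisms through \<open>s\<close>, built one summand at a time. In an additive category these are
  the morphisms through a finite direct sum of copies of \<open>s\<close>, but closure under sums
  and composites follows here without choosing such an object.\<close>

inductive thru :: "'o \<Rightarrow> 'm \<Rightarrow> bool" for s where
  thru_zero: "a \<in> Ob C \<Longrightarrow> b \<in> Ob C \<Longrightarrow> thru s (zero_mor C a b)"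
| thru_step: "thru s f \<Longrightarrow> \<guillemotleft>p : Dom C f \<rightarrow> s\<guillemotright> \<Longrightarrow> \<guillemotleft>r : s \<rightarrow> Cod C f\<guillemotright> \<Longrightarrow> thru s (r \<cdot> p \<boxplus> f)"

lemma thru_arr: "thru s f \<Longrightarrow> arr f"
  by (induction rule: thru.induct) (auto simp: in_hom_iff)

lemma thru_plus: "thru s f \<Longrightarrow> thru s g \<Longrightarrow> Dom C f = Dom C g \<Longrightarrow> Cod C f = Cod C g \<Longrightarrow> thru s (f \<boxplus> g)"
proof (induction rule: thru.induct)
  case (thru_zero a b)
  then show ?case using thru_arr[of s g] by simp
next
  case (thru_step f p r)
  have "arr f" "arr g" using thru_step thru_arr by auto
  then show ?case using thru_step thru.thru_step[of s "f \<boxplus> g" p r] by (simp add: in_hom_iff plus_ac(2))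
qed

lemma thru_Cmp: "thru s f \<Longrightarrow> \<guillemotleft>g : a \<rightarrow> Dom C f\<guillemotright> \<Longrightarrow> \<guillemotleft>h : Cod C f \<rightarrow> b\<guillemotright> \<Longrightarrow> thru s (h \<cdot> (f \<cdot> g))"
proof (induction rule: thru.induct)
  case (thru_zero a b)
  then show ?case by (simp add: in_hom_iff thru.thru_zero)
next
  case (thru_step f p r)
  then have f: "arr f" by (simp add: thru_arr)
  have "thru s ((h \<cdot> r) \<cdot> (p \<cdot> g) \<boxplus> h \<cdot> (f \<cdot> g))"
    using thru_step f by (intro thru.thru_step) (auto simp: in_hom_iff)
  then show ?case using thru_step f by (simp add: in_hom_iff)
qed

lemma thru_factor: "\<guillemotleft>p : a \<rightarrow> s\<guillemotright> \<Longrightarrow> \<guillemotleft>r : s \<rightarrow> b\<guillemotright> \<Longrightarrow> thru s (r \<cdot> p)"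
  using thru_step[OF thru_zero[of a b], where p=p and r=r] by (simp add: in_hom_iff)

lemma thru_dsum:
  assumes "is_dsum C p (replicate n s)"
  shows "thru s (Id C p)"
proof (rule is_dsum_induct[OF assms])
  show "thru s (zero_mor C p p)" using assms by (simp add: thru_zero is_dsum_def)
next
  fix f g assume "\<guillemotleft>f : p \<rightarrow> p\<guillemotright>" "\<guillemotleft>g : p \<rightarrow> p\<guillemotright>" "thru s f" "thru s g"
  then show "thru s (f \<boxplus> g)" by (simp add: thru_plus in_hom_iff)
qed (auto intro: thru_factor split: if_splits)

end

section \<open>Triangulated categories\<close>

locale tri_cat = linear_cat k T + triangulated_category k T
  for k :: "('k, 'r) ring_scheme" and T :: "('k, 'o, 'm, 'z) tricat_scheme" (structure)
begin

notation plus_mor (infixl \<open>\<boxplus>\<close> 65)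

lemma dsum_exists: "set xs \<subseteq> Ob T \<Longrightarrow> \<exists>p. is_dsum T p xs"
  using additive by (auto simp: additive_category_def)

lemma obtain_zero: obtains z where "is_zero_object T z" "z \<in> Ob T"
  using dsum_exists[of "[]"] by (auto simp: is_zero_object_def is_dsum_def)

section \<open>The shift as a fully faithful additive functor\<close>

lemma shift_Ob [simp]: "a \<in> Ob T \<Longrightarrow> \<Sigma> a \<in> Ob T"
  using shift_equivalence by (auto simp: linear_equivalence_def linear_functor_def)

lemma shift_simps [simp]:
  assumes "arr f"
  shows "arr (shift_mor T f)" "Dom T (shift_mor T f) = \<Sigma> (Dom T f)" "Cod T (shift_mor T f) = \<Sigma> (Cod T f)"
proof -
  have "\<guillemotleft>shift_mor T f : \<Sigma> (Dom T f) \<rightarrow> \<Sigma> (Cod T f)\<guillemotright>"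
    using shift_equivalence assms by (auto simp: linear_equivalence_def linear_functor_def arr_def)
  then show "arr (shift_mor T f)" "Dom T (shift_mor T f) = \<Sigma> (Dom T f)" "Cod T (shift_mor T f) = \<Sigma> (Cod T f)"
    by (auto simp: in_hom_iff)
qed

lemma shift_Id [simp]: "a \<in> Ob T \<Longrightarrow> shift_mor T (Id T a) = Id T (\<Sigma> a)"
  using shift_equivalence by (auto simp: linear_equivalence_def linear_functor_def)

lemma shift_Cmp [simp]:
  "arr f \<Longrightarrow> arr g \<Longrightarrow> Cod T f = Dom T g \<Longrightarrow> shift_mor T (g \<cdot> f) = shift_mor T g \<cdot> shift_mor T f"
proof -
  assume "arr f" "arr g" "Cod T f = Dom T g"
  then have "\<guillemotleft>f : Dom T f \<rightarrow> Cod T f\<guillemotright>" "\<guillemotleft>g : Cod T f \<rightarrow> Cod T g\<guillemotright>" by (auto simp: in_hom_iff)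
  then show ?thesis
    using shift_equivalence unfolding linear_equivalence_def linear_functor_def by blast
qed

lemma shift_plus [simp]:
  assumes "arr f" "arr g" "Dom T g = Dom T f" "Cod T g = Cod T f"
  shows "shift_mor T (f \<boxplus> g) = shift_mor T f \<boxplus> shift_mor T g"
proof -
  have "\<guillemotleft>f : Dom T f \<rightarrow> Cod T f\<guillemotright>" "\<guillemotleft>g : Dom T f \<rightarrow> Cod T f\<guillemotright>" using assms by (auto simp: in_hom_iff)
  then have "shift_mor T (f \<oplus>\<^bsub>Hom T (Dom T f) (Cod T f)\<^esub> g)
      = shift_mor T f \<oplus>\<^bsub>Hom T (\<Sigma> (Dom T f)) (\<Sigma> (Cod T f))\<^esub> shift_mor T g"
    using shift_equivalence unfolding linear_equivalence_def linear_functor_def by blast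
  then show ?thesis using assms by (simp add: plus_mor_def)
qed

lemma shift_zero [simp]:
  assumes "a \<in> Ob T" "b \<in> Ob T"
  shows "shift_mor T (zero_mor T a b) = zero_mor T (\<Sigma> a) (\<Sigma> b)"
proof -
  let ?z = "shift_mor T (zero_mor T a b)"
  have "?z \<boxplus> ?z = ?z" using assms by (simp flip: shift_plus)
  then have "?z \<boxplus> ?z = ?z \<boxplus> zero_mor T (\<Sigma> a) (\<Sigma> b)" using assms by simp
  then show ?thesis by (rule plus_cancel[rotated 7]) (use assms in simp_all)
qed

lemma shift_neg [simp]: "arr f \<Longrightarrow> shift_mor T (neg_mor f) = neg_mor (shift_mor T f)"
  by (rule neg_unique) (simp_all flip: shift_plus)

lemma shift_faithful:
  assumes "arr f" "arr g" "Dom T g = Dom T f" "Cod T g = Cod T f" "shift_mor T f = shift_mor T g"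
  shows "f = g"
proof -
  have "inj_on (shift_mor T) (carrier (Hom T (Dom T f) (Cod T f)))"
    using shift_equivalence assms(1) by (auto simp: linear_equivalence_def bij_betw_def)
  then show ?thesis using assms by (auto dest: inj_onD)
qed

lemma shift_full:
  assumes "\<guillemotleft>f : \<Sigma> a \<rightarrow> \<Sigma> b\<guillemotright>" "a \<in> Ob T" "b \<in> Ob T"
  obtains g where "\<guillemotleft>g : a \<rightarrow> b\<guillemotright>" "f = shift_mor T g"
proof -
  have "shift_mor T ` carrier (Hom T a b) = carrier (Hom T (\<Sigma> a) (\<Sigma> b))"
    using shift_equivalence assms by (auto simp: linear_equivalence_def bij_betw_def)
  then have "f \<in> shift_mor T ` carrier (Hom T a b)" using assms by (simp add: in_hom_iff)
  then show thesis using assms that by (auto simp: in_hom_iff)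
qed

lemma shift_dense:
  assumes "b \<in> Ob T"
  obtains a u v where "a \<in> Ob T" "\<guillemotleft>u : \<Sigma> a \<rightarrow> b\<guillemotright>" "\<guillemotleft>v : b \<rightarrow> \<Sigma> a\<guillemotright>" "v \<cdot> u = Id T (\<Sigma> a)" "u \<cdot> v = Id T b"
  using shift_equivalence assms unfolding linear_equivalence_def isomorphic_def is_iso_def by blast

lemma is_isoI:
  "\<guillemotleft>u : a \<rightarrow> b\<guillemotright> \<Longrightarrow> \<guillemotleft>v : b \<rightarrow> a\<guillemotright> \<Longrightarrow> v \<cdot> u = Id T a \<Longrightarrow> u \<cdot> v = Id T b \<Longrightarrow> is_iso T u a b"
  by (auto simp: is_iso_def)

lemma is_iso_Id: "a \<in> Ob T \<Longrightarrow> is_iso T (Id T a) a a"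
  by (rule is_isoI[where v="Id T a"]) (auto simp: in_hom_iff)

lemma shift_zero_object: "is_zero_object T z \<Longrightarrow> is_zero_object T (\<Sigma> z)"
  using shift_Id[of z] shift_zero[of z z] by (metis is_zero_object_iff shift_Ob)

section \<open>Rotation and the exact Hom sequences of a triangle\<close>

lemma dist_hom:
  assumes "dist_triangle T a b c f g h"
  shows "\<guillemotleft>f : a \<rightarrow> b\<guillemotright>" "\<guillemotleft>g : b \<rightarrow> c\<guillemotright>" "\<guillemotleft>h : c \<rightarrow> \<Sigma> a\<guillemotright>"
  using assms by (auto simp: dist_triangle_def candidate_triangle_def)

lemma neg_shift: "\<guillemotleft>f : a \<rightarrow> b\<guillemotright> \<Longrightarrow> \<ominus>\<^bsub>Hom T (\<Sigma> a) (\<Sigma> b)\<^esub> shift_mor T f = neg_mor (shift_mor T f)"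
  by (simp add: neg_mor_def in_hom_iff)

lemma rotate: "dist_triangle T a b c f g h \<Longrightarrow> dist_triangle T b c (\<Sigma> a) g h (neg_mor (shift_mor T f))"
  using TR2[of a b c f g h] dist_hom(1)[of a b c f g h] by (simp add: dist_triangle_def neg_shift)

lemma rotate_back:
  assumes "\<guillemotleft>f : a \<rightarrow> b\<guillemotright>" "dist_triangle T b c (\<Sigma> a) g h (neg_mor (shift_mor T f))"
  shows "dist_triangle T a b c f g h"
  using TR2[of a b c f g h] dist_hom[OF assms(2)] assms by (simp add: candidate_triangle_def neg_shift)

text \<open>TR3 extends \<open>(Id T a, f)\<close> to a map from the trivial triangle on
  \<open>a\<close>, whose third object is zero, so \<open>g \<cdot> f\<close> factors through zero.
  The other two composites follow by rotation, the last one up to sign.\<close>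

lemma dist_zero:
  assumes d: "dist_triangle T a b c f g h"
  shows "g \<cdot> f = zero_mor T a c" "h \<cdot> g = zero_mor T b (\<Sigma> a)" "shift_mor T f \<cdot> h = zero_mor T c (\<Sigma> b)"
proof -
  have *: "g \<cdot> f = zero_mor T a c" if "dist_triangle T a b c f g h" for a b c f g h
  proof -
    obtain z where z: "is_zero_object T z" "z \<in> Ob T" by (rule obtain_zero)
    note h = dist_hom[OF that]
    have "dist_triangle T a a z (Id T a) (zero_mor T a z) (zero_mor T z (\<Sigma> a))"
      using h z by (intro TR1_id) (auto simp: in_hom_iff)
    from TR3[OF this that, of "Id T a" f] h
    obtain \<gamma> where "\<guillemotleft>\<gamma> : z \<rightarrow> c\<guillemotright>" "\<gamma> \<cdot> zero_mor T a z = g \<cdot> f" by (auto simp: in_hom_iff)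
    then show ?thesis using h by (auto simp: in_hom_iff)
  qed
  show "g \<cdot> f = zero_mor T a c" "h \<cdot> g = zero_mor T b (\<Sigma> a)"
    using *[OF d] *[OF rotate[OF d]] by auto
  have n: "neg_mor (shift_mor T f) \<cdot> h = zero_mor T c (\<Sigma> b)"
    using *[OF rotate[OF rotate[OF d]]] .
  show "shift_mor T f \<cdot> h = zero_mor T c (\<Sigma> b)"
    by (rule neg_eq_zero) (use dist_hom[OF d] n in \<open>auto simp: in_hom_iff\<close>)
qed

text \<open>TR3 completes a third component, whereas a first one is sought. Both triangles are
  therefore rotated once, a component \<open>\<Sigma> x \<rightarrow> \<Sigma> a\<close> is
  completed, and fullness and faithfulness of the shift bring it back.\<close>

lemma exact_cov:
  assumes d: "dist_triangle T a b c f g h" and t: "\<guillemotleft>t : x \<rightarrow> b\<guillemotright>" and gt: "g \<cdot> t = zero_mor T x c"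
  obtains r where "\<guillemotleft>r : x \<rightarrow> a\<guillemotright>" "t = f \<cdot> r"
proof -
  obtain z where z: "is_zero_object T z" "z \<in> Ob T" by (rule obtain_zero)
  note h = dist_hom[OF d]
  have "dist_triangle T x x z (Id T x) (zero_mor T x z) (zero_mor T z (\<Sigma> x))"
    using t z by (intro TR1_id) (auto simp: in_hom_iff)
  then have "dist_triangle T x z (\<Sigma> x) (zero_mor T x z) (zero_mor T z (\<Sigma> x)) (neg_mor (shift_mor T (Id T x)))"
    by (rule rotate)
  moreover have "\<guillemotleft>zero_mor T z c : z \<rightarrow> c\<guillemotright>" "zero_mor T z c \<cdot> zero_mor T x z = g \<cdot> t"
    using h t gt z by (simp_all add: in_hom_iff)
  ultimately obtain \<gamma> where \<gamma>: "\<guillemotleft>\<gamma> : \<Sigma> x \<rightarrow> \<Sigma> a\<guillemotright>"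
    and "shift_mor T t \<cdot> neg_mor (shift_mor T (Id T x)) = neg_mor (shift_mor T f) \<cdot> \<gamma>"
    using TR3[OF _ rotate[OF d] t] by blast
  then have "neg_mor (shift_mor T t) = neg_mor (shift_mor T f \<cdot> \<gamma>)" using t h by (simp add: in_hom_iff)
  then have "neg_mor (neg_mor (shift_mor T t)) = neg_mor (neg_mor (shift_mor T f \<cdot> \<gamma>))" by simp
  then have eq: "shift_mor T t = shift_mor T f \<cdot> \<gamma>" using t h \<gamma> by (simp add: in_hom_iff)
  obtain r where r: "\<guillemotleft>r : x \<rightarrow> a\<guillemotright>" "\<gamma> = shift_mor T r"
    using shift_full[OF \<gamma>] t h by (auto simp: in_hom_iff)
  have "t = f \<cdot> r" by (rule shift_faithful) (use r t h eq in \<open>auto simp: in_hom_iff\<close>)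
  then show thesis using r that by blast
qed

lemma zero_triangle:
  assumes "x \<in> Ob T" and z: "is_zero_object T z"
  shows "dist_triangle T z x x (zero_mor T z x) (Id T x) (zero_mor T x (\<Sigma> z))"
proof -
  have "z \<in> Ob T" using z by (simp add: is_zero_object_iff)
  moreover have "dist_triangle T x x (\<Sigma> z) (Id T x) (zero_mor T x (\<Sigma> z)) (zero_mor T (\<Sigma> z) (\<Sigma> x))"
    by (rule TR1_id) (use assms in \<open>simp_all add: shift_zero_object\<close>)
  ultimately show ?thesis
    using assms rotate_back[of "zero_mor T z x" z x] by (simp add: in_hom_iff)
qed

text \<open>TR3 is applied to maps into the triangle
  \<open>z \<rightarrow> x \<rightarrow> x\<close> with \<open>z\<close> zero; the completed third
  component is the factorisation.\<close>

lemma exact_contra: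
  assumes d: "dist_triangle T a b c f g h" and t: "\<guillemotleft>t : b \<rightarrow> x\<guillemotright>" and tf: "t \<cdot> f = zero_mor T a x"
  obtains r where "\<guillemotleft>r : c \<rightarrow> x\<guillemotright>" "t = r \<cdot> g"
proof -
  obtain z where z: "is_zero_object T z" "z \<in> Ob T" by (rule obtain_zero)
  note h = dist_hom[OF d]
  have "x \<in> Ob T" using t by (auto simp: in_hom_iff)
  then have "dist_triangle T z x x (zero_mor T z x) (Id T x) (zero_mor T x (\<Sigma> z))"
    using z(1) by (rule zero_triangle)
  moreover have "\<guillemotleft>zero_mor T a z : a \<rightarrow> z\<guillemotright>" "t \<cdot> f = zero_mor T z x \<cdot> zero_mor T a z"
    using h t tf z by (simp_all add: in_hom_iff)
  ultimately obtain \<gamma> where "\<guillemotleft>\<gamma> : c \<rightarrow> x\<guillemotright>" "\<gamma> \<cdot> g = Id T x \<cdot> t"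
    using TR3[OF d _ _ t] by blast
  then show thesis using that t by (auto simp: in_hom_iff)
qed

lemma exact_cov2:
  assumes "dist_triangle T a b c f g h" "\<guillemotleft>t : x \<rightarrow> c\<guillemotright>" "h \<cdot> t = zero_mor T x (\<Sigma> a)"
  obtains r where "\<guillemotleft>r : x \<rightarrow> b\<guillemotright>" "t = g \<cdot> r"
  using exact_cov[OF rotate[OF assms(1)] assms(2,3)] that by blast

lemma exact_contra2:
  assumes "dist_triangle T a b c f g h" "\<guillemotleft>t : c \<rightarrow> x\<guillemotright>" "t \<cdot> g = zero_mor T b x"
  obtains r where "\<guillemotleft>r : \<Sigma> a \<rightarrow> x\<guillemotright>" "t = r \<cdot> h"
  using exact_contra[OF rotate[OF assms(1)] assms(2,3)] that by blast

text \<open>\<open>shift_mor T u \<cdot> h\<close> is the obstruction to extending \<open>u\<close>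
  along \<open>f\<close>. Exactness is applied at \<open>\<Sigma> a\<close> after a rotation and the
  result is shifted back; the sign of the rotated morphism is absorbed in
  \<open>neg_mor v\<close>.\<close>

lemma exact_contra3:
  assumes d: "dist_triangle T a b c f g h" and u: "\<guillemotleft>u : a \<rightarrow> x\<guillemotright>" "shift_mor T u \<cdot> h = zero_mor T c (\<Sigma> x)"
  obtains w where "\<guillemotleft>w : b \<rightarrow> x\<guillemotright>" "u = w \<cdot> f"
proof -
  note h = dist_hom[OF d]
  have "\<guillemotleft>shift_mor T u : \<Sigma> a \<rightarrow> \<Sigma> x\<guillemotright>" using u by (auto simp: in_hom_iff)
  then obtain r where r: "\<guillemotleft>r : \<Sigma> b \<rightarrow> \<Sigma> x\<guillemotright>" "shift_mor T u = r \<cdot> neg_mor (shift_mor T f)"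
    using exact_contra2[OF rotate[OF d] _ u(2)] by blast
  obtain v where v: "\<guillemotleft>v : b \<rightarrow> x\<guillemotright>" "r = shift_mor T v"
    using shift_full[OF r(1)] h u by (auto simp: in_hom_iff)
  have "u = neg_mor v \<cdot> f" by (rule shift_faithful) (use r(2) v u h in \<open>auto simp: in_hom_iff\<close>)
  then show thesis using that[of "neg_mor v"] v by (auto simp: in_hom_iff)
qed

lemma exact_cov_shift:
  assumes d: "dist_triangle T a b c f g h" and t: "\<guillemotleft>t : x \<rightarrow> \<Sigma> b\<guillemotright>" "shift_mor T g \<cdot> t = zero_mor T x (\<Sigma> c)"
  obtains r where "\<guillemotleft>r : x \<rightarrow> \<Sigma> a\<guillemotright>" "t = shift_mor T f \<cdot> r"
proof -
  note h = dist_hom[OF d]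
  have "neg_mor (shift_mor T g) \<cdot> t = zero_mor T x (\<Sigma> c)" using t h by (auto simp: in_hom_iff)
  with exact_cov2[OF rotate[OF rotate[OF d]] t(1)]
  obtain r where "\<guillemotleft>r : x \<rightarrow> \<Sigma> a\<guillemotright>" "t = neg_mor (shift_mor T f) \<cdot> r" by blast
  then show thesis using that[of "neg_mor r"] h by (auto simp: in_hom_iff)
qed

section \<open>Rotating back, split triangles and complements\<close>

lemma dist_iso:
  assumes d: "dist_triangle T a b c f g h" and u: "\<guillemotleft>u : c \<rightarrow> c'\<guillemotright>" "\<guillemotleft>v : c' \<rightarrow> c\<guillemotright>" "v \<cdot> u = Id T c" "u \<cdot> v = Id T c'"
  shows "dist_triangle T a b c' f (u \<cdot> g) (h \<cdot> v)"
proof (rule TR1_iso[OF d, where \<alpha>="Id T a" and \<beta>="Id T b" and \<gamma>=u])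
  note h = dist_hom[OF d]
  show "candidate_triangle T a b c' f (u \<cdot> g) (h \<cdot> v)" using h u by (auto simp: candidate_triangle_def in_hom_iff)
  show "is_iso T (Id T a) a a" "is_iso T (Id T b) b b" using h by (auto simp: in_hom_iff is_iso_Id)
  show "is_iso T u c c'" using u by (rule is_isoI)
  show "Id T b \<cdot> f = f \<cdot> Id T a" "u \<cdot> g = u \<cdot> g \<cdot> Id T b" using h u by (auto simp: in_hom_iff)
  show "shift_mor T (Id T a) \<cdot> h = h \<cdot> v \<cdot> u" using h u by (auto simp: in_hom_iff)
qed

text \<open>The shift is an autoequivalence but not strictly invertible, so rotating back requires
  an isomorphism of the third object \<open>y\<close> with some \<open>\<Sigma> b\<close>. The two
  backward rotations negate the recovered \<open>f\<close> and \<open>g\<close> and leave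
  \<open>h\<close> as it is.\<close>

lemma unrotate:
  assumes d: "dist_triangle T c x y h m l" and x: "x = \<Sigma> a" and a: "a \<in> Ob T" and b: "b \<in> Ob T"
    and u: "\<guillemotleft>u : y \<rightarrow> \<Sigma> b\<guillemotright>" "\<guillemotleft>v : \<Sigma> b \<rightarrow> y\<guillemotright>" "v \<cdot> u = Id T y" "u \<cdot> v = Id T (\<Sigma> b)"
  obtains f g where "dist_triangle T a b c f g h"
proof -
  have d': "dist_triangle T c x (\<Sigma> b) h (u \<cdot> m) (l \<cdot> v)" using dist_iso[OF d u] .
  note h' = dist_hom[OF d']
  have c: "c \<in> Ob T" using h' by (auto simp: in_hom_iff)
  obtain g where g: "\<guillemotleft>g : b \<rightarrow> c\<guillemotright>" "l \<cdot> v = shift_mor T g" using shift_full[OF h'(3) b c] .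
  obtain f where f: "\<guillemotleft>f : a \<rightarrow> b\<guillemotright>" "u \<cdot> m = shift_mor T f" using shift_full[OF h'(2)[unfolded x] a b] .
  have "dist_triangle T b c (\<Sigma> a) (neg_mor g) h (u \<cdot> m)"
    by (rule rotate_back) (use d' g x in \<open>auto simp: in_hom_iff\<close>)
  then have "dist_triangle T a b c (neg_mor f) (neg_mor g) h"
    using f rotate_back[of "neg_mor f" a b] by (auto simp: in_hom_iff)
  then show thesis by (rule that)
qed

text \<open>Realises a prescribed extension class \<open>h\<close> as the third morphism of a
  triangle: the cone of \<open>h\<close>, replaced by an isomorphic shift, is rotated back.\<close>

lemma cocone:
  assumes h: "\<guillemotleft>h : c \<rightarrow> \<Sigma> a\<guillemotright>" and a: "a \<in> Ob T"
  obtains b f g where "b \<in> Ob T" "dist_triangle T a b c f g h"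
proof -
  obtain y m l where d: "dist_triangle T c (\<Sigma> a) y h m l" using TR1_cone[OF h] by blast
  then have "y \<in> Ob T" using dist_hom[OF d] by (auto simp: in_hom_iff)
  then obtain b u v where b: "b \<in> Ob T" "\<guillemotleft>u : \<Sigma> b \<rightarrow> y\<guillemotright>" "\<guillemotleft>v : y \<rightarrow> \<Sigma> b\<guillemotright>"
    "v \<cdot> u = Id T (\<Sigma> b)" "u \<cdot> v = Id T y" by (rule shift_dense)
  show thesis
    using unrotate[OF d refl a b(1) b(3,2,5,4)] that[OF b(1)] by blast
qed

lemma split_triangle:
  assumes d: "dist_triangle T a b c f g h" and h0: "h = zero_mor T c (\<Sigma> a)"
  shows "is_dsum T b [a, c]"
proof -
  note h = dist_hom[OF d]
  obtain r where r: "\<guillemotleft>r : c \<rightarrow> b\<guillemotright>" "Id T c = g \<cdot> r"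
    using exact_cov2[OF d, of "Id T c" c] h h0 by (auto simp: in_hom_iff)
  obtain l where l: "\<guillemotleft>l : b \<rightarrow> a\<guillemotright>" "Id T a = l \<cdot> f"
    using exact_contra3[OF d, of "Id T a" a] h h0 by (auto simp: in_hom_iff)
  have gf: "g \<cdot> f = zero_mor T a c" using dist_zero[OF d] by simp
  \<comment> \<open>The section \<open>r\<close> of \<open>g\<close> and the retraction
    \<open>l\<close> of \<open>f\<close> were chosen independently; the correction by
    \<open>f \<cdot> (l \<cdot> r)\<close> makes \<open>l\<close> vanish on the section without
    changing its composite with \<open>g\<close>.\<close>
  define r' where "r' = r \<boxplus> neg_mor (f \<cdot> (l \<cdot> r))"
  have r': "\<guillemotleft>r' : c \<rightarrow> b\<guillemotright>" using r l h by (auto simp: r'_def in_hom_iff)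
  have gfx: "g \<cdot> (f \<cdot> x) = zero_mor T (Dom T x) c" "l \<cdot> (f \<cdot> x) = x" if "arr x" "Cod T x = a" for x
  proof -
    have "g \<cdot> (f \<cdot> x) = (g \<cdot> f) \<cdot> x" using that h by (simp add: in_hom_iff del: gf)
    then show "g \<cdot> (f \<cdot> x) = zero_mor T (Dom T x) c" using that h by (simp add: gf in_hom_iff)
    have "l \<cdot> (f \<cdot> x) = (l \<cdot> f) \<cdot> x" using that h l(1) by (simp add: in_hom_iff)
    then show "l \<cdot> (f \<cdot> x) = x" using that by (simp flip: l(2))
  qed
  have gr': "g \<cdot> r' = Id T c" using r l h gfx[of "l \<cdot> r"] by (auto simp: r'_def in_hom_iff)
  have lr': "l \<cdot> r' = zero_mor T c a" using r(1) l(1) h gfx[of "l \<cdot> r"] by (auto simp: r'_def in_hom_iff)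
  \<comment> \<open>The defect of the biproduct identity. It is killed by \<open>g\<close>, so it is
    \<open>f \<cdot> p\<close>; it is killed by \<open>l\<close> as well, and \<open>l\<close>
    recovers \<open>p\<close>.\<close>
  define w where "w = Id T b \<boxplus> neg_mor (f \<cdot> l \<boxplus> r' \<cdot> g)"
  have w: "\<guillemotleft>w : b \<rightarrow> b\<guillemotright>" using r' l h by (auto simp: w_def in_hom_iff)
  have gr'x: "g \<cdot> (r' \<cdot> g) = g" and lr'x: "l \<cdot> (r' \<cdot> g) = zero_mor T b a"
  proof -
    have "g \<cdot> (r' \<cdot> g) = (g \<cdot> r') \<cdot> g" using r' h by (simp add: in_hom_iff)
    then show "g \<cdot> (r' \<cdot> g) = g" using h gr' by (simp add: in_hom_iff)
    have "l \<cdot> (r' \<cdot> g) = (l \<cdot> r') \<cdot> g" using r' h l(1) by (simp add: in_hom_iff)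
    then show "l \<cdot> (r' \<cdot> g) = zero_mor T b a" using h lr' l by (simp add: in_hom_iff)
  qed
  have "g \<cdot> w = zero_mor T b c" using r' l(1) h gfx[of l] gr'x by (auto simp: w_def in_hom_iff)
  then obtain p where p: "\<guillemotleft>p : b \<rightarrow> a\<guillemotright>" "w = f \<cdot> p" using exact_cov[OF d w] by blast
  have "p = l \<cdot> w" using gfx(2)[of p] p by (simp add: in_hom_iff)
  also have "\<dots> = zero_mor T b a" using r' l(1) h gfx[of l] lr'x by (auto simp: w_def in_hom_iff)
  finally have "w = zero_mor T b b" using p h by (simp add: in_hom_iff)
  then have "Id T b = f \<cdot> l \<boxplus> r' \<cdot> g"
    unfolding w_def using r' l h by (subst (asm) diff_eq_zero) (auto simp: in_hom_iff)
  then show ?thesis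
    unfolding is_dsum_pair_iff using r' l h gr' lr' gf by metis
qed

text \<open>A cone of the split monomorphism \<open>i\<close> is a complement: \<open>r\<close>
  cancels \<open>i\<close> in \<open>shift_mor T i \<cdot> h = 0\<close>, so \<open>h\<close> is
  zero. In contrast to \<open>split_triangle\<close> the given retraction \<open>r\<close> is kept,
  and \<open>u\<close> is obtained by factoring \<open>1 - i r\<close> through the cone.\<close>

lemma retract_complement:
  assumes i: "\<guillemotleft>i : x \<rightarrow> p\<guillemotright>" and r: "\<guillemotleft>r : p \<rightarrow> x\<guillemotright>" and ri: "r \<cdot> i = Id T x"
  obtains y u v where "\<guillemotleft>u : y \<rightarrow> p\<guillemotright>" "\<guillemotleft>v : p \<rightarrow> y\<guillemotright>" "v \<cdot> u = Id T y" "v \<cdot> i = zero_mor T x y"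
    "r \<cdot> u = zero_mor T y x" "i \<cdot> r \<boxplus> u \<cdot> v = Id T p"
proof -
  obtain y v h where d: "dist_triangle T x p y i v h" using TR1_cone[OF i] by blast
  note h = dist_hom[OF d]
  have "h = shift_mor T (r \<cdot> i) \<cdot> h" using h ri by (auto simp: in_hom_iff)
  also have "\<dots> = shift_mor T r \<cdot> (shift_mor T i \<cdot> h)" using h r by (auto simp: in_hom_iff)
  also have "\<dots> = zero_mor T y (\<Sigma> x)" using dist_zero(3)[OF d] r h by (auto simp: in_hom_iff)
  finally have h0: "h = zero_mor T y (\<Sigma> x)" .
  have vi: "v \<cdot> i = zero_mor T x y" using dist_zero[OF d] by simp
  obtain \<rho> where \<rho>: "\<guillemotleft>\<rho> : y \<rightarrow> p\<guillemotright>" "Id T y = v \<cdot> \<rho>"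
    using exact_cov2[OF d, of "Id T y" y] h h0 by (auto simp: in_hom_iff)
  define e where "e = Id T p \<boxplus> neg_mor (i \<cdot> r)"
  have e: "\<guillemotleft>e : p \<rightarrow> p\<guillemotright>" using i r by (auto simp: e_def in_hom_iff)
  have "e \<cdot> i = zero_mor T x p" using i r ri by (auto simp: e_def in_hom_iff)
  then obtain u where u: "\<guillemotleft>u : y \<rightarrow> p\<guillemotright>" "e = u \<cdot> v" using exact_contra[OF d e] by blast
  have 1: "i \<cdot> r \<boxplus> u \<cdot> v = Id T p"
    using u(2)[symmetric] diff_eq[of "Id T p" "i \<cdot> r"] i r by (auto simp: e_def in_hom_iff)
  have vir: "v \<cdot> (i \<cdot> r) = zero_mor T p y"
  proof -
    have "v \<cdot> (i \<cdot> r) = (v \<cdot> i) \<cdot> r" using h i r by (simp add: in_hom_iff del: vi)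
    then show ?thesis using vi r h by (simp add: in_hom_iff)
  qed
  have rir: "r \<cdot> (i \<cdot> r) = r"
  proof -
    have "r \<cdot> (i \<cdot> r) = (r \<cdot> i) \<cdot> r" using i r by (simp add: in_hom_iff)
    then show ?thesis using ri r by (simp add: in_hom_iff)
  qed
  have "v \<cdot> u = v \<cdot> u \<cdot> (v \<cdot> \<rho>)" using \<rho>(2)[symmetric] h u(1) by (simp add: in_hom_iff)
  also have "\<dots> = v \<cdot> (e \<cdot> \<rho>)" using u \<rho>(1) h by (simp add: in_hom_iff)
  also have "\<dots> = (v \<cdot> e) \<cdot> \<rho>" using e \<rho>(1) h by (simp add: in_hom_iff)
  also have "v \<cdot> e = v" using h i r vir by (simp add: e_def in_hom_iff)
  finally have 2: "v \<cdot> u = Id T y" using \<rho> by simp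
  have "r \<cdot> u = r \<cdot> u \<cdot> (v \<cdot> \<rho>)" using \<rho>(2)[symmetric] r u(1) by (simp add: in_hom_iff)
  also have "\<dots> = r \<cdot> (e \<cdot> \<rho>)" using u \<rho>(1) h r by (simp add: in_hom_iff)
  also have "\<dots> = (r \<cdot> e) \<cdot> \<rho>" using e \<rho>(1) r by (simp add: in_hom_iff)
  also have "r \<cdot> e = zero_mor T p x" using i r rir by (simp add: e_def in_hom_iff)
  finally have "r \<cdot> u = zero_mor T y x" using \<rho>(1) r by (simp add: in_hom_iff)
  then show thesis using that[OF u(1) h(2) 2 vi _ 1] by blast
qed

lemma retract_is_summand:
  assumes "\<guillemotleft>i : x \<rightarrow> p\<guillemotright>" "\<guillemotleft>r : p \<rightarrow> x\<guillemotright>" "r \<cdot> i = Id T x"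
  shows "is_summand T x p"
proof -
  obtain y u v where "\<guillemotleft>u : y \<rightarrow> p\<guillemotright>" "\<guillemotleft>v : p \<rightarrow> y\<guillemotright>" "v \<cdot> u = Id T y" "v \<cdot> i = zero_mor T x y"
    "r \<cdot> u = zero_mor T y x" "i \<cdot> r \<boxplus> u \<cdot> v = Id T p"
    using retract_complement[OF assms] by blast
  then have "is_dsum T p [x, y]" unfolding is_dsum_pair_iff using assms by blast
  then show ?thesis by (auto simp: is_summand_def)
qed

lemma summand_retract:
  assumes "is_summand T x p"
  obtains i r where "\<guillemotleft>i : x \<rightarrow> p\<guillemotright>" "\<guillemotleft>r : p \<rightarrow> x\<guillemotright>" "r \<cdot> i = Id T x"
  using assms by (auto simp: is_summand_def elim: is_dsum_pairE)

text \<open>Each \<open>thru_step\<close> adjoins one copy of \<open>s\<close> to the direct sum,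
  with \<open>(p, g)\<close> as the map into it and \<open>(r, h)\<close> as the map out of
  it.\<close>

lemma thru_replicate:
  "thru s f \<Longrightarrow> s \<in> Ob T \<Longrightarrow> \<exists>n p g h. is_dsum T p (replicate n s) \<and> \<guillemotleft>g : Dom T f \<rightarrow> p\<guillemotright> \<and> \<guillemotleft>h : p \<rightarrow> Cod T f\<guillemotright> \<and> f = h \<cdot> g"
proof (induction rule: thru.induct)
  case (thru_zero a b)
  obtain z where z: "is_zero_object T z" "z \<in> Ob T" by (rule obtain_zero)
  have "is_dsum T z (replicate 0 s)" using z by (simp add: is_zero_object_def)
  moreover have "\<guillemotleft>zero_mor T a z : a \<rightarrow> z\<guillemotright>" "\<guillemotleft>zero_mor T z b : z \<rightarrow> b\<guillemotright>" "zero_mor T z b \<cdot> zero_mor T a z = zero_mor T a b"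
    using thru_zero z by (auto simp: in_hom_iff)
  ultimately show ?case using thru_zero by (metis zero_simps(2,3))
next
  case (thru_step f p r)
  then obtain n q g h where q: "is_dsum T q (replicate n s)" and gh: "\<guillemotleft>g : Dom T f \<rightarrow> q\<guillemotright>" "\<guillemotleft>h : q \<rightarrow> Cod T f\<guillemotright>" "f = h \<cdot> g"
    by blast
  have f: "arr f" using thru_step(1) by (rule thru_arr)
  obtain P where P: "is_dsum T P [s, q]" using dsum_exists[of "[s, q]"] thru_step(2) gh(1) by (auto simp: in_hom_iff)
  obtain i i' e e' where *: "\<guillemotleft>i : s \<rightarrow> P\<guillemotright>" "\<guillemotleft>i' : q \<rightarrow> P\<guillemotright>" "\<guillemotleft>e : P \<rightarrow> s\<guillemotright>" "\<guillemotleft>e' : P \<rightarrow> q\<guillemotright>"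
    "e \<cdot> i = Id T s" "e' \<cdot> i' = Id T q" "e' \<cdot> i = zero_mor T s q" "e \<cdot> i' = zero_mor T q s"
    using is_dsum_pairE[OF P] .
  have **: "e \<cdot> (i \<cdot> x) = x" "e' \<cdot> (i \<cdot> x) = zero_mor T (Dom T x) q" if "arr x" "Cod T x = s" for x
  proof -
    have "e \<cdot> (i \<cdot> x) = (e \<cdot> i) \<cdot> x" "e' \<cdot> (i \<cdot> x) = (e' \<cdot> i) \<cdot> x" using *(1-4) that by (simp_all add: in_hom_iff)
    then show "e \<cdot> (i \<cdot> x) = x" "e' \<cdot> (i \<cdot> x) = zero_mor T (Dom T x) q" using * that by (simp_all add: in_hom_iff)
  qed
  have ***: "e' \<cdot> (i' \<cdot> x) = x" "e \<cdot> (i' \<cdot> x) = zero_mor T (Dom T x) s" if "arr x" "Cod T x = q" for x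
  proof -
    have "e \<cdot> (i' \<cdot> x) = (e \<cdot> i') \<cdot> x" "e' \<cdot> (i' \<cdot> x) = (e' \<cdot> i') \<cdot> x" using *(1-4) that by (simp_all add: in_hom_iff)
    then show "e' \<cdot> (i' \<cdot> x) = x" "e \<cdot> (i' \<cdot> x) = zero_mor T (Dom T x) s" using * that by (simp_all add: in_hom_iff)
  qed
  have "r \<cdot> p \<boxplus> f = (r \<cdot> e \<boxplus> h \<cdot> e') \<cdot> (i \<cdot> p \<boxplus> i' \<cdot> g)"
    using *(1-4) thru_step(2,3) gh(1,2) f gh(3)[symmetric] by (simp add: in_hom_iff ** ***)
  moreover have "is_dsum T P (replicate (Suc n) s)" using is_dsum_Cons[OF q P] by simp
  moreover have "\<guillemotleft>i \<cdot> p \<boxplus> i' \<cdot> g : Dom T (r \<cdot> p \<boxplus> f) \<rightarrow> P\<guillemotright>" "\<guillemotleft>r \<cdot> e \<boxplus> h \<cdot> e' : P \<rightarrow> Cod T (r \<cdot> p \<boxplus> f)\<guillemotright>"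
    using *(1-4) thru_step(2,3) gh(1,2) f by (auto simp: in_hom_iff)
  ultimately show ?case by blast
qed

text \<open>Membership becomes a condition on the identity of \<open>x\<close> alone, so closure
  properties of the additive closure reduce to those of the ideal \<open>thru s\<close>.\<close>

lemma add_closure_iff:
  assumes "s \<in> Ob T"
  shows "x \<in> add_closure T s \<longleftrightarrow> x \<in> Ob T \<and> thru s (Id T x)"
proof
  assume "x \<in> add_closure T s"
  then obtain n p where p: "is_dsum T p (replicate n s)" "is_summand T x p" by (auto simp: add_closure_def)
  obtain i r where ir: "\<guillemotleft>i : x \<rightarrow> p\<guillemotright>" "\<guillemotleft>r : p \<rightarrow> x\<guillemotright>" "r \<cdot> i = Id T x" using p(2) by (rule summand_retract)
  have "thru s (r \<cdot> (Id T p \<cdot> i))" by (rule thru_Cmp[OF thru_dsum[OF p(1)]]) (use ir in \<open>auto simp: in_hom_iff\<close>)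
  then show "x \<in> Ob T \<and> thru s (Id T x)" using ir by (auto simp: in_hom_iff)
next
  assume x: "x \<in> Ob T \<and> thru s (Id T x)"
  then obtain n p g h where "is_dsum T p (replicate n s)" "\<guillemotleft>g : x \<rightarrow> p\<guillemotright>" "\<guillemotleft>h : p \<rightarrow> x\<guillemotright>" "h \<cdot> g = Id T x"
    using thru_replicate[of s "Id T x"] assms by auto
  then show "x \<in> add_closure T s"
    using retract_is_summand[of g x p h] by (auto simp: add_closure_def)
qed

end

section \<open>Two-term objects over a presilting subcategory\<close>

context tri_cat
begin

text \<open>The third object is a shift already, so the backward rotation involves no isomorphism:
  only the third morphism has to be written as a shift.\<close>

lemma unrotate1:
  assumes d: "dist_triangle T b c (\<Sigma> a) g h m" and a: "a \<in> Ob T"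
  obtains f where "dist_triangle T a b c f g h"
proof -
  note h = dist_hom[OF d]
  have b: "b \<in> Ob T" using h by (auto simp: in_hom_iff)
  obtain w where w: "\<guillemotleft>w : a \<rightarrow> b\<guillemotright>" "m = shift_mor T w" using shift_full[OF h(3) a b] .
  have "dist_triangle T a b c (neg_mor w) g h"
    by (rule rotate_back) (use d w in \<open>auto simp: in_hom_iff\<close>)
  then show thesis by (rule that)
qed

text \<open>\<open>ext_zero x t\<close> is the vanishing of \<open>\<bbbE>(x, t) = T(x, \<Sigma> t)\<close>.\<close>

definition ext_zero :: "'o \<Rightarrow> 'o \<Rightarrow> bool"
  where "ext_zero x t \<longleftrightarrow> (\<forall>\<delta>. \<guillemotleft>\<delta> : x \<rightarrow> \<Sigma> t\<guillemotright> \<longrightarrow> \<delta> = zero_mor T x (\<Sigma> t))"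

lemma ext_zeroD: "ext_zero x t \<Longrightarrow> \<guillemotleft>\<delta> : x \<rightarrow> \<Sigma> t\<guillemotright> \<Longrightarrow> \<delta> = zero_mor T x (\<Sigma> t)"
  by (simp add: ext_zero_def)

lemma ext_zero_left:
  assumes d: "dist_triangle T a b c f g h" and "ext_zero a t" "ext_zero c t"
  shows "ext_zero b t"
  unfolding ext_zero_def
proof (intro allI impI)
  fix \<delta> assume \<delta>: "\<guillemotleft>\<delta> : b \<rightarrow> \<Sigma> t\<guillemotright>"
  note h = dist_hom[OF d]
  have "\<delta> \<cdot> f = zero_mor T a (\<Sigma> t)" using assms(2) h \<delta> by (auto simp: ext_zero_def in_hom_iff)
  then obtain r where "\<guillemotleft>r : c \<rightarrow> \<Sigma> t\<guillemotright>" "\<delta> = r \<cdot> g" using exact_contra[OF d \<delta>] by blast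
  then show "\<delta> = zero_mor T b (\<Sigma> t)" using ext_zeroD[OF assms(3), of r] h by (auto simp: in_hom_iff)
qed

lemma ext_zero_right:
  assumes d: "dist_triangle T a b c f g h" and "ext_zero x a" "ext_zero x c"
  shows "ext_zero x b"
  unfolding ext_zero_def
proof (intro allI impI)
  fix \<delta> assume \<delta>: "\<guillemotleft>\<delta> : x \<rightarrow> \<Sigma> b\<guillemotright>"
  note h = dist_hom[OF d]
  have "shift_mor T g \<cdot> \<delta> = zero_mor T x (\<Sigma> c)" using assms(3) h \<delta> by (auto simp: ext_zero_def in_hom_iff)
  then obtain r where "\<guillemotleft>r : x \<rightarrow> \<Sigma> a\<guillemotright>" "\<delta> = shift_mor T f \<cdot> r" using exact_cov_shift[OF d \<delta>] by blast
  then show "\<delta> = zero_mor T x (\<Sigma> b)" using ext_zeroD[OF assms(2), of r] h by (auto simp: in_hom_iff)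
qed

lemma ext_zero_retract_left:
  assumes "ext_zero x t" "t \<in> Ob T" and i: "\<guillemotleft>i : y \<rightarrow> x\<guillemotright>" and r: "\<guillemotleft>r : x \<rightarrow> y\<guillemotright>" and ri: "r \<cdot> i = Id T y"
  shows "ext_zero y t"
  unfolding ext_zero_def
proof (intro allI impI)
  fix \<delta> assume \<delta>: "\<guillemotleft>\<delta> : y \<rightarrow> \<Sigma> t\<guillemotright>"
  have "\<guillemotleft>\<delta> \<cdot> r : x \<rightarrow> \<Sigma> t\<guillemotright>" using \<delta> r by (auto simp: in_hom_iff)
  then have "\<delta> \<cdot> r = zero_mor T x (\<Sigma> t)" by (rule ext_zeroD[OF assms(1)])
  moreover have "\<delta> = (\<delta> \<cdot> r) \<cdot> i" using \<delta> r i ri by (simp add: in_hom_iff)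
  ultimately show "\<delta> = zero_mor T y (\<Sigma> t)" using i \<delta> by (auto simp: in_hom_iff)
qed

lemma ext_zero_retract_right:
  assumes "ext_zero x t" "x \<in> Ob T" and i: "\<guillemotleft>i : y \<rightarrow> t\<guillemotright>" and r: "\<guillemotleft>r : t \<rightarrow> y\<guillemotright>" and ri: "r \<cdot> i = Id T y"
  shows "ext_zero x y"
  unfolding ext_zero_def
proof (intro allI impI)
  fix \<delta> assume \<delta>: "\<guillemotleft>\<delta> : x \<rightarrow> \<Sigma> y\<guillemotright>"
  have "\<guillemotleft>shift_mor T i \<cdot> \<delta> : x \<rightarrow> \<Sigma> t\<guillemotright>" using \<delta> i by (auto simp: in_hom_iff)
  then have 0: "shift_mor T i \<cdot> \<delta> = zero_mor T x (\<Sigma> t)" by (rule ext_zeroD[OF assms(1)])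
  have "\<delta> = shift_mor T (r \<cdot> i) \<cdot> \<delta>" using ri \<delta> i by (auto simp: in_hom_iff)
  also have "\<dots> = shift_mor T r \<cdot> (shift_mor T i \<cdot> \<delta>)" using \<delta> i r by (simp add: in_hom_iff)
  also have "\<dots> = zero_mor T x (\<Sigma> y)" using 0 \<delta> r by (simp add: in_hom_iff)
  finally show "\<delta> = zero_mor T x (\<Sigma> y)" .
qed

lemma ext_zero_dsum_left:
  assumes "is_dsum T p xs" "\<And>x. x \<in> set xs \<Longrightarrow> ext_zero x t" "t \<in> Ob T"
  shows "ext_zero p t"
  unfolding ext_zero_def
proof (intro allI impI)
  fix \<delta> assume \<delta>: "\<guillemotleft>\<delta> : p \<rightarrow> \<Sigma> t\<guillemotright>"
  have "\<delta> \<cdot> Id T p = zero_mor T p (\<Sigma> t)"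
  proof (rule is_dsum_induct[OF assms(1)])
    fix x i q assume "x \<in> set xs" and iq: "\<guillemotleft>i : x \<rightarrow> p\<guillemotright>" "\<guillemotleft>q : p \<rightarrow> x\<guillemotright>"
    then have "\<delta> \<cdot> i = zero_mor T x (\<Sigma> t)" using assms(2) \<delta> by (auto simp: ext_zero_def in_hom_iff)
    from reassoc[OF this, of q] show "\<delta> \<cdot> (i \<cdot> q) = zero_mor T p (\<Sigma> t)" using iq \<delta> by (auto simp: in_hom_iff)
  qed (use \<delta> in \<open>auto simp: in_hom_iff\<close>)
  then show "\<delta> = zero_mor T p (\<Sigma> t)" using \<delta> by (auto simp: in_hom_iff)
qed

lemma ext_zero_dsum_right:
  assumes "is_dsum T p xs" "\<And>t. t \<in> set xs \<Longrightarrow> ext_zero x t" "x \<in> Ob T"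
  shows "ext_zero x p"
  unfolding ext_zero_def
proof (intro allI impI)
  fix \<delta> assume \<delta>: "\<guillemotleft>\<delta> : x \<rightarrow> \<Sigma> p\<guillemotright>"
  have p: "p \<in> Ob T" using assms(1) by (simp add: is_dsum_def)
  have "shift_mor T (Id T p) \<cdot> \<delta> = zero_mor T x (\<Sigma> p)"
  proof (rule is_dsum_induct[OF assms(1)])
    fix t i q assume "t \<in> set xs" and iq: "\<guillemotleft>i : t \<rightarrow> p\<guillemotright>" "\<guillemotleft>q : p \<rightarrow> t\<guillemotright>"
    then have "shift_mor T q \<cdot> \<delta> = zero_mor T x (\<Sigma> t)" using assms(2) \<delta> by (auto simp: ext_zero_def in_hom_iff)
    then show "shift_mor T (i \<cdot> q) \<cdot> \<delta> = zero_mor T x (\<Sigma> p)" using iq \<delta> by (auto simp: in_hom_iff)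
  qed (use \<delta> p in \<open>auto simp: in_hom_iff\<close>)
  then show "\<delta> = zero_mor T x (\<Sigma> p)" using \<delta> p by (auto simp: in_hom_iff)
qed

end

locale two_term = tri_cat k T
  for k :: "('k, 'r) ring_scheme" and T :: "('k, 'o, 'm, 'z) tricat_scheme" (structure) +
  fixes s :: 'o and S C :: "'o set"
  assumes s: "s \<in> Ob T" and S_def: "S = add_closure T s" and presilting: "presilting T S"
    and C_def: "C = star T S (\<Sigma> ` S)"
begin

notation plus_mor (infixl \<open>\<boxplus>\<close> 65)

section \<open>Closure properties of \<open>S\<close> and of its shift\<close>

lemma S_iff: "x \<in> S \<longleftrightarrow> x \<in> Ob T \<and> thru s (Id T x)"
  unfolding S_def by (rule add_closure_iff[OF s])

lemma S_Ob: "x \<in> S \<Longrightarrow> x \<in> Ob T"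
  by (simp add: S_iff)

lemma s_S: "s \<in> S"
  using s thru_factor[of "Id T s" s s "Id T s" s] by (simp add: S_iff in_hom_iff)

lemma thru_via_S: "a \<in> S \<Longrightarrow> \<guillemotleft>f : x \<rightarrow> a\<guillemotright> \<Longrightarrow> \<guillemotleft>g : a \<rightarrow> y\<guillemotright> \<Longrightarrow> thru s (g \<cdot> f)"
  using thru_Cmp[of s "Id T a" f x g y] by (simp add: S_iff in_hom_iff)

lemma S_sum:
  assumes "a \<in> S" "b \<in> S" "\<guillemotleft>f : x \<rightarrow> a\<guillemotright>" "\<guillemotleft>g : a \<rightarrow> x\<guillemotright>" "\<guillemotleft>f' : x \<rightarrow> b\<guillemotright>" "\<guillemotleft>g' : b \<rightarrow> x\<guillemotright>"
    "g \<cdot> f \<boxplus> g' \<cdot> f' = Id T x"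
  shows "x \<in> S"
proof -
  have "thru s (g \<cdot> f \<boxplus> g' \<cdot> f')"
    by (rule thru_plus) (use assms thru_via_S in \<open>auto simp: in_hom_iff\<close>)
  then show ?thesis using assms by (simp add: S_iff in_hom_iff)
qed

lemma S_dsum:
  assumes "is_dsum T p xs" "set xs \<subseteq> S"
  shows "p \<in> S"
proof -
  have p: "p \<in> Ob T" using assms by (simp add: is_dsum_def)
  have "thru s (Id T p)"
  proof (rule is_dsum_induct[OF assms(1)])
    show "thru s (zero_mor T p p)" using p by (simp add: thru_zero)
    show "thru s (i \<cdot> q)" if "x \<in> set xs" "\<guillemotleft>i : x \<rightarrow> p\<guillemotright>" "\<guillemotleft>q : p \<rightarrow> x\<guillemotright>" for x i q
      using thru_via_S[of x q p i p] assms that by auto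
  qed (simp add: thru_plus in_hom_iff)
  then show ?thesis using p by (simp add: S_iff)
qed

lemma S_zero: "is_zero_object T z \<Longrightarrow> z \<in> S"
  using S_dsum[of z "[]"] by (simp add: is_zero_object_def)

lemma S_ext: "a \<in> S \<Longrightarrow> b \<in> S \<Longrightarrow> \<guillemotleft>f : a \<rightarrow> \<Sigma> b\<guillemotright> \<Longrightarrow> f = zero_mor T a (\<Sigma> b)"
proof -
  assume ab: "a \<in> S" "b \<in> S" and f: "\<guillemotleft>f : a \<rightarrow> \<Sigma> b\<guillemotright>"
  have "\<forall>i>0. carrier (Hom T a ((\<Sigma> ^^ i) b)) = {zero_mor T a ((\<Sigma> ^^ i) b)}"
    using presilting ab by (simp add: presilting_def)
  from this[rule_format, of 1] have "carrier (Hom T a (\<Sigma> b)) = {zero_mor T a (\<Sigma> b)}" by simp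
  then show ?thesis using f unfolding in_hom_def by blast
qed

lemma S_ext2: "a \<in> S \<Longrightarrow> b \<in> S \<Longrightarrow> \<guillemotleft>f : a \<rightarrow> \<Sigma> (\<Sigma> b)\<guillemotright> \<Longrightarrow> f = zero_mor T a (\<Sigma> (\<Sigma> b))"
proof -
  assume ab: "a \<in> S" "b \<in> S" and f: "\<guillemotleft>f : a \<rightarrow> \<Sigma> (\<Sigma> b)\<guillemotright>"
  have "\<forall>i>0. carrier (Hom T a ((\<Sigma> ^^ i) b)) = {zero_mor T a ((\<Sigma> ^^ i) b)}"
    using presilting ab by (simp add: presilting_def)
  from this[rule_format, of 2] have "carrier (Hom T a (\<Sigma> (\<Sigma> b))) = {zero_mor T a (\<Sigma> (\<Sigma> b))}"
    by (simp add: numeral_2_eq_2)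
  then show ?thesis using f unfolding in_hom_def by blast
qed

lemma S_ext_shift: "a \<in> S \<Longrightarrow> b \<in> S \<Longrightarrow> \<guillemotleft>f : \<Sigma> a \<rightarrow> \<Sigma> (\<Sigma> b)\<guillemotright> \<Longrightarrow> f = zero_mor T (\<Sigma> a) (\<Sigma> (\<Sigma> b))"
  using shift_full[of f a "\<Sigma> b"] S_ext[of a b] S_Ob by (metis shift_zero shift_Ob)

text \<open>Direct sums and retracts of objects of \<open>\<Sigma> S\<close> are shifts of objects
  of \<open>S\<close> up to isomorphism. Since \<open>x\<close> is only isomorphic to some
  \<open>\<Sigma> w\<close>, the decomposition of its identity is transported to
  \<open>\<Sigma> w\<close> and then, by full faithfulness, to \<open>w\<close>.\<close>

lemma shift_S:
  assumes ab: "a \<in> S" "b \<in> S" and hom: "\<guillemotleft>f : x \<rightarrow> \<Sigma> a\<guillemotright>" "\<guillemotleft>g : \<Sigma> a \<rightarrow> x\<guillemotright>" "\<guillemotleft>f' : x \<rightarrow> \<Sigma> b\<guillemotright>" "\<guillemotleft>g' : \<Sigma> b \<rightarrow> x\<guillemotright>"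
    and eq: "g \<cdot> f \<boxplus> g' \<cdot> f' = Id T x"
  obtains w u v where "w \<in> S" "\<guillemotleft>u : x \<rightarrow> \<Sigma> w\<guillemotright>" "\<guillemotleft>v : \<Sigma> w \<rightarrow> x\<guillemotright>" "v \<cdot> u = Id T x" "u \<cdot> v = Id T (\<Sigma> w)"
proof -
  have "x \<in> Ob T" using hom by (auto simp: in_hom_iff)
  then obtain w v u where w: "w \<in> Ob T" "\<guillemotleft>v : \<Sigma> w \<rightarrow> x\<guillemotright>" "\<guillemotleft>u : x \<rightarrow> \<Sigma> w\<guillemotright>" "u \<cdot> v = Id T (\<Sigma> w)" "v \<cdot> u = Id T x"
    by (rule shift_dense)
  have Ob: "a \<in> Ob T" "b \<in> Ob T" using ab S_Ob by auto
  have "\<guillemotleft>f \<cdot> v : \<Sigma> w \<rightarrow> \<Sigma> a\<guillemotright>" "\<guillemotleft>u \<cdot> g : \<Sigma> a \<rightarrow> \<Sigma> w\<guillemotright>" "\<guillemotleft>f' \<cdot> v : \<Sigma> w \<rightarrow> \<Sigma> b\<guillemotright>" "\<guillemotleft>u \<cdot> g' : \<Sigma> b \<rightarrow> \<Sigma> w\<guillemotright>"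
    using hom w by (auto simp: in_hom_iff)
  then obtain m n m' n' where *: "\<guillemotleft>m : w \<rightarrow> a\<guillemotright>" "f \<cdot> v = shift_mor T m" "\<guillemotleft>n : a \<rightarrow> w\<guillemotright>" "u \<cdot> g = shift_mor T n"
    "\<guillemotleft>m' : w \<rightarrow> b\<guillemotright>" "f' \<cdot> v = shift_mor T m'" "\<guillemotleft>n' : b \<rightarrow> w\<guillemotright>" "u \<cdot> g' = shift_mor T n'"
    using shift_full w(1) Ob by metis
  have "shift_mor T (Id T w) = u \<cdot> ((g \<cdot> f \<boxplus> g' \<cdot> f') \<cdot> v)" unfolding eq using w by (simp add: in_hom_iff)
  also have "\<dots> = (u \<cdot> g) \<cdot> (f \<cdot> v) \<boxplus> (u \<cdot> g') \<cdot> (f' \<cdot> v)" using w(1-3) hom by (simp add: in_hom_iff)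
  also have "\<dots> = shift_mor T (n \<cdot> m \<boxplus> n' \<cdot> m')"
    unfolding *(2,4,6,8) using *(1,3,5,7) by (simp add: in_hom_iff)
  finally have "Id T w = n \<cdot> m \<boxplus> n' \<cdot> m'"
    by (rule shift_faithful[rotated 4]) (use w(1) *(1,3,5,7) in \<open>simp_all add: in_hom_iff\<close>)
  then have "w \<in> S" using S_sum[OF ab *(1,3,5,7)] by simp
  then show thesis using that w by blast
qed

lemma shift_S_dsum:
  assumes "a \<in> S" "b \<in> S" "is_dsum T x [\<Sigma> a, \<Sigma> b]"
  obtains w u v where "w \<in> S" "\<guillemotleft>u : x \<rightarrow> \<Sigma> w\<guillemotright>" "\<guillemotleft>v : \<Sigma> w \<rightarrow> x\<guillemotright>" "v \<cdot> u = Id T x" "u \<cdot> v = Id T (\<Sigma> w)"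
proof -
  obtain i i' q q' where "\<guillemotleft>i : \<Sigma> a \<rightarrow> x\<guillemotright>" "\<guillemotleft>i' : \<Sigma> b \<rightarrow> x\<guillemotright>" "\<guillemotleft>q : x \<rightarrow> \<Sigma> a\<guillemotright>" "\<guillemotleft>q' : x \<rightarrow> \<Sigma> b\<guillemotright>"
    "i \<cdot> q \<boxplus> i' \<cdot> q' = Id T x" using is_dsum_pairE[OF assms(3)] .
  then show thesis using shift_S[OF assms(1,2), of q x i q' i'] that by blast
qed

section \<open>Closure of \<open>C\<close> under cones, extensions and retracts\<close>

lemma C_I: "a \<in> S \<Longrightarrow> b \<in> S \<Longrightarrow> dist_triangle T a c (\<Sigma> b) f g h \<Longrightarrow> c \<in> C"
  unfolding C_def star_def by blast

lemma C_I2: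
  assumes "a \<in> S" "b \<in> S" "dist_triangle T b a c f g h"
  shows "c \<in> C"
  using C_I[OF assms(1,2) rotate[OF assms(3)]] .

lemma C_E:
  assumes "c \<in> C"
  obtains a b \<sigma> \<alpha> \<beta> where "a \<in> S" "b \<in> S" "dist_triangle T b a c \<sigma> \<alpha> \<beta>"
proof -
  obtain a b f g h where *: "a \<in> S" "b \<in> S" "dist_triangle T a c (\<Sigma> b) f g h"
    using assms unfolding C_def star_def by blast
  obtain \<sigma> where "dist_triangle T b a c \<sigma> f g" using unrotate1[OF *(3)] *(2) S_Ob by blast
  then show thesis using that * by blast
qed

lemma C_Ob: "c \<in> C \<Longrightarrow> c \<in> Ob T"
  by (erule C_E) (use dist_hom in \<open>auto simp: in_hom_iff\<close>)

lemma S_C: "a \<in> S \<Longrightarrow> a \<in> C"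
proof -
  assume a: "a \<in> S"
  obtain z where z: "is_zero_object T z" by (rule obtain_zero)
  show ?thesis using C_I2[OF a S_zero[OF z] zero_triangle[OF S_Ob[OF a] z]] .
qed

lemma shift_S_C: "a \<in> S \<Longrightarrow> \<Sigma> a \<in> C"
proof -
  assume a: "a \<in> S"
  obtain z where z: "is_zero_object T z" by (rule obtain_zero)
  show ?thesis using C_I[OF S_zero[OF z] a zero_triangle[OF _ z]] S_Ob[OF a] by simp
qed

text \<open>Degrees one and two of the presilting condition both enter:
  \<open>shift_mor T \<beta> \<cdot> t\<close> lies in \<open>T(a, \<Sigma>\<Sigma> s1) = 0\<close>,
  so \<open>t\<close> comes from \<open>T(a, \<Sigma> s0)\<close>, which vanishes too.\<close>

lemma ext_zero_S:
  assumes a: "a \<in> S" and c: "c \<in> C"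
  shows "ext_zero a c"
  unfolding ext_zero_def
proof (intro allI impI)
  fix t assume t: "\<guillemotleft>t : a \<rightarrow> \<Sigma> c\<guillemotright>"
  obtain s0 s1 \<sigma> \<alpha> \<beta> where *: "s0 \<in> S" "s1 \<in> S" "dist_triangle T s1 s0 c \<sigma> \<alpha> \<beta>" using c by (rule C_E)
  note h = dist_hom[OF *(3)]
  have "\<guillemotleft>shift_mor T \<beta> \<cdot> t : a \<rightarrow> \<Sigma> (\<Sigma> s1)\<guillemotright>" using h t by (auto simp: in_hom_iff)
  then have "shift_mor T \<beta> \<cdot> t = zero_mor T a (\<Sigma> (\<Sigma> s1))" using S_ext2 a * by blast
  with exact_cov_shift[OF rotate[OF *(3)] t] obtain r where r: "\<guillemotleft>r : a \<rightarrow> \<Sigma> s0\<guillemotright>" "t = shift_mor T \<alpha> \<cdot> r" by blast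
  have "r = zero_mor T a (\<Sigma> s0)" using S_ext r a * by blast
  then show "t = zero_mor T a (\<Sigma> c)" using r h by (auto simp: in_hom_iff)
qed

text \<open>Objects of \<open>S\<close> are projective with respect to triangles whose first term is
  in \<open>C\<close>. This is the surjectivity of \<open>F g\<close>, and the source of the lifting
  arguments below.\<close>

lemma lift:
  assumes d: "dist_triangle T a b c f g h" and "a \<in> C" "x \<in> S" "\<guillemotleft>t : x \<rightarrow> c\<guillemotright>"
  obtains r where "\<guillemotleft>r : x \<rightarrow> b\<guillemotright>" "t = g \<cdot> r"
proof -
  have "\<guillemotleft>h \<cdot> t : x \<rightarrow> \<Sigma> a\<guillemotright>" using dist_hom[OF d] assms(4) by (auto simp: in_hom_iff)
  then have "h \<cdot> t = zero_mor T x (\<Sigma> a)" using ext_zeroD[OF ext_zero_S[OF assms(3,2)]] by blast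
  then show thesis using exact_cov2[OF d assms(4)] that by blast
qed

text \<open>The octahedron on \<open>s0 \<rightarrow> c \<rightarrow> z\<close> presents the cone of
  the composite as an extension of \<open>\<Sigma> a\<close> by \<open>\<Sigma> s1\<close>. Its
  connecting morphism lies in \<open>T(\<Sigma> a, \<Sigma>\<Sigma> s1) = 0\<close>, so the cone is
  a direct sum and lies in \<open>\<Sigma> S\<close> up to isomorphism.\<close>

lemma C_cone:
  assumes d: "dist_triangle T a c z f g h" and a: "a \<in> S" and c: "c \<in> C"
  shows "z \<in> C"
proof -
  obtain s0 s1 \<sigma> \<alpha> \<beta> where *: "s0 \<in> S" "s1 \<in> S" "dist_triangle T s1 s0 c \<sigma> \<alpha> \<beta>" using c by (rule C_E)
  note h = dist_hom[OF *(3)] dist_hom[OF d]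
  have "\<guillemotleft>g \<cdot> \<alpha> : s0 \<rightarrow> z\<guillemotright>" using h by (auto simp: in_hom_iff)
  then obtain b' l l' where d': "dist_triangle T s0 z b' (g \<cdot> \<alpha>) l l'" using TR1_cone by blast
  obtain p q where o: "dist_triangle T (\<Sigma> s1) b' (\<Sigma> a) p q (shift_mor T \<beta> \<cdot> neg_mor (shift_mor T f))"
    using TR4[OF rotate[OF *(3)] rotate[OF d] d'] by blast
  have "shift_mor T \<beta> \<cdot> neg_mor (shift_mor T f) = zero_mor T (\<Sigma> a) (\<Sigma> (\<Sigma> s1))"
    using dist_hom(3)[OF o] S_ext_shift a * by blast
  from split_triangle[OF o this] have "is_dsum T b' [\<Sigma> s1, \<Sigma> a]" .
  then obtain w u v where w: "w \<in> S" "\<guillemotleft>u : b' \<rightarrow> \<Sigma> w\<guillemotright>" "\<guillemotleft>v : \<Sigma> w \<rightarrow> b'\<guillemotright>" "v \<cdot> u = Id T b'" "u \<cdot> v = Id T (\<Sigma> w)"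
    using shift_S_dsum[OF *(2) a] by blast
  show ?thesis using C_I[OF *(1) w(1) dist_iso[OF d' w(2-5)]] .
qed

lemma C_ext_shift_S:
  assumes d: "dist_triangle T c e (\<Sigma> a) f g h" and a: "a \<in> S" and c: "c \<in> C"
  shows "e \<in> C"
  using unrotate1[OF d S_Ob[OF a]] C_cone a c by metis

text \<open>Dual use of the octahedral axiom, on
  \<open>e \<rightarrow> c \<rightarrow> \<Sigma> s1\<close>: the cone of the composite is a split
  extension of \<open>\<Sigma> s0\<close> by \<open>\<Sigma> a\<close>, and rotating back presents
  \<open>e\<close> by two objects of \<open>S\<close>.\<close>

lemma C_ext_S:
  assumes d: "dist_triangle T a e c f g h" and a: "a \<in> S" and c: "c \<in> C"
  shows "e \<in> C"
proof -
  obtain s0 s1 \<sigma> \<alpha> \<beta> where *: "s0 \<in> S" "s1 \<in> S" "dist_triangle T s1 s0 c \<sigma> \<alpha> \<beta>" using c by (rule C_E)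
  note h = dist_hom[OF *(3)] dist_hom[OF d]
  note d1 = rotate[OF rotate[OF *(3)]]
  have "\<guillemotleft>\<beta> \<cdot> g : e \<rightarrow> \<Sigma> s1\<guillemotright>" using h by (auto simp: in_hom_iff)
  then obtain b' l l' where d': "dist_triangle T e (\<Sigma> s1) b' (\<beta> \<cdot> g) l l'" using TR1_cone by blast
  obtain p q where o: "dist_triangle T (\<Sigma> a) b' (\<Sigma> s0) p q (shift_mor T h \<cdot> neg_mor (shift_mor T \<alpha>))"
    using TR4[OF rotate[OF d] d1 d'] by blast
  have "shift_mor T h \<cdot> neg_mor (shift_mor T \<alpha>) = zero_mor T (\<Sigma> s0) (\<Sigma> (\<Sigma> a))"
    using dist_hom(3)[OF o] S_ext_shift a * by blast
  from split_triangle[OF o this] have "is_dsum T b' [\<Sigma> a, \<Sigma> s0]" .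
  then obtain w u v where w: "w \<in> S" "\<guillemotleft>u : b' \<rightarrow> \<Sigma> w\<guillemotright>" "\<guillemotleft>v : \<Sigma> w \<rightarrow> b'\<guillemotright>" "v \<cdot> u = Id T b'" "u \<cdot> v = Id T (\<Sigma> w)"
    using shift_S_dsum[OF a *(1)] by blast
  obtain m n where "dist_triangle T s1 w e m n (\<beta> \<cdot> g)"
    using unrotate[OF d' refl S_Ob[OF *(2)] S_Ob[OF w(1)] w(2-5)] .
  then show ?thesis using C_I2 * w by blast
qed

text \<open>The presentation \<open>s0 \<rightarrow> c'\<close> lifts to \<open>e\<close>. By the
  octahedral axiom the cone \<open>z\<close> of the lift is an extension of
  \<open>\<Sigma> s1\<close> by \<open>c\<close>, and \<open>e\<close> is an extension of
  \<open>z\<close> by \<open>s0\<close>, so the two one-sided cases apply.\<close>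

lemma C_ext:
  assumes d: "dist_triangle T c e c' f g h" and c: "c \<in> C" "c' \<in> C"
  shows "e \<in> C"
proof -
  obtain s0 s1 \<sigma> \<alpha> \<beta> where *: "s0 \<in> S" "s1 \<in> S" "dist_triangle T s1 s0 c' \<sigma> \<alpha> \<beta>" using c(2) by (rule C_E)
  obtain r where r: "\<guillemotleft>r : s0 \<rightarrow> e\<guillemotright>" "\<alpha> = g \<cdot> r"
    using lift[OF d c(1) *(1) dist_hom(2)[OF *(3)]] .
  obtain z m n where z: "dist_triangle T s0 e z r m n" using TR1_cone[OF r(1)] by blast
  obtain p q x where o: "dist_triangle T z (\<Sigma> s1) (\<Sigma> c) p q x"
    using TR4[OF z rotate[OF d]] rotate[OF *(3)] unfolding r(2) by blast
  obtain y where "dist_triangle T c z (\<Sigma> s1) y p q" using unrotate1[OF o C_Ob[OF c(1)]] .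
  then have "z \<in> C" using C_ext_shift_S * c by blast
  then show ?thesis using C_ext_S[OF z *(1)] by blast
qed

text \<open>The point is that the cone \<open>w\<close> of \<open>p \<cdot> \<alpha>\<close> lies in
  \<open>\<Sigma> S\<close> up to isomorphism. Maps of triangles in both directions give
  \<open>\<gamma>\<close> and \<open>\<mu>\<close> with \<open>\<gamma> \<cdot> \<mu>\<close> equal
  to the identity up to a morphism through \<open>\<Sigma> s0\<close>; the identity of
  \<open>w\<close> is then a sum of morphisms through \<open>\<Sigma> s1\<close> and through
  \<open>\<Sigma> s0\<close>.\<close>

lemma C_retract:
  assumes c: "c \<in> C" and i: "\<guillemotleft>i : c' \<rightarrow> c\<guillemotright>" and p: "\<guillemotleft>p : c \<rightarrow> c'\<guillemotright>" and pi: "p \<cdot> i = Id T c'"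
  shows "c' \<in> C"
proof -
  obtain s0 s1 \<sigma> \<alpha> \<beta> where *: "s0 \<in> S" "s1 \<in> S" "dist_triangle T s1 s0 c \<sigma> \<alpha> \<beta>" using c by (rule C_E)
  note h = dist_hom[OF *(3)]
  have "\<guillemotleft>p \<cdot> \<alpha> : s0 \<rightarrow> c'\<guillemotright>" using h p by (auto simp: in_hom_iff)
  then obtain w l m where d: "dist_triangle T s0 c' w (p \<cdot> \<alpha>) l m" using TR1_cone by blast
  note h' = dist_hom[OF d]
  have Id: "\<guillemotleft>Id T s0 : s0 \<rightarrow> s0\<guillemotright>" "p \<cdot> \<alpha> = p \<cdot> \<alpha> \<cdot> Id T s0" using h p by (auto simp: in_hom_iff)
  obtain \<gamma> where \<gamma>: "\<guillemotleft>\<gamma> : \<Sigma> s1 \<rightarrow> w\<guillemotright>" "\<gamma> \<cdot> \<beta> = l \<cdot> p"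
    using TR3[OF rotate[OF *(3)] d Id(1) p Id(2)] by blast
  \<comment> \<open>The idempotent \<open>i \<cdot> p\<close> lifts to an endomorphism
    \<open>\<theta>\<close> of \<open>s0\<close>, not idempotent in general, which is the first
    component of the map of triangles back to the presentation of \<open>c\<close>.\<close>
  have "\<guillemotleft>i \<cdot> (p \<cdot> \<alpha>) : s0 \<rightarrow> c\<guillemotright>" using h p i by (auto simp: in_hom_iff)
  then obtain \<theta> where \<theta>: "\<guillemotleft>\<theta> : s0 \<rightarrow> s0\<guillemotright>" "i \<cdot> (p \<cdot> \<alpha>) = \<alpha> \<cdot> \<theta>"
    using lift[OF *(3) S_C[OF *(2)] *(1)] by blast
  obtain \<mu> where \<mu>: "\<guillemotleft>\<mu> : w \<rightarrow> \<Sigma> s1\<guillemotright>" "\<mu> \<cdot> l = \<beta> \<cdot> i"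
    using TR3[OF d rotate[OF *(3)] \<theta>(1) i \<theta>(2)] by blast
  have "\<gamma> \<cdot> (\<mu> \<cdot> l) = l"
  proof -
    have "\<gamma> \<cdot> (\<mu> \<cdot> l) = (\<gamma> \<cdot> \<beta>) \<cdot> i" unfolding \<mu>(2) using h i \<gamma>(1) by (simp add: in_hom_iff)
    also have "\<dots> = l \<cdot> (p \<cdot> i)" unfolding \<gamma>(2) using p i h' by (simp add: in_hom_iff)
    finally show ?thesis using pi h' by (simp add: in_hom_iff)
  qed
  then have "(Id T w \<boxplus> neg_mor (\<gamma> \<cdot> \<mu>)) \<cdot> l = zero_mor T c' w"
    using h' \<gamma>(1) \<mu>(1) by (auto simp: in_hom_iff)
  then obtain \<nu> where \<nu>: "\<guillemotleft>\<nu> : \<Sigma> s0 \<rightarrow> w\<guillemotright>" "Id T w \<boxplus> neg_mor (\<gamma> \<cdot> \<mu>) = \<nu> \<cdot> m"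
    using exact_contra2[OF d, of "Id T w \<boxplus> neg_mor (\<gamma> \<cdot> \<mu>)" w] h' \<gamma>(1) \<mu>(1) by (auto simp: in_hom_iff)
  have "Id T w = \<gamma> \<cdot> \<mu> \<boxplus> \<nu> \<cdot> m"
    by (rule diff_eq) (use h' \<gamma>(1) \<mu>(1) \<nu> in \<open>auto simp: in_hom_iff\<close>)
  then obtain w' u v where w: "w' \<in> S" "\<guillemotleft>u : w \<rightarrow> \<Sigma> w'\<guillemotright>" "\<guillemotleft>v : \<Sigma> w' \<rightarrow> w\<guillemotright>" "v \<cdot> u = Id T w" "u \<cdot> v = Id T (\<Sigma> w')"
    using shift_S[OF *(2) *(1) \<mu>(1) \<gamma>(1) h'(3) \<nu>(1)] by metis
  show ?thesis using C_I[OF *(1) w(1) dist_iso[OF d w(2-5)]] .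
qed

text \<open>The sum is compared with the extension of \<open>c'\<close> by \<open>c\<close> of class
  zero, which lies in \<open>C\<close>; matching injections and projections exhibit \<open>p\<close>
  as a retract of it.\<close>

lemma C_pair:
  assumes "is_dsum T p [c, c']" "c \<in> C" "c' \<in> C"
  shows "p \<in> C"
proof -
  have "\<guillemotleft>zero_mor T c' (\<Sigma> c) : c' \<rightarrow> \<Sigma> c\<guillemotright>" using assms C_Ob by (auto simp: in_hom_iff)
  then obtain b f g where b: "dist_triangle T c b c' f g (zero_mor T c' (\<Sigma> c))"
    using cocone C_Ob assms by metis
  obtain j j' r r' where 1: "\<guillemotleft>j : c \<rightarrow> b\<guillemotright>" "\<guillemotleft>j' : c' \<rightarrow> b\<guillemotright>" "\<guillemotleft>r : b \<rightarrow> c\<guillemotright>" "\<guillemotleft>r' : b \<rightarrow> c'\<guillemotright>"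
    "r \<cdot> j = Id T c" "r' \<cdot> j' = Id T c'" "r' \<cdot> j = zero_mor T c c'" "r \<cdot> j' = zero_mor T c' c"
    using is_dsum_pairE[OF split_triangle[OF b refl]] .
  obtain i i' q q' where 2: "\<guillemotleft>i : c \<rightarrow> p\<guillemotright>" "\<guillemotleft>i' : c' \<rightarrow> p\<guillemotright>" "\<guillemotleft>q : p \<rightarrow> c\<guillemotright>" "\<guillemotleft>q' : p \<rightarrow> c'\<guillemotright>"
    and eq: "i \<cdot> q \<boxplus> i' \<cdot> q' = Id T p"
    using is_dsum_pairE[OF assms(1)] .
  have "(i \<cdot> r \<boxplus> i' \<cdot> r') \<cdot> (j \<cdot> q \<boxplus> j' \<cdot> q') = Id T p"
    using 1(1-4) 2 by (simp add: in_hom_iff 1(5-8)[THEN reassoc] eq)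
  moreover have "\<guillemotleft>j \<cdot> q \<boxplus> j' \<cdot> q' : p \<rightarrow> b\<guillemotright>" "\<guillemotleft>i \<cdot> r \<boxplus> i' \<cdot> r' : b \<rightarrow> p\<guillemotright>"
    using 1(1-4) 2 by (auto simp: in_hom_iff)
  moreover have "b \<in> C" using C_ext b assms by blast
  ultimately show ?thesis using C_retract by blast
qed

text \<open>Since \<open>T(s0, \<Sigma> t) = 0\<close>, every class in
  \<open>T(x, \<Sigma> t)\<close> has the form \<open>shift_mor T u \<cdot> \<beta>\<close> with
  \<open>u : s1 \<rightarrow> t\<close>, and such a class is the obstruction to extending
  \<open>u\<close> along \<open>\<sigma>\<close>.\<close>

lemma ext_zero_iff:
  assumes d: "dist_triangle T s1 s0 x \<sigma> \<alpha> \<beta>" and S: "s0 \<in> S" "s1 \<in> S" and t: "t \<in> C"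
  shows "ext_zero x t \<longleftrightarrow> (\<forall>u. \<guillemotleft>u : s1 \<rightarrow> t\<guillemotright> \<longrightarrow> (\<exists>w. \<guillemotleft>w : s0 \<rightarrow> t\<guillemotright> \<and> u = w \<cdot> \<sigma>))"
proof
  note h = dist_hom[OF d]
  assume ext: "ext_zero x t"
  show "\<forall>u. \<guillemotleft>u : s1 \<rightarrow> t\<guillemotright> \<longrightarrow> (\<exists>w. \<guillemotleft>w : s0 \<rightarrow> t\<guillemotright> \<and> u = w \<cdot> \<sigma>)"
  proof (intro allI impI)
    fix u assume u: "\<guillemotleft>u : s1 \<rightarrow> t\<guillemotright>"
    have "\<guillemotleft>shift_mor T u \<cdot> \<beta> : x \<rightarrow> \<Sigma> t\<guillemotright>" using h u by (auto simp: in_hom_iff)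
    then have "shift_mor T u \<cdot> \<beta> = zero_mor T x (\<Sigma> t)" by (rule ext_zeroD[OF ext])
    then show "\<exists>w. \<guillemotleft>w : s0 \<rightarrow> t\<guillemotright> \<and> u = w \<cdot> \<sigma>" using exact_contra3[OF d u] by blast
  qed
next
  note h = dist_hom[OF d]
  assume ext: "\<forall>u. \<guillemotleft>u : s1 \<rightarrow> t\<guillemotright> \<longrightarrow> (\<exists>w. \<guillemotleft>w : s0 \<rightarrow> t\<guillemotright> \<and> u = w \<cdot> \<sigma>)"
  show "ext_zero x t"
    unfolding ext_zero_def
  proof (intro allI impI)
    fix \<delta> assume \<delta>: "\<guillemotleft>\<delta> : x \<rightarrow> \<Sigma> t\<guillemotright>"
    have "\<guillemotleft>\<delta> \<cdot> \<alpha> : s0 \<rightarrow> \<Sigma> t\<guillemotright>" using h \<delta> by (auto simp: in_hom_iff)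
    then have "\<delta> \<cdot> \<alpha> = zero_mor T s0 (\<Sigma> t)" by (rule ext_zeroD[OF ext_zero_S[OF S(1) t]])
    then obtain \<epsilon> where \<epsilon>: "\<guillemotleft>\<epsilon> : \<Sigma> s1 \<rightarrow> \<Sigma> t\<guillemotright>" "\<delta> = \<epsilon> \<cdot> \<beta>" using exact_contra2[OF d \<delta>] by blast
    obtain u where u: "\<guillemotleft>u : s1 \<rightarrow> t\<guillemotright>" "\<epsilon> = shift_mor T u" using shift_full[OF \<epsilon>(1) S_Ob[OF S(2)] C_Ob[OF t]] .
    obtain w where w: "\<guillemotleft>w : s0 \<rightarrow> t\<guillemotright>" "u = w \<cdot> \<sigma>" using ext u by blast
    have "\<delta> = shift_mor T w \<cdot> (shift_mor T \<sigma> \<cdot> \<beta>)" using \<epsilon>(2) u(2) w h by (simp add: in_hom_iff)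
    then show "\<delta> = zero_mor T x (\<Sigma> t)" using dist_zero(3)[OF d] w h by (simp add: in_hom_iff)
  qed
qed

end

section \<open>Noetherian modules\<close>

context module
begin

lemma submodule_Inter:
  assumes "\<And>N. N \<in> F \<Longrightarrow> submodule N R M" "F \<noteq> {}"
  shows "submodule (\<Inter>F) R M"
proof (rule submoduleI)
  obtain N where "N \<in> F" using assms(2) by blast
  then show "\<Inter>F \<subseteq> carrier M" using submoduleE(1)[OF assms(1)] by blast
  have "\<zero>\<^bsub>M\<^esub> \<in> N" if "N \<in> F" for N
    using submodule.axioms(1)[OF assms(1)[OF that]] subgroup.one_closed by fastforce
  then show "\<zero>\<^bsub>M\<^esub> \<in> \<Inter>F" by blast
next
  fix x assume x: "x \<in> \<Inter>F"
  then show "\<ominus>\<^bsub>M\<^esub> x \<in> \<Inter>F" using submoduleE(3)[OF assms(1)] by auto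
  fix y assume "y \<in> \<Inter>F"
  then show "x \<oplus>\<^bsub>M\<^esub> y \<in> \<Inter>F" using submoduleE(5)[OF assms(1)] x by auto
next
  fix r x assume "r \<in> carrier R" "x \<in> \<Inter>F"
  then show "r \<odot>\<^bsub>M\<^esub> x \<in> \<Inter>F" using submoduleE(4)[OF assms(1)] by auto
qed

lemma submodule_carrier: "submodule (carrier M) R M"
  by (rule submoduleI) auto

lemma submodule_zero: "submodule N R M \<Longrightarrow> \<zero>\<^bsub>M\<^esub> \<in> N"
  using submodule.axioms(1) subgroup.one_closed by fastforce

text \<open>In the application \<open>H\<close> is the span of the other generators. The part of
  \<open>N\<close> in the span of \<open>b\<close> and \<open>H\<close>, taken modulo
  \<open>H\<close>, is described by its ideal of coefficients of \<open>b\<close>, in the manner of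
  leading coefficients.\<close>

lemma coefficient_ideal:
  assumes N: "submodule N R M" and H: "submodule H R M" and b: "b \<in> carrier M"
  shows "ideal {r \<in> carrier R. \<exists>m\<in>H. r \<odot>\<^bsub>M\<^esub> b \<oplus>\<^bsub>M\<^esub> m \<in> N} R" (is "ideal ?I R")
proof (rule idealI)
  note E = submoduleE[OF N] and EH = submoduleE[OF H]
  show "ring R" by (rule R.ring_axioms)
  show "subgroup ?I (add_monoid R)"
  proof (rule group.subgroupI)
    show "Group.group (add_monoid R)" by (rule R.a_group)
    show "?I \<subseteq> carrier (add_monoid R)" by auto
    have "\<zero> \<in> ?I" using b submodule_zero[OF N] submodule_zero[OF H] by (auto intro!: bexI[of _ "\<zero>\<^bsub>M\<^esub>"])
    then show "?I \<noteq> {}" by blast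
  next
    fix r assume "r \<in> ?I"
    then obtain m where r: "r \<in> carrier R" "m \<in> H" "r \<odot>\<^bsub>M\<^esub> b \<oplus>\<^bsub>M\<^esub> m \<in> N" by blast
    then have m: "m \<in> carrier M" using EH(1) by blast
    have "(\<ominus> r) \<odot>\<^bsub>M\<^esub> b \<oplus>\<^bsub>M\<^esub> (\<ominus>\<^bsub>M\<^esub> m) = \<ominus>\<^bsub>M\<^esub> (r \<odot>\<^bsub>M\<^esub> b \<oplus>\<^bsub>M\<^esub> m)"
      using r m b by (simp add: smult_l_minus M.minus_add)
    then have "(\<ominus> r) \<odot>\<^bsub>M\<^esub> b \<oplus>\<^bsub>M\<^esub> (\<ominus>\<^bsub>M\<^esub> m) \<in> N" using E(3) r by simp
    then show "inv\<^bsub>add_monoid R\<^esub> r \<in> ?I" using r EH(3) by (auto simp flip: a_inv_def)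
  next
    fix r r' assume "r \<in> ?I" "r' \<in> ?I"
    then obtain m m' where r: "r \<in> carrier R" "m \<in> H" "r \<odot>\<^bsub>M\<^esub> b \<oplus>\<^bsub>M\<^esub> m \<in> N"
      and r': "r' \<in> carrier R" "m' \<in> H" "r' \<odot>\<^bsub>M\<^esub> b \<oplus>\<^bsub>M\<^esub> m' \<in> N" by blast
    have m: "m \<in> carrier M" "m' \<in> carrier M" using r r' EH(1) by auto
    have "(r \<oplus> r') \<odot>\<^bsub>M\<^esub> b \<oplus>\<^bsub>M\<^esub> (m \<oplus>\<^bsub>M\<^esub> m') = (r \<odot>\<^bsub>M\<^esub> b \<oplus>\<^bsub>M\<^esub> m) \<oplus>\<^bsub>M\<^esub> (r' \<odot>\<^bsub>M\<^esub> b \<oplus>\<^bsub>M\<^esub> m')"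
      using r r' m b by (simp add: smult_l_distr M.a_ac)
    then have "(r \<oplus> r') \<odot>\<^bsub>M\<^esub> b \<oplus>\<^bsub>M\<^esub> (m \<oplus>\<^bsub>M\<^esub> m') \<in> N" using r r' E(5) by simp
    then show "r \<otimes>\<^bsub>add_monoid R\<^esub> r' \<in> ?I" using r r' EH(5) by auto
  qed
next
  note E = submoduleE[OF N] and EH = submoduleE[OF H]
  fix r x assume "r \<in> ?I" and x: "x \<in> carrier R"
  then obtain m where r: "r \<in> carrier R" "m \<in> H" "r \<odot>\<^bsub>M\<^esub> b \<oplus>\<^bsub>M\<^esub> m \<in> N" by blast
  then have m: "m \<in> carrier M" using EH(1) by blast
  have "(x \<otimes> r) \<odot>\<^bsub>M\<^esub> b \<oplus>\<^bsub>M\<^esub> x \<odot>\<^bsub>M\<^esub> m = x \<odot>\<^bsub>M\<^esub> (r \<odot>\<^bsub>M\<^esub> b \<oplus>\<^bsub>M\<^esub> m)"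
    using r m x b by (simp add: smult_assoc1 smult_r_distr)
  then have "(x \<otimes> r) \<odot>\<^bsub>M\<^esub> b \<oplus>\<^bsub>M\<^esub> x \<odot>\<^bsub>M\<^esub> m \<in> N" using E(4)[OF x r(3)] by simp
  then show *: "x \<otimes> r \<in> ?I" using r x EH(4)[OF x r(2)] by auto
  show "r \<otimes> x \<in> ?I" using * r x R.m_comm by simp
qed

lemma submodule_span_insert:
  assumes H: "submodule H R M" and b: "b \<in> carrier M"
  shows "submodule {r \<odot>\<^bsub>M\<^esub> b \<oplus>\<^bsub>M\<^esub> m | r m. r \<in> carrier R \<and> m \<in> H} R M" (is "submodule ?N R M")
proof (rule submoduleI)
  note EH = submoduleE[OF H]
  show "?N \<subseteq> carrier M" using EH(1) b by auto
  have "\<zero>\<^bsub>M\<^esub> = \<zero> \<odot>\<^bsub>M\<^esub> b \<oplus>\<^bsub>M\<^esub> \<zero>\<^bsub>M\<^esub>" using b by simp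
  then show "\<zero>\<^bsub>M\<^esub> \<in> ?N" using submodule_zero[OF H] by blast
next
  note EH = submoduleE[OF H]
  fix x assume "x \<in> ?N"
  then obtain r m where x: "x = r \<odot>\<^bsub>M\<^esub> b \<oplus>\<^bsub>M\<^esub> m" "r \<in> carrier R" "m \<in> H" by blast
  then have "\<ominus>\<^bsub>M\<^esub> x = (\<ominus> r) \<odot>\<^bsub>M\<^esub> b \<oplus>\<^bsub>M\<^esub> (\<ominus>\<^bsub>M\<^esub> m)"
    using EH(1) b by (auto simp: smult_l_minus M.minus_add)
  then show "\<ominus>\<^bsub>M\<^esub> x \<in> ?N" using x EH(3)[OF x(3)] by blast
  fix y assume "y \<in> ?N"
  then obtain r' m' where y: "y = r' \<odot>\<^bsub>M\<^esub> b \<oplus>\<^bsub>M\<^esub> m'" "r' \<in> carrier R" "m' \<in> H" by blast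
  have "m \<in> carrier M" "m' \<in> carrier M" using x y EH(1) by auto
  then have "x \<oplus>\<^bsub>M\<^esub> y = (r \<oplus> r') \<odot>\<^bsub>M\<^esub> b \<oplus>\<^bsub>M\<^esub> (m \<oplus>\<^bsub>M\<^esub> m')"
    using x y b by (simp add: smult_l_distr M.a_ac)
  moreover have "r \<oplus> r' \<in> carrier R" using x y by simp
  ultimately show "x \<oplus>\<^bsub>M\<^esub> y \<in> ?N" using EH(5)[OF x(3) y(3)] by blast
next
  note EH = submoduleE[OF H]
  fix a x assume a: "a \<in> carrier R" and "x \<in> ?N"
  then obtain r m where x: "x = r \<odot>\<^bsub>M\<^esub> b \<oplus>\<^bsub>M\<^esub> m" "r \<in> carrier R" "m \<in> H" by blast
  have "m \<in> carrier M" using x EH(1) by blast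
  then have "a \<odot>\<^bsub>M\<^esub> x = (a \<otimes> r) \<odot>\<^bsub>M\<^esub> b \<oplus>\<^bsub>M\<^esub> a \<odot>\<^bsub>M\<^esub> m" using x a b by (simp add: smult_assoc1 smult_r_distr)
  moreover have "a \<otimes> r \<in> carrier R" using x a by simp
  ultimately show "a \<odot>\<^bsub>M\<^esub> x \<in> ?N" using EH(4)[OF a x(3)] by blast
qed

text \<open>Generation is phrased without linear combinations: in the applications one only has to test
  whether a given submodule contains the generators.\<close>

definition generates :: "'c set \<Rightarrow> 'c set \<Rightarrow> bool"
  where "generates G N \<longleftrightarrow> (\<forall>N'. submodule N' R M \<and> G \<subseteq> N' \<longrightarrow> N \<subseteq> N')"

text \<open>\<open>generates B N\<close> asks only that \<open>N\<close> lie in the span of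
  \<open>B\<close>. Induction on \<open>B\<close>: the intersection of \<open>N\<close> with the
  span \<open>H\<close> of the smaller set is finitely generated by induction, and finitely many
  elements of \<open>N\<close> realise generators of the coefficient ideal of
  \<open>b\<close>.\<close>

lemma noetherian_generates:
  assumes noeth: "noetherian_ring R" and "finite B" "B \<subseteq> carrier M" "submodule N R M" "generates B N"
  shows "\<exists>G. finite G \<and> G \<subseteq> N \<and> generates G N"
  using assms(2-)
proof (induction B arbitrary: N)
  case empty
  then show ?case by (intro exI[of _ "{}"]) simp
next
  case (insert b B)
  define H where "H = \<Inter>{N'. submodule N' R M \<and> B \<subseteq> N'}"
  have H: "submodule H R M" unfolding H_def
    by (rule submodule_Inter) (use submodule_carrier insert in auto)
  have BH: "B \<subseteq> H" by (auto simp: H_def)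
  have b: "b \<in> carrier M" using insert by simp
  note EH = submoduleE[OF H] and EN = submoduleE[OF insert(5)]
  let ?L = "{r \<odot>\<^bsub>M\<^esub> b \<oplus>\<^bsub>M\<^esub> m | r m. r \<in> carrier R \<and> m \<in> H}"
  have "b \<in> ?L"
    using b submodule_zero[OF H] by (auto intro!: exI[of _ \<one>] exI[of _ "\<zero>\<^bsub>M\<^esub>"])
  moreover have "m \<in> ?L" if "m \<in> H" for m
    using b that EH(1) by (auto intro!: exI[of _ \<zero>] exI[of _ m])
  ultimately have NL: "N \<subseteq> ?L"
    using insert(6) submodule_span_insert[OF H b] BH unfolding generates_def by blast
  let ?I = "{r \<in> carrier R. \<exists>m\<in>H. r \<odot>\<^bsub>M\<^esub> b \<oplus>\<^bsub>M\<^esub> m \<in> N}"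
  have I: "ideal ?I R" by (rule coefficient_ideal[OF insert(5) H b])
  obtain A where A: "A \<subseteq> carrier R" "finite A" "?I = Idl A"
    using noetherian_ring.finetely_gen[OF noeth I] by blast
  have "A \<subseteq> ?I" unfolding A(3) by (rule R.genideal_self[OF A(1)])
  then have "\<forall>\<alpha>\<in>A. \<exists>m. m \<in> H \<and> \<alpha> \<odot>\<^bsub>M\<^esub> b \<oplus>\<^bsub>M\<^esub> m \<in> N" by blast
  then obtain m where m: "\<And>\<alpha>. \<alpha> \<in> A \<Longrightarrow> m \<alpha> \<in> H \<and> \<alpha> \<odot>\<^bsub>M\<^esub> b \<oplus>\<^bsub>M\<^esub> m \<alpha> \<in> N" by metis
  have NH: "submodule (N \<inter> H) R M"
    using submodule_Inter[of "{N, H}"] H insert(5) by auto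
  have "generates B (N \<inter> H)" unfolding generates_def H_def by blast
  then obtain G' where G': "finite G'" "G' \<subseteq> N \<inter> H" "generates G' (N \<inter> H)"
    using insert.IH[OF _ NH] insert.prems(1) by blast
  let ?G = "(\<lambda>\<alpha>. \<alpha> \<odot>\<^bsub>M\<^esub> b \<oplus>\<^bsub>M\<^esub> m \<alpha>) ` A \<union> G'"
  have "generates ?G N"
    unfolding generates_def
  proof (intro allI impI subsetI)
    fix N' n assume "submodule N' R M \<and> ?G \<subseteq> N'" and n: "n \<in> N"
    then have N': "submodule N' R M" and G: "?G \<subseteq> N'" by auto
    note E' = submoduleE[OF N']
    have NN': "submodule (N' \<inter> N) R M"
      using submodule_Inter[of "{N', N}"] N' insert(5) by auto
    \<comment> \<open>The coefficients realised by elements of both \<open>N'\<close> and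
      \<open>N\<close>. They again form an ideal containing \<open>A\<close>, so every coefficient
      that occurs in \<open>N\<close> occurs here.\<close>
    let ?J = "{r \<in> carrier R. \<exists>m\<in>H. r \<odot>\<^bsub>M\<^esub> b \<oplus>\<^bsub>M\<^esub> m \<in> N' \<inter> N}"
    have "ideal ?J R" by (rule coefficient_ideal[OF NN' H b])
    moreover have "A \<subseteq> ?J" using m G A(1) by blast
    ultimately have IJ: "?I \<subseteq> ?J" unfolding A(3) by (rule R.genideal_minimal)
    obtain r l where r: "n = r \<odot>\<^bsub>M\<^esub> b \<oplus>\<^bsub>M\<^esub> l" "r \<in> carrier R" "l \<in> H" using NL n by blast
    then have "r \<in> ?I" using n by blast
    then obtain l' where l': "l' \<in> H" "r \<odot>\<^bsub>M\<^esub> b \<oplus>\<^bsub>M\<^esub> l' \<in> N'" "r \<odot>\<^bsub>M\<^esub> b \<oplus>\<^bsub>M\<^esub> l' \<in> N" using IJ by blast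
    have c: "l \<in> carrier M" "l' \<in> carrier M" "r \<odot>\<^bsub>M\<^esub> b \<in> carrier M" using r l' EH(1) b by auto
    \<comment> \<open>The terms in \<open>b\<close> cancel, so the difference lies in
      \<open>H\<close>; lying in \<open>N\<close> too, it is in the span of
      \<open>G'\<close>.\<close>
    have "n \<oplus>\<^bsub>M\<^esub> \<ominus>\<^bsub>M\<^esub> (r \<odot>\<^bsub>M\<^esub> b \<oplus>\<^bsub>M\<^esub> l') = l \<oplus>\<^bsub>M\<^esub> \<ominus>\<^bsub>M\<^esub> l' \<oplus>\<^bsub>M\<^esub> (r \<odot>\<^bsub>M\<^esub> b \<oplus>\<^bsub>M\<^esub> \<ominus>\<^bsub>M\<^esub> (r \<odot>\<^bsub>M\<^esub> b))"
      using c unfolding r(1) by (simp add: M.minus_add M.a_ac del: M.r_neg)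
    also have "\<dots> = l \<oplus>\<^bsub>M\<^esub> \<ominus>\<^bsub>M\<^esub> l'" using c by (simp add: M.r_neg)
    finally have eq: "n \<oplus>\<^bsub>M\<^esub> \<ominus>\<^bsub>M\<^esub> (r \<odot>\<^bsub>M\<^esub> b \<oplus>\<^bsub>M\<^esub> l') = l \<oplus>\<^bsub>M\<^esub> \<ominus>\<^bsub>M\<^esub> l'" .
    have "n \<oplus>\<^bsub>M\<^esub> \<ominus>\<^bsub>M\<^esub> (r \<odot>\<^bsub>M\<^esub> b \<oplus>\<^bsub>M\<^esub> l') \<in> N" using EN(3,5) n l'(3) by blast
    moreover have "l \<oplus>\<^bsub>M\<^esub> \<ominus>\<^bsub>M\<^esub> l' \<in> H" using EH(3,5) r l' by blast
    ultimately have "n \<oplus>\<^bsub>M\<^esub> \<ominus>\<^bsub>M\<^esub> (r \<odot>\<^bsub>M\<^esub> b \<oplus>\<^bsub>M\<^esub> l') \<in> N \<inter> H" using eq by simp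
    then have "n \<oplus>\<^bsub>M\<^esub> \<ominus>\<^bsub>M\<^esub> (r \<odot>\<^bsub>M\<^esub> b \<oplus>\<^bsub>M\<^esub> l') \<in> N'"
      using G'(3) N' G unfolding generates_def by blast
    then have "n \<oplus>\<^bsub>M\<^esub> \<ominus>\<^bsub>M\<^esub> (r \<odot>\<^bsub>M\<^esub> b \<oplus>\<^bsub>M\<^esub> l') \<oplus>\<^bsub>M\<^esub> (r \<odot>\<^bsub>M\<^esub> b \<oplus>\<^bsub>M\<^esub> l') \<in> N'" using E'(5) l'(2) by blast
    moreover have "n \<in> carrier M" using n EN(1) by blast
    ultimately show "n \<in> N'" using c by (simp add: M.a_assoc M.l_neg)
  qed
  moreover have "finite ?G" "?G \<subseteq> N" using A G' m by auto
  ultimately show ?case by blast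
qed

text \<open>Sums over a generating set occur only here, in turning \<open>fin_gen_module\<close>
  into the submodule test of \<open>generates\<close>.\<close>

lemma noetherian_submodule:
  assumes "noetherian_ring R" "fin_gen_module R M" and N: "submodule N R M"
  shows "\<exists>G. finite G \<and> G \<subseteq> N \<and> generates G N"
proof -
  obtain B where B: "finite B" "B \<subseteq> carrier M"
    "\<forall>x \<in> carrier M. \<exists>c \<in> B \<rightarrow> carrier R. x = (\<Oplus>\<^bsub>M\<^esub>b\<in>B. c b \<odot>\<^bsub>M\<^esub> b)"
    using assms(2) unfolding fin_gen_module_def by (elim exE conjE) (rule that)
  have gen: "carrier M \<subseteq> N'" if N': "submodule N' R M" and "B \<subseteq> N'" for N'
  proof
    fix x assume "x \<in> carrier M"
    from bspec[OF B(3) this] obtain c where c: "c \<in> B \<rightarrow> carrier R" "x = (\<Oplus>\<^bsub>M\<^esub>b\<in>B. c b \<odot>\<^bsub>M\<^esub> b)" ..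
    note E = submoduleE[OF N']
    have cM: "c b \<odot>\<^bsub>M\<^esub> b \<in> carrier M" if "b \<in> B" for b by (rule smult_closed[OF Pi_mem[OF c(1) that] subsetD[OF B(2) that]])
    have "(\<Oplus>\<^bsub>M\<^esub>b\<in>B'. c b \<odot>\<^bsub>M\<^esub> b) \<in> N'" if "finite B'" "B' \<subseteq> B" for B'
      using that
    proof (induction B')
      case empty
      then show ?case using submodule_zero[OF N'] by simp
    next
      case (insert b B')
      have "(\<Oplus>\<^bsub>M\<^esub>b\<in>insert b B'. c b \<odot>\<^bsub>M\<^esub> b) = c b \<odot>\<^bsub>M\<^esub> b \<oplus>\<^bsub>M\<^esub> (\<Oplus>\<^bsub>M\<^esub>b\<in>B'. c b \<odot>\<^bsub>M\<^esub> b)"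
        by (rule M.finsum_insert) (use insert cM in auto)
      moreover have "c b \<odot>\<^bsub>M\<^esub> b \<in> N'"
        using insert(4) \<open>B \<subseteq> N'\<close> by (intro E(4) Pi_mem[OF c(1)]) auto
      ultimately show ?case using insert E(5) by auto
    qed
    from this[OF B(1) subset_refl] show "x \<in> N'" unfolding c(2) .
  qed
  have gB: "generates B N"
    unfolding generates_def using order_trans[OF submoduleE(1)[OF N] gen] by simp
  show ?thesis by (rule noetherian_generates[OF assms(1) B(1,2) N gB])
qed

end

section \<open>Weak kernels\<close>

locale two_term_noetherian = two_term k T s S C
  for k :: "('k, 'r) ring_scheme" and T :: "('k, 'o, 'm, 'z) tricat_scheme" (structure) and s S C +
  assumes noetherian: "noetherian_ring k" and hom_finite: "hom_finite k T"
begin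

notation plus_mor (infixl \<open>\<boxplus>\<close> 65)

text \<open>Right submodules of \<open>T(a, b)\<close> over the endomorphism ring of
  \<open>a\<close>. Negatives and scalars are not listed since they arise by composing with
  multiples of the identity.\<close>

definition right_closed :: "'o \<Rightarrow> 'o \<Rightarrow> 'm set \<Rightarrow> bool"
  where "right_closed a b N \<longleftrightarrow> a \<in> Ob T \<and> b \<in> Ob T \<and> (\<forall>x\<in>N. \<guillemotleft>x : a \<rightarrow> b\<guillemotright>) \<and> zero_mor T a b \<in> N \<and>
    (\<forall>x\<in>N. \<forall>y\<in>N. x \<boxplus> y \<in> N) \<and> (\<forall>x\<in>N. \<forall>e. \<guillemotleft>e : a \<rightarrow> a\<guillemotright> \<longrightarrow> x \<cdot> e \<in> N)"

lemma right_closed_submodule: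
  assumes "right_closed a b N"
  shows "submodule N k (Hom T a b)"
proof -
  have ab: "a \<in> Ob T" "b \<in> Ob T" and N: "\<And>x. x \<in> N \<Longrightarrow> \<guillemotleft>x : a \<rightarrow> b\<guillemotright>"
    and cl: "zero_mor T a b \<in> N" "\<And>x y. x \<in> N \<Longrightarrow> y \<in> N \<Longrightarrow> x \<boxplus> y \<in> N" "\<And>x e. x \<in> N \<Longrightarrow> \<guillemotleft>e : a \<rightarrow> a\<guillemotright> \<Longrightarrow> x \<cdot> e \<in> N"
    using assms unfolding right_closed_def by auto
  interpret module k "Hom T a b" using ab by (rule Hom_module)
  show ?thesis
  proof (rule submoduleI)
    show "N \<subseteq> carrier (Hom T a b)" using N ab by (auto simp: in_hom_iff)
    show "zero_mor T a b \<in> N" by (rule cl)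
  next
    fix x assume x: "x \<in> N"
    note h = N[OF x]
    have "x \<cdot> neg_mor (Id T a) \<in> N" using x cl(3) ab by (auto simp: in_hom_iff)
    then have "neg_mor x \<in> N" using h by (simp add: in_hom_iff)
    then show "\<ominus>\<^bsub>Hom T a b\<^esub> x \<in> N" using h by (simp add: in_hom_iff neg_mor_def)
    fix y assume y: "y \<in> N"
    show "x \<oplus>\<^bsub>Hom T a b\<^esub> y \<in> N" using cl(2)[OF x y] h by (simp add: in_hom_iff plus_mor_def)
  next
    fix r x assume r: "r \<in> carrier k" and x: "x \<in> N"
    note h = N[OF x]
    have "x \<cdot> (r \<odot>\<^bsub>Hom T a a\<^esub> Id T a) \<in> N" using x cl(3) ab r by (auto simp: in_hom_iff)
    then show "r \<odot>\<^bsub>Hom T a b\<^esub> x \<in> N" using h smult_eq[of x r] r by (simp add: in_hom_iff)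
  qed
qed

text \<open>Serves both for \<open>S\<close>, where covers give weak kernels, and for the class
  \<open>Y\<close> of a cotorsion pair, where they give traces.\<close>

definition sum_closed :: "'o set \<Rightarrow> bool"
  where "sum_closed D \<longleftrightarrow> D \<subseteq> Ob T \<and> (\<forall>z. is_zero_object T z \<longrightarrow> z \<in> D) \<and>
    (\<forall>x\<in>D. \<forall>y\<in>D. \<forall>p. is_dsum T p [x, y] \<longrightarrow> p \<in> D)"

text \<open>\<open>\<phi>\<close> stands for the evaluation map from a finite power of
  \<open>a\<close>, described by two properties: every element of \<open>G\<close> factors through
  it, and it is killed by whatever kills \<open>G\<close>. In this form a cover of a finite
  generating set is at once a cover of the whole submodule that it generates.\<close>

definition covers :: "'o \<Rightarrow> 'o \<Rightarrow> 'm set \<Rightarrow> 'o \<Rightarrow> 'm \<Rightarrow> bool"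
  where "covers a b G d \<phi> \<longleftrightarrow> \<guillemotleft>\<phi> : d \<rightarrow> b\<guillemotright> \<and> (\<forall>g\<in>G. \<exists>g'. \<guillemotleft>g' : a \<rightarrow> d\<guillemotright> \<and> g = \<phi> \<cdot> g') \<and>
    (\<forall>t \<psi>. \<guillemotleft>\<psi> : b \<rightarrow> t\<guillemotright> \<and> (\<forall>g\<in>G. \<psi> \<cdot> g = zero_mor T a t) \<longrightarrow> \<psi> \<cdot> \<phi> = zero_mor T d t)"

lemma coversD:
  assumes "covers a b G d \<phi>"
  shows "\<guillemotleft>\<phi> : d \<rightarrow> b\<guillemotright>" "\<And>g. g \<in> G \<Longrightarrow> \<exists>g'. \<guillemotleft>g' : a \<rightarrow> d\<guillemotright> \<and> g = \<phi> \<cdot> g'"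
    "\<And>t \<psi>. \<guillemotleft>\<psi> : b \<rightarrow> t\<guillemotright> \<Longrightarrow> (\<And>g. g \<in> G \<Longrightarrow> \<psi> \<cdot> g = zero_mor T a t) \<Longrightarrow> \<psi> \<cdot> \<phi> = zero_mor T d t"
  using assms unfolding covers_def by auto

lemma finite_cover:
  assumes D: "sum_closed D"
    and a: "a \<in> D" and b: "b \<in> Ob T" and G: "finite G" "\<And>g. g \<in> G \<Longrightarrow> \<guillemotleft>g : a \<rightarrow> b\<guillemotright>"
  shows "\<exists>d\<in>D. \<exists>\<phi>. covers a b G d \<phi>"
  using G
proof (induction G)
  case empty
  obtain z where z: "is_zero_object T z" "z \<in> Ob T" by (rule obtain_zero)
  then show ?case using D b by (intro bexI[of _ z] exI[of _ "zero_mor T z b"]) (auto simp: in_hom_iff sum_closed_def covers_def)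
next
  case (insert g G)
  then obtain d \<phi> where d: "d \<in> D" and cov: "covers a b G d \<phi>" by auto
  note d = d coversD(1)[OF cov] and fac = coversD(2)[OF cov] and kill = coversD(3)[OF cov]
  have g: "\<guillemotleft>g : a \<rightarrow> b\<guillemotright>" using insert by simp
  have "a \<in> Ob T" "d \<in> Ob T" using g d(2) by (simp_all add: in_hom_iff)
  then obtain p where p: "is_dsum T p [a, d]" using dsum_exists[of "[a, d]"] by auto
  obtain i i' q q' where *: "\<guillemotleft>i : a \<rightarrow> p\<guillemotright>" "\<guillemotleft>i' : d \<rightarrow> p\<guillemotright>" "\<guillemotleft>q : p \<rightarrow> a\<guillemotright>" "\<guillemotleft>q' : p \<rightarrow> d\<guillemotright>"
    "q \<cdot> i = Id T a" "q' \<cdot> i' = Id T d" "q' \<cdot> i = zero_mor T a d" "q \<cdot> i' = zero_mor T d a"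
    using is_dsum_pairE[OF p] .
  let ?\<phi> = "g \<cdot> q \<boxplus> \<phi> \<cdot> q'"
  have 1: "g = ?\<phi> \<cdot> i" using *(1-4) g d by (simp add: in_hom_iff *(5-8))
  have 2: "\<exists>x'. \<guillemotleft>x' : a \<rightarrow> p\<guillemotright> \<and> x = ?\<phi> \<cdot> x'" if "x \<in> G" for x
  proof -
    obtain x' where x': "\<guillemotleft>x' : a \<rightarrow> d\<guillemotright>" "x = \<phi> \<cdot> x'" using fac \<open>x \<in> G\<close> by blast
    have "?\<phi> \<cdot> (i' \<cdot> x') = \<phi> \<cdot> x'" using *(1-4) g d x'(1) by (simp add: in_hom_iff *(5-8)[THEN reassoc])
    then show ?thesis using x' * by (intro exI[of _ "i' \<cdot> x'"]) (auto simp: in_hom_iff)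
  qed
  have 3: "\<psi> \<cdot> ?\<phi> = zero_mor T p t" if \<psi>: "\<guillemotleft>\<psi> : b \<rightarrow> t\<guillemotright>" "\<forall>x\<in>insert g G. \<psi> \<cdot> x = zero_mor T a t" for t \<psi>
  proof -
    have "\<psi> \<cdot> \<phi> = zero_mor T d t" "\<psi> \<cdot> g = zero_mor T a t" using kill[OF \<psi>(1)] \<psi>(2) by auto
    note this[THEN reassoc]
    then show ?thesis using \<psi>(1) g d *(3,4) by (simp add: in_hom_iff)
  qed
  have "\<guillemotleft>?\<phi> : p \<rightarrow> b\<guillemotright>" using *(1-4) g d by (auto simp: in_hom_iff)
  moreover have "p \<in> D" using D p a d(1) unfolding sum_closed_def by blast
  moreover have "\<exists>x'. \<guillemotleft>x' : a \<rightarrow> p\<guillemotright> \<and> x = ?\<phi> \<cdot> x'" if "x \<in> insert g G" for x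
    using that 1 2 *(1) by blast
  ultimately show ?case using 3 unfolding covers_def by (intro bexI[of _ p] exI[of _ ?\<phi>] conjI) blast+
qed

text \<open>The morphisms that factor through a cover of a finite generating set form a submodule of
  \<open>T(a, b)\<close>; it contains the generators, hence \<open>N\<close>.\<close>

lemma hom_cover:
  assumes D: "sum_closed D"
    and a: "a \<in> D" and N: "right_closed a b N"
  obtains d \<phi> where "d \<in> D" "covers a b N d \<phi>"
proof -
  have ab: "a \<in> Ob T" "b \<in> Ob T" and NH: "\<And>x. x \<in> N \<Longrightarrow> \<guillemotleft>x : a \<rightarrow> b\<guillemotright>" using N by (auto simp: right_closed_def)
  interpret module k "Hom T a b" using ab by (rule Hom_module)
  obtain G where G: "finite G" "G \<subseteq> N" "generates G N"
    using noetherian_submodule[OF noetherian _ right_closed_submodule[OF N]] hom_finite ab by (auto simp: hom_finite_def)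
  have GH: "\<And>g. g \<in> G \<Longrightarrow> \<guillemotleft>g : a \<rightarrow> b\<guillemotright>" using NH G(2) by blast
  obtain d \<phi> where d: "d \<in> D" and cov: "covers a b G d \<phi>"
    using finite_cover[OF D a ab(2) G(1) GH] by blast
  note d = d coversD(1)[OF cov] and fac = coversD(2)[OF cov] and kill = coversD(3)[OF cov]
  let ?N = "{x. \<exists>x'. \<guillemotleft>x' : a \<rightarrow> d\<guillemotright> \<and> x = \<phi> \<cdot> x'}"
  have "right_closed a b ?N"
    unfolding right_closed_def
  proof (intro conjI ballI allI impI)
    show "zero_mor T a b \<in> ?N" using ab d by (auto simp: in_hom_iff intro!: exI[of _ "zero_mor T a d"])
    fix x assume "x \<in> ?N"
    then obtain x' where x: "\<guillemotleft>x' : a \<rightarrow> d\<guillemotright>" "x = \<phi> \<cdot> x'" by blast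
    show "\<guillemotleft>x : a \<rightarrow> b\<guillemotright>" using x d by (auto simp: in_hom_iff)
    show "x \<cdot> e \<in> ?N" if "\<guillemotleft>e : a \<rightarrow> a\<guillemotright>" for e
      using x d that by (auto simp: in_hom_iff intro!: exI[of _ "x' \<cdot> e"])
    fix y assume "y \<in> ?N"
    then obtain y' where y: "\<guillemotleft>y' : a \<rightarrow> d\<guillemotright>" "y = \<phi> \<cdot> y'" by blast
    show "x \<boxplus> y \<in> ?N" using x y d by (auto simp: in_hom_iff intro!: exI[of _ "x' \<boxplus> y'"])
  qed (use ab in auto)
  then have "submodule ?N k (Hom T a b)" by (rule right_closed_submodule)
  moreover have "G \<subseteq> ?N" using fac by blast
  ultimately have "N \<subseteq> ?N" using G(3) unfolding generates_def by simp
  then have "covers a b N d \<phi>" unfolding covers_def using d(2) kill G(2) by blast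
  then show thesis using that d(1) by blast
qed

text \<open>Factoring through \<open>\<kappa>\<close> is an additive condition, and the identity of
  \<open>a\<close> is a sum of morphisms through \<open>s\<close>, so it suffices to test it on
  morphisms from \<open>s\<close>.\<close>

lemma factor_S:
  assumes a: "a \<in> S" and \<kappa>: "\<guillemotleft>\<kappa> : d \<rightarrow> b\<guillemotright>" and x: "\<guillemotleft>x : a \<rightarrow> b\<guillemotright>"
    and fac: "\<And>e. \<guillemotleft>e : s \<rightarrow> a\<guillemotright> \<Longrightarrow> \<exists>x'. \<guillemotleft>x' : s \<rightarrow> d\<guillemotright> \<and> x \<cdot> e = \<kappa> \<cdot> x'"
  obtains x' where "\<guillemotleft>x' : a \<rightarrow> d\<guillemotright>" "x = \<kappa> \<cdot> x'"
proof -
  have "thru s f \<Longrightarrow> Cod T f = a \<Longrightarrow> \<exists>x'. \<guillemotleft>x' : Dom T f \<rightarrow> d\<guillemotright> \<and> x \<cdot> f = \<kappa> \<cdot> x'" for f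
  proof (induction rule: thru.induct)
    case (thru_zero a' b')
    then show ?case using \<kappa> x by (intro exI[of _ "zero_mor T a' d"]) (auto simp: in_hom_iff)
  next
    case (thru_step f p r)
    have f: "arr f" "Cod T f = a" using thru_arr[OF thru_step(1)] thru_step(2,3,5) by (simp_all add: in_hom_iff)
    obtain x1 where x1: "\<guillemotleft>x1 : Dom T f \<rightarrow> d\<guillemotright>" "x \<cdot> f = \<kappa> \<cdot> x1" using thru_step(4) f by auto
    obtain x2 where x2: "\<guillemotleft>x2 : s \<rightarrow> d\<guillemotright>" "x \<cdot> r = \<kappa> \<cdot> x2" using fac[of r] thru_step(3) f by auto
    have "x \<cdot> (r \<cdot> p \<boxplus> f) = \<kappa> \<cdot> (x2 \<cdot> p \<boxplus> x1)"
      using f thru_step(2,3) x \<kappa> x1 x2(1) by (simp add: in_hom_iff reassoc[OF x2(2)])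
    then show ?case using f thru_step(2,3) x1 x2 \<kappa> by (intro exI[of _ "x2 \<cdot> p \<boxplus> x1"]) (auto simp: in_hom_iff)
  qed
  from this[of "Id T a"] show thesis using that a x by (auto simp: S_iff in_hom_iff)
qed

text \<open>At \<open>s\<close>, the kernel of \<open>F a \<rightarrow> F c\<close> is a submodule
  of the finitely generated module \<open>T(s, a)\<close>; a cover of it is an object of
  \<open>S\<close> that maps onto the kernel functor. Hence the image of \<open>F \<psi>\<close> is
  finitely presented.\<close>

lemma weak_kernel:
  assumes a: "a \<in> S" and \<psi>: "\<guillemotleft>\<psi> : a \<rightarrow> c\<guillemotright>"
  obtains d \<kappa> where "d \<in> S" "\<guillemotleft>\<kappa> : d \<rightarrow> a\<guillemotright>" "\<psi> \<cdot> \<kappa> = zero_mor T d c"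
    "\<And>b x. b \<in> S \<Longrightarrow> \<guillemotleft>x : b \<rightarrow> a\<guillemotright> \<Longrightarrow> \<psi> \<cdot> x = zero_mor T b c \<Longrightarrow> \<exists>x'. \<guillemotleft>x' : b \<rightarrow> d\<guillemotright> \<and> x = \<kappa> \<cdot> x'"
proof -
  let ?N = "{x. \<guillemotleft>x : s \<rightarrow> a\<guillemotright> \<and> \<psi> \<cdot> x = zero_mor T s c}"
  have N: "right_closed s a ?N"
    unfolding right_closed_def
  proof (intro conjI ballI allI impI)
    fix x e assume "x \<in> ?N" and e: "\<guillemotleft>e : s \<rightarrow> s\<guillemotright>"
    then have "\<guillemotleft>x : s \<rightarrow> a\<guillemotright>" "\<psi> \<cdot> x = zero_mor T s c" by auto
    then show "x \<cdot> e \<in> ?N" using e \<psi> reassoc[of \<psi> x _ e] by (auto simp: in_hom_iff)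
  qed (use S_Ob[OF a] s \<psi> in \<open>auto simp: in_hom_iff\<close>)
  have S: "sum_closed S" using S_Ob S_zero S_dsum by (auto simp: sum_closed_def)
  obtain d \<kappa> where d: "d \<in> S" and cov: "covers s a ?N d \<kappa>"
    using hom_cover[OF S s_S N] .
  note d = d coversD(1)[OF cov] and fac = coversD(2)[OF cov] and kill = coversD(3)[OF cov]
  have "\<exists>x'. \<guillemotleft>x' : b \<rightarrow> d\<guillemotright> \<and> x = \<kappa> \<cdot> x'" if b: "b \<in> S" and x: "\<guillemotleft>x : b \<rightarrow> a\<guillemotright>" "\<psi> \<cdot> x = zero_mor T b c" for b x
  proof -
    have "\<exists>x'. \<guillemotleft>x' : s \<rightarrow> d\<guillemotright> \<and> x \<cdot> e = \<kappa> \<cdot> x'" if e: "\<guillemotleft>e : s \<rightarrow> b\<guillemotright>" for e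
      by (rule fac) (use e x \<psi> reassoc[OF x(2), of e] in \<open>auto simp: in_hom_iff\<close>)
    then show ?thesis using factor_S[OF b d(2) x(1)] by metis
  qed
  moreover have "\<psi> \<cdot> \<kappa> = zero_mor T d c" by (rule kill[OF \<psi>]) simp
  ultimately show thesis using that[OF d] by blast
qed

end

section \<open>Cotorsion pairs and the torsion part of an object\<close>

lemma full_sub_simps [simp]:
  "Ob (full_sub T U) = U" "Hom (full_sub T U) = Hom T" "Cmp (full_sub T U) = Cmp T" "Id (full_sub T U) = Id T"
  "Dom (full_sub T U) = Dom T" "Cod (full_sub T U) = Cod T"
  by (simp_all add: full_sub_def)

context two_term
begin

section \<open>Summands in \<open>C\<close> and Ext-orthogonal classes\<close>

lemma in_hom_full_sub: "U \<subseteq> Ob T \<Longrightarrow> \<guillemotleft>f : a \<rightarrow>\<^bsub>full_sub T U\<^esub> b\<guillemotright> \<longleftrightarrow> a \<in> U \<and> b \<in> U \<and> \<guillemotleft>f : a \<rightarrow> b\<guillemotright>"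
  unfolding in_hom_def by auto

lemma C_sub: "C \<subseteq> Ob T" using C_Ob by blast

lemma is_dsum_full_sub: "is_dsum (full_sub T C) p xs \<longleftrightarrow> p \<in> C \<and> set xs \<subseteq> C \<and> is_dsum T p xs"
proof -
  have *: "set xs \<subseteq> C \<Longrightarrow> j < length xs \<Longrightarrow> xs ! j \<in> C" for j by (simp add: subset_code(1))
  show ?thesis
    using C_sub unfolding is_dsum_def in_hom_full_sub[OF C_sub] full_sub_simps
    by (intro iffI; elim conjE exE; intro conjI exI) (auto simp: *)
qed

text \<open>Both summands of \<open>p\<close> are retracts of it and therefore lie in
  \<open>C\<close>, so a summand in \<open>T\<close> is a summand in \<open>C\<close>.\<close>

lemma summand_full_sub:
  assumes "p \<in> C" "\<guillemotleft>i : x \<rightarrow> p\<guillemotright>" "\<guillemotleft>r : p \<rightarrow> x\<guillemotright>" "r \<cdot> i = Id T x"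
  shows "is_summand (full_sub T C) x p"
proof -
  obtain y u v where uv: "\<guillemotleft>u : y \<rightarrow> p\<guillemotright>" "\<guillemotleft>v : p \<rightarrow> y\<guillemotright>" "v \<cdot> u = Id T y" "v \<cdot> i = zero_mor T x y"
    "r \<cdot> u = zero_mor T y x" "i \<cdot> r \<boxplus> u \<cdot> v = Id T p"
    using retract_complement[OF assms(2-4)] .
  have "is_dsum T p [x, y]" unfolding is_dsum_pair_iff using uv assms by blast
  then have "is_dsum (full_sub T C) p [x, y]"
    using C_retract[OF assms] C_retract[OF assms(1) uv(1-3)] assms(1) by (simp add: is_dsum_full_sub)
  then show ?thesis by (auto simp: is_summand_def)
qed

lemma summand_full_subD:
  assumes "is_summand (full_sub T C) x p"
  shows "x \<in> C" "is_summand T x p"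
  using assms by (auto simp: is_summand_def is_dsum_full_sub)

lemma ext_zero_iff_E_ext:
  assumes "x \<in> Ob T" "y \<in> Ob T"
  shows "carrier (E_ext T x y) = {\<zero>\<^bsub>E_ext T x y\<^esub>} \<longleftrightarrow> ext_zero x y"
proof -
  have 1: "carrier (Hom T x (\<Sigma> y)) = {\<delta>. \<guillemotleft>\<delta> : x \<rightarrow> \<Sigma> y\<guillemotright>}" using assms by (auto simp: in_hom_def)
  have 2: "\<guillemotleft>zero_mor T x (\<Sigma> y) : x \<rightarrow> \<Sigma> y\<guillemotright>" using assms by (simp add: in_hom_iff)
  show ?thesis unfolding ext_zero_def E_ext_def 1 using 2 by blast
qed

definition left_ext_perp :: "'o set \<Rightarrow> 'o set"
  where "left_ext_perp Y = {c \<in> C. \<forall>y\<in>Y. ext_zero c y}"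

definition right_ext_perp :: "'o set \<Rightarrow> 'o set"
  where "right_ext_perp X = {c \<in> C. \<forall>x\<in>X. ext_zero x c}"

text \<open>Each class is the Ext-orthogonal of the other: for \<open>c\<close> orthogonal to
  \<open>Y\<close> the triangle \<open>y \<rightarrow> x \<rightarrow> c\<close> splits and
  \<open>c\<close> is a summand of \<open>x\<close>, and dually. Conversely, orthogonal classes are
  automatically closed under sums and summands. A cotorsion pair is thereby determined by either of
  its classes.\<close>

lemma cotorsion_pair_iff:
  "complete_cotorsion_pair T C X Y \<longleftrightarrow> X = left_ext_perp Y \<and> Y = right_ext_perp X \<and>
    (\<forall>c\<in>C. \<exists>x\<in>X. \<exists>y\<in>Y. \<exists>f g h. dist_triangle T c y x f g h) \<and>
    (\<forall>c\<in>C. \<exists>x\<in>X. \<exists>y\<in>Y. \<exists>f g h. dist_triangle T y x c f g h)" (is "?L \<longleftrightarrow> ?R")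
proof
  assume L: ?L
  then have XC: "X \<subseteq> C" and YC: "Y \<subseteq> C" by (auto simp: complete_cotorsion_pair_def additive_summand_closed_def)
  have Xsum: "\<And>x p. p \<in> X \<Longrightarrow> is_summand (full_sub T C) x p \<Longrightarrow> x \<in> X"
    and Ysum: "\<And>x p. p \<in> Y \<Longrightarrow> is_summand (full_sub T C) x p \<Longrightarrow> x \<in> Y"
    using L unfolding complete_cotorsion_pair_def additive_summand_closed_def by blast+
  have E: "ext_zero x y" if "x \<in> X" "y \<in> Y" for x y
    using L that XC YC C_sub by (subst ext_zero_iff_E_ext[symmetric]) (auto simp: complete_cotorsion_pair_def)
  have T1: "\<exists>x\<in>X. \<exists>y\<in>Y. \<exists>f g h. dist_triangle T c y x f g h"
    and T2: "\<exists>x\<in>X. \<exists>y\<in>Y. \<exists>f g h. dist_triangle T y x c f g h" if "c \<in> C" for c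
    using L that unfolding complete_cotorsion_pair_def E_triangle_def by blast+
  have "c \<in> X" if "c \<in> left_ext_perp Y" for c
  proof -
    have c: "c \<in> C" "\<And>y. y \<in> Y \<Longrightarrow> ext_zero c y" using that by (auto simp: left_ext_perp_def)
    obtain x y f g h where d: "x \<in> X" "y \<in> Y" "dist_triangle T y x c f g h" using T2[OF c(1)] by blast
    have "h = zero_mor T c (\<Sigma> y)" using ext_zeroD[OF c(2)[OF d(2)] dist_hom(3)[OF d(3)]] .
    from split_triangle[OF d(3) this] obtain i r where "\<guillemotleft>i : c \<rightarrow> x\<guillemotright>" "\<guillemotleft>r : x \<rightarrow> c\<guillemotright>" "r \<cdot> i = Id T c"
      by (auto elim: is_dsum_pairE)
    then show "c \<in> X" using Xsum[OF d(1) summand_full_sub] d(1) XC by blast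
  qed
  then have X: "X = left_ext_perp Y" using E XC by (auto simp: left_ext_perp_def)
  have "c \<in> Y" if "c \<in> right_ext_perp X" for c
  proof -
    have c: "c \<in> C" "\<And>x. x \<in> X \<Longrightarrow> ext_zero x c" using that by (auto simp: right_ext_perp_def)
    obtain x y f g h where d: "x \<in> X" "y \<in> Y" "dist_triangle T c y x f g h" using T1[OF c(1)] by blast
    have "h = zero_mor T x (\<Sigma> c)" using ext_zeroD[OF c(2)[OF d(1)] dist_hom(3)[OF d(3)]] .
    from split_triangle[OF d(3) this] obtain i r where "\<guillemotleft>i : c \<rightarrow> y\<guillemotright>" "\<guillemotleft>r : y \<rightarrow> c\<guillemotright>" "r \<cdot> i = Id T c"
      by (auto elim: is_dsum_pairE)
    then show "c \<in> Y" using Ysum[OF d(2) summand_full_sub] d(2) YC by blast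
  qed
  then have "Y = right_ext_perp X" using E YC by (auto simp: right_ext_perp_def)
  then show ?R using X T1 T2 by blast
next
  assume R: ?R
  then have X: "X = left_ext_perp Y" and Y: "Y = right_ext_perp X" by blast+
  have XC: "X \<subseteq> C" using X by (auto simp: left_ext_perp_def)
  have YC: "Y \<subseteq> C" using Y by (auto simp: right_ext_perp_def)
  have XI: "c \<in> X" if "c \<in> C" "\<And>y. y \<in> Y \<Longrightarrow> ext_zero c y" for c using that X by (auto simp: left_ext_perp_def)
  have YI: "c \<in> Y" if "c \<in> C" "\<And>x. x \<in> X \<Longrightarrow> ext_zero x c" for c using that Y by (auto simp: right_ext_perp_def)
  have E: "ext_zero x y" if "x \<in> X" "y \<in> Y" for x y using X that by (auto simp: left_ext_perp_def)
  have OX: "x \<in> Ob T" if "x \<in> X" for x using that XC C_sub by blast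
  have OY: "y \<in> Ob T" if "y \<in> Y" for y using that YC C_sub by blast
  have sX: "additive_summand_closed (full_sub T C) X"
    unfolding additive_summand_closed_def
  proof (intro conjI allI impI)
    show "X \<subseteq> Ob (full_sub T C)" using XC by simp
    fix xs p assume xs: "set xs \<subseteq> X \<and> is_dsum (full_sub T C) p xs"
    then have xs: "p \<in> C" "set xs \<subseteq> X" "is_dsum T p xs" by (auto simp: is_dsum_full_sub)
    show "p \<in> X"
      by (rule XI[OF xs(1)], rule ext_zero_dsum_left[OF xs(3)]) (use xs(2) E OY in auto)
  next
    fix x p assume xp: "p \<in> X \<and> is_summand (full_sub T C) x p"
    then have x: "x \<in> C" "is_summand T x p" using summand_full_subD by auto
    obtain i r where ir: "\<guillemotleft>i : x \<rightarrow> p\<guillemotright>" "\<guillemotleft>r : p \<rightarrow> x\<guillemotright>" "r \<cdot> i = Id T x" using x(2) by (rule summand_retract)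
    show "x \<in> X"
      by (rule XI[OF x(1)], rule ext_zero_retract_left[OF E OY ir]) (use xp in auto)
  qed
  have sY: "additive_summand_closed (full_sub T C) Y"
    unfolding additive_summand_closed_def
  proof (intro conjI allI impI)
    show "Y \<subseteq> Ob (full_sub T C)" using YC by simp
    fix xs p assume xs: "set xs \<subseteq> Y \<and> is_dsum (full_sub T C) p xs"
    then have xs: "p \<in> C" "set xs \<subseteq> Y" "is_dsum T p xs" by (auto simp: is_dsum_full_sub)
    show "p \<in> Y"
      by (rule YI[OF xs(1)], rule ext_zero_dsum_right[OF xs(3)]) (use xs(2) E OX in auto)
  next
    fix x p assume xp: "p \<in> Y \<and> is_summand (full_sub T C) x p"
    then have x: "x \<in> C" "is_summand T x p" using summand_full_subD by auto
    obtain i r where ir: "\<guillemotleft>i : x \<rightarrow> p\<guillemotright>" "\<guillemotleft>r : p \<rightarrow> x\<guillemotright>" "r \<cdot> i = Id T x" using x(2) by (rule summand_retract)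
    show "x \<in> Y"
      by (rule YI[OF x(1)], rule ext_zero_retract_right[OF E OX ir]) (use xp in auto)
  qed
  have "carrier (E_ext T x y) = {\<zero>\<^bsub>E_ext T x y\<^esub>}" if "x \<in> X" "y \<in> Y" for x y
    using ext_zero_iff_E_ext[OF OX OY] E that by blast
  then show ?L
    unfolding complete_cotorsion_pair_def E_triangle_def using sX sY R XC YC by blast
qed

text \<open>Morphisms that the restricted Yoneda functor sends to zero.\<close>

definition ghost :: "'m \<Rightarrow> bool"
  where "ghost g \<longleftrightarrow> (\<forall>a\<in>S. \<forall>u. \<guillemotleft>u : a \<rightarrow> Dom T g\<guillemotright> \<longrightarrow> g \<cdot> u = zero_mor T a (Cod T g))"

lemma ghostD: "ghost g \<Longrightarrow> \<guillemotleft>g : c \<rightarrow> d\<guillemotright> \<Longrightarrow> a \<in> S \<Longrightarrow> \<guillemotleft>u : a \<rightarrow> c\<guillemotright> \<Longrightarrow> g \<cdot> u = zero_mor T a d"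
  by (auto simp: ghost_def in_hom_iff)

lemma ghostI: "\<guillemotleft>g : c \<rightarrow> d\<guillemotright> \<Longrightarrow> (\<And>a u. a \<in> S \<Longrightarrow> \<guillemotleft>u : a \<rightarrow> c\<guillemotright> \<Longrightarrow> g \<cdot> u = zero_mor T a d) \<Longrightarrow> ghost g"
  unfolding ghost_def by (metis in_hom_iff)

text \<open>A morphism \<open>s1 \<rightarrow> c\<close> lifts along \<open>g\<close>, extends over
  \<open>s0\<close> inside \<open>y\<close>, and returns along \<open>g\<close>. That
  \<open>g\<close> is onto after applying \<open>F\<close> is enough for this.\<close>

lemma right_ext_perp_quotient:
  assumes X: "X \<subseteq> C" and y: "y \<in> right_ext_perp X" and c: "c \<in> C" and g: "\<guillemotleft>g : y \<rightarrow> c\<guillemotright>"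
    and epi: "\<And>a u. a \<in> S \<Longrightarrow> \<guillemotleft>u : a \<rightarrow> c\<guillemotright> \<Longrightarrow> \<exists>u'. \<guillemotleft>u' : a \<rightarrow> y\<guillemotright> \<and> u = g \<cdot> u'"
  shows "c \<in> right_ext_perp X"
proof -
  have "ext_zero x c" if x: "x \<in> X" for x
  proof -
    obtain s0 s1 \<sigma> \<alpha> \<beta> where *: "s0 \<in> S" "s1 \<in> S" "dist_triangle T s1 s0 x \<sigma> \<alpha> \<beta>" using C_E[OF subsetD[OF X x]] .
    have y: "y \<in> C" "ext_zero x y" using y x by (auto simp: right_ext_perp_def)
    have "\<exists>w. \<guillemotleft>w : s0 \<rightarrow> c\<guillemotright> \<and> u = w \<cdot> \<sigma>" if u: "\<guillemotleft>u : s1 \<rightarrow> c\<guillemotright>" for u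
    proof -
      obtain u' where u': "\<guillemotleft>u' : s1 \<rightarrow> y\<guillemotright>" "u = g \<cdot> u'" using epi[OF *(2) u] by blast
      obtain w where w: "\<guillemotleft>w : s0 \<rightarrow> y\<guillemotright>" "u' = w \<cdot> \<sigma>" using ext_zero_iff[OF *(3,1,2) y(1)] y(2) u'(1) by blast
      show ?thesis using dist_hom[OF *(3)] w u' g by (intro exI[of _ "g \<cdot> w"]) (auto simp: in_hom_iff)
    qed
    then show "ext_zero x c" using ext_zero_iff[OF *(3,1,2) c] by blast
  qed
  then show ?thesis using c by (simp add: right_ext_perp_def)
qed

lemma right_ext_perp_ext:
  assumes "dist_triangle T a b c f g h" "a \<in> right_ext_perp X" "c \<in> right_ext_perp X"
  shows "b \<in> right_ext_perp X"
  using assms C_ext[OF assms(1)] ext_zero_right[OF assms(1)] by (auto simp: right_ext_perp_def)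

text \<open>The image under \<open>F\<close> of \<open>c' \<rightarrow> c \<rightarrow> z\<close> is a short exact sequence.\<close>

definition S_exact :: "'o \<Rightarrow> 'o \<Rightarrow> 'o \<Rightarrow> 'm \<Rightarrow> 'm \<Rightarrow> bool"
  where "S_exact c' c z m \<rho> \<longleftrightarrow> \<guillemotleft>m : c' \<rightarrow> c\<guillemotright> \<and> \<guillemotleft>\<rho> : c \<rightarrow> z\<guillemotright> \<and> (\<forall>a\<in>S.
    (\<forall>v. \<guillemotleft>v : a \<rightarrow> c'\<guillemotright> \<and> m \<cdot> v = zero_mor T a c \<longrightarrow> v = zero_mor T a c') \<and>
    (\<forall>v. \<guillemotleft>v : a \<rightarrow> c\<guillemotright> \<longrightarrow> (\<rho> \<cdot> v = zero_mor T a z \<longleftrightarrow> (\<exists>w. \<guillemotleft>w : a \<rightarrow> c'\<guillemotright> \<and> v = m \<cdot> w))) \<and>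
    (\<forall>v. \<guillemotleft>v : a \<rightarrow> z\<guillemotright> \<longrightarrow> (\<exists>w. \<guillemotleft>w : a \<rightarrow> c\<guillemotright> \<and> v = \<rho> \<cdot> w)))"

end

context two_term_noetherian
begin

text \<open>The trace of \<open>Y\<close> in \<open>c\<close> is the image of \<open>\<psi> : s0 \<rightarrow> c\<close>, where \<open>s0\<close> covers a finite sum of copies
  of the approximation \<open>ys\<close> of \<open>s\<close>.\<close>

lemma torsion_part:
  assumes cot: "complete_cotorsion_pair T C X Y" and c: "c \<in> C"
  obtains c' z m \<rho> where "c' \<in> Y" "z \<in> C" "S_exact c' c z m \<rho>"
    "\<And>y g. y \<in> Y \<Longrightarrow> \<guillemotleft>g : y \<rightarrow> z\<guillemotright> \<Longrightarrow> ghost g"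
proof -
  have X: "X = left_ext_perp Y" and Y: "Y = right_ext_perp X"
    and tri: "\<And>c. c \<in> C \<Longrightarrow> \<exists>x\<in>X. \<exists>y\<in>Y. \<exists>f g h. dist_triangle T c y x f g h"
    using cot unfolding cotorsion_pair_iff by blast+
  have XC: "X \<subseteq> C" using X by (auto simp: left_ext_perp_def)
  have YC: "Y \<subseteq> C" using Y by (auto simp: right_ext_perp_def)
  have ext: "ext_zero x y" if "x \<in> X" "y \<in> Y" for x y using X that by (auto simp: left_ext_perp_def)
  obtain xs ys \<eta> \<eta>' \<eta>'' where xs: "xs \<in> X" "ys \<in> Y" and dS: "dist_triangle T s ys xs \<eta> \<eta>' \<eta>''"
    using tri[OF S_C[OF s_S]] by blast
  note hS = dist_hom[OF dS]
  have cO: "c \<in> Ob T" "ys \<in> Ob T" using c xs YC C_Ob by auto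
  have "sum_closed Y"
    unfolding sum_closed_def
  proof (intro conjI ballI allI impI)
    show "Y \<subseteq> Ob T" using YC C_sub by blast
    fix z assume "is_zero_object T z"
    then have "z \<in> C" "is_dsum T z []" using S_C[OF S_zero] by (auto simp: is_zero_object_def)
    then show "z \<in> Y" using XC C_Ob ext_zero_dsum_right[of z "[]"] unfolding Y right_ext_perp_def by auto
  next
    fix y y' p assume y: "y \<in> Y" "y' \<in> Y" and p: "is_dsum T p [y, y']"
    then have "p \<in> C" using C_pair YC by blast
    moreover have "ext_zero x p" if "x \<in> X" for x
      by (rule ext_zero_dsum_right[OF p]) (use ext that y XC C_Ob in auto)
    ultimately show "p \<in> Y" unfolding Y right_ext_perp_def by auto
  qed
  moreover have "right_closed ys c {g. \<guillemotleft>g : ys \<rightarrow> c\<guillemotright>}"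
    using cO unfolding right_closed_def by (auto simp: in_hom_iff)
  ultimately obtain Y0 \<phi> where Y0: "Y0 \<in> Y" and cov: "covers ys c {g. \<guillemotleft>g : ys \<rightarrow> c\<guillemotright>} Y0 \<phi>"
    using hom_cover xs(2) by metis
  note \<phi> = coversD(1)[OF cov]
  have Y0C: "Y0 \<in> C" using Y0 YC by blast
  obtain s0 b1 \<sigma>0 \<pi> \<beta>0 where s0: "s0 \<in> S" "b1 \<in> S" and d0: "dist_triangle T b1 s0 Y0 \<sigma>0 \<pi> \<beta>0"
    using Y0C by (rule C_E)
  note h0 = dist_hom[OF d0]
  have \<pi>_lift: "\<exists>r. \<guillemotleft>r : a \<rightarrow> s0\<guillemotright> \<and> t = \<pi> \<cdot> r" if "a \<in> S" "\<guillemotleft>t : a \<rightarrow> Y0\<guillemotright>" for a t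
    using lift[OF d0 S_C[OF s0(2)] that] by metis
  \<comment> \<open>\<open>\<pi>\<close> is onto under \<open>F\<close>, so \<open>\<phi>\<close>
    and \<open>\<psi>\<close> have the same image; but \<open>\<psi>\<close> starts in
    \<open>S\<close>, which gives it a weak kernel and keeps its cone in \<open>C\<close>.\<close>
  define \<psi> where "\<psi> = \<phi> \<cdot> \<pi>"
  have \<psi>: "\<guillemotleft>\<psi> : s0 \<rightarrow> c\<guillemotright>" using \<phi> h0 by (auto simp: \<psi>_def in_hom_iff)
  \<comment> \<open>A morphism from \<open>s\<close> to \<open>y\<close> extends along
    \<open>\<eta>\<close> to \<open>ys\<close> because \<open>T(xs, \<Sigma> y) = 0\<close>, and
    every \<open>ys \<rightarrow> c\<close> factors through the cover. Morphisms from other objects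
    of \<open>S\<close> reduce to those from \<open>s\<close>.\<close>
  have trace: "\<exists>x'. \<guillemotleft>x' : a \<rightarrow> s0\<guillemotright> \<and> g \<cdot> u = \<psi> \<cdot> x'"
    if a: "a \<in> S" and y: "y \<in> Y" and g: "\<guillemotleft>g : y \<rightarrow> c\<guillemotright>" and u: "\<guillemotleft>u : a \<rightarrow> y\<guillemotright>" for a y g u
  proof -
    have "\<exists>x'. \<guillemotleft>x' : s \<rightarrow> s0\<guillemotright> \<and> (g \<cdot> u) \<cdot> e = \<psi> \<cdot> x'" if e: "\<guillemotleft>e : s \<rightarrow> a\<guillemotright>" for e
    proof -
      have ue: "\<guillemotleft>u \<cdot> e : s \<rightarrow> y\<guillemotright>" using u e by (auto simp: in_hom_iff)
      have "\<guillemotleft>shift_mor T (u \<cdot> e) \<cdot> \<eta>'' : xs \<rightarrow> \<Sigma> y\<guillemotright>" using u e hS by (auto simp: in_hom_iff)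
      then have "shift_mor T (u \<cdot> e) \<cdot> \<eta>'' = zero_mor T xs (\<Sigma> y)" by (rule ext_zeroD[OF ext[OF xs(1) y]])
      then obtain u' where u': "\<guillemotleft>u' : ys \<rightarrow> y\<guillemotright>" "u \<cdot> e = u' \<cdot> \<eta>" using exact_contra3[OF dS ue] by blast
      have "\<guillemotleft>g \<cdot> u' : ys \<rightarrow> c\<guillemotright>" using g u' by (auto simp: in_hom_iff)
      then obtain g' where g': "\<guillemotleft>g' : ys \<rightarrow> Y0\<guillemotright>" "g \<cdot> u' = \<phi> \<cdot> g'" using coversD(2)[OF cov] by blast
      have "\<guillemotleft>g' \<cdot> \<eta> : s \<rightarrow> Y0\<guillemotright>" using g' hS by (auto simp: in_hom_iff)
      then obtain r where r: "\<guillemotleft>r : s \<rightarrow> s0\<guillemotright>" "g' \<cdot> \<eta> = \<pi> \<cdot> r" using \<pi>_lift[OF s_S] by blast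
      have "(g \<cdot> u) \<cdot> e = g \<cdot> (u' \<cdot> \<eta>)" using g u e u'(2)[symmetric] by (simp add: in_hom_iff)
      also have "\<dots> = (g \<cdot> u') \<cdot> \<eta>" using g u'(1) hS by (simp add: in_hom_iff)
      also have "\<dots> = \<phi> \<cdot> (g' \<cdot> \<eta>)" unfolding g'(2) using \<phi> g'(1) hS by (simp add: in_hom_iff)
      also have "\<dots> = \<psi> \<cdot> r" unfolding r(2) \<psi>_def using \<phi> r(1) h0 by (simp add: in_hom_iff)
      finally show ?thesis using r(1) by blast
    qed
    moreover have "\<guillemotleft>g \<cdot> u : a \<rightarrow> c\<guillemotright>" using g u by (auto simp: in_hom_iff)
    ultimately show ?thesis using factor_S[OF a \<psi>] by metis
  qed
  obtain z \<rho> \<delta> where dz: "dist_triangle T s0 c z \<psi> \<rho> \<delta>" using TR1_cone[OF \<psi>] by blast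
  note hz = dist_hom[OF dz]
  have zC: "z \<in> C" by (rule C_cone[OF dz s0(1) c])
  \<comment> \<open>The image of \<open>F \<psi>\<close> is presented by the weak kernel
    \<open>\<kappa>\<close>, so the cone \<open>c'\<close> of \<open>\<kappa>\<close> represents the
    trace, while the cone \<open>z\<close> of \<open>\<psi>\<close> represents the quotient by
    it.\<close>
  obtain s2 \<kappa> where \<kappa>: "s2 \<in> S" "\<guillemotleft>\<kappa> : s2 \<rightarrow> s0\<guillemotright>" "\<psi> \<cdot> \<kappa> = zero_mor T s2 c"
    and wk: "\<And>b x. b \<in> S \<Longrightarrow> \<guillemotleft>x : b \<rightarrow> s0\<guillemotright> \<Longrightarrow> \<psi> \<cdot> x = zero_mor T b c \<Longrightarrow> \<exists>x'. \<guillemotleft>x' : b \<rightarrow> s2\<guillemotright> \<and> x = \<kappa> \<cdot> x'"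
    by (rule weak_kernel[OF s0(1) \<psi>]) (rule that)
  obtain c' j \<epsilon> where dc: "dist_triangle T s2 s0 c' \<kappa> j \<epsilon>" using TR1_cone[OF \<kappa>(2)] by blast
  note hc = dist_hom[OF dc]
  have c'C: "c' \<in> C" by (rule C_I2[OF s0(1) \<kappa>(1) dc])
  obtain m where m: "\<guillemotleft>m : c' \<rightarrow> c\<guillemotright>" "\<psi> = m \<cdot> j" using exact_contra[OF dc \<psi> \<kappa>(3)] .
  have j_lift: "\<exists>r. \<guillemotleft>r : a \<rightarrow> s0\<guillemotright> \<and> t = j \<cdot> r" if "a \<in> S" "\<guillemotleft>t : a \<rightarrow> c'\<guillemotright>" for a t
    using lift[OF dc S_C[OF \<kappa>(1)] that] by metis
  \<comment> \<open>\<open>j\<close> identifies whatever \<open>\<psi>\<close> identifies on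
    \<open>S\<close>, which makes \<open>F m\<close> injective.\<close>
  have j_eq: "j \<cdot> x = j \<cdot> x'" if b: "b \<in> S" and x: "\<guillemotleft>x : b \<rightarrow> s0\<guillemotright>" "\<guillemotleft>x' : b \<rightarrow> s0\<guillemotright>" and eq: "\<psi> \<cdot> x = \<psi> \<cdot> x'" for b x x'
  proof -
    have "\<psi> \<cdot> (x \<boxplus> neg_mor x') = zero_mor T b c" using x \<psi> eq by (auto simp: in_hom_iff)
    moreover have "\<guillemotleft>x \<boxplus> neg_mor x' : b \<rightarrow> s0\<guillemotright>" using x by (auto simp: in_hom_iff)
    ultimately obtain t where t: "\<guillemotleft>t : b \<rightarrow> s2\<guillemotright>" "x \<boxplus> neg_mor x' = \<kappa> \<cdot> t" using wk[OF b] by blast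
    have "j \<cdot> (x \<boxplus> neg_mor x') = zero_mor T b c'"
      unfolding t(2) using t(1) \<kappa>(2) hc reassoc[OF dist_zero(1)[OF dc], of t] by (simp add: in_hom_iff)
    then have "j \<cdot> x \<boxplus> neg_mor (j \<cdot> x') = zero_mor T b c'" using x hc by (simp add: in_hom_iff)
    then show ?thesis by (subst (asm) diff_eq_zero) (use x hc in \<open>auto simp: in_hom_iff\<close>)
  qed
  have \<rho>\<psi>: "\<rho> \<cdot> \<psi> = zero_mor T s0 z" using dist_zero(1)[OF dz] .
  have "S_exact c' c z m \<rho>"
    unfolding S_exact_def
  proof (intro conjI ballI allI impI)
    show "\<guillemotleft>m : c' \<rightarrow> c\<guillemotright>" "\<guillemotleft>\<rho> : c \<rightarrow> z\<guillemotright>" using m hz by auto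
    fix a assume a: "a \<in> S"
    then have aO: "a \<in> Ob T" by (rule S_Ob)
    fix v
    {
      assume "\<guillemotleft>v : a \<rightarrow> c'\<guillemotright> \<and> m \<cdot> v = zero_mor T a c"
      then obtain v' where v: "m \<cdot> v = zero_mor T a c" and v': "\<guillemotleft>v' : a \<rightarrow> s0\<guillemotright>" "v = j \<cdot> v'" using j_lift[OF a] by blast
      have "\<psi> \<cdot> v' = m \<cdot> (j \<cdot> v')" unfolding m(2) using m(1) hc v'(1) by (simp add: in_hom_iff)
      then have "\<psi> \<cdot> v' = \<psi> \<cdot> zero_mor T a s0" using v v' \<psi> aO by (simp add: in_hom_iff)
      from j_eq[OF a v'(1) _ this] show "v = zero_mor T a c'" using v' hc aO by (simp add: in_hom_iff)
    next
      assume v: "\<guillemotleft>v : a \<rightarrow> c\<guillemotright>"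
      show "\<rho> \<cdot> v = zero_mor T a z \<longleftrightarrow> (\<exists>w. \<guillemotleft>w : a \<rightarrow> c'\<guillemotright> \<and> v = m \<cdot> w)"
      proof
        assume "\<rho> \<cdot> v = zero_mor T a z"
        then obtain w where w: "\<guillemotleft>w : a \<rightarrow> s0\<guillemotright>" "v = \<psi> \<cdot> w" using exact_cov[OF dz v] by blast
        then have "v = m \<cdot> (j \<cdot> w)" unfolding m(2) using m(1) hc by (simp add: in_hom_iff)
        then show "\<exists>w. \<guillemotleft>w : a \<rightarrow> c'\<guillemotright> \<and> v = m \<cdot> w" using w(1) hc by (intro exI[of _ "j \<cdot> w"]) (auto simp: in_hom_iff)
      next
        assume "\<exists>w. \<guillemotleft>w : a \<rightarrow> c'\<guillemotright> \<and> v = m \<cdot> w"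
        then obtain w where w: "\<guillemotleft>w : a \<rightarrow> c'\<guillemotright>" "v = m \<cdot> w" by blast
        obtain w' where w': "\<guillemotleft>w' : a \<rightarrow> s0\<guillemotright>" "w = j \<cdot> w'" using j_lift[OF a w(1)] by blast
        have "v = \<psi> \<cdot> w'" unfolding w(2) w'(2) m(2) using m(1) hc w'(1) by (simp add: in_hom_iff)
        then show "\<rho> \<cdot> v = zero_mor T a z" using reassoc[OF \<rho>\<psi>, of w'] \<psi> w'(1) hz by (simp add: in_hom_iff)
      qed
    next
      assume "\<guillemotleft>v : a \<rightarrow> z\<guillemotright>"
      then show "\<exists>w. \<guillemotleft>w : a \<rightarrow> c\<guillemotright> \<and> v = \<rho> \<cdot> w" using lift[OF dz S_C[OF s0(1)] a] by metis
    }
  qed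
  \<comment> \<open>\<open>F c'\<close> is a quotient of \<open>F Y0\<close>, but no morphism
    \<open>Y0 \<rightarrow> c'\<close> is at hand. The extension is found in \<open>Y0\<close> after
    passing along \<open>\<pi>\<close>, lifted to \<open>s0\<close>, and compared under
    \<open>\<psi>\<close>; \<open>j_eq\<close> brings it to \<open>c'\<close>.\<close>
  moreover have "c' \<in> Y"
  proof -
    have "ext_zero x c'" if x: "x \<in> X" for x
    proof -
      obtain p0 p1 \<sigma> \<alpha> \<beta> where p: "p0 \<in> S" "p1 \<in> S" and d: "dist_triangle T p1 p0 x \<sigma> \<alpha> \<beta>" using C_E[OF subsetD[OF XC x]] .
      note h = dist_hom[OF d]
      have "\<exists>w. \<guillemotleft>w : p0 \<rightarrow> c'\<guillemotright> \<and> u = w \<cdot> \<sigma>" if u: "\<guillemotleft>u : p1 \<rightarrow> c'\<guillemotright>" for u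
      proof -
        obtain u' where u': "\<guillemotleft>u' : p1 \<rightarrow> s0\<guillemotright>" "u = j \<cdot> u'" using j_lift[OF p(2) u] by blast
        have "\<guillemotleft>\<pi> \<cdot> u' : p1 \<rightarrow> Y0\<guillemotright>" using u' h0 by (auto simp: in_hom_iff)
        then obtain w where w: "\<guillemotleft>w : p0 \<rightarrow> Y0\<guillemotright>" "\<pi> \<cdot> u' = w \<cdot> \<sigma>"
          using ext_zero_iff[OF d p Y0C] ext[OF x Y0] by blast
        obtain w' where w': "\<guillemotleft>w' : p0 \<rightarrow> s0\<guillemotright>" "w = \<pi> \<cdot> w'" using \<pi>_lift[OF p(1) w(1)] by blast
        have "\<psi> \<cdot> u' = \<phi> \<cdot> (\<pi> \<cdot> u')" using \<phi> h0 u'(1) by (simp add: \<psi>_def in_hom_iff)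
        also have "\<dots> = \<psi> \<cdot> (w' \<cdot> \<sigma>)" unfolding w(2) w'(2) using \<phi> h0 w'(1) h by (simp add: \<psi>_def in_hom_iff)
        finally have "j \<cdot> u' = j \<cdot> (w' \<cdot> \<sigma>)" using j_eq[OF p(2) u'(1)] w'(1) h by (auto simp: in_hom_iff)
        then show ?thesis using u' w'(1) h hc by (intro exI[of _ "j \<cdot> w'"]) (auto simp: in_hom_iff)
      qed
      then show ?thesis using ext_zero_iff[OF d p c'C] by blast
    qed
    then show ?thesis using c'C unfolding Y right_ext_perp_def by blast
  qed
  moreover have "ghost g" if y: "y \<in> Y" and g: "\<guillemotleft>g : y \<rightarrow> z\<guillemotright>" for y g
  proof (rule ghostI[OF g])
    fix a u assume a: "a \<in> S" and u: "\<guillemotleft>u : a \<rightarrow> y\<guillemotright>"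
    \<comment> \<open>Extension closure of \<open>Y\<close> makes the quotient by the trace
      torsionfree. The extension has to be by an object of \<open>Y\<close>, so the cone
      \<open>z'\<close> of \<open>\<phi>\<close> replaces the cone \<open>z\<close> of
      \<open>\<psi>\<close>; its class, pulled back along \<open>t \<cdot> g\<close>, has a middle
      term \<open>e\<close> in \<open>Y\<close>.\<close>
    obtain z' \<rho>' \<delta>' where dz': "dist_triangle T Y0 c z' \<phi> \<rho>' \<delta>'" using TR1_cone[OF \<phi>] by blast
    note hz' = dist_hom[OF dz']
    have \<rho>'\<psi>: "\<rho>' \<cdot> \<psi> = zero_mor T s0 z'"
      unfolding \<psi>_def using \<phi> h0 hz' reassoc[OF dist_zero(1)[OF dz'], of \<pi>] by (simp add: in_hom_iff)
    then obtain t where t: "\<guillemotleft>t : z \<rightarrow> z'\<guillemotright>" "\<rho>' = t \<cdot> \<rho>" using exact_contra[OF dz hz'(2)] by blast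
    have "\<guillemotleft>\<delta>' \<cdot> (t \<cdot> g) : y \<rightarrow> \<Sigma> Y0\<guillemotright>" using t(1) g hz' by (auto simp: in_hom_iff)
    then obtain e f p where de: "dist_triangle T Y0 e y f p (\<delta>' \<cdot> (t \<cdot> g))" using cocone[OF _ C_Ob[OF Y0C]] by blast
    note he = dist_hom[OF de]
    have eY: "e \<in> Y" using right_ext_perp_ext[OF de, of X] Y0 y Y by simp
    have tgp: "\<guillemotleft>t \<cdot> (g \<cdot> p) : e \<rightarrow> z'\<guillemotright>" using t(1) g he by (auto simp: in_hom_iff)
    have "\<delta>' \<cdot> (t \<cdot> (g \<cdot> p)) = (\<delta>' \<cdot> (t \<cdot> g)) \<cdot> p" using t(1) g he hz' by (simp add: in_hom_iff)
    then have "\<delta>' \<cdot> (t \<cdot> (g \<cdot> p)) = zero_mor T e (\<Sigma> Y0)" using dist_zero(2)[OF de] by simp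
    then obtain q where q: "\<guillemotleft>q : e \<rightarrow> c\<guillemotright>" "t \<cdot> (g \<cdot> p) = \<rho>' \<cdot> q" using exact_cov2[OF dz' tgp] by blast
    obtain u' where u': "\<guillemotleft>u' : a \<rightarrow> e\<guillemotright>" "u = p \<cdot> u'" using lift[OF de Y0C a u] .
    obtain x' where x': "\<guillemotleft>x' : a \<rightarrow> s0\<guillemotright>" "q \<cdot> u' = \<psi> \<cdot> x'" using trace[OF a eY q(1) u'(1)] by blast
    have "t \<cdot> (g \<cdot> u) = (t \<cdot> (g \<cdot> p)) \<cdot> u'" unfolding u'(2) using t(1) g he u'(1) by (simp add: in_hom_iff)
    also have "\<dots> = \<rho>' \<cdot> (q \<cdot> u')" unfolding q(2) using hz' q(1) u'(1) by (simp add: in_hom_iff)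
    also have "\<dots> = zero_mor T a z'" unfolding x'(2) using reassoc[OF \<rho>'\<psi>, of x'] \<psi> x'(1) hz' by (simp add: in_hom_iff)
    finally have tgu: "t \<cdot> (g \<cdot> u) = zero_mor T a z'" .
    \<comment> \<open>Vanishing in \<open>z'\<close> suffices: a lift \<open>v\<close> of
      \<open>g \<cdot> u\<close> to \<open>c\<close> is then killed by \<open>\<rho>'\<close>, so it
      factors through \<open>\<phi>\<close>, hence through \<open>\<psi>\<close>, which
      \<open>\<rho>\<close> kills.\<close>
    have "\<guillemotleft>g \<cdot> u : a \<rightarrow> z\<guillemotright>" using g u by (auto simp: in_hom_iff)
    then obtain v where v: "\<guillemotleft>v : a \<rightarrow> c\<guillemotright>" "g \<cdot> u = \<rho> \<cdot> v" using lift[OF dz S_C[OF s0(1)] a] by blast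
    have "\<rho>' \<cdot> v = t \<cdot> (\<rho> \<cdot> v)" unfolding t(2) using t(1) hz v(1) by (simp add: in_hom_iff)
    then have "\<rho>' \<cdot> v = zero_mor T a z'" using tgu v(2) by simp
    then obtain w where w: "\<guillemotleft>w : a \<rightarrow> Y0\<guillemotright>" "v = \<phi> \<cdot> w" using exact_cov[OF dz' v(1)] by blast
    obtain w' where w': "\<guillemotleft>w' : a \<rightarrow> s0\<guillemotright>" "w = \<pi> \<cdot> w'" using \<pi>_lift[OF a w(1)] by blast
    have "v = \<psi> \<cdot> w'" unfolding w(2) w'(2) \<psi>_def using \<phi> h0 w'(1) by (simp add: in_hom_iff)
    then show "g \<cdot> u = zero_mor T a z"
      unfolding v(2) using reassoc[OF \<rho>\<psi>, of w'] \<psi> w'(1) hz by (simp add: in_hom_iff)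
  qed
  ultimately show thesis using that zC by blast
qed

end

section \<open>Cotorsion pairs from functorially finite torsion classes\<close>

context tri_cat
begin

lemma ext_zero_shift: "a \<in> Ob T \<Longrightarrow> y \<in> Ob T \<Longrightarrow> ext_zero (\<Sigma> a) (\<Sigma> y) \<longleftrightarrow> ext_zero a y"
proof
  assume Ob: "a \<in> Ob T" "y \<in> Ob T" and ext: "ext_zero (\<Sigma> a) (\<Sigma> y)"
  show "ext_zero a y"
    unfolding ext_zero_def
  proof (intro allI impI)
    fix \<delta> assume \<delta>: "\<guillemotleft>\<delta> : a \<rightarrow> \<Sigma> y\<guillemotright>"
    then have "\<guillemotleft>shift_mor T \<delta> : \<Sigma> a \<rightarrow> \<Sigma> (\<Sigma> y)\<guillemotright>" by (auto simp: in_hom_iff)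
    then have "shift_mor T \<delta> = zero_mor T (\<Sigma> a) (\<Sigma> (\<Sigma> y))" by (rule ext_zeroD[OF ext])
    then have "shift_mor T \<delta> = shift_mor T (zero_mor T a (\<Sigma> y))" using Ob by simp
    then show "\<delta> = zero_mor T a (\<Sigma> y)"
      by (rule shift_faithful[rotated 4]) (use \<delta> in \<open>auto simp: in_hom_iff\<close>)
  qed
next
  assume Ob: "a \<in> Ob T" "y \<in> Ob T" and ext: "ext_zero a y"
  show "ext_zero (\<Sigma> a) (\<Sigma> y)"
    unfolding ext_zero_def
  proof (intro allI impI)
    fix \<delta> assume \<delta>: "\<guillemotleft>\<delta> : \<Sigma> a \<rightarrow> \<Sigma> (\<Sigma> y)\<guillemotright>"
    obtain \<epsilon> where \<epsilon>: "\<guillemotleft>\<epsilon> : a \<rightarrow> \<Sigma> y\<guillemotright>" "\<delta> = shift_mor T \<epsilon>" using shift_full[OF \<delta> Ob(1)] Ob(2) by auto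
    then show "\<delta> = zero_mor T (\<Sigma> a) (\<Sigma> (\<Sigma> y))" using ext_zeroD[OF ext \<epsilon>(1)] Ob by simp
  qed
qed

section \<open>Local endomorphism rings and minimal approximations\<close>

lemma local_unit:
  assumes loc: "local_ring (End_ring T x)" and w: "\<guillemotleft>w : x \<rightarrow> x\<guillemotright>" and nu: "w \<notin> Units (End_ring T x)"
  obtains v where "\<guillemotleft>v : x \<rightarrow> x\<guillemotright>" "(Id T x \<boxplus> neg_mor w) \<cdot> v = Id T x"
proof -
  let ?R = "End_ring T x"
  let ?u = "Id T x \<boxplus> neg_mor w"
  have x: "x \<in> Ob T" using w by (auto simp: in_hom_iff)
  have car: "f \<in> carrier ?R \<longleftrightarrow> \<guillemotleft>f : x \<rightarrow> x\<guillemotright>" for f using x by (simp add: End_ring_def in_hom_iff)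
  have u: "\<guillemotleft>?u : x \<rightarrow> x\<guillemotright>" using w by (auto simp: in_hom_iff)
  have "w \<boxplus> ?u = Id T x"
    using diff_eq[of "Id T x" w ?u] w by (auto simp: in_hom_iff)
  then have sum: "w \<oplus>\<^bsub>?R\<^esub> ?u = Id T x" using w by (simp add: End_ring_def plus_mor_def in_hom_iff)
  \<comment> \<open>In a local ring a sum of two non-units is a non-unit, while \<open>w\<close> and
    \<open>1 - w\<close> add up to the identity.\<close>
  have "Id T x \<in> Units ?R" using x by (auto simp: Units_def End_ring_def)
  then have "?u \<in> Units ?R" using loc w u nu sum car unfolding local_ring_def by (metis Diff_iff)
  then obtain v where "v \<in> carrier ?R" "?u \<otimes>\<^bsub>?R\<^esub> v = \<one>\<^bsub>?R\<^esub>" unfolding Units_def by blast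
  then show thesis using that car by (simp add: End_ring_def)
qed

lemma unit_inverse:
  assumes "w \<in> Units (End_ring T x)" "x \<in> Ob T"
  obtains v where "\<guillemotleft>v : x \<rightarrow> x\<guillemotright>" "v \<cdot> w = Id T x"
proof -
  obtain v where "v \<in> carrier (End_ring T x)" "v \<otimes>\<^bsub>End_ring T x\<^esub> w = \<one>\<^bsub>End_ring T x\<^esub>"
    using assms(1) unfolding Units_def by blast
  then show thesis using that assms(2) by (simp add: End_ring_def in_hom_iff)
qed

text \<open>A Nakayama-type elimination: if no endomorphism killing \<open>f\<close> is invertible on a local summand,
  then \<open>\<delta> = \<delta> \<gamma>\<close> with \<open>\<gamma> f = 0\<close> forces \<open>\<delta> = 0\<close>; the summands are removed one at a time.\<close>

lemma local_elimination:
  assumes b: "biproduct z I x \<iota> q" and loc: "\<And>i. i \<in> I \<Longrightarrow> local_ring (End_ring T (x i))"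
    and f: "\<guillemotleft>f : a \<rightarrow> z\<guillemotright>"
    and nonunit: "\<And>\<gamma> m. \<guillemotleft>\<gamma> : z \<rightarrow> z\<guillemotright> \<Longrightarrow> \<gamma> \<cdot> f = zero_mor T a z \<Longrightarrow> m \<in> I \<Longrightarrow> q m \<cdot> (\<gamma> \<cdot> \<iota> m) \<notin> Units (End_ring T (x m))"
    and \<delta>: "\<guillemotleft>\<delta> : z \<rightarrow> t\<guillemotright>" and \<gamma>0: "\<guillemotleft>\<gamma>0 : z \<rightarrow> z\<guillemotright>" "\<gamma>0 \<cdot> f = zero_mor T a z" "\<delta> = \<delta> \<cdot> \<gamma>0"
  shows "\<delta> = zero_mor T z t"
proof -
  define E where "E B = finsum (Hom T z z) (\<lambda>i. \<iota> i \<cdot> q i) B" for B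
  have z: "z \<in> Ob T" and I: "finite I" and EI: "E I = Id T z" using b by (auto simp: biproduct_def E_def)
  have iq: "\<guillemotleft>\<iota> i : x i \<rightarrow> z\<guillemotright>" "\<guillemotleft>q i : z \<rightarrow> x i\<guillemotright>" "\<guillemotleft>\<iota> i \<cdot> q i : z \<rightarrow> z\<guillemotright>" if "i \<in> I" for i
    using b that by (auto simp: biproduct_def in_hom_iff)
  have E: "\<guillemotleft>E B : z \<rightarrow> z\<guillemotright>" if "B \<subseteq> I" for B
    unfolding E_def by (rule finsum_mor(1)[OF z z finite_subset[OF that I]]) (use iq that in auto)
  \<comment> \<open>Invariant of the elimination: \<open>E (I - B)\<close> is the projection onto
    the summands not yet removed, and it is zero once \<open>B = I\<close>. The endomorphism
    \<open>\<gamma>\<close> changes at each step, which is why the non-unit hypothesis covers all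
    \<open>\<gamma>\<close> that kill \<open>f\<close>.\<close>
  have main: "\<exists>\<gamma>. \<guillemotleft>\<gamma> : z \<rightarrow> z\<guillemotright> \<and> \<gamma> \<cdot> f = zero_mor T a z \<and> \<delta> = \<delta> \<cdot> (E (I - B) \<cdot> \<gamma>)" if "finite B" "B \<subseteq> I" for B
    using that
  proof (induction B)
    case empty
    show ?case using \<gamma>0 EI by (intro exI[of _ \<gamma>0]) (simp add: in_hom_iff)
  next
    case (insert m B)
    then obtain \<gamma> where \<gamma>: "\<guillemotleft>\<gamma> : z \<rightarrow> z\<guillemotright>" "\<gamma> \<cdot> f = zero_mor T a z" and eq: "\<delta> \<cdot> (E (I - B) \<cdot> \<gamma>) = \<delta>" by auto
    have m: "m \<in> I" using insert by simp
    let ?E = "E (I - insert m B)"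
    have E': "\<guillemotleft>?E : z \<rightarrow> z\<guillemotright>" by (rule E) blast
    have "I - B = insert m (I - insert m B)" using insert by auto
    moreover have "E (insert m (I - insert m B)) = \<iota> m \<cdot> q m \<boxplus> ?E"
      unfolding E_def
      by (rule finsum_mor(2)[where f="\<lambda>i. \<iota> i \<cdot> q i", OF z z]) (use iq I m in auto)
    ultimately have split: "E (I - B) = \<iota> m \<cdot> q m \<boxplus> ?E" by simp
    let ?w = "q m \<cdot> (\<gamma> \<cdot> \<iota> m)"
    have w: "\<guillemotleft>?w : x m \<rightarrow> x m\<guillemotright>" using iq[OF m] \<gamma> by (auto simp: in_hom_iff)
    \<comment> \<open>\<open>1 - ?w\<close> has a right inverse, so an equation with
      \<open>\<delta> \<cdot> \<iota> m\<close> on both sides can be solved for it.\<close>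
    obtain v where v: "\<guillemotleft>v : x m \<rightarrow> x m\<guillemotright>" "(Id T (x m) \<boxplus> neg_mor ?w) \<cdot> v = Id T (x m)"
      using local_unit[OF loc[OF m] w nonunit[OF \<gamma> m]] .
    have d: "\<delta> \<cdot> (\<iota> m \<cdot> (q m \<cdot> \<gamma>)) \<boxplus> \<delta> \<cdot> (?E \<cdot> \<gamma>) = \<delta>"
      using eq unfolding split using iq[OF m] E' \<gamma>(1) \<delta> by (simp add: in_hom_iff)
    have "\<delta> \<cdot> \<iota> m = (\<delta> \<cdot> (\<iota> m \<cdot> (q m \<cdot> \<gamma>)) \<boxplus> \<delta> \<cdot> (?E \<cdot> \<gamma>)) \<cdot> \<iota> m" unfolding d ..
    also have "\<dots> = \<delta> \<cdot> (\<iota> m \<cdot> ?w) \<boxplus> \<delta> \<cdot> (?E \<cdot> (\<gamma> \<cdot> \<iota> m))"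
      using iq[OF m] E' \<gamma>(1) \<delta> by (simp add: in_hom_iff)
    finally have e: "\<delta> \<cdot> \<iota> m = \<delta> \<cdot> (\<iota> m \<cdot> ?w) \<boxplus> \<delta> \<cdot> (?E \<cdot> (\<gamma> \<cdot> \<iota> m))" .
    have "\<delta> \<cdot> \<iota> m \<boxplus> neg_mor (\<delta> \<cdot> (\<iota> m \<cdot> ?w)) = \<delta> \<cdot> (?E \<cdot> (\<gamma> \<cdot> \<iota> m))"
    proof -
      let ?A = "\<delta> \<cdot> (\<iota> m \<cdot> ?w)" and ?B = "\<delta> \<cdot> (?E \<cdot> (\<gamma> \<cdot> \<iota> m))"
      have AB: "\<guillemotleft>?A : x m \<rightarrow> t\<guillemotright>" "\<guillemotleft>?B : x m \<rightarrow> t\<guillemotright>" using iq[OF m] E' \<gamma>(1) \<delta> by (auto simp: in_hom_iff)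
      have "?A \<boxplus> ?B \<boxplus> neg_mor ?A = ?B \<boxplus> (?A \<boxplus> neg_mor ?A)"
        using AB by (simp add: in_hom_iff plus_ac del: plus_neg)
      also have "\<dots> = ?B" using AB by (simp add: in_hom_iff)
      finally show ?thesis by (subst e)
    qed
    then have "(\<delta> \<cdot> \<iota> m) \<cdot> ((Id T (x m) \<boxplus> neg_mor ?w) \<cdot> v) = \<delta> \<cdot> (?E \<cdot> (\<gamma> \<cdot> \<iota> m)) \<cdot> v"
      using iq[OF m] E' \<gamma>(1) \<delta> v(1) w by (simp add: in_hom_iff flip: plus_Cmp assoc Cmp_neg)
    then have e2: "\<delta> \<cdot> \<iota> m = \<delta> \<cdot> (?E \<cdot> (\<gamma> \<cdot> (\<iota> m \<cdot> v)))"
      unfolding v(2) using iq[OF m] E' \<gamma>(1) \<delta> v(1) by (simp add: in_hom_iff)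
    \<comment> \<open>Substituting the solved \<open>\<delta> \<cdot> \<iota> m\<close> in
      \<open>d\<close> yields this endomorphism. Both summands apply \<open>\<gamma>\<close> first,
      so \<open>f\<close> is still killed.\<close>
    let ?\<gamma> = "\<gamma> \<cdot> (\<iota> m \<cdot> (v \<cdot> (q m \<cdot> \<gamma>))) \<boxplus> \<gamma>"
    have \<gamma>': "\<guillemotleft>?\<gamma> : z \<rightarrow> z\<guillemotright>" using iq[OF m] \<gamma>(1) v(1) by (auto simp: in_hom_iff)
    have "?\<gamma> \<cdot> f = zero_mor T a z" using iq[OF m] \<gamma> v(1) f by (simp add: in_hom_iff)
    moreover have "\<delta> \<cdot> (?E \<cdot> ?\<gamma>) = \<delta>"
    proof -
      have "\<delta> \<cdot> (?E \<cdot> ?\<gamma>) = (\<delta> \<cdot> (?E \<cdot> (\<gamma> \<cdot> (\<iota> m \<cdot> v)))) \<cdot> (q m \<cdot> \<gamma>) \<boxplus> \<delta> \<cdot> (?E \<cdot> \<gamma>)"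
        using iq[OF m] E' \<gamma>(1) \<delta> v(1) by (simp add: in_hom_iff)
      also have "\<dots> = \<delta> \<cdot> (\<iota> m \<cdot> (q m \<cdot> \<gamma>)) \<boxplus> \<delta> \<cdot> (?E \<cdot> \<gamma>)"
        unfolding e2[symmetric] using iq[OF m] E' \<gamma>(1) \<delta> by (simp add: in_hom_iff)
      finally show ?thesis unfolding d .
    qed
    ultimately show ?case using \<gamma>' by (intro exI[of _ ?\<gamma>]) auto
  qed
  obtain \<gamma> where "\<guillemotleft>\<gamma> : z \<rightarrow> z\<guillemotright>" and d: "\<delta> = \<delta> \<cdot> (E {} \<cdot> \<gamma>)" using main[OF I subset_refl] by auto
  then have "\<delta> \<cdot> (E {} \<cdot> \<gamma>) = zero_mor T z t" using z \<delta> by (simp add: E_def in_hom_iff)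
  then show ?thesis using d by simp
qed

definition left_approx :: "'o set \<Rightarrow> 'o \<Rightarrow> 'o \<Rightarrow> 'm \<Rightarrow> bool"
  where "left_approx Y a y f \<longleftrightarrow> y \<in> Y \<and> \<guillemotleft>f : a \<rightarrow> y\<guillemotright> \<and>
    (\<forall>y'\<in>Y. \<forall>h. \<guillemotleft>h : a \<rightarrow> y'\<guillemotright> \<longrightarrow> (\<exists>g. \<guillemotleft>g : y \<rightarrow> y'\<guillemotright> \<and> h = g \<cdot> f))"

lemma left_approxD:
  assumes "left_approx Y a y f"
  shows "y \<in> Y" "\<guillemotleft>f : a \<rightarrow> y\<guillemotright>" "\<And>y' h. y' \<in> Y \<Longrightarrow> \<guillemotleft>h : a \<rightarrow> y'\<guillemotright> \<Longrightarrow> \<exists>g. \<guillemotleft>g : y \<rightarrow> y'\<guillemotright> \<and> h = g \<cdot> f"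
  using assms by (auto simp: left_approx_def)

text \<open>The consequence of minimality of an approximation \<open>f\<close> that Wakamatsu's lemma needs.\<close>

definition almost_minimal :: "'o \<Rightarrow> 'o \<Rightarrow> 'm \<Rightarrow> bool"
  where "almost_minimal a y f \<longleftrightarrow> (\<forall>t \<delta> \<gamma>. \<guillemotleft>\<delta> : y \<rightarrow> t\<guillemotright> \<and> \<guillemotleft>\<gamma> : y \<rightarrow> y\<guillemotright> \<and> \<gamma> \<cdot> f = zero_mor T a y \<and> \<delta> = \<delta> \<cdot> \<gamma> \<longrightarrow> \<delta> = zero_mor T y t)"

text \<open>If some \<open>\<gamma>\<close> with \<open>\<gamma> \<cdot> f = 0\<close> is invertible
  on the summand \<open>x m\<close>, the component of \<open>f\<close> there is determined by the
  others, so projecting that summand away leaves an approximation with fewer summands. If there is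
  none, the elimination argument applies.\<close>

lemma minimal_approx:
  assumes Yret: "\<And>y i r x. y \<in> Y \<Longrightarrow> \<guillemotleft>i : x \<rightarrow> y\<guillemotright> \<Longrightarrow> \<guillemotleft>r : y \<rightarrow> x\<guillemotright> \<Longrightarrow> r \<cdot> i = Id T x \<Longrightarrow> x \<in> Y"
    and b: "biproduct z I x \<iota> q" "\<And>i. i \<in> I \<Longrightarrow> local_ring (End_ring T (x i))" and f: "left_approx Y a z f"
  shows "\<exists>y f. left_approx Y a y f \<and> almost_minimal a y f"
  using b f
proof (induction "card I" arbitrary: z I \<iota> q f rule: less_induct)
  case less
  note b = less.prems(1) and loc = less.prems(2) and f = left_approxD[OF less.prems(3)]
  show ?case
  proof (cases "\<exists>\<gamma> m. \<guillemotleft>\<gamma> : z \<rightarrow> z\<guillemotright> \<and> \<gamma> \<cdot> f = zero_mor T a z \<and> m \<in> I \<and> q m \<cdot> (\<gamma> \<cdot> \<iota> m) \<in> Units (End_ring T (x m))")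
    case False
    have "almost_minimal a z f"
      unfolding almost_minimal_def
    proof (intro allI impI, elim conjE)
      fix t \<delta> \<gamma> assume *: "\<guillemotleft>\<delta> : z \<rightarrow> t\<guillemotright>" "\<guillemotleft>\<gamma> : z \<rightarrow> z\<guillemotright>" "\<gamma> \<cdot> f = zero_mor T a z" "\<delta> = \<delta> \<cdot> \<gamma>"
      show "\<delta> = zero_mor T z t"
        by (rule local_elimination[OF b loc f(2) _ *]) (use False in blast)+
    qed
    then show ?thesis using less.prems(3) by blast
  next
    case True
    then obtain \<gamma> m where \<gamma>: "\<guillemotleft>\<gamma> : z \<rightarrow> z\<guillemotright>" "\<gamma> \<cdot> f = zero_mor T a z" and m: "m \<in> I"
      and unit: "q m \<cdot> (\<gamma> \<cdot> \<iota> m) \<in> Units (End_ring T (x m))" by blast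
    have iq: "\<guillemotleft>\<iota> m : x m \<rightarrow> z\<guillemotright>" "\<guillemotleft>q m : z \<rightarrow> x m\<guillemotright>" "q m \<cdot> \<iota> m = Id T (x m)"
      using b m by (auto simp: biproduct_def)
    have xm: "x m \<in> Ob T" using iq by (auto simp: in_hom_iff)
    obtain v where v: "\<guillemotleft>v : x m \<rightarrow> x m\<guillemotright>" "v \<cdot> (q m \<cdot> (\<gamma> \<cdot> \<iota> m)) = Id T (x m)"
      using unit_inverse[OF unit xm] .
    obtain z' u c where u: "\<guillemotleft>u : z' \<rightarrow> z\<guillemotright>" "\<guillemotleft>c : z \<rightarrow> z'\<guillemotright>" "c \<cdot> u = Id T z'" "\<iota> m \<cdot> q m \<boxplus> u \<cdot> c = Id T z"
      using retract_complement[OF iq] by metis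
    have b': "biproduct z' (I - {m}) x (\<lambda>i. c \<cdot> \<iota> i) (\<lambda>i. q i \<cdot> u)" using biproduct_remove(1)[OF b m u] .
    have fsplit: "f = \<iota> m \<cdot> (q m \<cdot> f) \<boxplus> u \<cdot> (c \<cdot> f)"
    proof -
      have "f = (\<iota> m \<cdot> q m \<boxplus> u \<cdot> c) \<cdot> f" unfolding u(4) using f(2) by (simp add: in_hom_iff)
      also have "\<dots> = \<iota> m \<cdot> (q m \<cdot> f) \<boxplus> u \<cdot> (c \<cdot> f)" using iq(1,2) u(1,2) f(2) by (simp add: in_hom_iff)
      finally show ?thesis .
    qed
    \<comment> \<open>Reading \<open>\<gamma> \<cdot> f = 0\<close> at component \<open>m\<close>
      and inverting the diagonal entry by \<open>v\<close> expresses \<open>q m \<cdot> f\<close> as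
      minus \<open>?k\<close> applied to the remaining components
      \<open>c \<cdot> f\<close>.\<close>
    let ?k = "v \<cdot> (q m \<cdot> (\<gamma> \<cdot> u))"
    have k: "\<guillemotleft>?k : z' \<rightarrow> x m\<guillemotright>" using v(1) iq u(1) \<gamma>(1) by (auto simp: in_hom_iff)
    have "v \<cdot> (q m \<cdot> (\<gamma> \<cdot> (\<iota> m \<cdot> (q m \<cdot> f) \<boxplus> u \<cdot> (c \<cdot> f)))) = zero_mor T a (x m)"
      unfolding fsplit[symmetric] \<gamma>(2) using v(1) iq f(2) by (auto simp: in_hom_iff)
    then have "(v \<cdot> (q m \<cdot> (\<gamma> \<cdot> \<iota> m))) \<cdot> (q m \<cdot> f) \<boxplus> ?k \<cdot> (c \<cdot> f) = zero_mor T a (x m)"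
      using v(1) iq(1,2) u(1,2) \<gamma>(1) f(2) by (simp add: in_hom_iff)
    then have s0: "q m \<cdot> f \<boxplus> ?k \<cdot> (c \<cdot> f) = zero_mor T a (x m)"
      unfolding v(2) using iq(1,2) f(2) by (simp add: in_hom_iff)
    have qf: "q m \<cdot> f = neg_mor (?k \<cdot> (c \<cdot> f))"
    proof (rule neg_unique)
      show "?k \<cdot> (c \<cdot> f) \<boxplus> q m \<cdot> f = zero_mor T (Dom T (?k \<cdot> (c \<cdot> f))) (Cod T (?k \<cdot> (c \<cdot> f)))"
        using s0 iq(1,2) f(2) u(2) k plus_ac(1)[of "?k \<cdot> (c \<cdot> f)" "q m \<cdot> f"] by (simp add: in_hom_iff del: assoc)
    qed (use iq(1,2) f(2) u(2) k in \<open>simp_all add: in_hom_iff del: assoc\<close>)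
    \<comment> \<open>\<open>r\<close> reconstructs \<open>f\<close> from
      \<open>c \<cdot> f\<close>, so whatever factors through \<open>f\<close> factors through
      \<open>c \<cdot> f\<close>.\<close>
    define r where "r = neg_mor (\<iota> m \<cdot> ?k) \<boxplus> u"
    have r: "\<guillemotleft>r : z' \<rightarrow> z\<guillemotright>" using iq(1,2) k u by (auto simp: r_def in_hom_iff simp del: assoc)
    have fr: "f = r \<cdot> (c \<cdot> f)"
    proof -
      have "f = \<iota> m \<cdot> neg_mor (?k \<cdot> (c \<cdot> f)) \<boxplus> u \<cdot> (c \<cdot> f)" using fsplit unfolding qf .
      also have "\<dots> = r \<cdot> (c \<cdot> f)"
        using iq(1,2) k u(1,2) f(2) v(1) \<gamma>(1) by (simp add: r_def in_hom_iff)
      finally show ?thesis .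
    qed
    have cf: "\<guillemotleft>c \<cdot> f : a \<rightarrow> z'\<guillemotright>" using f(2) u by (auto simp: in_hom_iff)
    have "left_approx Y a z' (c \<cdot> f)"
      unfolding left_approx_def
    proof (intro conjI ballI allI impI)
      show "z' \<in> Y" using Yret[OF f(1) u(1,2,3)] .
      show "\<guillemotleft>c \<cdot> f : a \<rightarrow> z'\<guillemotright>" by (rule cf)
      fix y' h assume "y' \<in> Y" "\<guillemotleft>h : a \<rightarrow> y'\<guillemotright>"
      then obtain g where g: "\<guillemotleft>g : z \<rightarrow> y'\<guillemotright>" "h = g \<cdot> f" using f(3) by blast
      have "h = (g \<cdot> r) \<cdot> (c \<cdot> f)"
        unfolding g(2) by (subst fr) (use g(1) r cf in \<open>simp add: in_hom_iff\<close>)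
      then show "\<exists>g. \<guillemotleft>g : z' \<rightarrow> y'\<guillemotright> \<and> h = g \<cdot> (c \<cdot> f)" using g(1) r by (intro exI[of _ "g \<cdot> r"]) (auto simp: in_hom_iff)
    qed
    moreover have "card (I - {m}) < card I"
      using b m by (intro card_Diff1_less) (auto simp: biproduct_def)
    ultimately show ?thesis using less.hyps[of "I - {m}"] b' loc by blast
  qed
qed

end

context two_term
begin

text \<open>\<open>V\<close> plays the role of the torsionfree class, seen in \<open>C\<close>.\<close>

definition ghost_perp :: "'o set \<Rightarrow> 'o set"
  where "ghost_perp V = {c \<in> C. \<forall>d\<in>V. \<forall>g. \<guillemotleft>g : c \<rightarrow> d\<guillemotright> \<longrightarrow> ghost g}"

lemma ghost_perp_retract:
  assumes y: "y \<in> ghost_perp V" and i: "\<guillemotleft>i : x \<rightarrow> y\<guillemotright>" and r: "\<guillemotleft>r : y \<rightarrow> x\<guillemotright>" and ri: "r \<cdot> i = Id T x"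
  shows "x \<in> ghost_perp V"
proof -
  have "x \<in> C" using y i r ri C_retract by (auto simp: ghost_perp_def)
  moreover have "ghost g" if d: "d \<in> V" and g: "\<guillemotleft>g : x \<rightarrow> d\<guillemotright>" for d g
  proof (rule ghostI[OF g])
    fix a u assume a: "a \<in> S" and u: "\<guillemotleft>u : a \<rightarrow> x\<guillemotright>"
    have gr: "\<guillemotleft>g \<cdot> r : y \<rightarrow> d\<guillemotright>" using g r by (auto simp: in_hom_iff)
    then have "ghost (g \<cdot> r)" using y d by (auto simp: ghost_perp_def)
    moreover have "\<guillemotleft>i \<cdot> u : a \<rightarrow> y\<guillemotright>" using i u by (auto simp: in_hom_iff)
    ultimately have 0: "(g \<cdot> r) \<cdot> (i \<cdot> u) = zero_mor T a d" using ghostD[OF _ gr a] by blast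
    have "g \<cdot> u = g \<cdot> ((r \<cdot> i) \<cdot> u)" unfolding ri using u by (simp add: in_hom_iff)
    also have "\<dots> = (g \<cdot> r) \<cdot> (i \<cdot> u)" using g r i u by (simp add: in_hom_iff)
    finally show "g \<cdot> u = zero_mor T a d" using 0 by simp
  qed
  ultimately show ?thesis by (simp add: ghost_perp_def)
qed

text \<open>\<open>g \<cdot> f\<close> is only a ghost, not zero, so \<open>g\<close> need not
  factor through \<open>p\<close>. On a lift \<open>r : b0 \<rightarrow> e\<close> of the
  presentation of \<open>y'\<close> this is repaired: \<open>g \<cdot> r\<close> kills
  \<open>\<sigma>\<close>, hence comes from a morphism on \<open>y'\<close>, which is a ghost. Every
  morphism from \<open>S\<close> to \<open>e\<close> is a sum of one through \<open>r\<close> and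
  one through \<open>f\<close>.\<close>

lemma ghost_perp_ext:
  assumes d: "dist_triangle T y e y' f p h" and y: "y \<in> ghost_perp V" and y': "y' \<in> ghost_perp V"
  shows "e \<in> ghost_perp V"
proof -
  have C: "y \<in> C" "y' \<in> C" using y y' by (auto simp: ghost_perp_def)
  note hd = dist_hom[OF d]
  have "ghost g" if v: "v \<in> V" and g: "\<guillemotleft>g : e \<rightarrow> v\<guillemotright>" for v g
  proof (rule ghostI[OF g])
    fix a u assume a: "a \<in> S" and u: "\<guillemotleft>u : a \<rightarrow> e\<guillemotright>"
    obtain b0 b1 \<sigma> \<alpha> \<beta> where b: "b0 \<in> S" "b1 \<in> S" and d': "dist_triangle T b1 b0 y' \<sigma> \<alpha> \<beta>" using C(2) by (rule C_E)
    note hd' = dist_hom[OF d']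
    have gf: "\<guillemotleft>g \<cdot> f : y \<rightarrow> v\<guillemotright>" using g hd by (auto simp: in_hom_iff)
    then have "ghost (g \<cdot> f)" using y v by (auto simp: ghost_perp_def)
    then have gft: "g \<cdot> (f \<cdot> t) = zero_mor T a' v" if "a' \<in> S" "\<guillemotleft>t : a' \<rightarrow> y\<guillemotright>" for a' t
      using ghostD[OF _ gf that] that g hd by (simp add: in_hom_iff)
    obtain r where r: "\<guillemotleft>r : b0 \<rightarrow> e\<guillemotright>" "\<alpha> = p \<cdot> r" using lift[OF d C(1) b(1) hd'(2)] .
    have r\<sigma>: "\<guillemotleft>r \<cdot> \<sigma> : b1 \<rightarrow> e\<guillemotright>" using r hd' by (auto simp: in_hom_iff)
    have "p \<cdot> (r \<cdot> \<sigma>) = \<alpha> \<cdot> \<sigma>" unfolding r(2) using r(1) hd hd' by (simp add: in_hom_iff)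
    then have "p \<cdot> (r \<cdot> \<sigma>) = zero_mor T b1 y'" using dist_zero(1)[OF d'] by simp
    then obtain t where t: "\<guillemotleft>t : b1 \<rightarrow> y\<guillemotright>" "r \<cdot> \<sigma> = f \<cdot> t" using exact_cov[OF d r\<sigma>] by blast
    have gr: "\<guillemotleft>g \<cdot> r : b0 \<rightarrow> v\<guillemotright>" using g r by (auto simp: in_hom_iff)
    have "(g \<cdot> r) \<cdot> \<sigma> = g \<cdot> (f \<cdot> t)" unfolding t(2)[symmetric] using g r(1) hd' by (simp add: in_hom_iff)
    then have "(g \<cdot> r) \<cdot> \<sigma> = zero_mor T b1 v" using gft[OF b(2) t(1)] by simp
    then obtain k' where k': "\<guillemotleft>k' : y' \<rightarrow> v\<guillemotright>" "g \<cdot> r = k' \<cdot> \<alpha>" using exact_contra[OF d' gr] by blast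
    have "ghost k'" using k'(1) y' v by (auto simp: ghost_perp_def)
    then have gr0: "g \<cdot> r = zero_mor T b0 v" unfolding k'(2) using ghostD[OF _ k'(1) b(1) hd'(2)] by blast
    have "\<guillemotleft>p \<cdot> u : a \<rightarrow> y'\<guillemotright>" using u hd by (auto simp: in_hom_iff)
    then obtain v' where v': "\<guillemotleft>v' : a \<rightarrow> b0\<guillemotright>" "p \<cdot> u = \<alpha> \<cdot> v'" using lift[OF d' S_C[OF b(2)] a] by blast
    have "p \<cdot> (u \<boxplus> neg_mor (r \<cdot> v')) = p \<cdot> u \<boxplus> neg_mor (\<alpha> \<cdot> v')"
      unfolding r(2) using u r(1) v'(1) hd by (simp add: in_hom_iff)
    also have "\<dots> = zero_mor T a y'" unfolding v'(2) using v'(1) hd' by (simp add: in_hom_iff)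
    finally have "p \<cdot> (u \<boxplus> neg_mor (r \<cdot> v')) = zero_mor T a y'" .
    moreover have "\<guillemotleft>u \<boxplus> neg_mor (r \<cdot> v') : a \<rightarrow> e\<guillemotright>" using u r(1) v'(1) by (auto simp: in_hom_iff)
    ultimately obtain t' where t': "\<guillemotleft>t' : a \<rightarrow> y\<guillemotright>" "u \<boxplus> neg_mor (r \<cdot> v') = f \<cdot> t'" using exact_cov[OF d] by blast
    have "u = r \<cdot> v' \<boxplus> f \<cdot> t'" by (rule diff_eq) (use u r(1) v'(1) t' in \<open>auto simp: in_hom_iff\<close>)
    then have "g \<cdot> u = (g \<cdot> r) \<cdot> v' \<boxplus> g \<cdot> (f \<cdot> t')" using g r(1) v'(1) t'(1) hd by (simp add: in_hom_iff)
    also have "\<dots> = zero_mor T a v" unfolding gr0 gft[OF a t'(1)] using v'(1) gr S_Ob[OF a] g by (auto simp: in_hom_iff)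
    finally show "g \<cdot> u = zero_mor T a v" .
  qed
  then show ?thesis using C_ext[OF d C] by (simp add: ghost_perp_def)
qed

text \<open>\<open>F\<close> is zero on \<open>\<Sigma> S\<close>, so every morphism out of
  \<open>\<Sigma> a\<close> is a ghost.\<close>

lemma ghost_perp_shift_S:
  assumes a: "a \<in> S"
  shows "\<Sigma> a \<in> ghost_perp V"
proof -
  have "ghost g" if g: "\<guillemotleft>g : \<Sigma> a \<rightarrow> d\<guillemotright>" for d g
  proof (rule ghostI[OF g])
    fix b u assume b: "b \<in> S" "\<guillemotleft>u : b \<rightarrow> \<Sigma> a\<guillemotright>"
    then have "u = zero_mor T b (\<Sigma> a)" using S_ext a by blast
    then show "g \<cdot> u = zero_mor T b d" using g S_Ob b by (auto simp: in_hom_iff)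
  qed
  then show ?thesis using shift_S_C[OF a] by (simp add: ghost_perp_def)
qed

text \<open>For \<open>\<delta>\<close> in \<open>T(x, \<Sigma> y')\<close>, the extension of class
  \<open>\<delta> \<cdot> p\<close> has its middle term in \<open>Y\<close>, so \<open>f\<close>
  lifts to it and the lift factors through \<open>f\<close>. Almost minimality then forces
  \<open>\<delta> \<cdot> p = 0\<close>. Thus \<open>\<delta>\<close> comes from some
  \<open>w : a \<rightarrow> y'\<close>, which extends along \<open>f\<close> and so represents the
  zero class.\<close>

lemma wakamatsu:
  assumes ks: "krull_schmidt T" and Y: "Y = ghost_perp V"
    and a: "a \<in> S" and f0: "left_approx Y a y0 f0"
  obtains y x f p h where "y \<in> Y" "x \<in> left_ext_perp Y" "dist_triangle T a y x f p h"
proof -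
  have YC: "Y \<subseteq> C" by (auto simp: Y ghost_perp_def)
  have "y0 \<in> Ob T" using left_approxD(1)[OF f0] YC C_Ob by blast
  then obtain xs where xs: "is_dsum T y0 xs" "\<forall>x\<in>set xs. local_ring (End_ring T x)"
    using ks unfolding krull_schmidt_def by blast
  obtain \<iota> q where b: "biproduct y0 {..<length xs} (\<lambda>i. xs ! i) \<iota> q" using xs(1) by (auto simp: is_dsum_iff)
  obtain y f where "left_approx Y a y f" and min: "almost_minimal a y f"
    using minimal_approx[of Y, OF _ b _ f0] ghost_perp_retract xs(2) unfolding Y by (metis lessThan_iff nth_mem)
  note f = left_approxD[OF this(1)]
  obtain x p h where d: "dist_triangle T a y x f p h" using TR1_cone[OF f(2)] by blast
  note hd = dist_hom[OF d]
  have aO: "a \<in> Ob T" using S_Ob[OF a] .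
  have "x \<in> C" using C_cone[OF d a] f(1) YC by blast
  moreover have "ext_zero x y'" if y': "y' \<in> Y" for y'
    unfolding ext_zero_def
  proof (intro allI impI)
    fix \<delta> assume \<delta>: "\<guillemotleft>\<delta> : x \<rightarrow> \<Sigma> y'\<guillemotright>"
    have y'O: "y' \<in> Ob T" using y' YC C_Ob by blast
    have \<delta>p: "\<guillemotleft>\<delta> \<cdot> p : y \<rightarrow> \<Sigma> y'\<guillemotright>" using \<delta> hd by (auto simp: in_hom_iff)
    obtain e i \<pi> where de: "dist_triangle T y' e y i \<pi> (\<delta> \<cdot> p)" using cocone[OF \<delta>p y'O] by blast
    note he = dist_hom[OF de]
    have e: "e \<in> Y" unfolding Y by (rule ghost_perp_ext[OF de]) (use y' f(1) Y in auto)
    have "(\<delta> \<cdot> p) \<cdot> f = \<delta> \<cdot> (p \<cdot> f)" using \<delta> hd by (simp add: in_hom_iff)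
    also have "\<dots> = zero_mor T a (\<Sigma> y')" unfolding dist_zero(1)[OF d] using \<delta> aO by (auto simp: in_hom_iff)
    finally obtain f' where f': "\<guillemotleft>f' : a \<rightarrow> e\<guillemotright>" "f = \<pi> \<cdot> f'" using exact_cov2[OF de f(2)] by blast
    obtain g where g: "\<guillemotleft>g : y \<rightarrow> e\<guillemotright>" "f' = g \<cdot> f" using f(3)[OF e f'(1)] by blast
    \<comment> \<open>\<open>\<pi> \<cdot> g\<close> fixes \<open>f\<close>, so
      \<open>?\<gamma>\<close> kills \<open>f\<close>; and \<open>\<delta> \<cdot> p\<close> kills
      \<open>\<pi>\<close>, so composing it with \<open>?\<gamma>\<close> does not change it. This
      is the situation of \<open>almost_minimal\<close>.\<close>
    let ?\<gamma> = "Id T y \<boxplus> neg_mor (\<pi> \<cdot> g)"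
    have \<gamma>: "\<guillemotleft>?\<gamma> : y \<rightarrow> y\<guillemotright>" using g(1) he by (auto simp: in_hom_iff)
    have pgf: "\<pi> \<cdot> (g \<cdot> f) = f" using f'(2) g(2) by simp
    have "?\<gamma> \<cdot> f = zero_mor T a y" using f(2) g(1) he pgf by (simp add: in_hom_iff)
    moreover have "\<delta> \<cdot> p = (\<delta> \<cdot> p) \<cdot> ?\<gamma>"
    proof -
      have "(\<delta> \<cdot> p) \<cdot> ?\<gamma> = \<delta> \<cdot> p \<boxplus> neg_mor ((\<delta> \<cdot> p) \<cdot> (\<pi> \<cdot> g))"
        using g(1) he \<delta>p by (simp add: in_hom_iff del: assoc)
      also have "(\<delta> \<cdot> p) \<cdot> (\<pi> \<cdot> g) = zero_mor T y (\<Sigma> y')"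
        using reassoc[OF dist_zero(2)[OF de], of g] g(1) he y'O by (simp add: in_hom_iff del: assoc)
      finally show ?thesis using \<delta>p by (auto simp: in_hom_iff simp del: assoc)
    qed
    ultimately have \<delta>p0: "\<delta> \<cdot> p = zero_mor T y (\<Sigma> y')" using min \<delta>p \<gamma> unfolding almost_minimal_def by blast
    obtain \<epsilon> where \<epsilon>: "\<guillemotleft>\<epsilon> : \<Sigma> a \<rightarrow> \<Sigma> y'\<guillemotright>" "\<delta> = \<epsilon> \<cdot> h" using exact_contra2[OF d \<delta> \<delta>p0] .
    obtain w where w: "\<guillemotleft>w : a \<rightarrow> y'\<guillemotright>" "\<epsilon> = shift_mor T w" using shift_full[OF \<epsilon>(1) aO y'O] .
    obtain g' where g': "\<guillemotleft>g' : y \<rightarrow> y'\<guillemotright>" "w = g' \<cdot> f" using f(3)[OF y' w(1)] by blast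
    have "\<delta> = shift_mor T g' \<cdot> (shift_mor T f \<cdot> h)" unfolding \<epsilon>(2) w(2) g'(2) using g'(1) hd by (simp add: in_hom_iff)
    then show "\<delta> = zero_mor T x (\<Sigma> y')" unfolding dist_zero(3)[OF d] using g'(1) hd by (auto simp: in_hom_iff)
  qed
  ultimately have "x \<in> left_ext_perp Y" by (simp add: left_ext_perp_def)
  then show thesis using that[OF f(1) _ d] by blast
qed

theorem ghost_perp_cotorsion_pair:
  assumes ks: "krull_schmidt T" and Y: "Y = ghost_perp V"
    and approx: "\<And>a. a \<in> S \<Longrightarrow> \<exists>y f. left_approx Y a y f"
  shows "complete_cotorsion_pair T C (left_ext_perp Y) Y"
proof -
  let ?X = "left_ext_perp Y"
  have YC: "Y \<subseteq> C" by (auto simp: Y ghost_perp_def)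
  have tri: "\<exists>y x f p h. y \<in> Y \<and> x \<in> ?X \<and> dist_triangle T a y x f p h" if "a \<in> S" for a
    using approx[OF that] wakamatsu[OF ks Y that] by metis
  have T1: "\<exists>x\<in>?X. \<exists>y\<in>Y. \<exists>f g h. dist_triangle T c y x f g h" if c: "c \<in> C" for c
  proof -
    obtain s0 s1 \<sigma> \<alpha> \<beta> where *: "s0 \<in> S" "s1 \<in> S" and d: "dist_triangle T s1 s0 c \<sigma> \<alpha> \<beta>" using c by (rule C_E)
    obtain y x v j j' where y: "y \<in> Y" "x \<in> ?X" and d': "dist_triangle T s0 y x v j j'" using tri[OF *(1)] by blast
    \<comment> \<open>The octahedron on \<open>s1 \<rightarrow> s0 \<rightarrow> y\<close>: the cone
      \<open>e\<close> of the composite is an extension of \<open>\<Sigma> s1\<close> by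
      \<open>y\<close> and receives \<open>c\<close> with cone \<open>x\<close>.\<close>
    have "\<guillemotleft>v \<cdot> \<sigma> : s1 \<rightarrow> y\<guillemotright>" using dist_hom[OF d] dist_hom[OF d'] by (auto simp: in_hom_iff)
    then obtain e l l' where d'': "dist_triangle T s1 y e (v \<cdot> \<sigma>) l l'" using TR1_cone by blast
    obtain p q m where o: "dist_triangle T c e x p q m" using TR4[OF d d' d''] by blast
    have "e \<in> Y"
      unfolding Y by (rule ghost_perp_ext[OF rotate[OF d''] _ ghost_perp_shift_S[OF *(2)]]) (use y Y in simp)
    then show ?thesis using o y by blast
  qed
  have T2: "\<exists>x\<in>?X. \<exists>y\<in>Y. \<exists>f g h. dist_triangle T y x c f g h" if c: "c \<in> C" for c
  proof -
    obtain s0 s1 \<sigma> \<alpha> \<beta> where *: "s0 \<in> S" "s1 \<in> S" and d: "dist_triangle T s1 s0 c \<sigma> \<alpha> \<beta>" using c by (rule C_E)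
    obtain y x v j j' where y: "y \<in> Y" "x \<in> ?X" and d': "dist_triangle T s1 y x v j j'" using tri[OF *(2)] by blast
    have yC: "y \<in> C" using y YC by blast
    \<comment> \<open>The octahedron on
      \<open>c \<rightarrow> \<Sigma> s1 \<rightarrow> \<Sigma> y\<close>, one shift above the
      wanted triangle: the cone of the composite is \<open>\<Sigma> e\<close> up to isomorphism and
      an extension of \<open>\<Sigma> x\<close> by \<open>\<Sigma> s0\<close>. Both ends are left
      Ext-orthogonal to shifts of objects of \<open>Y\<close>, hence \<open>e\<close> is so to
      \<open>Y\<close>.\<close>
    let ?v = "neg_mor (shift_mor T v)"
    note d1 = rotate[OF rotate[OF d]] and d2 = rotate[OF rotate[OF rotate[OF d']]]
    have "\<guillemotleft>?v \<cdot> \<beta> : c \<rightarrow> \<Sigma> y\<guillemotright>" using dist_hom[OF d] dist_hom[OF d'] by (auto simp: in_hom_iff)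
    then obtain b' l l' where d3: "dist_triangle T c (\<Sigma> y) b' (?v \<cdot> \<beta>) l l'" using TR1_cone by blast
    obtain p q m where o: "dist_triangle T (\<Sigma> s0) b' (\<Sigma> x) p q m" using TR4[OF d1 d2 d3] by blast
    have b'O: "b' \<in> Ob T" using dist_hom[OF o] by (auto simp: in_hom_iff)
    obtain e u w where e: "e \<in> Ob T" "\<guillemotleft>u : \<Sigma> e \<rightarrow> b'\<guillemotright>" "\<guillemotleft>w : b' \<rightarrow> \<Sigma> e\<guillemotright>" "w \<cdot> u = Id T (\<Sigma> e)" "u \<cdot> w = Id T b'"
      using shift_dense[OF b'O] .
    obtain f g where de: "dist_triangle T y e c f g (?v \<cdot> \<beta>)"
      using unrotate[OF d3 refl C_Ob[OF yC] e(1) e(3,2,5,4)] .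
    have eC: "e \<in> C" by (rule C_ext[OF de yC c])
    have "ext_zero e y'" if y': "y' \<in> Y" for y'
    proof -
      have y'C: "y' \<in> C" "y' \<in> Ob T" using y' YC C_Ob by auto
      have "ext_zero s0 y'" "ext_zero x y'" using ext_zero_S[OF *(1) y'C(1)] y(2) y' by (auto simp: left_ext_perp_def)
      moreover have "x \<in> Ob T" using dist_hom[OF d'] by (auto simp: in_hom_iff)
      ultimately have "ext_zero (\<Sigma> s0) (\<Sigma> y')" "ext_zero (\<Sigma> x) (\<Sigma> y')" using ext_zero_shift y'C S_Ob[OF *(1)] by auto
      then have "ext_zero b' (\<Sigma> y')" by (rule ext_zero_left[OF o])
      then have "ext_zero (\<Sigma> e) (\<Sigma> y')" using ext_zero_retract_left[OF _ _ e(2-4)] y'C by simp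
      then show ?thesis using ext_zero_shift y'C e(1) by blast
    qed
    then have "e \<in> ?X" using eC by (simp add: left_ext_perp_def)
    then show ?thesis using de y by blast
  qed
  have "Y = right_ext_perp ?X"
  proof
    show "Y \<subseteq> right_ext_perp ?X" using YC by (auto simp: right_ext_perp_def left_ext_perp_def)
    show "right_ext_perp ?X \<subseteq> Y"
    proof
      fix c assume "c \<in> right_ext_perp ?X"
      then have c: "c \<in> C" "\<And>x. x \<in> ?X \<Longrightarrow> ext_zero x c" by (auto simp: right_ext_perp_def)
      obtain x y f g h where *: "x \<in> ?X" "y \<in> Y" and d: "dist_triangle T c y x f g h" using T1[OF c(1)] by blast
      have "h = zero_mor T x (\<Sigma> c)" by (rule ext_zeroD[OF c(2)[OF *(1)] dist_hom(3)[OF d]])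
      from split_triangle[OF d this] obtain i r where "\<guillemotleft>i : c \<rightarrow> y\<guillemotright>" "\<guillemotleft>r : y \<rightarrow> c\<guillemotright>" "r \<cdot> i = Id T c"
        by (auto elim: is_dsum_pairE)
      then show "c \<in> Y" using ghost_perp_retract[of y V] *(2) Y by blast
    qed
  qed
  then show ?thesis unfolding cotorsion_pair_iff using T1 T2 by blast
qed

end

section \<open>The category of finitely presented functors\<close>

lemma module_homs_zero:
  assumes "module k M" "module k N" "h \<in> module_homs k M N"
  shows "h \<zero>\<^bsub>M\<^esub> = \<zero>\<^bsub>N\<^esub>"
proof -
  interpret M: module k M by fact
  interpret N: module k N by fact
  have h: "h \<zero>\<^bsub>M\<^esub> \<in> carrier N" "h (\<zero>\<^bsub>M\<^esub> \<oplus>\<^bsub>M\<^esub> \<zero>\<^bsub>M\<^esub>) = h \<zero>\<^bsub>M\<^esub> \<oplus>\<^bsub>N\<^esub> h \<zero>\<^bsub>M\<^esub>"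
    using assms(3) M.M.zero_closed by (auto simp: module_homs_def simp del: M.M.l_zero M.M.r_zero)
  then show ?thesis by (metis M.M.l_zero M.M.zero_closed N.M.add.l_cancel_one')
qed

lemma module_homs_diff:
  assumes "module k M" "module k N" "h \<in> module_homs k M N" "x \<in> carrier M" "y \<in> carrier M"
  shows "h (x \<ominus>\<^bsub>M\<^esub> y) = h x \<ominus>\<^bsub>N\<^esub> h y"
proof -
  interpret M: module k M by fact
  interpret N: module k N by fact
  have h: "h u \<in> carrier N" "h (u \<oplus>\<^bsub>M\<^esub> v) = h u \<oplus>\<^bsub>N\<^esub> h v" if "u \<in> carrier M" "v \<in> carrier M" for u v
    using assms(3) that by (auto simp: module_homs_def)
  have "h (x \<ominus>\<^bsub>M\<^esub> y) \<oplus>\<^bsub>N\<^esub> h y = h ((x \<ominus>\<^bsub>M\<^esub> y) \<oplus>\<^bsub>M\<^esub> y)"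
    using assms(4,5) h(2)[of "x \<ominus>\<^bsub>M\<^esub> y" y] by simp
  also have "(x \<ominus>\<^bsub>M\<^esub> y) \<oplus>\<^bsub>M\<^esub> y = x"
    using assms(4,5) by (simp add: M.M.minus_eq M.M.a_assoc M.M.l_neg)
  finally have "h (x \<ominus>\<^bsub>M\<^esub> y) \<oplus>\<^bsub>N\<^esub> h y = h x" .
  then show ?thesis using assms(4,5) h(1)[of "x \<ominus>\<^bsub>M\<^esub> y" y] h(1)[of y y] h(1)[of x x]
    by (metis M.M.minus_closed N.M.add.inv_closed N.M.add.inv_solve_right N.M.minus_eq)
qed

locale functor_category =
  fixes k :: "('k, 'r) ring_scheme" and A :: "('k, 'o, 'm, 'z) lincat_scheme"
    and H :: "('k, ('k, 'o, 'm, 'x) modfunc, ('k, 'o, 'm, 'x) modmor) lincat" (structure)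
  assumes H_def: "H = mod_cat k A"
begin

definition app :: "('k, 'o, 'm, 'x) modmor \<Rightarrow> 'o \<Rightarrow> 'x \<Rightarrow> 'x"
  where "app \<phi> = snd (snd \<phi>)"

lemma ObD:
  assumes "M \<in> Ob H"
  shows "additive_cofunctor k A M" "\<And>a. a \<in> Ob A \<Longrightarrow> module k (FOb M a)"
    "\<And>f a b. \<guillemotleft>f : a \<rightarrow>\<^bsub>A\<^esub> b\<guillemotright> \<Longrightarrow> FMor M f \<in> module_homs k (FOb M b) (FOb M a)"
  using assms by (auto simp: H_def mod_cat_def fin_pres_cofunctor_def additive_cofunctor_def)

lemma add_closed: "M \<in> Ob H \<Longrightarrow> a \<in> Ob A \<Longrightarrow> x \<in> carrier (FOb M a) \<Longrightarrow> y \<in> carrier (FOb M a) \<Longrightarrow>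
    x \<oplus>\<^bsub>FOb M a\<^esub> y \<in> carrier (FOb M a)"
  and smult_closed: "M \<in> Ob H \<Longrightarrow> a \<in> Ob A \<Longrightarrow> r \<in> carrier k \<Longrightarrow> x \<in> carrier (FOb M a) \<Longrightarrow>
    r \<odot>\<^bsub>FOb M a\<^esub> x \<in> carrier (FOb M a)"
  and diff_closed: "M \<in> Ob H \<Longrightarrow> a \<in> Ob A \<Longrightarrow> x \<in> carrier (FOb M a) \<Longrightarrow> y \<in> carrier (FOb M a) \<Longrightarrow>
    x \<ominus>\<^bsub>FOb M a\<^esub> y \<in> carrier (FOb M a)"
  and diff_eq_zero: "M \<in> Ob H \<Longrightarrow> a \<in> Ob A \<Longrightarrow> x \<in> carrier (FOb M a) \<Longrightarrow> y \<in> carrier (FOb M a) \<Longrightarrow>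
    x \<ominus>\<^bsub>FOb M a\<^esub> y = \<zero>\<^bsub>FOb M a\<^esub> \<longleftrightarrow> x = y"
proof -
  assume M: "M \<in> Ob H" "a \<in> Ob A"
  interpret module k "FOb M a" using ObD(2)[OF M] .
  show "x \<in> carrier (FOb M a) \<Longrightarrow> y \<in> carrier (FOb M a) \<Longrightarrow> x \<oplus>\<^bsub>FOb M a\<^esub> y \<in> carrier (FOb M a)"
    "r \<in> carrier k \<Longrightarrow> x \<in> carrier (FOb M a) \<Longrightarrow> r \<odot>\<^bsub>FOb M a\<^esub> x \<in> carrier (FOb M a)"
    "x \<in> carrier (FOb M a) \<Longrightarrow> y \<in> carrier (FOb M a) \<Longrightarrow> x \<ominus>\<^bsub>FOb M a\<^esub> y \<in> carrier (FOb M a)"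
    by auto
  assume x: "x \<in> carrier (FOb M a)" and y: "y \<in> carrier (FOb M a)"
  have "x = (x \<ominus>\<^bsub>FOb M a\<^esub> y) \<oplus>\<^bsub>FOb M a\<^esub> y"
    using x y by (simp add: M.minus_eq M.a_assoc M.l_neg)
  then show "x \<ominus>\<^bsub>FOb M a\<^esub> y = \<zero>\<^bsub>FOb M a\<^esub> \<longleftrightarrow> x = y"
    using x y by (auto simp: M.minus_eq M.r_neg)
qed

lemma FMor_closed: "M \<in> Ob H \<Longrightarrow> \<guillemotleft>f : a \<rightarrow>\<^bsub>A\<^esub> b\<guillemotright> \<Longrightarrow> x \<in> carrier (FOb M b) \<Longrightarrow> FMor M f x \<in> carrier (FOb M a)"
  using ObD(3) by (fastforce simp: module_homs_def)

lemma in_H_iff: "\<guillemotleft>\<phi> : M \<rightarrow> N\<guillemotright> \<longleftrightarrow> M \<in> Ob H \<and> N \<in> Ob H \<and> (\<exists>\<eta>. \<phi> = (M, N, \<eta>) \<and> \<eta> \<in> nat_trans k A M N)"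
  by (auto simp: in_hom_def H_def mod_cat_def)

lemma carrier_H: "M \<in> Ob H \<Longrightarrow> N \<in> Ob H \<Longrightarrow> carrier (Hom H M N) = {\<phi>. \<guillemotleft>\<phi> : M \<rightarrow> N\<guillemotright>}"
  by (auto simp: in_hom_def)

lemma app_hom: "\<guillemotleft>\<phi> : M \<rightarrow> N\<guillemotright> \<Longrightarrow> a \<in> Ob A \<Longrightarrow> app \<phi> a \<in> module_homs k (FOb M a) (FOb N a)"
  by (auto simp: in_H_iff app_def nat_trans_def)

lemma app_closed: "\<guillemotleft>\<phi> : M \<rightarrow> N\<guillemotright> \<Longrightarrow> a \<in> Ob A \<Longrightarrow> x \<in> carrier (FOb M a) \<Longrightarrow> app \<phi> a x \<in> carrier (FOb N a)"
  using app_hom[of \<phi> M N a] by (auto simp: module_homs_def)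

lemma app_add: "\<guillemotleft>\<phi> : M \<rightarrow> N\<guillemotright> \<Longrightarrow> a \<in> Ob A \<Longrightarrow> x \<in> carrier (FOb M a) \<Longrightarrow> y \<in> carrier (FOb M a) \<Longrightarrow>
    app \<phi> a (x \<oplus>\<^bsub>FOb M a\<^esub> y) = app \<phi> a x \<oplus>\<^bsub>FOb N a\<^esub> app \<phi> a y"
  using app_hom[of \<phi> M N a] by (auto simp: module_homs_def)

lemma app_smult: "\<guillemotleft>\<phi> : M \<rightarrow> N\<guillemotright> \<Longrightarrow> a \<in> Ob A \<Longrightarrow> r \<in> carrier k \<Longrightarrow> x \<in> carrier (FOb M a) \<Longrightarrow>
    app \<phi> a (r \<odot>\<^bsub>FOb M a\<^esub> x) = r \<odot>\<^bsub>FOb N a\<^esub> app \<phi> a x"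
  using app_hom[of \<phi> M N a] by (auto simp: module_homs_def)

lemma app_natural: "\<guillemotleft>\<phi> : M \<rightarrow> N\<guillemotright> \<Longrightarrow> \<guillemotleft>f : a \<rightarrow>\<^bsub>A\<^esub> b\<guillemotright> \<Longrightarrow> x \<in> carrier (FOb M b) \<Longrightarrow>
    app \<phi> a (FMor M f x) = FMor N f (app \<phi> b x)"
  by (auto simp: in_H_iff app_def nat_trans_def)

lemma app_zero: "\<guillemotleft>\<phi> : M \<rightarrow> N\<guillemotright> \<Longrightarrow> a \<in> Ob A \<Longrightarrow> app \<phi> a \<zero>\<^bsub>FOb M a\<^esub> = \<zero>\<^bsub>FOb N a\<^esub>"
  by (rule module_homs_zero[OF _ _ app_hom]) (auto simp: in_H_iff ObD)

lemma app_diff: "\<guillemotleft>\<phi> : M \<rightarrow> N\<guillemotright> \<Longrightarrow> a \<in> Ob A \<Longrightarrow> x \<in> carrier (FOb M a) \<Longrightarrow> y \<in> carrier (FOb M a) \<Longrightarrow>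
    app \<phi> a (x \<ominus>\<^bsub>FOb M a\<^esub> y) = app \<phi> a x \<ominus>\<^bsub>FOb N a\<^esub> app \<phi> a y"
  by (rule module_homs_diff[OF _ _ app_hom]) (auto simp: in_H_iff ObD)

lemma mor_eqI:
  assumes "\<guillemotleft>\<phi> : M \<rightarrow> N\<guillemotright>" "\<guillemotleft>\<psi> : M \<rightarrow> N\<guillemotright>" "\<And>a x. a \<in> Ob A \<Longrightarrow> x \<in> carrier (FOb M a) \<Longrightarrow> app \<phi> a x = app \<psi> a x"
  shows "\<phi> = \<psi>"
proof -
  obtain \<eta> \<theta> where *: "\<phi> = (M, N, \<eta>)" "\<eta> \<in> nat_trans k A M N" "\<psi> = (M, N, \<theta>)" "\<theta> \<in> nat_trans k A M N"
    using assms(1,2) by (auto simp: in_H_iff)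
  have "\<eta> a = \<theta> a" if a: "a \<in> Ob A" for a
    by (rule extensionalityI[of _ "carrier (FOb M a)"]) (use * a assms(3) in \<open>auto simp: nat_trans_def app_def\<close>)
  then have "\<eta> = \<theta>"
    by (intro extensionalityI[of _ "Ob A"]) (use * in \<open>auto simp: nat_trans_def\<close>)
  then show ?thesis using * by simp
qed

text \<open>Morphisms are tagged extensional families. Together with \<open>mor_eqI\<close> this
  reduces their construction and comparison to pointwise formulas on the carriers.\<close>

lemma mor_exists:
  assumes M: "M \<in> Ob H" and N: "N \<in> Ob H"
    and closed: "\<And>a x. a \<in> Ob A \<Longrightarrow> x \<in> carrier (FOb M a) \<Longrightarrow> t a x \<in> carrier (FOb N a)"
    and add: "\<And>a x y. a \<in> Ob A \<Longrightarrow> x \<in> carrier (FOb M a) \<Longrightarrow> y \<in> carrier (FOb M a) \<Longrightarrow>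
      t a (x \<oplus>\<^bsub>FOb M a\<^esub> y) = t a x \<oplus>\<^bsub>FOb N a\<^esub> t a y"
    and smult: "\<And>a r x. a \<in> Ob A \<Longrightarrow> r \<in> carrier k \<Longrightarrow> x \<in> carrier (FOb M a) \<Longrightarrow>
      t a (r \<odot>\<^bsub>FOb M a\<^esub> x) = r \<odot>\<^bsub>FOb N a\<^esub> t a x"
    and nat: "\<And>f a b x. \<guillemotleft>f : a \<rightarrow>\<^bsub>A\<^esub> b\<guillemotright> \<Longrightarrow> x \<in> carrier (FOb M b) \<Longrightarrow> t a (FMor M f x) = FMor N f (t b x)"
  obtains \<phi> where "\<guillemotleft>\<phi> : M \<rightarrow> N\<guillemotright>" "\<And>a x. a \<in> Ob A \<Longrightarrow> x \<in> carrier (FOb M a) \<Longrightarrow> app \<phi> a x = t a x"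
proof -
  let ?\<eta> = "\<lambda>a\<in>Ob A. \<lambda>x\<in>carrier (FOb M a). t a x"
  note cl = add_closed[OF M] smult_closed[OF M]
  have "?\<eta> \<in> nat_trans k A M N"
    unfolding nat_trans_def
  proof (intro CollectI conjI ballI allI impI)
    fix a assume a: "a \<in> Ob A"
    show "?\<eta> a \<in> module_homs k (FOb M a) (FOb N a) \<inter> extensional (carrier (FOb M a))"
      using a by (auto simp: module_homs_def closed add smult cl)
  next
    fix a b f x assume f: "\<guillemotleft>f : a \<rightarrow>\<^bsub>A\<^esub> b\<guillemotright>" and x: "x \<in> carrier (FOb M b)"
    then have "a \<in> Ob A" "b \<in> Ob A" by (auto simp: in_hom_def)
    then show "?\<eta> a (FMor M f x) = FMor N f (?\<eta> b x)" using nat[OF f x] FMor_closed[OF M f x] x by simp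
  qed simp
  then have "\<guillemotleft>(M, N, ?\<eta>) : M \<rightarrow> N\<guillemotright>" using M N by (simp add: in_H_iff)
  then show thesis by (rule that) (simp add: app_def)
qed

lemma Cmp_H:
  assumes "\<guillemotleft>\<phi> : M \<rightarrow> N\<guillemotright>" "\<guillemotleft>\<psi> : N \<rightarrow> P\<guillemotright>"
  shows "\<guillemotleft>\<psi> \<cdot> \<phi> : M \<rightarrow> P\<guillemotright>" "\<And>a x. a \<in> Ob A \<Longrightarrow> x \<in> carrier (FOb M a) \<Longrightarrow> app (\<psi> \<cdot> \<phi>) a x = app \<psi> a (app \<phi> a x)"
proof -
  have Ob: "M \<in> Ob H" "P \<in> Ob H" using assms by (auto simp: in_H_iff)
  obtain \<chi> where \<chi>: "\<guillemotleft>\<chi> : M \<rightarrow> P\<guillemotright>" "\<And>a x. a \<in> Ob A \<Longrightarrow> x \<in> carrier (FOb M a) \<Longrightarrow> app \<chi> a x = app \<psi> a (app \<phi> a x)"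
    by (rule mor_exists[OF Ob, where t="\<lambda>a x. app \<psi> a (app \<phi> a x)"])
      (use assms in \<open>auto simp: app_closed[OF assms(1)] app_closed[OF assms(2)] app_add[OF assms(1)] app_add[OF assms(2)]
        app_smult[OF assms(1)] app_smult[OF assms(2)] app_natural[OF assms(1)] app_natural[OF assms(2)] in_hom_def[of A]\<close>)
  obtain \<eta> \<theta> \<zeta> where *: "\<phi> = (M, N, \<eta>)" "\<psi> = (N, P, \<theta>)" "\<chi> = (M, P, \<zeta>)" "\<zeta> \<in> nat_trans k A M P"
    using assms \<chi> by (auto simp: in_H_iff)
  have "(\<lambda>a\<in>Ob A. \<lambda>x\<in>carrier (FOb M a). \<theta> a (\<eta> a x)) = \<zeta>"
  proof (rule extensionalityI[of _ "Ob A"])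
    fix a assume a: "a \<in> Ob A"
    show "(\<lambda>a\<in>Ob A. \<lambda>x\<in>carrier (FOb M a). \<theta> a (\<eta> a x)) a = \<zeta> a"
      by (rule extensionalityI[of _ "carrier (FOb M a)"]) (use a * \<chi>(2) in \<open>auto simp: nat_trans_def app_def\<close>)
  qed (use * in \<open>auto simp: nat_trans_def\<close>)
  then have "\<psi> \<cdot> \<phi> = \<chi>" by (simp add: * H_def mod_cat_def)
  then show "\<guillemotleft>\<psi> \<cdot> \<phi> : M \<rightarrow> P\<guillemotright>" "\<And>a x. a \<in> Ob A \<Longrightarrow> x \<in> carrier (FOb M a) \<Longrightarrow> app (\<psi> \<cdot> \<phi>) a x = app \<psi> a (app \<phi> a x)"
    using \<chi> by auto
qed

lemma Id_H:
  assumes M: "M \<in> Ob H"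
  shows "\<guillemotleft>Id H M : M \<rightarrow> M\<guillemotright>" "\<And>a x. a \<in> Ob A \<Longrightarrow> x \<in> carrier (FOb M a) \<Longrightarrow> app (Id H M) a x = x"
proof -
  obtain \<chi> where \<chi>: "\<guillemotleft>\<chi> : M \<rightarrow> M\<guillemotright>" "\<And>a x. a \<in> Ob A \<Longrightarrow> x \<in> carrier (FOb M a) \<Longrightarrow> app \<chi> a x = x"
    by (rule mor_exists[OF M M, where t="\<lambda>a x. x"]) auto
  obtain \<zeta> where *: "\<chi> = (M, M, \<zeta>)" "\<zeta> \<in> nat_trans k A M M" using \<chi> by (auto simp: in_H_iff)
  have "(\<lambda>a\<in>Ob A. \<lambda>x\<in>carrier (FOb M a). x) = \<zeta>"
  proof (rule extensionalityI[of _ "Ob A"])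
    fix a assume a: "a \<in> Ob A"
    show "(\<lambda>a\<in>Ob A. \<lambda>x\<in>carrier (FOb M a). x) a = \<zeta> a"
      by (rule extensionalityI[of _ "carrier (FOb M a)"]) (use a * \<chi>(2) in \<open>auto simp: nat_trans_def app_def\<close>)
  qed (use * in \<open>auto simp: nat_trans_def\<close>)
  then have "Id H M = \<chi>" by (simp add: * H_def mod_cat_def)
  then show "\<guillemotleft>Id H M : M \<rightarrow> M\<guillemotright>" "\<And>a x. a \<in> Ob A \<Longrightarrow> x \<in> carrier (FOb M a) \<Longrightarrow> app (Id H M) a x = x"
    using \<chi> by auto
qed

lemma zero_H:
  assumes M: "M \<in> Ob H" and N: "N \<in> Ob H"
  shows "\<guillemotleft>zero_mor H M N : M \<rightarrow> N\<guillemotright>" "\<And>a x. a \<in> Ob A \<Longrightarrow> x \<in> carrier (FOb M a) \<Longrightarrow> app (zero_mor H M N) a x = \<zero>\<^bsub>FOb N a\<^esub>"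
proof -
  have N_zero: "\<zero>\<^bsub>FOb N a\<^esub> \<in> carrier (FOb N a)" "\<zero>\<^bsub>FOb N a\<^esub> \<oplus>\<^bsub>FOb N a\<^esub> \<zero>\<^bsub>FOb N a\<^esub> = \<zero>\<^bsub>FOb N a\<^esub>"
    "\<And>r. r \<in> carrier k \<Longrightarrow> r \<odot>\<^bsub>FOb N a\<^esub> \<zero>\<^bsub>FOb N a\<^esub> = \<zero>\<^bsub>FOb N a\<^esub>" if "a \<in> Ob A" for a
  proof -
    interpret module k "FOb N a" using ObD(2)[OF N that] .
    show "\<zero>\<^bsub>FOb N a\<^esub> \<in> carrier (FOb N a)" "\<zero>\<^bsub>FOb N a\<^esub> \<oplus>\<^bsub>FOb N a\<^esub> \<zero>\<^bsub>FOb N a\<^esub> = \<zero>\<^bsub>FOb N a\<^esub>"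
      "\<And>r. r \<in> carrier k \<Longrightarrow> r \<odot>\<^bsub>FOb N a\<^esub> \<zero>\<^bsub>FOb N a\<^esub> = \<zero>\<^bsub>FOb N a\<^esub>" by simp_all
  qed
  have nat: "\<zero>\<^bsub>FOb N a\<^esub> = FMor N f \<zero>\<^bsub>FOb N b\<^esub>" if f: "\<guillemotleft>f : a \<rightarrow>\<^bsub>A\<^esub> b\<guillemotright>" for f a b
    using module_homs_zero[OF _ _ ObD(3)[OF N f]] ObD(2)[OF N] f by (simp add: in_hom_def)
  obtain \<chi> where \<chi>: "\<guillemotleft>\<chi> : M \<rightarrow> N\<guillemotright>" "\<And>a x. a \<in> Ob A \<Longrightarrow> x \<in> carrier (FOb M a) \<Longrightarrow> app \<chi> a x = \<zero>\<^bsub>FOb N a\<^esub>"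
    by (rule mor_exists[OF M N, where t="\<lambda>a x. \<zero>\<^bsub>FOb N a\<^esub>"]) (use N_zero nat in auto)
  obtain \<zeta> where *: "\<chi> = (M, N, \<zeta>)" "\<zeta> \<in> nat_trans k A M N" using \<chi> by (auto simp: in_H_iff)
  have "(\<lambda>a\<in>Ob A. \<lambda>x\<in>carrier (FOb M a). \<zero>\<^bsub>FOb N a\<^esub>) = \<zeta>"
  proof (rule extensionalityI[of _ "Ob A"])
    fix a assume a: "a \<in> Ob A"
    show "(\<lambda>a\<in>Ob A. \<lambda>x\<in>carrier (FOb M a). \<zero>\<^bsub>FOb N a\<^esub>) a = \<zeta> a"
      by (rule extensionalityI[of _ "carrier (FOb M a)"]) (use a * \<chi>(2) in \<open>auto simp: nat_trans_def app_def\<close>)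
  qed (use * in \<open>auto simp: nat_trans_def\<close>)
  then have "zero_mor H M N = \<chi>" by (simp add: * H_def mod_cat_def)
  then show "\<guillemotleft>zero_mor H M N : M \<rightarrow> N\<guillemotright>" "\<And>a x. a \<in> Ob A \<Longrightarrow> x \<in> carrier (FOb M a) \<Longrightarrow> app (zero_mor H M N) a x = \<zero>\<^bsub>FOb N a\<^esub>"
    using \<chi> by auto
qed

lemma eq_zeroI:
  assumes "\<guillemotleft>\<phi> : M \<rightarrow> N\<guillemotright>" "\<And>a x. a \<in> Ob A \<Longrightarrow> x \<in> carrier (FOb M a) \<Longrightarrow> app \<phi> a x = \<zero>\<^bsub>FOb N a\<^esub>"
  shows "\<phi> = zero_mor H M N"
proof -
  have Ob: "M \<in> Ob H" "N \<in> Ob H" using assms by (auto simp: in_H_iff)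
  show ?thesis by (rule mor_eqI[OF assms(1) zero_H(1)[OF Ob]]) (simp add: assms(2) zero_H(2)[OF Ob])
qed

lemma hom_zero_iff:
  assumes "M \<in> Ob H" "N \<in> Ob H"
  shows "carrier (Hom H M N) = {zero_mor H M N} \<longleftrightarrow>
    (\<forall>\<phi>. \<guillemotleft>\<phi> : M \<rightarrow> N\<guillemotright> \<longrightarrow> (\<forall>a\<in>Ob A. \<forall>x\<in>carrier (FOb M a). app \<phi> a x = \<zero>\<^bsub>FOb N a\<^esub>))"
proof
  assume *: "carrier (Hom H M N) = {zero_mor H M N}"
  show "\<forall>\<phi>. \<guillemotleft>\<phi> : M \<rightarrow> N\<guillemotright> \<longrightarrow> (\<forall>a\<in>Ob A. \<forall>x\<in>carrier (FOb M a). app \<phi> a x = \<zero>\<^bsub>FOb N a\<^esub>)"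
  proof (intro allI impI ballI)
    fix \<phi> a x assume "\<guillemotleft>\<phi> : M \<rightarrow> N\<guillemotright>" and ax: "a \<in> Ob A" "x \<in> carrier (FOb M a)"
    then have "\<phi> = zero_mor H M N" using * carrier_H[OF assms] by blast
    then show "app \<phi> a x = \<zero>\<^bsub>FOb N a\<^esub>" using zero_H(2)[OF assms ax] by simp
  qed
next
  assume "\<forall>\<phi>. \<guillemotleft>\<phi> : M \<rightarrow> N\<guillemotright> \<longrightarrow> (\<forall>a\<in>Ob A. \<forall>x\<in>carrier (FOb M a). app \<phi> a x = \<zero>\<^bsub>FOb N a\<^esub>)"
  then have "\<phi> = zero_mor H M N" if "\<guillemotleft>\<phi> : M \<rightarrow> N\<guillemotright>" for \<phi> using eq_zeroI[OF that] that by blast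
  then show "carrier (Hom H M N) = {zero_mor H M N}" using carrier_H[OF assms] zero_H(1)[OF assms] by blast
qed

section \<open>Isomorphisms and exactness tested pointwise\<close>

lemma iso_pointwise:
  assumes \<phi>: "\<guillemotleft>\<phi> : M \<rightarrow> N\<guillemotright>" and bij: "\<And>a. a \<in> Ob A \<Longrightarrow> bij_betw (app \<phi> a) (carrier (FOb M a)) (carrier (FOb N a))"
  shows "is_iso H \<phi> M N"
proof -
  have Ob: "M \<in> Ob H" "N \<in> Ob H" using \<phi> by (auto simp: in_H_iff)
  define t where "t a = inv_into (carrier (FOb M a)) (app \<phi> a)" for a
  have t: "t a y \<in> carrier (FOb M a)" "app \<phi> a (t a y) = y" if "a \<in> Ob A" "y \<in> carrier (FOb N a)" for a y
    using bij[OF that(1)] that(2) unfolding t_def bij_betw_def by (auto intro: inv_into_into f_inv_into_f)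
  have t': "t a (app \<phi> a x) = x" if "a \<in> Ob A" "x \<in> carrier (FOb M a)" for a x
    using bij[OF that(1)] that(2) unfolding t_def bij_betw_def by simp
  have eq: "t a y = x" if "a \<in> Ob A" "x \<in> carrier (FOb M a)" "app \<phi> a x = y" for a x y
    using t' that by blast
  note cl = add_closed[OF Ob(1)] smult_closed[OF Ob(1)]
  obtain \<psi> where \<psi>: "\<guillemotleft>\<psi> : N \<rightarrow> M\<guillemotright>" "\<And>a y. a \<in> Ob A \<Longrightarrow> y \<in> carrier (FOb N a) \<Longrightarrow> app \<psi> a y = t a y"
  proof (rule mor_exists[OF Ob(2,1), where t=t])
    fix f a b x assume f: "\<guillemotleft>f : a \<rightarrow>\<^bsub>A\<^esub> b\<guillemotright>" and x: "x \<in> carrier (FOb N b)"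
    then have ab: "a \<in> Ob A" "b \<in> Ob A" by (auto simp: in_hom_def)
    show "t a (FMor N f x) = FMor M f (t b x)"
      by (rule eq) (use ab f x t FMor_closed[OF Ob(1) f] app_natural[OF \<phi> f] in auto)
  qed (auto intro!: eq simp: t cl app_add[OF \<phi>] app_smult[OF \<phi>])
  show ?thesis
    unfolding is_iso_def
  proof (intro conjI exI[of _ \<psi>])
    show "\<guillemotleft>\<phi> : M \<rightarrow> N\<guillemotright>" "\<guillemotleft>\<psi> : N \<rightarrow> M\<guillemotright>" using \<phi> \<psi> by auto
    show "\<psi> \<cdot> \<phi> = Id H M"
      by (rule mor_eqI[OF Cmp_H(1)[OF \<phi> \<psi>(1)] Id_H(1)[OF Ob(1)]])
        (simp add: Cmp_H(2)[OF \<phi> \<psi>(1)] Id_H(2)[OF Ob(1)] \<psi>(2) app_closed[OF \<phi>] t')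
    show "\<phi> \<cdot> \<psi> = Id H N"
      by (rule mor_eqI[OF Cmp_H(1)[OF \<psi>(1) \<phi>] Id_H(1)[OF Ob(2)]])
        (simp add: Cmp_H(2)[OF \<psi>(1) \<phi>] Id_H(2)[OF Ob(2)] \<psi>(2) t)
  qed
qed

lemma isomorphicE:
  assumes "isomorphic H M N"
  obtains \<phi> \<psi> where "\<guillemotleft>\<phi> : M \<rightarrow> N\<guillemotright>" "\<guillemotleft>\<psi> : N \<rightarrow> M\<guillemotright>"
    "\<And>a x. a \<in> Ob A \<Longrightarrow> x \<in> carrier (FOb M a) \<Longrightarrow> app \<psi> a (app \<phi> a x) = x"
    "\<And>a x. a \<in> Ob A \<Longrightarrow> x \<in> carrier (FOb N a) \<Longrightarrow> app \<phi> a (app \<psi> a x) = x"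
proof -
  obtain \<phi> \<psi> where *: "\<guillemotleft>\<phi> : M \<rightarrow> N\<guillemotright>" "\<guillemotleft>\<psi> : N \<rightarrow> M\<guillemotright>" "\<psi> \<cdot> \<phi> = Id H M" "\<phi> \<cdot> \<psi> = Id H N"
    using assms by (auto simp: isomorphic_def is_iso_def)
  have Ob: "M \<in> Ob H" "N \<in> Ob H" using * by (auto simp: in_H_iff)
  show thesis
    by (rule that[OF *(1,2)]) (metis * Ob Cmp_H(2) Id_H(2))+
qed

lemma isomorphicI:
  assumes "\<guillemotleft>\<phi> : M \<rightarrow> N\<guillemotright>" "\<guillemotleft>\<psi> : N \<rightarrow> M\<guillemotright>"
    "\<And>a x. a \<in> Ob A \<Longrightarrow> x \<in> carrier (FOb M a) \<Longrightarrow> app \<psi> a (app \<phi> a x) = x"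
    "\<And>a x. a \<in> Ob A \<Longrightarrow> x \<in> carrier (FOb N a) \<Longrightarrow> app \<phi> a (app \<psi> a x) = x"
  shows "isomorphic H M N"
proof -
  have "bij_betw (app \<phi> a) (carrier (FOb M a)) (carrier (FOb N a))" if "a \<in> Ob A" for a
    by (rule bij_betw_byWitness[where f'="app \<psi> a"]) (use assms that app_closed[OF assms(1)] app_closed[OF assms(2)] in auto)
  then show ?thesis using iso_pointwise[OF assms(1)] unfolding isomorphic_def by blast
qed

lemma isomorphic_refl: "M \<in> Ob H \<Longrightarrow> isomorphic H M M"
  by (rule isomorphicI[OF Id_H(1) Id_H(1)]) (auto simp: Id_H(2))

lemma isomorphic_sym: "isomorphic H M N \<Longrightarrow> isomorphic H N M"
  by (erule isomorphicE) (rule isomorphicI)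

lemma isomorphic_trans:
  assumes "isomorphic H M N" "isomorphic H N P"
  shows "isomorphic H M P"
proof -
  obtain \<phi> \<psi> where 1: "\<guillemotleft>\<phi> : M \<rightarrow> N\<guillemotright>" "\<guillemotleft>\<psi> : N \<rightarrow> M\<guillemotright>"
    "\<And>a x. a \<in> Ob A \<Longrightarrow> x \<in> carrier (FOb M a) \<Longrightarrow> app \<psi> a (app \<phi> a x) = x"
    "\<And>a x. a \<in> Ob A \<Longrightarrow> x \<in> carrier (FOb N a) \<Longrightarrow> app \<phi> a (app \<psi> a x) = x"
    by (rule isomorphicE[OF assms(1)]) (rule that)
  obtain \<phi>' \<psi>' where 2: "\<guillemotleft>\<phi>' : N \<rightarrow> P\<guillemotright>" "\<guillemotleft>\<psi>' : P \<rightarrow> N\<guillemotright>"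
    "\<And>a x. a \<in> Ob A \<Longrightarrow> x \<in> carrier (FOb N a) \<Longrightarrow> app \<psi>' a (app \<phi>' a x) = x"
    "\<And>a x. a \<in> Ob A \<Longrightarrow> x \<in> carrier (FOb P a) \<Longrightarrow> app \<phi>' a (app \<psi>' a x) = x"
    by (rule isomorphicE[OF assms(2)]) (rule that)
  show ?thesis
    by (rule isomorphicI[OF Cmp_H(1)[OF 1(1) 2(1)] Cmp_H(1)[OF 2(2) 1(2)]])
      (simp_all add: Cmp_H(2)[OF 1(1) 2(1)] Cmp_H(2)[OF 2(2) 1(2)] 1(3,4) 2(3,4) app_closed[OF 1(1)] app_closed[OF 2(1)]
        app_closed[OF 1(2)] app_closed[OF 2(2)])
qed

lemma hom_zero_iso:
  assumes "isomorphic H M M'" "isomorphic H N N'" "carrier (Hom H M N) = {zero_mor H M N}"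
  shows "carrier (Hom H M' N') = {zero_mor H M' N'}"
proof -
  obtain \<phi> \<psi> where 1: "\<guillemotleft>\<phi> : M \<rightarrow> M'\<guillemotright>" "\<guillemotleft>\<psi> : M' \<rightarrow> M\<guillemotright>"
    "\<And>a x. a \<in> Ob A \<Longrightarrow> x \<in> carrier (FOb M' a) \<Longrightarrow> app \<phi> a (app \<psi> a x) = x"
    by (rule isomorphicE[OF assms(1)]) (rule that)
  obtain \<phi>' \<psi>' where 2: "\<guillemotleft>\<phi>' : N \<rightarrow> N'\<guillemotright>" "\<guillemotleft>\<psi>' : N' \<rightarrow> N\<guillemotright>"
    "\<And>a x. a \<in> Ob A \<Longrightarrow> x \<in> carrier (FOb N' a) \<Longrightarrow> app \<phi>' a (app \<psi>' a x) = x"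
    by (rule isomorphicE[OF assms(2)]) (rule that)
  have Ob: "M \<in> Ob H" "M' \<in> Ob H" "N \<in> Ob H" "N' \<in> Ob H" using 1 2 by (auto simp: in_H_iff)
  have "app \<chi> a x = \<zero>\<^bsub>FOb N' a\<^esub>" if \<chi>: "\<guillemotleft>\<chi> : M' \<rightarrow> N'\<guillemotright>" and ax: "a \<in> Ob A" "x \<in> carrier (FOb M' a)" for \<chi> a x
  proof -
    note c1 = Cmp_H[OF 1(1) \<chi>] and c2 = Cmp_H[OF c1(1) 2(2)]
    have "app (\<psi>' \<cdot> (\<chi> \<cdot> \<phi>)) a (app \<psi> a x) = \<zero>\<^bsub>FOb N a\<^esub>"
      using assms(3)[unfolded hom_zero_iff[OF Ob(1,3)], rule_format, OF c2(1) ax(1) app_closed[OF 1(2) ax]] .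
    then have "app \<psi>' a (app \<chi> a x) = \<zero>\<^bsub>FOb N a\<^esub>"
      using c1(2) c2(2) ax 1(3) app_closed[OF 1(2) ax] by simp
    then show ?thesis using 2(3)[OF ax(1) app_closed[OF \<chi> ax]] app_zero[OF 2(1) ax(1)] by simp
  qed
  then show ?thesis unfolding hom_zero_iff[OF Ob(2,4)] by blast
qed

text \<open>A kernel factorisation is obtained by inverting \<open>f\<close> on its image, a
  cokernel factorisation by choosing preimages under \<open>g\<close>. Linearity and naturality of
  both follow from uniqueness of the values.\<close>

lemma short_exact_pointwise:
  assumes f: "\<guillemotleft>f : M \<rightarrow> N\<guillemotright>" and g: "\<guillemotleft>g : N \<rightarrow> P\<guillemotright>"
    and inj: "\<And>a. a \<in> Ob A \<Longrightarrow> inj_on (app f a) (carrier (FOb M a))"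
    and exact: "\<And>a y. a \<in> Ob A \<Longrightarrow> y \<in> carrier (FOb N a) \<Longrightarrow> app g a y = \<zero>\<^bsub>FOb P a\<^esub> \<longleftrightarrow> y \<in> app f a ` carrier (FOb M a)"
    and surj: "\<And>a. a \<in> Ob A \<Longrightarrow> app g a ` carrier (FOb N a) = carrier (FOb P a)"
  shows "short_exact H M N P f g"
proof -
  have Ob: "M \<in> Ob H" "N \<in> Ob H" "P \<in> Ob H" using f g by (auto simp: in_H_iff)
  note cl = add_closed smult_closed diff_closed diff_eq_zero
  have gf: "g \<cdot> f = zero_mor H M P"
    by (rule eq_zeroI[OF Cmp_H(1)[OF f g]]) (use exact app_closed[OF f] Cmp_H(2)[OF f g] in auto)
  have "\<exists>!u. \<guillemotleft>u : X \<rightarrow> M\<guillemotright> \<and> f \<cdot> u = t" if t: "\<guillemotleft>t : X \<rightarrow> N\<guillemotright>" and gt: "g \<cdot> t = zero_mor H X P" for X t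
  proof -
    have X: "X \<in> Ob H" using t by (simp add: in_H_iff)
    define w where "w a x = inv_into (carrier (FOb M a)) (app f a) (app t a x)" for a x
    have "app t a x \<in> app f a ` carrier (FOb M a)" if "a \<in> Ob A" "x \<in> carrier (FOb X a)" for a x
      using exact[OF that(1) app_closed[OF t that]] Cmp_H(2)[OF t g that] gt zero_H(2)[OF X Ob(3) that] by simp
    then have w: "w a x \<in> carrier (FOb M a)" "app f a (w a x) = app t a x" if "a \<in> Ob A" "x \<in> carrier (FOb X a)" for a x
      using that unfolding w_def by (auto intro: inv_into_into f_inv_into_f)
    have eq: "y = w a x" if "a \<in> Ob A" "x \<in> carrier (FOb X a)" "y \<in> carrier (FOb M a)" "app f a y = app t a x" for a x y
      using inj_onD[OF inj[OF that(1)]] that w by metis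
    obtain u where u: "\<guillemotleft>u : X \<rightarrow> M\<guillemotright>" "\<And>a x. a \<in> Ob A \<Longrightarrow> x \<in> carrier (FOb X a) \<Longrightarrow> app u a x = w a x"
    proof (rule mor_exists[OF X Ob(1), where t=w])
      fix h a b x assume h: "\<guillemotleft>h : a \<rightarrow>\<^bsub>A\<^esub> b\<guillemotright>" and x: "x \<in> carrier (FOb X b)"
      then have ab: "a \<in> Ob A" "b \<in> Ob A" by (auto simp: in_hom_def)
      show "w a (FMor X h x) = FMor M h (w b x)"
        by (rule eq[symmetric]) (use ab h x w FMor_closed[OF Ob(1) h] FMor_closed[OF X h] app_natural[OF f h] app_natural[OF t h] in auto)
    qed (auto intro!: eq[symmetric] simp: w add_closed[OF Ob(1)] add_closed[OF X] smult_closed[OF Ob(1)] smult_closed[OF X] app_add[OF f] app_add[OF t] app_smult[OF f] app_smult[OF t])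
    show ?thesis
    proof (rule ex1I[of _ u])
      show "\<guillemotleft>u : X \<rightarrow> M\<guillemotright> \<and> f \<cdot> u = t"
        using u(1) by (auto intro!: mor_eqI[OF Cmp_H(1)[OF u(1) f] t] simp: Cmp_H(2)[OF u(1) f] u(2) w)
      fix u' assume u': "\<guillemotleft>u' : X \<rightarrow> M\<guillemotright> \<and> f \<cdot> u' = t"
      then have h: "\<guillemotleft>u' : X \<rightarrow> M\<guillemotright>" by blast
      show "u' = u"
        by (rule mor_eqI[OF h u(1)]) (use u' Cmp_H(2)[OF h f] app_closed[OF h] eq u(2) in auto)
    qed
  qed
  then have K: "is_kernel H M N P f g" unfolding is_kernel_def using f g gf by blast
  have "\<exists>!u. \<guillemotleft>u : P \<rightarrow> X\<guillemotright> \<and> u \<cdot> g = t" if t: "\<guillemotleft>t : N \<rightarrow> X\<guillemotright>" and tf: "t \<cdot> f = zero_mor H M X" for X t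
  proof -
    have X: "X \<in> Ob H" using t by (simp add: in_H_iff)
    have tf0: "app t a (app f a x) = \<zero>\<^bsub>FOb X a\<^esub>" if "a \<in> Ob A" "x \<in> carrier (FOb M a)" for a x
      using Cmp_H(2)[OF f t that] tf zero_H(2)[OF Ob(1) X that] by simp
    \<comment> \<open>Two preimages differ by an element of the kernel of \<open>g\<close>, which
      lies in the image of \<open>f\<close> and is killed by \<open>t\<close>.\<close>
    have wd: "app t a y = app t a y'" if a: "a \<in> Ob A" and y: "y \<in> carrier (FOb N a)" "y' \<in> carrier (FOb N a)"
      and eq: "app g a y = app g a y'" for a y y'
    proof -
      have "app g a (y \<ominus>\<^bsub>FOb N a\<^esub> y') = \<zero>\<^bsub>FOb P a\<^esub>"
        using app_diff[OF g a y] eq cl(4)[OF Ob(3) a app_closed[OF g a y(1)] app_closed[OF g a y(2)]] by simp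
      then have "app t a (y \<ominus>\<^bsub>FOb N a\<^esub> y') = \<zero>\<^bsub>FOb X a\<^esub>"
        using exact[OF a cl(3)[OF Ob(2) a y]] tf0[OF a] by auto
      then show ?thesis
        using app_diff[OF t a y] cl(4)[OF X a app_closed[OF t a y(1)] app_closed[OF t a y(2)]] by simp
    qed
    define l where "l a p = inv_into (carrier (FOb N a)) (app g a) p" for a p
    have l: "l a p \<in> carrier (FOb N a)" "app g a (l a p) = p" if "a \<in> Ob A" "p \<in> carrier (FOb P a)" for a p
      using surj[OF that(1)] that(2) unfolding l_def by (auto intro: inv_into_into f_inv_into_f)
    define w where "w a p = app t a (l a p)" for a p
    have weq: "w a p = app t a y" if "a \<in> Ob A" "p \<in> carrier (FOb P a)" "y \<in> carrier (FOb N a)" "app g a y = p" for a p y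
      unfolding w_def by (rule wd) (use that l in auto)
    obtain u where u: "\<guillemotleft>u : P \<rightarrow> X\<guillemotright>" "\<And>a p. a \<in> Ob A \<Longrightarrow> p \<in> carrier (FOb P a) \<Longrightarrow> app u a p = w a p"
    proof (rule mor_exists[OF Ob(3) X, where t=w])
      fix a p assume "a \<in> Ob A" "p \<in> carrier (FOb P a)"
      then show "w a p \<in> carrier (FOb X a)" unfolding w_def using app_closed[OF t] l by simp
    next
      fix a p p' assume a: "a \<in> Ob A" and p: "p \<in> carrier (FOb P a)" "p' \<in> carrier (FOb P a)"
      have "w a (p \<oplus>\<^bsub>FOb P a\<^esub> p') = app t a (l a p \<oplus>\<^bsub>FOb N a\<^esub> l a p')"
        by (rule weq) (use a p l cl(1) Ob app_add[OF g] in auto)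
      then show "w a (p \<oplus>\<^bsub>FOb P a\<^esub> p') = w a p \<oplus>\<^bsub>FOb X a\<^esub> w a p'" using app_add[OF t] a p l by (simp add: w_def)
    next
      fix a r p assume a: "a \<in> Ob A" and r: "r \<in> carrier k" and p: "p \<in> carrier (FOb P a)"
      have "w a (r \<odot>\<^bsub>FOb P a\<^esub> p) = app t a (r \<odot>\<^bsub>FOb N a\<^esub> l a p)"
        by (rule weq) (use a p r l cl(2) Ob app_smult[OF g] in auto)
      then show "w a (r \<odot>\<^bsub>FOb P a\<^esub> p) = r \<odot>\<^bsub>FOb X a\<^esub> w a p" using app_smult[OF t] a p r l by (simp add: w_def)
    next
      fix h a b p assume h: "\<guillemotleft>h : a \<rightarrow>\<^bsub>A\<^esub> b\<guillemotright>" and p: "p \<in> carrier (FOb P b)"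
      then have ab: "a \<in> Ob A" "b \<in> Ob A" by (auto simp: in_hom_def)
      have "w a (FMor P h p) = app t a (FMor N h (l b p))"
        by (rule weq) (use ab h p l FMor_closed[OF _ h] Ob app_natural[OF g h] in auto)
      then show "w a (FMor P h p) = FMor X h (w b p)" using app_natural[OF t h] ab p l by (simp add: w_def)
    qed (rule that)
    show ?thesis
    proof (rule ex1I[of _ u])
      show "\<guillemotleft>u : P \<rightarrow> X\<guillemotright> \<and> u \<cdot> g = t"
        using u(1) by (auto intro!: mor_eqI[OF Cmp_H(1)[OF g u(1)] t] weq simp: Cmp_H(2)[OF g u(1)] u(2) app_closed[OF g])
      fix u' assume u': "\<guillemotleft>u' : P \<rightarrow> X\<guillemotright> \<and> u' \<cdot> g = t"
      then have h: "\<guillemotleft>u' : P \<rightarrow> X\<guillemotright>" by blast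
      show "u' = u"
      proof (rule mor_eqI[OF h u(1)])
        fix a p assume a: "a \<in> Ob A" and p: "p \<in> carrier (FOb P a)"
        have "app u' a p = app t a (l a p)" using u' Cmp_H(2)[OF g h a l(1)[OF a p]] l(2)[OF a p] by auto
        then show "app u' a p = app u a p" using u(2)[OF a p] by (simp add: w_def)
      qed
    qed
  qed
  then have "is_cokernel H M N P f g" unfolding is_cokernel_def using f g gf by blast
  with K show ?thesis by (simp add: short_exact_def)
qed

end

section \<open>The restricted Yoneda functor\<close>

lemma representable_full_sub [simp]: "representable (full_sub T S) t = representable T t"
  by (simp add: representable_def)

lemma representable_simps [simp]:
  "FOb (representable T t) a = Hom T a t" "FMor (representable T t) f x = x \<cdot>\<^bsub>T\<^esub> f"
  by (simp_all add: representable_def)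

lemma FOb_restricted_yoneda [simp]: "FOb (restricted_yoneda T S) = representable T"
  by (simp add: restricted_yoneda_def)

context two_term
begin

abbreviation H :: "('k, ('k, 'o, 'm, 'm) modfunc, ('k, 'o, 'm, 'm) modmor) lincat"
  where "H \<equiv> mod_cat k (full_sub T S)"

abbreviation F :: "('o, ('k, 'o, 'm, 'm) modfunc, 'm, ('k, 'o, 'm, 'm) modmor) func"
  where "F \<equiv> restricted_yoneda T S"

interpretation H: functor_category k "full_sub T S" H
  by unfold_locales simp

lemma S_sub: "S \<subseteq> Ob T" using S_Ob by blast

lemmas in_hom_S = in_hom_full_sub[OF S_sub]

lemma Hom_iff: "a \<in> Ob T \<Longrightarrow> b \<in> Ob T \<Longrightarrow> x \<in> carrier (Hom T a b) \<longleftrightarrow> \<guillemotleft>x : a \<rightarrow> b\<guillemotright>"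
  by (simp add: in_hom_def)

lemma Hom_closed:
  assumes "\<guillemotleft>x : a \<rightarrow> b\<guillemotright>"
  shows "\<guillemotleft>y : a \<rightarrow> b\<guillemotright> \<Longrightarrow> \<guillemotleft>x \<oplus>\<^bsub>Hom T a b\<^esub> y : a \<rightarrow> b\<guillemotright>"
    and "r \<in> carrier k \<Longrightarrow> \<guillemotleft>r \<odot>\<^bsub>Hom T a b\<^esub> x : a \<rightarrow> b\<guillemotright>"
proof -
  have ab: "a \<in> Ob T" "b \<in> Ob T" using assms by (auto simp: in_hom_iff)
  interpret module k "Hom T a b" using ab by (rule Hom_module)
  show "\<guillemotleft>y : a \<rightarrow> b\<guillemotright> \<Longrightarrow> \<guillemotleft>x \<oplus>\<^bsub>Hom T a b\<^esub> y : a \<rightarrow> b\<guillemotright>"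
    "r \<in> carrier k \<Longrightarrow> \<guillemotleft>r \<odot>\<^bsub>Hom T a b\<^esub> x : a \<rightarrow> b\<guillemotright>"
    using assms by (simp_all add: in_hom_def del: carrier_Hom)
qed

section \<open>\<open>F\<close> takes values in finitely presented functors\<close>

lemma additive_yoneda:
  assumes c: "c \<in> Ob T"
  shows "additive_cofunctor k (full_sub T S) (representable T c)"
proof -
  have car: "x \<in> carrier (Hom T a c) \<longleftrightarrow> \<guillemotleft>x : a \<rightarrow> c\<guillemotright>" if "a \<in> S" for a x
    using Hom_iff[OF S_Ob[OF that] c] .
  have "FMor (representable T c) f \<in> module_homs k (Hom T b c) (Hom T a c)"
    if f: "a \<in> S" "b \<in> S" "\<guillemotleft>f : a \<rightarrow> b\<guillemotright>" for a b f
    using f Cmp_in[OF f(3)] Cmp_add_left[OF f(3)] Cmp_smult_left[OF _ f(3)]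
    by (auto simp: module_homs_def car simp del: carrier_Hom)
  moreover have "x \<cdot> (f \<oplus>\<^bsub>Hom T a b\<^esub> g) = x \<cdot> f \<oplus>\<^bsub>Hom T a c\<^esub> x \<cdot> g"
    if "\<guillemotleft>f : a \<rightarrow> b\<guillemotright>" "\<guillemotleft>g : a \<rightarrow> b\<guillemotright>" "b \<in> S" "x \<in> carrier (Hom T b c)" for a b f g x
    using Cmp_add_right that car by blast
  moreover have "x \<cdot> (g \<cdot> f) = x \<cdot> g \<cdot> f"
    if "\<guillemotleft>f : a \<rightarrow> b\<guillemotright>" "\<guillemotleft>g : b \<rightarrow> b'\<guillemotright>" "b' \<in> S" "x \<in> carrier (Hom T b' c)" for a b b' f g x
    using Cmp_assoc[OF that(1,2)] that(3,4) car by simp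
  moreover have "module k (Hom T a c)" "x \<in> carrier (Hom T a c) \<Longrightarrow> x \<cdot> Id T a = x" if "a \<in> S" for a x
    using Hom_module[OF S_Ob[OF that] c] Cmp_Id[of x a c] car[OF that, of x] by auto
  ultimately show ?thesis
    unfolding additive_cofunctor_def full_sub_simps representable_simps in_hom_S by blast
qed

lemma nat_trans_yoneda:
  assumes g: "\<guillemotleft>g : c \<rightarrow> d\<guillemotright>"
  shows "(\<lambda>a\<in>S. \<lambda>x\<in>carrier (Hom T a c). g \<cdot> x) \<in> nat_trans k (full_sub T S) (representable T c) (representable T d)"
proof -
  have cd: "c \<in> Ob T" "d \<in> Ob T" using g by (auto simp: in_hom_iff)
  have car: "x \<in> carrier (Hom T a c) \<longleftrightarrow> \<guillemotleft>x : a \<rightarrow> c\<guillemotright>" "x \<in> carrier (Hom T a d) \<longleftrightarrow> \<guillemotleft>x : a \<rightarrow> d\<guillemotright>" if "a \<in> S" for a x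
    using Hom_iff[OF S_Ob[OF that]] cd by auto
  have "(\<lambda>x\<in>carrier (Hom T a c). g \<cdot> x) \<in> module_homs k (Hom T a c) (Hom T a d)" if a: "a \<in> S" for a
    using a Cmp_in[OF _ g] Cmp_add_right[OF _ _ g] Cmp_smult_right[OF _ _ g] Hom_closed
    by (auto simp: module_homs_def car simp del: carrier_Hom)
  moreover have "g \<cdot> (x \<cdot> f) = g \<cdot> x \<cdot> f" "x \<cdot> f \<in> carrier (Hom T a c)"
    if "a \<in> S" "b \<in> S" "\<guillemotleft>f : a \<rightarrow> b\<guillemotright>" "x \<in> carrier (Hom T b c)" for a b f x
    using Cmp_assoc[OF that(3) _ g] Cmp_in[OF that(3)] that car by simp_all
  ultimately show ?thesis
    unfolding nat_trans_def full_sub_simps representable_simps in_hom_S by (auto simp del: carrier_Hom)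
qed

text \<open>Right exactness of \<open>F\<close> on a presenting triangle, so that \<open>F c\<close>
  is the cokernel of \<open>F \<sigma>\<close>. Surjectivity is the lifting property of
  \<open>S\<close>; exactness in the middle holds for every triangle.\<close>

lemma C_presentation_exact:
  assumes d: "dist_triangle T s1 s0 c \<sigma> \<alpha> \<beta>" and S: "s0 \<in> S" "s1 \<in> S" and a: "a \<in> S"
  shows "(\<lambda>x. \<alpha> \<cdot> x) ` {x. \<guillemotleft>x : a \<rightarrow> s0\<guillemotright>} = {x. \<guillemotleft>x : a \<rightarrow> c\<guillemotright>}"
    and "(\<lambda>x. \<sigma> \<cdot> x) ` {x. \<guillemotleft>x : a \<rightarrow> s1\<guillemotright>} = {x. \<guillemotleft>x : a \<rightarrow> s0\<guillemotright> \<and> \<alpha> \<cdot> x = zero_mor T a c}"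
proof -
  note h = dist_hom[OF d]
  have "\<guillemotleft>\<alpha> \<cdot> x : a \<rightarrow> c\<guillemotright>" if "\<guillemotleft>x : a \<rightarrow> s0\<guillemotright>" for x using that h by (auto simp: in_hom_iff)
  moreover have "\<exists>x'. \<guillemotleft>x' : a \<rightarrow> s0\<guillemotright> \<and> x = \<alpha> \<cdot> x'" if "\<guillemotleft>x : a \<rightarrow> c\<guillemotright>" for x using lift[OF d S_C[OF S(2)] a that] by metis
  ultimately show "(\<lambda>x. \<alpha> \<cdot> x) ` {x. \<guillemotleft>x : a \<rightarrow> s0\<guillemotright>} = {x. \<guillemotleft>x : a \<rightarrow> c\<guillemotright>}" by blast
  have "\<guillemotleft>\<sigma> \<cdot> x : a \<rightarrow> s0\<guillemotright>" "\<alpha> \<cdot> (\<sigma> \<cdot> x) = zero_mor T a c" if "\<guillemotleft>x : a \<rightarrow> s1\<guillemotright>" for x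
    using that h reassoc[OF dist_zero(1)[OF d], of x] by (auto simp: in_hom_iff)
  moreover have "\<exists>x'. \<guillemotleft>x' : a \<rightarrow> s1\<guillemotright> \<and> x = \<sigma> \<cdot> x'" if "\<guillemotleft>x : a \<rightarrow> s0\<guillemotright>" "\<alpha> \<cdot> x = zero_mor T a c" for x
    using exact_cov[OF d that] by metis
  ultimately show "(\<lambda>x. \<sigma> \<cdot> x) ` {x. \<guillemotleft>x : a \<rightarrow> s1\<guillemotright>} = {x. \<guillemotleft>x : a \<rightarrow> s0\<guillemotright> \<and> \<alpha> \<cdot> x = zero_mor T a c}" by blast
qed

lemma yoneda_Ob:
  assumes c: "c \<in> C"
  shows "representable T c \<in> Ob H"
proof -
  obtain s0 s1 \<sigma> \<alpha> \<beta> where S: "s0 \<in> S" "s1 \<in> S" and d: "dist_triangle T s1 s0 c \<sigma> \<alpha> \<beta>" using c by (rule C_E)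
  have Ob: "c \<in> Ob T" "s0 \<in> Ob T" "s1 \<in> Ob T" using c C_Ob S S_Ob by auto
  note n1 = nat_trans_yoneda[OF dist_hom(1)[OF d]] and n2 = nat_trans_yoneda[OF dist_hom(2)[OF d]]
  let ?\<sigma> = "\<lambda>a\<in>S. \<lambda>x\<in>carrier (Hom T a s1). \<sigma> \<cdot> x" and ?\<alpha> = "\<lambda>a\<in>S. \<lambda>x\<in>carrier (Hom T a s0). \<alpha> \<cdot> x"
  have "?\<alpha> a ` carrier (Hom T a s0) = carrier (Hom T a c) \<and>
      ?\<sigma> a ` carrier (Hom T a s1) = {x \<in> carrier (Hom T a s0). ?\<alpha> a x = zero_mor T a c}" if a: "a \<in> S" for a
  proof -
    have aO: "a \<in> Ob T" using a by (rule S_Ob)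
    have car: "carrier (Hom T a x) = {u. \<guillemotleft>u : a \<rightarrow> x\<guillemotright>}" if "x \<in> Ob T" for x
      using Hom_iff[OF aO that] by blast
    have \<alpha>: "?\<alpha> a x = \<alpha> \<cdot> x" if "\<guillemotleft>x : a \<rightarrow> s0\<guillemotright>" for x using that a car[OF Ob(2)] by simp
    have \<sigma>: "?\<sigma> a x = \<sigma> \<cdot> x" if "\<guillemotleft>x : a \<rightarrow> s1\<guillemotright>" for x using that a car[OF Ob(3)] by simp
    have "?\<alpha> a ` {x. \<guillemotleft>x : a \<rightarrow> s0\<guillemotright>} = (\<lambda>x. \<alpha> \<cdot> x) ` {x. \<guillemotleft>x : a \<rightarrow> s0\<guillemotright>}"
      "?\<sigma> a ` {x. \<guillemotleft>x : a \<rightarrow> s1\<guillemotright>} = (\<lambda>x. \<sigma> \<cdot> x) ` {x. \<guillemotleft>x : a \<rightarrow> s1\<guillemotright>}"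
      by (rule image_cong, simp, use \<alpha> in blast) (rule image_cong, simp, use \<sigma> in blast)
    moreover have "{x \<in> {u. \<guillemotleft>u : a \<rightarrow> s0\<guillemotright>}. ?\<alpha> a x = zero_mor T a c} = {x. \<guillemotleft>x : a \<rightarrow> s0\<guillemotright> \<and> \<alpha> \<cdot> x = zero_mor T a c}"
      by (intro Collect_cong conj_cong refl) (simp_all only: mem_Collect_eq \<alpha>)
    ultimately show ?thesis
      using C_presentation_exact[OF d S a] car[OF Ob(1)] car[OF Ob(2)] car[OF Ob(3)] by simp
  qed
  then have "fin_pres_cofunctor k (full_sub T S) (representable T c)"
    unfolding fin_pres_cofunctor_def full_sub_simps representable_full_sub representable_simps
    by (intro conjI additive_yoneda Ob bexI[OF _ S(1)] bexI[OF _ S(2)] bexI[OF _ n1] bexI[OF _ n2] ballI)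
      simp_all
  then show ?thesis by (simp add: mod_cat_def)
qed

lemma carrier_yoneda:
  "c \<in> C \<Longrightarrow> a \<in> S \<Longrightarrow> x \<in> carrier (FOb (representable T c) a) \<longleftrightarrow> \<guillemotleft>x : a \<rightarrow> c\<guillemotright>"
  using Hom_iff S_Ob C_Ob by simp

lemma yoneda_mor:
  assumes g: "\<guillemotleft>g : c \<rightarrow> d\<guillemotright>" and cd: "c \<in> C" "d \<in> C"
  shows "\<guillemotleft>FMor F g : representable T c \<rightarrow>\<^bsub>H\<^esub> representable T d\<guillemotright>"
    and "\<And>a x. a \<in> S \<Longrightarrow> \<guillemotleft>x : a \<rightarrow> c\<guillemotright> \<Longrightarrow> H.app (FMor F g) a x = g \<cdot> x"
proof -
  have DC: "Dom T g = c" "Cod T g = d" using g by (auto simp: in_hom_iff)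
  show "\<guillemotleft>FMor F g : representable T c \<rightarrow>\<^bsub>H\<^esub> representable T d\<guillemotright>"
    unfolding H.in_H_iff using yoneda_Ob[OF cd(1)] yoneda_Ob[OF cd(2)] nat_trans_yoneda[OF g]
    by (simp add: restricted_yoneda_def DC)
  show "H.app (FMor F g) a x = g \<cdot> x" if "a \<in> S" "\<guillemotleft>x : a \<rightarrow> c\<guillemotright>" for a x
    using that Hom_iff[OF S_Ob[OF that(1)] C_Ob[OF cd(1)]] by (simp add: H.app_def restricted_yoneda_def DC)
qed

text \<open>By the Yoneda argument at \<open>s0\<close>, \<open>\<phi>\<close> is determined by the
  image of \<open>\<alpha>\<close>, a morphism \<open>s0 \<rightarrow> d\<close>. Naturality along
  \<open>\<sigma>\<close> shows that it vanishes on \<open>s1\<close>, so it descends to the cone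
  \<open>c\<close>.\<close>

lemma yoneda_full:
  assumes \<phi>: "\<guillemotleft>\<phi> : representable T c \<rightarrow>\<^bsub>H\<^esub> representable T d\<guillemotright>" and cd: "c \<in> C" "d \<in> C"
  obtains g where "\<guillemotleft>g : c \<rightarrow> d\<guillemotright>" "\<phi> = FMor F g"
proof -
  obtain s0 s1 \<sigma> \<alpha> \<beta> where S: "s0 \<in> S" "s1 \<in> S" and t: "dist_triangle T s1 s0 c \<sigma> \<alpha> \<beta>" using cd(1) by (rule C_E)
  note h = dist_hom[OF t]
  note car = carrier_yoneda[OF cd(1)] carrier_yoneda[OF cd(2)]
  have cl: "\<guillemotleft>H.app \<phi> a x : a \<rightarrow> d\<guillemotright>" if "a \<in> S" "\<guillemotleft>x : a \<rightarrow> c\<guillemotright>" for a x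
    using H.app_closed[OF \<phi>, of a x] that car by simp
  have nat: "H.app \<phi> a (x \<cdot> f) = H.app \<phi> b x \<cdot> f" if "a \<in> S" "b \<in> S" "\<guillemotleft>f : a \<rightarrow> b\<guillemotright>" "\<guillemotleft>x : b \<rightarrow> c\<guillemotright>" for a b f x
    using H.app_natural[OF \<phi>, of f a b x] that car by (simp add: in_hom_S)
  let ?v = "H.app \<phi> s0 \<alpha>"
  have v: "\<guillemotleft>?v : s0 \<rightarrow> d\<guillemotright>" by (rule cl[OF S(1) h(2)])
  have "?v \<cdot> \<sigma> = H.app \<phi> s1 (\<alpha> \<cdot> \<sigma>)" using nat[OF S(2,1) h(1,2)] by simp
  also have "\<dots> = zero_mor T s1 d" unfolding dist_zero(1)[OF t] using H.app_zero[OF \<phi>, of s1] S(2) by simp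
  finally obtain g where g: "\<guillemotleft>g : c \<rightarrow> d\<guillemotright>" "?v = g \<cdot> \<alpha>" using exact_contra[OF t v] by blast
  have "\<phi> = FMor F g"
  proof (rule H.mor_eqI[OF \<phi> yoneda_mor(1)[OF g(1) cd]])
    fix a x assume a: "a \<in> Ob (full_sub T S)" and "x \<in> carrier (FOb (representable T c) a)"
    then have a: "a \<in> S" and x: "\<guillemotleft>x : a \<rightarrow> c\<guillemotright>" using car by auto
    obtain x' where x': "\<guillemotleft>x' : a \<rightarrow> s0\<guillemotright>" "x = \<alpha> \<cdot> x'" using lift[OF t S_C[OF S(2)] a x] .
    have "H.app \<phi> a x = ?v \<cdot> x'" unfolding x'(2) by (rule nat[OF a S(1) x'(1) h(2)])
    also have "\<dots> = g \<cdot> x" unfolding g(2) x'(2) using g(1) h x'(1) by (simp add: in_hom_iff)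
    finally show "H.app \<phi> a x = H.app (FMor F g) a x" using yoneda_mor(2)[OF g(1) cd a x] by simp
  qed
  then show thesis using that g by blast
qed

text \<open>A presentation of \<open>M\<close> starts with a natural transformation between
  representables, hence is given by a morphism \<open>\<sigma> : s1 \<rightarrow> s0\<close> in
  \<open>S\<close>. Its cone \<open>c\<close> lies in \<open>C\<close>, and \<open>F c\<close> is
  the same cokernel as \<open>M\<close>.\<close>

lemma yoneda_dense:
  assumes M: "M \<in> Ob H"
  obtains c where "c \<in> C" "isomorphic H (representable T c) M"
proof -
  have "fin_pres_cofunctor k (full_sub T S) M" using M by (simp add: mod_cat_def)
  then obtain s0 s1 \<theta> \<pi> where S: "s0 \<in> S" "s1 \<in> S"
    and \<theta>: "\<theta> \<in> nat_trans k (full_sub T S) (representable T s1) (representable T s0)"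
    and \<pi>: "\<pi> \<in> nat_trans k (full_sub T S) (representable T s0) M"
    and pres: "\<forall>a \<in> S. \<pi> a ` carrier (Hom T a s0) = carrier (FOb M a) \<and>
      \<theta> a ` carrier (Hom T a s1) = {x \<in> carrier (Hom T a s0). \<pi> a x = \<zero>\<^bsub>FOb M a\<^esub>}"
    unfolding fin_pres_cofunctor_def full_sub_simps representable_full_sub
    by (elim conjE bexE) (rule that)
  have SO: "s0 \<in> Ob T" "s1 \<in> Ob T" using S S_Ob by auto
  note car0 = carrier_yoneda[OF S_C[OF S(1)]] and car1 = carrier_yoneda[OF S_C[OF S(2)]]
  have \<theta>': "\<guillemotleft>(representable T s1, representable T s0, \<theta>) : representable T s1 \<rightarrow>\<^bsub>H\<^esub> representable T s0\<guillemotright>"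
    and \<pi>': "\<guillemotleft>(representable T s0, M, \<pi>) : representable T s0 \<rightarrow>\<^bsub>H\<^esub> M\<guillemotright>"
    unfolding H.in_H_iff using \<theta> \<pi> M yoneda_Ob S_C S by auto
  \<comment> \<open>The value of \<open>\<theta>\<close> on the identity; by naturality
    \<open>\<theta>\<close> is composition with it.\<close>
  define \<sigma> where "\<sigma> = \<theta> s1 (Id T s1)"
  have Id1: "\<guillemotleft>Id T s1 : s1 \<rightarrow> s1\<guillemotright>" by (rule Id_in[OF SO(2)])
  have \<sigma>: "\<guillemotleft>\<sigma> : s1 \<rightarrow> s0\<guillemotright>"
    using H.app_closed[OF \<theta>', of s1 "Id T s1"] S Id1 car0[OF S(2)] car1[OF S(2)] by (simp add: \<sigma>_def H.app_def)
  have \<theta>_eq: "\<theta> a y = \<sigma> \<cdot> y" if a: "a \<in> S" and y: "\<guillemotleft>y : a \<rightarrow> s1\<guillemotright>" for a y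
    using H.app_natural[OF \<theta>', of y a s1 "Id T s1"] a y S car1[OF S(2)] Id1
    by (simp add: H.app_def in_hom_S \<sigma>_def) (simp add: in_hom_iff)
  obtain c g h where d: "dist_triangle T s1 s0 c \<sigma> g h" using TR1_cone[OF \<sigma>] by blast
  have c: "c \<in> C" by (rule C_I2[OF S d])
  note hd = dist_hom[OF d]
  have onto: "\<exists>x. \<guillemotleft>x : a \<rightarrow> s0\<guillemotright> \<and> \<pi> a x = m" if "a \<in> S" "m \<in> carrier (FOb M a)" for a m
  proof -
    have "m \<in> \<pi> a ` carrier (Hom T a s0)" using pres that by simp
    then show ?thesis using Hom_iff[OF S_Ob[OF that(1)] SO(1)] by blast
  qed
  have ker: "\<pi> a x = \<zero>\<^bsub>FOb M a\<^esub> \<longleftrightarrow> g \<cdot> x = zero_mor T a c" if a: "a \<in> S" and x: "\<guillemotleft>x : a \<rightarrow> s0\<guillemotright>" for a x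
  proof -
    have aO: "a \<in> Ob T" using a by (rule S_Ob)
    have "\<pi> a x = \<zero>\<^bsub>FOb M a\<^esub> \<longleftrightarrow> x \<in> \<theta> a ` {y. \<guillemotleft>y : a \<rightarrow> s1\<guillemotright>}"
    proof -
      have "{y. \<guillemotleft>y : a \<rightarrow> s1\<guillemotright>} = carrier (Hom T a s1)" "x \<in> carrier (Hom T a s0)" using Hom_iff aO SO x by auto
      then show ?thesis using pres a by simp
    qed
    also have "\<theta> a ` {y. \<guillemotleft>y : a \<rightarrow> s1\<guillemotright>} = (\<lambda>y. \<sigma> \<cdot> y) ` {y. \<guillemotleft>y : a \<rightarrow> s1\<guillemotright>}" using \<theta>_eq[OF a] by auto
    also have "x \<in> \<dots> \<longleftrightarrow> g \<cdot> x = zero_mor T a c" using C_presentation_exact(2)[OF d S a] x by auto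
    finally show ?thesis .
  qed
  \<comment> \<open>\<open>\<pi>\<close> and \<open>g\<close> identify the same pairs, since they
    have the same kernel; this makes the comparison map well defined and injective.\<close>
  have eq: "\<pi> a x = \<pi> a y \<longleftrightarrow> g \<cdot> x = g \<cdot> y" if a: "a \<in> S" and x: "\<guillemotleft>x : a \<rightarrow> s0\<guillemotright>" and y: "\<guillemotleft>y : a \<rightarrow> s0\<guillemotright>" for a x y
  proof -
    have aO: "a \<in> Ob T" using a by (rule S_Ob)
    interpret module k "Hom T a s0" using aO SO by (intro Hom_module)
    have xy: "x \<ominus>\<^bsub>Hom T a s0\<^esub> y = x \<boxplus> neg_mor y"
      using x y by (simp add: a_minus_def plus_mor_def neg_mor_def in_hom_iff)
    have D: "\<guillemotleft>x \<boxplus> neg_mor y : a \<rightarrow> s0\<guillemotright>" using x y by (auto simp: in_hom_iff)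
    have mem: "x \<in> carrier (Hom T a s0)" "y \<in> carrier (Hom T a s0)" using Hom_iff aO SO x y by auto
    have "\<pi> a (x \<boxplus> neg_mor y) = \<pi> a x \<ominus>\<^bsub>FOb M a\<^esub> \<pi> a y"
      using H.app_diff[OF \<pi>', of a x y] a mem xy by (simp add: H.app_def)
    moreover have "\<pi> a x \<in> carrier (FOb M a)" "\<pi> a y \<in> carrier (FOb M a)"
      using H.app_closed[OF \<pi>', of a] a mem by (auto simp: H.app_def)
    ultimately have "\<pi> a x = \<pi> a y \<longleftrightarrow> \<pi> a (x \<boxplus> neg_mor y) = \<zero>\<^bsub>FOb M a\<^esub>"
      using H.diff_eq_zero[OF M, of a] a by simp
    also have "\<dots> \<longleftrightarrow> g \<cdot> x \<boxplus> neg_mor (g \<cdot> y) = zero_mor T a c"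
      unfolding ker[OF a D] using x y hd by (simp add: in_hom_iff)
    also have "\<dots> \<longleftrightarrow> g \<cdot> x = g \<cdot> y" by (rule diff_eq_zero) (use x y hd in \<open>auto simp: in_hom_iff\<close>)
    finally show ?thesis .
  qed
  \<comment> \<open>An arbitrary lift along \<open>g\<close>; by \<open>eq\<close> the value
    \<open>\<pi> a (l a x)\<close> does not depend on the choice.\<close>
  define l where "l a x = (SOME x'. \<guillemotleft>x' : a \<rightarrow> s0\<guillemotright> \<and> x = g \<cdot> x')" for a x
  have l: "\<guillemotleft>l a x : a \<rightarrow> s0\<guillemotright>" "g \<cdot> l a x = x" if a: "a \<in> S" and x: "\<guillemotleft>x : a \<rightarrow> c\<guillemotright>" for a x
  proof -
    have "\<exists>x'. \<guillemotleft>x' : a \<rightarrow> s0\<guillemotright> \<and> x = g \<cdot> x'" using lift[OF d S_C[OF S(2)] a x] by metis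
    from someI_ex[OF this] show "\<guillemotleft>l a x : a \<rightarrow> s0\<guillemotright>" "g \<cdot> l a x = x" by (auto simp: l_def)
  qed
  define t where "t a x = \<pi> a (l a x)" for a x
  have t: "t a (g \<cdot> x) = \<pi> a x" if a: "a \<in> S" and x: "\<guillemotleft>x : a \<rightarrow> s0\<guillemotright>" for a x
  proof -
    have gx: "\<guillemotleft>g \<cdot> x : a \<rightarrow> c\<guillemotright>" using x hd by (auto simp: in_hom_iff)
    show ?thesis unfolding t_def using eq[OF a l(1)[OF a gx] x] l(2)[OF a gx] by simp
  qed
  have cov: "\<exists>x'. \<guillemotleft>x' : a \<rightarrow> s0\<guillemotright> \<and> x = g \<cdot> x'" if "a \<in> S" "x \<in> carrier (Hom T a c)" for a x
    using l[OF that(1), of x] that Hom_iff[OF S_Ob[OF that(1)] C_Ob[OF c]] by metis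
  have \<pi>_app: "H.app (representable T s0, M, \<pi>) = \<pi>" by (simp add: H.app_def)
  note \<pi>_rules = H.app_closed[OF \<pi>', unfolded \<pi>_app full_sub_simps representable_simps] H.app_add[OF \<pi>', unfolded \<pi>_app full_sub_simps representable_simps]
    H.app_smult[OF \<pi>', unfolded \<pi>_app full_sub_simps representable_simps] H.app_natural[OF \<pi>', unfolded \<pi>_app full_sub_simps representable_simps]
  have mem0: "x \<in> carrier (Hom T a s0) \<longleftrightarrow> \<guillemotleft>x : a \<rightarrow> s0\<guillemotright>" if "a \<in> S" for a x
    using Hom_iff[OF S_Ob[OF that] SO(1)] .
  obtain \<phi> where \<phi>: "\<guillemotleft>\<phi> : representable T c \<rightarrow>\<^bsub>H\<^esub> M\<guillemotright>"
    "\<And>a x. a \<in> Ob (full_sub T S) \<Longrightarrow> x \<in> carrier (FOb (representable T c) a) \<Longrightarrow> H.app \<phi> a x = t a x"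
  proof (rule H.mor_exists[OF yoneda_Ob[OF c] M, where t=t], unfold full_sub_simps representable_simps)
    fix a x assume a: "a \<in> S" and x: "x \<in> carrier (Hom T a c)"
    obtain x' where x': "\<guillemotleft>x' : a \<rightarrow> s0\<guillemotright>" "x = g \<cdot> x'" using cov[OF a x] by blast
    show "t a x \<in> carrier (FOb M a)" unfolding x'(2) t[OF a x'(1)] by (rule \<pi>_rules(1)) (use a x' mem0 in auto)
  next
    fix a x y assume a: "a \<in> S" and x: "x \<in> carrier (Hom T a c)" "y \<in> carrier (Hom T a c)"
    obtain x' where x': "\<guillemotleft>x' : a \<rightarrow> s0\<guillemotright>" "x = g \<cdot> x'" using cov[OF a x(1)] by blast
    obtain y' where y': "\<guillemotleft>y' : a \<rightarrow> s0\<guillemotright>" "y = g \<cdot> y'" using cov[OF a x(2)] by blast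
    have p: "x' \<oplus>\<^bsub>Hom T a s0\<^esub> y' = x' \<boxplus> y'" using x' y' by (simp add: plus_mor_def in_hom_iff)
    have q: "x \<oplus>\<^bsub>Hom T a c\<^esub> y = g \<cdot> (x' \<boxplus> y')"
      using Cmp_add_right[OF x'(1) y'(1) hd(2)] x'(2) y'(2) p by simp
    have xy: "\<guillemotleft>x' \<boxplus> y' : a \<rightarrow> s0\<guillemotright>" using x' y' by (auto simp: in_hom_iff)
    show "t a (x \<oplus>\<^bsub>Hom T a c\<^esub> y) = t a x \<oplus>\<^bsub>FOb M a\<^esub> t a y"
      unfolding q t[OF a xy] unfolding x'(2) y'(2) t[OF a x'(1)] t[OF a y'(1)] p[symmetric]
      by (rule \<pi>_rules(2)) (use a x' y' mem0 in auto)
  next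
    fix a r x assume a: "a \<in> S" and r: "r \<in> carrier k" and x: "x \<in> carrier (Hom T a c)"
    obtain x' where x': "\<guillemotleft>x' : a \<rightarrow> s0\<guillemotright>" "x = g \<cdot> x'" using cov[OF a x] by blast
    have q: "r \<odot>\<^bsub>Hom T a c\<^esub> x = g \<cdot> (r \<odot>\<^bsub>Hom T a s0\<^esub> x')"
      using Cmp_smult_right[OF r x'(1) hd(2)] x'(2) by simp
    have rx: "\<guillemotleft>r \<odot>\<^bsub>Hom T a s0\<^esub> x' : a \<rightarrow> s0\<guillemotright>" using x' r by (auto simp: in_hom_iff)
    show "t a (r \<odot>\<^bsub>Hom T a c\<^esub> x) = r \<odot>\<^bsub>FOb M a\<^esub> t a x"
      unfolding q t[OF a rx] unfolding x'(2) t[OF a x'(1)]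
      by (rule \<pi>_rules(3)) (use a r x' mem0 in auto)
  next
    fix f a b x assume "\<guillemotleft>f : a \<rightarrow>\<^bsub>full_sub T S\<^esub> b\<guillemotright>" and x: "x \<in> carrier (Hom T b c)"
    then have f: "\<guillemotleft>f : a \<rightarrow> b\<guillemotright>" "a \<in> S" "b \<in> S" and f': "\<guillemotleft>f : a \<rightarrow>\<^bsub>full_sub T S\<^esub> b\<guillemotright>" by (auto simp: in_hom_S)
    obtain x' where x': "\<guillemotleft>x' : b \<rightarrow> s0\<guillemotright>" "x = g \<cdot> x'" using cov[OF f(3) x] by blast
    have q: "x \<cdot> f = g \<cdot> (x' \<cdot> f)" unfolding x'(2) using f(1) x'(1) hd by (simp add: in_hom_iff)
    have xf: "\<guillemotleft>x' \<cdot> f : a \<rightarrow> s0\<guillemotright>" using f x' by (auto simp: in_hom_iff)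
    show "t a (x \<cdot> f) = FMor M f (t b x)"
      unfolding q t[OF f(2) xf] unfolding x'(2) t[OF f(3) x'(1)]
      by (rule \<pi>_rules(4)[OF f']) (use f x' mem0 in auto)
  qed (rule that; simp)
  have "bij_betw (H.app \<phi> a) (carrier (Hom T a c)) (carrier (FOb M a))" if a: "a \<in> S" for a
    unfolding bij_betw_def
  proof
    have memc: "x \<in> carrier (Hom T a c) \<longleftrightarrow> \<guillemotleft>x : a \<rightarrow> c\<guillemotright>" for x using Hom_iff[OF S_Ob[OF a] C_Ob[OF c]] .
    have app: "H.app \<phi> a (g \<cdot> x) = \<pi> a x" if "\<guillemotleft>x : a \<rightarrow> s0\<guillemotright>" for x
    proof -
      have "\<guillemotleft>g \<cdot> x : a \<rightarrow> c\<guillemotright>" using that hd by (auto simp: in_hom_iff)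
      then show ?thesis using \<phi>(2)[of a "g \<cdot> x"] t[OF a that] a memc by simp
    qed
    show "inj_on (H.app \<phi> a) (carrier (Hom T a c))"
    proof (rule inj_onI)
      fix x y assume xy: "x \<in> carrier (Hom T a c)" "y \<in> carrier (Hom T a c)" and e: "H.app \<phi> a x = H.app \<phi> a y"
      obtain x' where x': "\<guillemotleft>x' : a \<rightarrow> s0\<guillemotright>" "x = g \<cdot> x'" using cov[OF a xy(1)] by blast
      obtain y' where y': "\<guillemotleft>y' : a \<rightarrow> s0\<guillemotright>" "y = g \<cdot> y'" using cov[OF a xy(2)] by blast
      show "x = y" using e unfolding x'(2) y'(2) app[OF x'(1)] app[OF y'(1)] eq[OF a x'(1) y'(1)] .
    qed
    show "H.app \<phi> a ` carrier (Hom T a c) = carrier (FOb M a)"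
    proof
      show "H.app \<phi> a ` carrier (Hom T a c) \<subseteq> carrier (FOb M a)" using H.app_closed[OF \<phi>(1), of a] a by auto
      show "carrier (FOb M a) \<subseteq> H.app \<phi> a ` carrier (Hom T a c)"
      proof
        fix m assume "m \<in> carrier (FOb M a)"
        then obtain x where x: "\<guillemotleft>x : a \<rightarrow> s0\<guillemotright>" "\<pi> a x = m" using onto[OF a] by blast
        have "\<guillemotleft>g \<cdot> x : a \<rightarrow> c\<guillemotright>" using x hd by (auto simp: in_hom_iff)
        then have "g \<cdot> x \<in> carrier (Hom T a c)" using memc by blast
        moreover have "m = H.app \<phi> a (g \<cdot> x)" using app[OF x(1)] x(2) by simp
        ultimately show "m \<in> H.app \<phi> a ` carrier (Hom T a c)" by (rule rev_image_eqI)
      qed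
    qed
  qed
  then have "is_iso H \<phi> (representable T c) M" using H.iso_pointwise[OF \<phi>(1)] by simp
  then show thesis using that[OF c] unfolding isomorphic_def by blast
qed

text \<open>The dictionary between torsion conditions in \<open>mod S\<close> and ghosts in
  \<open>C\<close>: \<open>F\<close> is full, and ghosts are what it sends to zero.\<close>

lemma hom_yoneda_zero_iff:
  assumes cd: "c \<in> C" "d \<in> C"
  shows "carrier (Hom H (representable T c) (representable T d)) = {zero_mor H (representable T c) (representable T d)}
    \<longleftrightarrow> (\<forall>g. \<guillemotleft>g : c \<rightarrow> d\<guillemotright> \<longrightarrow> ghost g)"
  unfolding H.hom_zero_iff[OF yoneda_Ob[OF cd(1)] yoneda_Ob[OF cd(2)]]
proof
  assume *: "\<forall>\<phi>. \<guillemotleft>\<phi> : representable T c \<rightarrow>\<^bsub>H\<^esub> representable T d\<guillemotright> \<longrightarrow> (\<forall>a\<in>Ob (full_sub T S).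
    \<forall>x\<in>carrier (FOb (representable T c) a). H.app \<phi> a x = \<zero>\<^bsub>FOb (representable T d) a\<^esub>)"
  show "\<forall>g. \<guillemotleft>g : c \<rightarrow> d\<guillemotright> \<longrightarrow> ghost g"
  proof (intro allI impI)
    fix g assume g: "\<guillemotleft>g : c \<rightarrow> d\<guillemotright>"
    show "ghost g"
      by (rule ghostI[OF g]) (use *[rule_format, OF yoneda_mor(1)[OF g cd]] yoneda_mor(2)[OF g cd] carrier_yoneda[OF cd(1)] in simp)
  qed
next
  assume *: "\<forall>g. \<guillemotleft>g : c \<rightarrow> d\<guillemotright> \<longrightarrow> ghost g"
  show "\<forall>\<phi>. \<guillemotleft>\<phi> : representable T c \<rightarrow>\<^bsub>H\<^esub> representable T d\<guillemotright> \<longrightarrow> (\<forall>a\<in>Ob (full_sub T S).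
    \<forall>x\<in>carrier (FOb (representable T c) a). H.app \<phi> a x = \<zero>\<^bsub>FOb (representable T d) a\<^esub>)"
  proof (intro allI impI ballI)
    fix \<phi> a x assume \<phi>: "\<guillemotleft>\<phi> : representable T c \<rightarrow>\<^bsub>H\<^esub> representable T d\<guillemotright>" and "a \<in> Ob (full_sub T S)"
      and x: "x \<in> carrier (FOb (representable T c) a)"
    then have a: "a \<in> S" by simp
    have x: "\<guillemotleft>x : a \<rightarrow> c\<guillemotright>" using x carrier_yoneda[OF cd(1) a] by blast
    obtain g where g: "\<guillemotleft>g : c \<rightarrow> d\<guillemotright>" "\<phi> = FMor F g" using yoneda_full[OF \<phi> cd] .
    show "H.app \<phi> a x = \<zero>\<^bsub>FOb (representable T d) a\<^esub>"
      unfolding g(2) yoneda_mor(2)[OF g(1) cd a x] using ghostD[OF _ g(1) a x] * g(1) by simp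
  qed
qed

lemma linear_functor_yoneda: "linear_functor k (full_sub T C) H F"
  unfolding linear_functor_def full_sub_simps in_hom_full_sub[OF C_sub] FOb_restricted_yoneda
proof (intro conjI allI ballI impI)
  show "representable T a \<in> Ob H" if "a \<in> C" for a using yoneda_Ob[OF that] .
  show "\<guillemotleft>FMor F f : representable T a \<rightarrow>\<^bsub>H\<^esub> representable T b\<guillemotright>" if "a \<in> C \<and> b \<in> C \<and> \<guillemotleft>f : a \<rightarrow> b\<guillemotright>" for a b f
    using yoneda_mor(1) that by blast
next
  fix a assume a: "a \<in> C"
  have I: "\<guillemotleft>Id T a : a \<rightarrow> a\<guillemotright>" using Id_in C_Ob a by blast
  show "FMor F (Id T a) = Id H (representable T a)"
    by (rule H.mor_eqI[OF yoneda_mor(1)[OF I a a] H.Id_H(1)[OF yoneda_Ob[OF a]]])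
      (use a carrier_yoneda[OF a] in \<open>simp add: yoneda_mor(2)[OF I a a] H.Id_H(2)[OF yoneda_Ob[OF a]] in_hom_iff\<close>)
next
  fix a b c f g assume "(a \<in> C \<and> b \<in> C \<and> \<guillemotleft>f : a \<rightarrow> b\<guillemotright>) \<and> b \<in> C \<and> c \<in> C \<and> \<guillemotleft>g : b \<rightarrow> c\<guillemotright>"
  then have C: "a \<in> C" "b \<in> C" "c \<in> C" and f: "\<guillemotleft>f : a \<rightarrow> b\<guillemotright>" and g: "\<guillemotleft>g : b \<rightarrow> c\<guillemotright>" by auto
  note gf = Cmp_in[OF f g]
  note Ff = yoneda_mor[OF f C(1,2)] and Fg = yoneda_mor[OF g C(2,3)] and Fgf = yoneda_mor[OF gf C(1,3)]
  show "FMor F (g \<cdot> f) = FMor F g \<cdot>\<^bsub>H\<^esub> FMor F f"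
  proof (rule H.mor_eqI[OF Fgf(1) H.Cmp_H(1)[OF Ff(1) Fg(1)]])
    fix d x assume d: "d \<in> Ob (full_sub T S)" and x: "x \<in> carrier (FOb (representable T a) d)"
    then have dS: "d \<in> S" and x': "\<guillemotleft>x : d \<rightarrow> a\<guillemotright>" using carrier_yoneda[OF C(1)] by auto
    have fx: "\<guillemotleft>f \<cdot> x : d \<rightarrow> b\<guillemotright>" using Cmp_in[OF x' f] .
    show "H.app (FMor F (g \<cdot> f)) d x = H.app (FMor F g \<cdot>\<^bsub>H\<^esub> FMor F f) d x"
      unfolding H.Cmp_H(2)[OF Ff(1) Fg(1) d x] Ff(2)[OF dS x'] Fg(2)[OF dS fx] Fgf(2)[OF dS x']
      by (rule Cmp_assoc[OF x' f g])
  qed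
next
  fix a b f g assume "(a \<in> C \<and> b \<in> C \<and> \<guillemotleft>f : a \<rightarrow> b\<guillemotright>) \<and> a \<in> C \<and> b \<in> C \<and> \<guillemotleft>g : a \<rightarrow> b\<guillemotright>"
  then have C: "a \<in> C" "b \<in> C" and f: "\<guillemotleft>f : a \<rightarrow> b\<guillemotright>" and g: "\<guillemotleft>g : a \<rightarrow> b\<guillemotright>" by auto
  have eq: "(f \<boxplus> g) \<cdot> x = (f \<cdot> x) \<oplus>\<^bsub>Hom T d b\<^esub> (g \<cdot> x)" if "d \<in> S" "x \<in> carrier (Hom T d a)" for d x
    using that f g C_Ob[OF C(1)] S_Ob[OF that(1)] by (simp add: in_hom_iff) (simp add: plus_mor_def)
  have fg: "f \<oplus>\<^bsub>Hom T a b\<^esub> g = f \<boxplus> g" using f by (simp add: plus_mor_def in_hom_iff)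
  show "FMor F (f \<oplus>\<^bsub>Hom T a b\<^esub> g) = FMor F f \<oplus>\<^bsub>Hom H (representable T a) (representable T b)\<^esub> FMor F g"
    unfolding fg using f g eq
    by (auto simp: restricted_yoneda_def mod_cat_def in_hom_iff fun_eq_iff restrict_def simp del: plus_Cmp carrier_Hom)
next
  fix a b f r assume r: "r \<in> carrier k" and "a \<in> C \<and> b \<in> C \<and> \<guillemotleft>f : a \<rightarrow> b\<guillemotright>"
  then have C: "a \<in> C" "b \<in> C" and f: "\<guillemotleft>f : a \<rightarrow> b\<guillemotright>" by auto
  have eq: "(r \<odot>\<^bsub>Hom T a b\<^esub> f) \<cdot> x = r \<odot>\<^bsub>Hom T d b\<^esub> (f \<cdot> x)" if "d \<in> S" "x \<in> carrier (Hom T d a)" for d x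
    using Cmp_smult_left[OF r _ f] that Hom_iff[OF S_Ob[OF that(1)] C_Ob[OF C(1)]] by blast
  have rf: "Dom T (r \<odot>\<^bsub>Hom T a b\<^esub> f) = a" "Cod T (r \<odot>\<^bsub>Hom T a b\<^esub> f) = b" "Dom T f = a" "Cod T f = b"
    using f r by (auto simp: in_hom_iff)
  show "FMor F (r \<odot>\<^bsub>Hom T a b\<^esub> f) = r \<odot>\<^bsub>Hom H (representable T a) (representable T b)\<^esub> FMor F f"
    using eq by (auto simp: restricted_yoneda_def mod_cat_def rf fun_eq_iff restrict_def simp del: carrier_Hom)
qed

end

section \<open>The bijection\<close>

context two_term_noetherian
begin

interpretation H: functor_category k "full_sub T S" H
  by unfold_locales simp

abbreviation EI :: "'o set \<Rightarrow> ('k, 'o, 'm, 'm) modfunc set"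
  where "EI Y \<equiv> essential_image H F Y"

lemma EI_iff: "M \<in> EI Y \<longleftrightarrow> M \<in> Ob H \<and> (\<exists>y\<in>Y. isomorphic H (representable T y) M)"
  by (simp add: essential_image_def)

lemma yoneda_EI: "y \<in> Y \<Longrightarrow> y \<in> C \<Longrightarrow> representable T y \<in> EI Y"
  using yoneda_Ob H.isomorphic_refl unfolding EI_iff by blast

text \<open>The sequence \<open>c' \<rightarrow> c \<rightarrow> z\<close> is transported along an
  isomorphism of \<open>F c\<close> with \<open>h\<close>. Exactness is kept in pointwise form
  because it serves twice: for short exactness, and to see that \<open>f\<close> is bijective when
  \<open>g\<close> vanishes.\<close>

lemma torsion_sequence:
  assumes cot: "complete_cotorsion_pair T C X Y" and h: "h \<in> Ob H"
  obtains t v f g where "t \<in> EI Y" "v \<in> right_perp H (EI Y)" "\<guillemotleft>f : t \<rightarrow>\<^bsub>H\<^esub> h\<guillemotright>" "\<guillemotleft>g : h \<rightarrow>\<^bsub>H\<^esub> v\<guillemotright>"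
    "\<And>a. a \<in> S \<Longrightarrow> inj_on (H.app f a) (carrier (FOb t a))"
    "\<And>a y. a \<in> S \<Longrightarrow> y \<in> carrier (FOb h a) \<Longrightarrow> H.app g a y = \<zero>\<^bsub>FOb v a\<^esub> \<longleftrightarrow> y \<in> H.app f a ` carrier (FOb t a)"
    "\<And>a. a \<in> S \<Longrightarrow> H.app g a ` carrier (FOb h a) = carrier (FOb v a)"
proof -
  have YC: "Y \<subseteq> C" using cot unfolding cotorsion_pair_iff right_ext_perp_def by blast
  obtain c where c: "c \<in> C" and iso: "isomorphic H (representable T c) h" using yoneda_dense[OF h] .
  obtain i j where i: "\<guillemotleft>i : representable T c \<rightarrow>\<^bsub>H\<^esub> h\<guillemotright>" and j: "\<guillemotleft>j : h \<rightarrow>\<^bsub>H\<^esub> representable T c\<guillemotright>"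
    and ji: "\<And>a x. a \<in> Ob (full_sub T S) \<Longrightarrow> x \<in> carrier (FOb (representable T c) a) \<Longrightarrow> H.app j a (H.app i a x) = x"
    and ij: "\<And>a x. a \<in> Ob (full_sub T S) \<Longrightarrow> x \<in> carrier (FOb h a) \<Longrightarrow> H.app i a (H.app j a x) = x"
    by (rule H.isomorphicE[OF iso]) (rule that)
  obtain c' z m \<rho> where c': "c' \<in> Y" and z: "z \<in> C" and ex: "S_exact c' c z m \<rho>"
    and gh: "\<And>y g. y \<in> Y \<Longrightarrow> \<guillemotleft>g : y \<rightarrow> z\<guillemotright> \<Longrightarrow> ghost g"
    by (rule torsion_part[OF cot c]) (rule that)
  have m: "\<guillemotleft>m : c' \<rightarrow> c\<guillemotright>" and \<rho>: "\<guillemotleft>\<rho> : c \<rightarrow> z\<guillemotright>"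
    and m0: "\<And>a v. a \<in> S \<Longrightarrow> \<guillemotleft>v : a \<rightarrow> c'\<guillemotright> \<Longrightarrow> m \<cdot> v = zero_mor T a c \<Longrightarrow> v = zero_mor T a c'"
    and \<rho>0: "\<And>a v. a \<in> S \<Longrightarrow> \<guillemotleft>v : a \<rightarrow> c\<guillemotright> \<Longrightarrow> \<rho> \<cdot> v = zero_mor T a z \<longleftrightarrow> (\<exists>w. \<guillemotleft>w : a \<rightarrow> c'\<guillemotright> \<and> v = m \<cdot> w)"
    and \<rho>s: "\<And>a v. a \<in> S \<Longrightarrow> \<guillemotleft>v : a \<rightarrow> z\<guillemotright> \<Longrightarrow> \<exists>w. \<guillemotleft>w : a \<rightarrow> c\<guillemotright> \<and> v = \<rho> \<cdot> w"
    using ex unfolding S_exact_def by blast+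
  have c'C: "c' \<in> C" using c' YC by blast
  note Fm = yoneda_mor[OF m c'C c] and F\<rho> = yoneda_mor[OF \<rho> c z]
  note car = carrier_yoneda[OF c] and car' = carrier_yoneda[OF c'C] and carz = carrier_yoneda[OF z]
  let ?f = "i \<cdot>\<^bsub>H\<^esub> FMor F m" and ?g = "FMor F \<rho> \<cdot>\<^bsub>H\<^esub> j"
  have f: "\<guillemotleft>?f : representable T c' \<rightarrow>\<^bsub>H\<^esub> h\<guillemotright>" by (rule H.Cmp_H(1)[OF Fm(1) i])
  have g: "\<guillemotleft>?g : h \<rightarrow>\<^bsub>H\<^esub> representable T z\<guillemotright>" by (rule H.Cmp_H(1)[OF j F\<rho>(1)])
  have fv: "H.app ?f a v = H.app i a (m \<cdot> v)" if "a \<in> S" "\<guillemotleft>v : a \<rightarrow> c'\<guillemotright>" for a v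
    using H.Cmp_H(2)[OF Fm(1) i, of a v] that car' Fm(2) by simp
  have jx: "\<guillemotleft>H.app j a x : a \<rightarrow> c\<guillemotright>" if "a \<in> S" "x \<in> carrier (FOb h a)" for a x
    using H.app_closed[OF j, of a x] that car[OF that(1)] by simp
  have gx: "H.app ?g a x = \<rho> \<cdot> H.app j a x" if "a \<in> S" "x \<in> carrier (FOb h a)" for a x
    using H.Cmp_H(2)[OF j F\<rho>(1), of a x] that F\<rho>(2)[OF that(1) jx[OF that]] by simp
  have iv: "H.app i a v \<in> carrier (FOb h a)" "H.app j a (H.app i a v) = v" if "a \<in> S" "\<guillemotleft>v : a \<rightarrow> c\<guillemotright>" for a v
    using H.app_closed[OF i, of a v] ji[of a v] that car[OF that(1)] by simp_all
  have mv: "\<guillemotleft>m \<cdot> v : a \<rightarrow> c\<guillemotright>" if "\<guillemotleft>v : a \<rightarrow> c'\<guillemotright>" for a v using Cmp_in[OF that m] .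
  show thesis
  proof (rule that[OF _ _ f g])
    show "representable T c' \<in> EI Y" by (rule yoneda_EI[OF c' c'C])
    show "representable T z \<in> right_perp H (EI Y)"
      unfolding right_perp_def
    proof (intro CollectI conjI ballI)
      show "representable T z \<in> Ob H" by (rule yoneda_Ob[OF z])
      fix u assume "u \<in> EI Y"
      then obtain y where y: "y \<in> Y" "isomorphic H (representable T y) u" unfolding EI_iff by blast
      have yC: "y \<in> C" using y YC by blast
      have "carrier (Hom H (representable T y) (representable T z)) = {zero_mor H (representable T y) (representable T z)}"
        unfolding hom_yoneda_zero_iff[OF yC z] using gh[OF y(1)] by blast
      then show "carrier (Hom H u (representable T z)) = {zero_mor H u (representable T z)}"
        by (rule H.hom_zero_iso[OF y(2) H.isomorphic_refl[OF yoneda_Ob[OF z]]])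
    qed
  next
    fix a assume a: "a \<in> S"
    show "inj_on (H.app ?f a) (carrier (FOb (representable T c') a))"
    proof (rule inj_onI)
      fix v w assume "v \<in> carrier (FOb (representable T c') a)" "w \<in> carrier (FOb (representable T c') a)"
        and e: "H.app ?f a v = H.app ?f a w"
      then have v: "\<guillemotleft>v : a \<rightarrow> c'\<guillemotright>" and w: "\<guillemotleft>w : a \<rightarrow> c'\<guillemotright>" using car'[OF a] by auto
      have "H.app j a (H.app i a (m \<cdot> v)) = H.app j a (H.app i a (m \<cdot> w))" using e fv[OF a v] fv[OF a w] by simp
      then have mm: "m \<cdot> v = m \<cdot> w" using iv(2)[OF a mv[OF v]] iv(2)[OF a mv[OF w]] by simp
      have "m \<cdot> (v \<boxplus> neg_mor w) = zero_mor T a c" using mm v w m by (auto simp: in_hom_iff)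
      then have "v \<boxplus> neg_mor w = zero_mor T a c'" using m0[OF a, of "v \<boxplus> neg_mor w"] v w by (auto simp: in_hom_iff)
      then show "v = w" by (subst (asm) diff_eq_zero) (use v w in \<open>auto simp: in_hom_iff\<close>)
    qed
    show "H.app ?g a ` carrier (FOb h a) = carrier (FOb (representable T z) a)"
    proof
      show "H.app ?g a ` carrier (FOb h a) \<subseteq> carrier (FOb (representable T z) a)"
        using H.app_closed[OF g, of a] a by auto
      show "carrier (FOb (representable T z) a) \<subseteq> H.app ?g a ` carrier (FOb h a)"
      proof
        fix v assume "v \<in> carrier (FOb (representable T z) a)"
        then have "\<guillemotleft>v : a \<rightarrow> z\<guillemotright>" using carz[OF a] by blast
        then obtain w where w: "\<guillemotleft>w : a \<rightarrow> c\<guillemotright>" "v = \<rho> \<cdot> w" using \<rho>s[OF a] by blast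
        have "v = H.app ?g a (H.app i a w)" using gx[OF a iv(1)[OF a w(1)]] iv(2)[OF a w(1)] w(2) by simp
        then show "v \<in> H.app ?g a ` carrier (FOb h a)" using iv(1)[OF a w(1)] by blast
      qed
    qed
    fix x assume x: "x \<in> carrier (FOb h a)"
    have "H.app ?g a x = \<zero>\<^bsub>FOb (representable T z) a\<^esub> \<longleftrightarrow> (\<exists>w. \<guillemotleft>w : a \<rightarrow> c'\<guillemotright> \<and> H.app j a x = m \<cdot> w)"
      unfolding gx[OF a x] using \<rho>0[OF a jx[OF a x]] by simp
    also have "\<dots> \<longleftrightarrow> (\<exists>w. \<guillemotleft>w : a \<rightarrow> c'\<guillemotright> \<and> x = H.app ?f a w)"
    proof -
      have "H.app j a x = m \<cdot> w \<longleftrightarrow> x = H.app ?f a w" if "\<guillemotleft>w : a \<rightarrow> c'\<guillemotright>" for w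
        using fv[OF a that] iv(2)[OF a mv[OF that]] ij[of a x] x a by auto
      then show ?thesis by blast
    qed
    also have "\<dots> \<longleftrightarrow> x \<in> H.app ?f a ` carrier (FOb (representable T c') a)" using car'[OF a] by auto
    finally show "H.app ?g a x = \<zero>\<^bsub>FOb (representable T z) a\<^esub> \<longleftrightarrow> x \<in> H.app ?f a ` carrier (FOb (representable T c') a)" .
  qed
qed

lemma EI_iso: "M \<in> EI Y \<Longrightarrow> isomorphic H M N \<Longrightarrow> N \<in> EI Y"
  using H.isomorphic_trans[of _ M N] H.isomorphicE[of M N] unfolding EI_iff H.in_H_iff by metis

text \<open>If \<open>h\<close> has no nonzero morphism to a torsionfree object, the epimorphism
  onto its torsionfree quotient is zero, so \<open>h\<close> is isomorphic to its torsion
  part.\<close>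

lemma cotorsion_pair_torsion_pair:
  assumes cot: "complete_cotorsion_pair T C X Y"
  shows "torsion_pair H (EI Y) (right_perp H (EI Y))"
proof -
  have "left_perp H (right_perp H (EI Y)) = EI Y"
  proof
    show "EI Y \<subseteq> left_perp H (right_perp H (EI Y))"
      by (auto simp: left_perp_def right_perp_def EI_iff)
    show "left_perp H (right_perp H (EI Y)) \<subseteq> EI Y"
    proof
      fix h assume "h \<in> left_perp H (right_perp H (EI Y))"
      then have h: "h \<in> Ob H" and hv: "\<And>v. v \<in> right_perp H (EI Y) \<Longrightarrow> carrier (Hom H h v) = {zero_mor H h v}"
        by (auto simp: left_perp_def)
      obtain t v f g where *: "t \<in> EI Y" "v \<in> right_perp H (EI Y)" "\<guillemotleft>f : t \<rightarrow>\<^bsub>H\<^esub> h\<guillemotright>" "\<guillemotleft>g : h \<rightarrow>\<^bsub>H\<^esub> v\<guillemotright>"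
        "\<And>a. a \<in> S \<Longrightarrow> inj_on (H.app f a) (carrier (FOb t a))"
        "\<And>a y. a \<in> S \<Longrightarrow> y \<in> carrier (FOb h a) \<Longrightarrow> H.app g a y = \<zero>\<^bsub>FOb v a\<^esub> \<longleftrightarrow> y \<in> H.app f a ` carrier (FOb t a)"
        by (rule torsion_sequence[OF cot h]) (rule that)
      have v: "v \<in> Ob H" using *(2) by (simp add: right_perp_def)
      have g0: "H.app g a y = \<zero>\<^bsub>FOb v a\<^esub>" if "a \<in> S" "y \<in> carrier (FOb h a)" for a y
        using hv[OF *(2), unfolded H.hom_zero_iff[OF h v], rule_format, OF *(4)] that by simp
      have "bij_betw (H.app f a) (carrier (FOb t a)) (carrier (FOb h a))" if a: "a \<in> S" for a
        unfolding bij_betw_def using *(5)[OF a] *(6)[OF a] g0[OF a] H.app_closed[OF *(3), of a] a by auto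
      then have "is_iso H f t h" using H.iso_pointwise[OF *(3)] by simp
      then have "isomorphic H t h" unfolding isomorphic_def by blast
      then show "h \<in> EI Y" by (rule EI_iso[OF *(1)])
    qed
  qed
  moreover have "\<exists>t\<in>EI Y. \<exists>v\<in>right_perp H (EI Y). \<exists>f g. short_exact H t h v f g" if h: "h \<in> Ob H" for h
  proof -
    obtain t v f g where *: "t \<in> EI Y" "v \<in> right_perp H (EI Y)" "\<guillemotleft>f : t \<rightarrow>\<^bsub>H\<^esub> h\<guillemotright>" "\<guillemotleft>g : h \<rightarrow>\<^bsub>H\<^esub> v\<guillemotright>"
      "\<And>a. a \<in> S \<Longrightarrow> inj_on (H.app f a) (carrier (FOb t a))"
      "\<And>a y. a \<in> S \<Longrightarrow> y \<in> carrier (FOb h a) \<Longrightarrow> H.app g a y = \<zero>\<^bsub>FOb v a\<^esub> \<longleftrightarrow> y \<in> H.app f a ` carrier (FOb t a)"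
      "\<And>a. a \<in> S \<Longrightarrow> H.app g a ` carrier (FOb h a) = carrier (FOb v a)"
      by (rule torsion_sequence[OF cot h]) (rule that)
    have "short_exact H t h v f g"
      by (rule H.short_exact_pointwise[OF *(3,4)]) (simp_all add: *(5-7))
    then show ?thesis using * by blast
  qed
  ultimately show ?thesis
    unfolding torsion_pair_def by (auto simp: EI_iff right_perp_def)
qed

text \<open>\<open>F\<close> carries the left approximation \<open>c \<rightarrow> y\<close> with
  cone \<open>x\<close> in \<open>X\<close> to one of \<open>h\<close>: a morphism from
  \<open>h\<close> to \<open>F y'\<close> comes from some \<open>c \<rightarrow> y'\<close> by
  fullness, and this extends to \<open>y\<close> because
  \<open>T(x, \<Sigma> y') = 0\<close>.\<close>

lemma cotorsion_pair_covariantly_finite: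
  assumes cot: "complete_cotorsion_pair T C X Y"
  shows "covariantly_finite H (EI Y)"
  unfolding covariantly_finite_def
proof
  fix h assume h: "h \<in> Ob H"
  have X: "X = left_ext_perp Y" and Y: "Y = right_ext_perp X"
    and tri: "\<And>c. c \<in> C \<Longrightarrow> \<exists>x\<in>X. \<exists>y\<in>Y. \<exists>f g h. dist_triangle T c y x f g h"
    using cot unfolding cotorsion_pair_iff by blast+
  have YC: "y \<in> C" if "y \<in> Y" for y using that Y unfolding right_ext_perp_def by blast
  obtain c where c: "c \<in> C" and iso: "isomorphic H (representable T c) h" using yoneda_dense[OF h] .
  obtain i j where i: "\<guillemotleft>i : representable T c \<rightarrow>\<^bsub>H\<^esub> h\<guillemotright>" and j: "\<guillemotleft>j : h \<rightarrow>\<^bsub>H\<^esub> representable T c\<guillemotright>"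
    and ij: "\<And>a x. a \<in> Ob (full_sub T S) \<Longrightarrow> x \<in> carrier (FOb h a) \<Longrightarrow> H.app i a (H.app j a x) = x"
    by (rule H.isomorphicE[OF iso]) (rule that)
  obtain x y f p q where xy: "x \<in> X" "y \<in> Y" and d: "dist_triangle T c y x f p q" using tri[OF c] by blast
  have yC: "y \<in> C" by (rule YC[OF xy(2)])
  note hd = dist_hom[OF d]
  note Ff = yoneda_mor[OF hd(1) c yC]
  have fj: "\<guillemotleft>FMor F f \<cdot>\<^bsub>H\<^esub> j : h \<rightarrow>\<^bsub>H\<^esub> representable T y\<guillemotright>" by (rule H.Cmp_H(1)[OF j Ff(1)])
  have "\<exists>g. \<guillemotleft>g : representable T y \<rightarrow>\<^bsub>H\<^esub> t\<guillemotright> \<and> \<phi> = g \<cdot>\<^bsub>H\<^esub> (FMor F f \<cdot>\<^bsub>H\<^esub> j)"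
    if t: "t \<in> EI Y" and \<phi>: "\<guillemotleft>\<phi> : h \<rightarrow>\<^bsub>H\<^esub> t\<guillemotright>" for t \<phi>
  proof -
    obtain y' where y': "y' \<in> Y" "isomorphic H (representable T y') t" using t unfolding EI_iff by blast
    have y'C: "y' \<in> C" by (rule YC[OF y'(1)])
    obtain \<theta> \<theta>' where \<theta>: "\<guillemotleft>\<theta> : representable T y' \<rightarrow>\<^bsub>H\<^esub> t\<guillemotright>" and \<theta>': "\<guillemotleft>\<theta>' : t \<rightarrow>\<^bsub>H\<^esub> representable T y'\<guillemotright>"
      and \<theta>\<theta>': "\<And>a x. a \<in> Ob (full_sub T S) \<Longrightarrow> x \<in> carrier (FOb t a) \<Longrightarrow> H.app \<theta> a (H.app \<theta>' a x) = x"
      by (rule H.isomorphicE[OF y'(2)]) (rule that)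
    note c1 = H.Cmp_H[OF i \<phi>]
    note c2 = H.Cmp_H[OF c1(1) \<theta>']
    obtain g where g: "\<guillemotleft>g : c \<rightarrow> y'\<guillemotright>" "\<theta>' \<cdot>\<^bsub>H\<^esub> (\<phi> \<cdot>\<^bsub>H\<^esub> i) = FMor F g" using yoneda_full[OF c2(1) c y'C] .
    have ext: "ext_zero x y'" using X xy(1) y'(1) unfolding left_ext_perp_def by blast
    have "\<guillemotleft>shift_mor T g \<cdot> q : x \<rightarrow> \<Sigma> y'\<guillemotright>" using g(1) hd by (auto simp: in_hom_iff)
    then have "shift_mor T g \<cdot> q = zero_mor T x (\<Sigma> y')" by (rule ext_zeroD[OF ext])
    then obtain g' where g': "\<guillemotleft>g' : y \<rightarrow> y'\<guillemotright>" "g = g' \<cdot> f" using exact_contra3[OF d g(1)] by blast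
    note Fg' = yoneda_mor[OF g'(1) yC y'C] and Fg = yoneda_mor[OF g(1) c y'C]
    note c3 = H.Cmp_H[OF Fg'(1) \<theta>]
    note c4 = H.Cmp_H[OF j Ff(1)]
    note c5 = H.Cmp_H[OF c4(1) c3(1)]
    have "\<phi> = (\<theta> \<cdot>\<^bsub>H\<^esub> FMor F g') \<cdot>\<^bsub>H\<^esub> (FMor F f \<cdot>\<^bsub>H\<^esub> j)"
    proof (rule H.mor_eqI[OF \<phi> c5(1)])
      fix a u assume a: "a \<in> Ob (full_sub T S)" and u: "u \<in> carrier (FOb h a)"
      have aS: "a \<in> S" using a by simp
      note ju = H.app_closed[OF j a u]
      have ju': "\<guillemotleft>H.app j a u : a \<rightarrow> c\<guillemotright>" using ju carrier_yoneda[OF c aS] by blast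
      have fju: "\<guillemotleft>f \<cdot> H.app j a u : a \<rightarrow> y\<guillemotright>" using Cmp_in[OF ju' hd(1)] .
      then have fju': "f \<cdot> H.app j a u \<in> carrier (FOb (representable T y) a)" using carrier_yoneda[OF yC aS] by blast
      have "H.app ((\<theta> \<cdot>\<^bsub>H\<^esub> FMor F g') \<cdot>\<^bsub>H\<^esub> (FMor F f \<cdot>\<^bsub>H\<^esub> j)) a u = H.app \<theta> a (g' \<cdot> (f \<cdot> H.app j a u))"
        unfolding c5(2)[OF a u] c4(2)[OF a u] Ff(2)[OF aS ju'] c3(2)[OF a fju'] Fg'(2)[OF aS fju] ..
      also have "g' \<cdot> (f \<cdot> H.app j a u) = g \<cdot> H.app j a u"
        unfolding g'(2) by (rule Cmp_assoc[OF ju' hd(1) g'(1), symmetric])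
      also have "\<dots> = H.app (\<theta>' \<cdot>\<^bsub>H\<^esub> (\<phi> \<cdot>\<^bsub>H\<^esub> i)) a (H.app j a u)" unfolding g(2) Fg(2)[OF aS ju'] ..
      also have "\<dots> = H.app \<theta>' a (H.app \<phi> a u)" unfolding c2(2)[OF a ju] c1(2)[OF a ju] ij[OF a u] ..
      also have "H.app \<theta> a \<dots> = H.app \<phi> a u" by (rule \<theta>\<theta>'[OF a H.app_closed[OF \<phi> a u]])
      finally show "H.app \<phi> a u = H.app ((\<theta> \<cdot>\<^bsub>H\<^esub> FMor F g') \<cdot>\<^bsub>H\<^esub> (FMor F f \<cdot>\<^bsub>H\<^esub> j)) a u" ..
    qed
    then show ?thesis using c3(1) by blast
  qed
  then show "\<exists>t\<in>EI Y. \<exists>f. \<guillemotleft>f : h \<rightarrow>\<^bsub>H\<^esub> t\<guillemotright> \<and> (\<forall>t'\<in>EI Y. \<forall>f'. \<guillemotleft>f' : h \<rightarrow>\<^bsub>H\<^esub> t'\<guillemotright> \<longrightarrow> (\<exists>g. \<guillemotleft>g : t \<rightarrow>\<^bsub>H\<^esub> t'\<guillemotright> \<and> f' = g \<cdot>\<^bsub>H\<^esub> f))"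
    using yoneda_EI[OF xy(2) yC] fj by blast
qed

text \<open>An isomorphism of \<open>F y\<close> with \<open>F c\<close> lifts by fullness to a
  morphism \<open>y \<rightarrow> c\<close>, though not necessarily to an isomorphism. The lift is
  onto on \<open>S\<close>, and closure of \<open>Y\<close> under quotients in this sense
  suffices.\<close>

lemma EI_inj:
  assumes cot: "complete_cotorsion_pair T C X Y" and Y'C: "Y' \<subseteq> C" and eq: "EI Y' \<subseteq> EI Y"
  shows "Y' \<subseteq> Y"
proof
  fix c assume c: "c \<in> Y'"
  have X: "X = left_ext_perp Y" and Y: "Y = right_ext_perp X" using cot unfolding cotorsion_pair_iff by blast+
  have XC: "X \<subseteq> C" using X unfolding left_ext_perp_def by blast
  have cC: "c \<in> C" using c Y'C by blast
  have "representable T c \<in> EI Y" using yoneda_EI[OF c cC] eq by blast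
  then obtain y where y: "y \<in> Y" and iso: "isomorphic H (representable T y) (representable T c)" unfolding EI_iff by blast
  have yC: "y \<in> C" using y Y unfolding right_ext_perp_def by blast
  obtain \<theta> \<theta>' where \<theta>: "\<guillemotleft>\<theta> : representable T y \<rightarrow>\<^bsub>H\<^esub> representable T c\<guillemotright>" and \<theta>': "\<guillemotleft>\<theta>' : representable T c \<rightarrow>\<^bsub>H\<^esub> representable T y\<guillemotright>"
    and \<theta>\<theta>': "\<And>a x. a \<in> Ob (full_sub T S) \<Longrightarrow> x \<in> carrier (FOb (representable T c) a) \<Longrightarrow> H.app \<theta> a (H.app \<theta>' a x) = x"
    by (rule H.isomorphicE[OF iso]) (rule that)
  obtain g where g: "\<guillemotleft>g : y \<rightarrow> c\<guillemotright>" "\<theta> = FMor F g" using yoneda_full[OF \<theta> yC cC] .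
  have "\<exists>u'. \<guillemotleft>u' : a \<rightarrow> y\<guillemotright> \<and> u = g \<cdot> u'" if a: "a \<in> S" and u: "\<guillemotleft>u : a \<rightarrow> c\<guillemotright>" for a u
  proof -
    have u': "u \<in> carrier (FOb (representable T c) a)" using carrier_yoneda[OF cC a] u by blast
    have v: "\<guillemotleft>H.app \<theta>' a u : a \<rightarrow> y\<guillemotright>" using H.app_closed[OF \<theta>' _ u'] a carrier_yoneda[OF yC a] by simp
    have "u = g \<cdot> H.app \<theta>' a u"
      using \<theta>\<theta>'[OF _ u'] a yoneda_mor(2)[OF g(1) yC cC a v] g(2) by simp
    then show ?thesis using v by blast
  qed
  then have "c \<in> right_ext_perp X" using right_ext_perp_quotient[OF XC _ cC g(1)] y Y by blast
  then show "c \<in> Y" using Y by simp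
qed

text \<open>The preimage of \<open>U\<close> is written as \<open>ghost_perp V'\<close>, with
  \<open>V'\<close> the preimage of \<open>V\<close>, because \<open>U\<close> is the left
  orthogonal of \<open>V\<close>; in this form its closure properties are available in
  \<open>C\<close>.\<close>

lemma torsion_pair_cotorsion_pair:
  assumes ks: "krull_schmidt T" and tor: "torsion_pair H U V" and fin: "covariantly_finite H U"
  shows "\<exists>X Y. complete_cotorsion_pair T C X Y \<and> EI Y = U"
proof -
  have U: "U \<subseteq> Ob H" and V: "V \<subseteq> Ob H" and V_eq: "V = right_perp H U" and U_eq: "U = left_perp H V"
    using tor unfolding torsion_pair_def by blast+
  have Uiso: "N \<in> U" if "M \<in> U" "isomorphic H M N" for M N
  proof -
    have N: "N \<in> Ob H" by (rule H.isomorphicE[OF that(2)]) (simp add: H.in_H_iff)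
    have "carrier (Hom H N v) = {zero_mor H N v}" if v: "v \<in> V" for v
      using H.hom_zero_iso[OF \<open>isomorphic H M N\<close> H.isomorphic_refl[of v]] \<open>M \<in> U\<close> U_eq v V unfolding left_perp_def by blast
    then show ?thesis using N unfolding U_eq left_perp_def by blast
  qed
  have Viso: "N \<in> V" if "M \<in> V" "isomorphic H M N" for M N
  proof -
    have N: "N \<in> Ob H" by (rule H.isomorphicE[OF that(2)]) (simp add: H.in_H_iff)
    have "carrier (Hom H u N) = {zero_mor H u N}" if u: "u \<in> U" for u
      using H.hom_zero_iso[OF H.isomorphic_refl[of u] \<open>isomorphic H M N\<close>] \<open>M \<in> V\<close> V_eq u U unfolding right_perp_def by blast
    then show ?thesis using N unfolding V_eq right_perp_def by blast
  qed
  define V' where "V' = {d \<in> C. representable T d \<in> V}"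
  define Y where "Y = ghost_perp V'"
  have YC: "Y \<subseteq> C" by (auto simp: Y_def ghost_perp_def)
  \<comment> \<open>Density replaces each object of \<open>V\<close> by some \<open>F d\<close>, so
    orthogonality to \<open>V\<close> is tested on \<open>V'\<close>.\<close>
  have Y_iff: "c \<in> Y \<longleftrightarrow> representable T c \<in> U" if c: "c \<in> C" for c
  proof
    assume cY: "c \<in> Y"
    have "carrier (Hom H (representable T c) v) = {zero_mor H (representable T c) v}" if v: "v \<in> V" for v
    proof -
      obtain d where d: "d \<in> C" "isomorphic H (representable T d) v" using yoneda_dense v V by blast
      have "representable T d \<in> V" by (rule Viso[OF v H.isomorphic_sym[OF d(2)]])
      then have "d \<in> V'" using d(1) by (simp add: V'_def)
      then have "carrier (Hom H (representable T c) (representable T d)) = {zero_mor H (representable T c) (representable T d)}"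
        unfolding hom_yoneda_zero_iff[OF c d(1)] using cY unfolding Y_def ghost_perp_def by blast
      then show ?thesis by (rule H.hom_zero_iso[OF H.isomorphic_refl[OF yoneda_Ob[OF c]] d(2)])
    qed
    then show "representable T c \<in> U" unfolding U_eq left_perp_def using yoneda_Ob[OF c] by blast
  next
    assume cU: "representable T c \<in> U"
    have "ghost g" if d: "d \<in> V'" and g: "\<guillemotleft>g : c \<rightarrow> d\<guillemotright>" for d g
    proof -
      have dC: "d \<in> C" "representable T d \<in> V" using d by (auto simp: V'_def)
      have "carrier (Hom H (representable T c) (representable T d)) = {zero_mor H (representable T c) (representable T d)}"
        using cU dC(2) unfolding U_eq left_perp_def by blast
      then show ?thesis using hom_yoneda_zero_iff[OF c dC(1)] g by blast
    qed
    then show "c \<in> Y" unfolding Y_def ghost_perp_def using c by blast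
  qed
  have EI: "EI Y = U"
  proof
    show "EI Y \<subseteq> U"
    proof
      fix u assume "u \<in> EI Y"
      then obtain y where y: "y \<in> Y" "isomorphic H (representable T y) u" unfolding EI_iff by blast
      then have "representable T y \<in> U" using Y_iff YC by blast
      then show "u \<in> U" by (rule Uiso[OF _ y(2)])
    qed
    show "U \<subseteq> EI Y"
    proof
      fix u assume u: "u \<in> U"
      then obtain c where c: "c \<in> C" "isomorphic H (representable T c) u" using yoneda_dense U by blast
      have "c \<in> Y" using Y_iff[OF c(1)] Uiso[OF u H.isomorphic_sym[OF c(2)]] by blast
      then show "u \<in> EI Y" unfolding EI_iff using c(2) u U by blast
    qed
  qed
  have "\<exists>y f. left_approx Y a y f" if a: "a \<in> S" for a
  proof -
    have aC: "a \<in> C" by (rule S_C[OF a])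
    obtain t \<phi> where t: "t \<in> U" and \<phi>: "\<guillemotleft>\<phi> : representable T a \<rightarrow>\<^bsub>H\<^esub> t\<guillemotright>"
      and ap: "\<forall>t'\<in>U. \<forall>f'. \<guillemotleft>f' : representable T a \<rightarrow>\<^bsub>H\<^esub> t'\<guillemotright> \<longrightarrow> (\<exists>g. \<guillemotleft>g : t \<rightarrow>\<^bsub>H\<^esub> t'\<guillemotright> \<and> f' = g \<cdot>\<^bsub>H\<^esub> \<phi>)"
      using fin yoneda_Ob[OF aC] unfolding covariantly_finite_def by blast
    obtain y where y: "y \<in> C" and iso: "isomorphic H (representable T y) t" using yoneda_dense t U by blast
    have yY: "y \<in> Y" using Y_iff[OF y] Uiso[OF t H.isomorphic_sym[OF iso]] by blast
    obtain \<theta> \<theta>' where \<theta>: "\<guillemotleft>\<theta> : representable T y \<rightarrow>\<^bsub>H\<^esub> t\<guillemotright>" and \<theta>': "\<guillemotleft>\<theta>' : t \<rightarrow>\<^bsub>H\<^esub> representable T y\<guillemotright>"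
      and \<theta>\<theta>': "\<And>a x. a \<in> Ob (full_sub T S) \<Longrightarrow> x \<in> carrier (FOb t a) \<Longrightarrow> H.app \<theta> a (H.app \<theta>' a x) = x"
      by (rule H.isomorphicE[OF iso]) (rule that)
    note c1 = H.Cmp_H[OF \<phi> \<theta>']
    obtain f where f: "\<guillemotleft>f : a \<rightarrow> y\<guillemotright>" "\<theta>' \<cdot>\<^bsub>H\<^esub> \<phi> = FMor F f" using yoneda_full[OF c1(1) aC y] .
    have I: "\<guillemotleft>Id T a : a \<rightarrow> a\<guillemotright>" using Id_in S_Ob[OF a] by blast
    have I': "Id T a \<in> carrier (FOb (representable T a) a)" using carrier_yoneda[OF aC a] I by blast
    have aS: "a \<in> Ob (full_sub T S)" using a by simp
    have "\<exists>g. \<guillemotleft>g : y \<rightarrow> y'\<guillemotright> \<and> h = g \<cdot> f" if y': "y' \<in> Y" and h: "\<guillemotleft>h : a \<rightarrow> y'\<guillemotright>" for y' h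
    proof -
      have y'C: "y' \<in> C" using y' YC by blast
      note Fh = yoneda_mor[OF h aC y'C]
      have "representable T y' \<in> U" using Y_iff[OF y'C] y' by blast
      then obtain \<gamma> where \<gamma>: "\<guillemotleft>\<gamma> : t \<rightarrow>\<^bsub>H\<^esub> representable T y'\<guillemotright>" "FMor F h = \<gamma> \<cdot>\<^bsub>H\<^esub> \<phi>" using ap Fh(1) by blast
      note c2 = H.Cmp_H[OF \<theta> \<gamma>(1)] and c3 = H.Cmp_H[OF \<phi> \<gamma>(1)]
      obtain g where g: "\<guillemotleft>g : y \<rightarrow> y'\<guillemotright>" "\<gamma> \<cdot>\<^bsub>H\<^esub> \<theta> = FMor F g" using yoneda_full[OF c2(1) y y'C] .
      \<comment> \<open>Equality under \<open>F\<close> determines morphisms only up to ghosts. As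
        the source \<open>a\<close> is itself in \<open>S\<close>, evaluation at its identity gives
        \<open>h = g \<cdot> f\<close> in \<open>T\<close>.\<close>
      have fI: "H.app \<theta>' a (H.app \<phi> a (Id T a)) = f"
        using c1(2)[OF aS I'] yoneda_mor(2)[OF f(1) aC y a I] f by (simp add: in_hom_iff)
      have f': "f \<in> carrier (FOb (representable T y) a)" using carrier_yoneda[OF y a] f(1) by blast
      have "h = H.app (FMor F h) a (Id T a)" using Fh(2)[OF a I] h by (simp add: in_hom_iff)
      also have "\<dots> = H.app \<gamma> a (H.app \<phi> a (Id T a))" unfolding \<gamma>(2) by (rule c3(2)[OF aS I'])
      also have "H.app \<phi> a (Id T a) = H.app \<theta> a f"
        unfolding fI[symmetric] by (rule \<theta>\<theta>'[OF aS H.app_closed[OF \<phi> aS I'], symmetric])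
      also have "H.app \<gamma> a (H.app \<theta> a f) = H.app (FMor F g) a f" unfolding g(2)[symmetric] by (rule c2(2)[OF aS f', symmetric])
      also have "\<dots> = g \<cdot> f" by (rule yoneda_mor(2)[OF g(1) y y'C a f(1)])
      finally show ?thesis using g(1) by blast
    qed
    then have "left_approx Y a y f" unfolding left_approx_def using yY f(1) by blast
    then show ?thesis by blast
  qed
  from ghost_perp_cotorsion_pair[OF ks Y_def this] show ?thesis using EI by blast
qed

text \<open>Injectivity: \<open>Y\<close> is recovered from its essential image, and
  \<open>X\<close> from \<open>Y\<close> as an orthogonal class. Surjectivity: the preimage of
  \<open>U\<close> gives a cotorsion pair, and \<open>V\<close> is determined by
  \<open>U\<close>.\<close>

theorem cotorsion_torsion_bijection:
  assumes ks: "krull_schmidt T"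
  shows "bij_betw (\<lambda>(X, Y). (EI Y, right_perp H (EI Y)))
    {(X, Y). complete_cotorsion_pair T C X Y} {(U, V). functorially_finite_torsion_pair H U V}"
  unfolding bij_betw_def
proof
  show "inj_on (\<lambda>(X, Y). (EI Y, right_perp H (EI Y))) {(X, Y). complete_cotorsion_pair T C X Y}"
  proof (rule inj_onI, clarsimp)
    fix X Y X' Y' assume 1: "complete_cotorsion_pair T C X Y" and 2: "complete_cotorsion_pair T C X' Y'"
      and eq: "EI Y = EI Y'"
    have X: "X = left_ext_perp Y" "X' = left_ext_perp Y'" and YC: "Y \<subseteq> C" "Y' \<subseteq> C"
      using 1 2 unfolding cotorsion_pair_iff right_ext_perp_def by blast+
    have "Y = Y'" using EI_inj[OF 1 YC(2)] EI_inj[OF 2 YC(1)] eq by blast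
    then show "X = X' \<and> Y = Y'" using X by simp
  qed
  show "(\<lambda>(X, Y). (EI Y, right_perp H (EI Y))) ` {(X, Y). complete_cotorsion_pair T C X Y}
    = {(U, V). functorially_finite_torsion_pair H U V}"
  proof
    show "(\<lambda>(X, Y). (EI Y, right_perp H (EI Y))) ` {(X, Y). complete_cotorsion_pair T C X Y}
      \<subseteq> {(U, V). functorially_finite_torsion_pair H U V}"
      using cotorsion_pair_torsion_pair cotorsion_pair_covariantly_finite
      by (auto simp: functorially_finite_torsion_pair_def)
    show "{(U, V). functorially_finite_torsion_pair H U V}
      \<subseteq> (\<lambda>(X, Y). (EI Y, right_perp H (EI Y))) ` {(X, Y). complete_cotorsion_pair T C X Y}"
    proof clarify
      fix U V assume "functorially_finite_torsion_pair H U V"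
      then have t: "torsion_pair H U V" and f: "covariantly_finite H U" by (auto simp: functorially_finite_torsion_pair_def)
      then obtain X Y where "complete_cotorsion_pair T C X Y" "EI Y = U" using torsion_pair_cotorsion_pair[OF ks] by blast
      moreover have "V = right_perp H U" using t by (simp add: torsion_pair_def)
      ultimately show "(U, V) \<in> (\<lambda>(X, Y). (EI Y, right_perp H (EI Y))) ` {(X, Y). complete_cotorsion_pair T C X Y}"
        by (intro image_eqI[of _ _ "(X, Y)"]) auto
    qed
  qed
qed

end

theorem theorem2:
  fixes k :: "('k, 'r) ring_scheme"
    and T :: "('k, 'o, 'm, 'z) tricat_scheme"
    and s :: 'o and S C :: "'o set"
  assumes "cring k" and "noetherian_ring k"
    and "triangulated_category k T" and "hom_finite k T" and "krull_schmidt T"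
    and "s \<in> Ob T" and S: "S = add_closure T s" and "presilting T S"
    and C: "C = star T S (\<Sigma>\<^bsub>T\<^esub> ` S)"
  defines "modS \<equiv> mod_cat k (full_sub T S)" and "F \<equiv> restricted_yoneda T S"
  shows "linear_functor k (full_sub T C) modS F \<and>
    bij_betw (\<lambda>(X, Y). (essential_image modS F Y, right_perp modS (essential_image modS F Y)))
      {(X, Y). complete_cotorsion_pair T C X Y}
      {(U, V). functorially_finite_torsion_pair modS U V} \<and>
    (\<forall>X Y. complete_cotorsion_pair T C X Y \<longrightarrow> torsion_class modS (essential_image modS F Y))"
proof -
  interpret triangulated_category k T by fact
  have "klinear_category k T" using additive by (simp add: additive_category_def)
  then interpret two_term_noetherian k T s S C
    by (intro two_term_noetherian.intro two_term.intro tri_cat.intro linear_cat.intro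
        two_term_axioms.intro two_term_noetherian_axioms.intro assms)
  show ?thesis
    unfolding modS_def F_def
    using linear_functor_yoneda cotorsion_torsion_bijection[OF assms(5)] cotorsion_pair_torsion_pair
    by (auto simp: torsion_class_def)
qed

end
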